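(* Let $p>7+d$ and $\sigma>d/2$. There exists $C>0$ such that for every smooth vector field $G(t,s,x,v)\in\mathbb R^d$ satisfying $$G(t,t,x,v)=0,$$ every $T>0$ and all $H\in \mathrm L^2(0,T;\mathrm L^2(\mathbb T^d))$, $$\big\|\mathrm K^{\mathrm{free}}_G[H]\big\|_{\mathrm L^2(0,T;\mathrm H^1(\mathbb T^d))}+\big\|\mathrm K^{\mathrm{fric}}_G[H]\big\|_{\mathrm L^2(0,T;\mathrm H^1(\mathbb T^d))}\le C(1+T)\sup_{0\le s,t\le T}\|\partial_sG(t,s)\|_{\mathcal H^p_\sigma}\,\|H\|_{\mathrm L^2(0,T;\mathrm L^2(\mathbb T^d))}.$$
   Context: Here $d\ge1$, $\mathbb T^d=\mathbb R^d/(2\pi\mathbb Z)^d$ with normalized Lebesgue measure, and for $p\in\mathbb N$, $\sigma\ge0$, $$\|\mathrm f\|_{\mathcal H^p_\sigma}=\Big(\sum_{|\alpha|+|\beta|\le p}\int_{\mathbb T^d}\int_{\mathbb R^d}(1+|v|^2)^{\sigma}|\partial_x^\alpha\partial_v^\beta \mathrm f(x,v)|^2\,dx\,dv\Big)^{1/2}.$$ For a smooth vector field $G(t,s,x,v)\in\mathbb R^d$ and a function $H(t,x)$, the averaging operators are $$\mathrm K^{\mathrm{free}}_G[H](t,x)=\int_0^t\int_{\mathbb R^d}[\nabla_xH](s,x-(t-s)v)\cdot G(t,s,x,v)\,dv\,ds,$$ $$\mathrm K^{\mathrm{fric}}_G[H](t,x)=\int_0^t\int_{\mathbb R^d}[\nabla_xH](s,x+(1-e^{t-s})v)\cdot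 G(t,s,x,v)\,dv\,ds.$$ *)

theory Defs
  imports "HOL-Analysis.Analysis"
begin

subsection \<open>Smoothness and partial derivatives\<close>

definition dir_deriv ::
    "'a::euclidean_space set \<Rightarrow> 'a \<Rightarrow> ('a \<Rightarrow> 'b::real_normed_vector) \<Rightarrow> 'a \<Rightarrow> 'b" where
  "dir_deriv A e f z = frechet_derivative f (at z within A) e"

text \<open>Smoothness up to the boundary: all iterated partial derivatives, taken within \<open>A\<close>,
  exist and are differentiable on \<open>A\<close>. It is only meaningful when derivatives within
  \<open>A\<close> are unique, as for products of nondegenerate intervals.\<close>

definition smooth_on ::
    "'a::euclidean_space set \<Rightarrow> ('a \<Rightarrow> 'b::real_normed_vector) \<Rightarrow> bool" where
  "smooth_on A f \<longleftrightarrow> (\<forall>es\<in>lists Basis. foldr (dir_deriv A) es f differentiable_on A)"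

text \<open>For functions of \<open>(x,v)\<close>; the index type carries no order, so
  \<open>multi_deriv\<close> applies the coordinate derivatives in an arbitrary but fixed order, which is
  immaterial for smooth functions.\<close>

definition index_list :: "'n::finite list" where
  "index_list = (SOME is. distinct is \<and> set is = UNIV)"

definition multi_deriv ::
    "('n::finite \<Rightarrow> 'a::euclidean_space) \<Rightarrow> ('n \<Rightarrow> nat) \<Rightarrow> ('a \<Rightarrow> 'b::real_normed_vector) \<Rightarrow> 'a \<Rightarrow> 'b" where
  "multi_deriv e \<alpha> = foldr (\<lambda>i D. (dir_deriv UNIV (e i) ^^ \<alpha> i) \<circ> D) index_list id"

definition dx_dv ::
    "('n::finite \<Rightarrow> nat) \<Rightarrow> ('n \<Rightarrow> nat) \<Rightarrow>
      ((real^'n) \<times> (real^'n) \<Rightarrow> 'b::real_normed_vector) \<Rightarrow> (real^'n) \<times> (real^'n) \<Rightarrow> 'b" where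
  "dx_dv \<alpha> \<beta> f =
     multi_deriv (\<lambda>i. (axis i 1, 0)) \<alpha> (multi_deriv (\<lambda>i. (0, axis i 1)) \<beta> f)"

definition grad :: "((real^'n) \<Rightarrow> real) \<Rightarrow> real^'n \<Rightarrow> real^'n" where
  "grad f x = (\<chi> i. dir_deriv UNIV (axis i 1) f x)"


subsection \<open>The torus and function spaces\<close>

text \<open>Functions on the torus are functions on \<open>\<real>\<^sup>d\<close> that are \<open>2\<pi>\<close>-periodic in every coordinate,
  and are integrated over one period cell.\<close>

definition periodic :: "((real^'n) \<Rightarrow> 'b) \<Rightarrow> bool" where
  "periodic f \<longleftrightarrow> (\<forall>x i. f (x + axis i (2 * pi)) = f x)"

definition torus :: "(real^'n) measure" where
  "torus = uniform_measure lborel (cbox 0 (\<chi> i. 2 * pi))"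

text \<open>Norms take values in \<open>[0,\<infinity>]\<close>, with value \<open>\<infinity>\<close> at measurable
  functions outside the corresponding space.\<close>

definition sqrt_ennreal :: "ennreal \<Rightarrow> ennreal" where
  "sqrt_ennreal a = (if a = \<infinity> then \<infinity> else ennreal (sqrt (enn2real a)))"

definition L2_norm_torus :: "((real^'n) \<Rightarrow> 'b::real_normed_vector) \<Rightarrow> ennreal" where
  "L2_norm_torus f = sqrt_ennreal (\<integral>\<^sup>+x. ennreal ((norm (f x))\<^sup>2) \<partial>torus)"

definition weak_grad :: "((real^'n) \<Rightarrow> real) \<Rightarrow> ((real^'n) \<Rightarrow> real^'n) \<Rightarrow> bool" where
  "weak_grad f g \<longleftrightarrow> integrable torus f \<and> integrable torus g \<and>
     (\<forall>\<phi>. smooth_on UNIV \<phi> \<and> periodic \<phi> \<longrightarrow>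
       (\<forall>i. (LINT x|torus. f x * grad \<phi> x $ i) = - (LINT x|torus. g x $ i * \<phi> x)))"

text \<open>The weak gradient is unique almost everywhere, so the infimum selects it if it exists
  and is \<open>\<infinity>\<close> otherwise.\<close>

definition H1_norm_torus :: "((real^'n) \<Rightarrow> real) \<Rightarrow> ennreal" where
  "H1_norm_torus f =
     (INF g\<in>{g. weak_grad f g}. sqrt_ennreal ((L2_norm_torus f)\<^sup>2 + (L2_norm_torus g)\<^sup>2))"

definition L2_time_norm ::
    "real \<Rightarrow> (((real^'n) \<Rightarrow> real) \<Rightarrow> ennreal) \<Rightarrow> (real \<Rightarrow> (real^'n) \<Rightarrow> real) \<Rightarrow> ennreal" where
  "L2_time_norm T N u = sqrt_ennreal (\<integral>\<^sup>+t\<in>{0<..<T}. (N (u t))\<^sup>2 \<partial>lborel)"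

abbreviation "L2L2_norm T \<equiv> L2_time_norm T L2_norm_torus"
abbreviation "L2H1_norm T \<equiv> L2_time_norm T H1_norm_torus"

text \<open>Elements of \<open>L\<^sup>2(0,T;L\<^sup>2)\<close> are given by jointly measurable representatives.\<close>

definition L2L2 :: "real \<Rightarrow> (real \<Rightarrow> (real^'n) \<Rightarrow> real) set" where
  "L2L2 T = {H. (\<forall>t\<in>{0<..<T}. periodic (H t)) \<and>
     set_borel_measurable lborel ({0<..<T} \<times> UNIV) (\<lambda>(t,x). H t x) \<and> L2L2_norm T H < \<infinity>}"

definition H_norm ::
    "nat \<Rightarrow> real \<Rightarrow> ((real^'n) \<times> (real^'n) \<Rightarrow> 'b::real_normed_vector) \<Rightarrow> ennreal" where
  "H_norm p \<sigma> f = sqrt_ennreal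
     (\<Sum>(\<alpha>,\<beta>)\<in>{(\<alpha>,\<beta>). sum \<alpha> UNIV + sum \<beta> UNIV \<le> p}.
        \<integral>\<^sup>+x. (\<integral>\<^sup>+v. ennreal ((1 + (norm v)\<^sup>2) powr \<sigma> * (norm (dx_dv \<alpha> \<beta> f (x,v)))\<^sup>2) \<partial>lborel) \<partial>torus)"


subsection \<open>The averaging operators\<close>

type_synonym 'n kernel = "real \<Rightarrow> real \<Rightarrow> (real^'n) \<Rightarrow> (real^'n) \<Rightarrow> (real^'n)"

definition smooth_kernel :: "real \<Rightarrow> 'n::finite kernel \<Rightarrow> bool" where
  "smooth_kernel T G \<longleftrightarrow>
     smooth_on ({0..T} \<times> {0..T} \<times> UNIV \<times> UNIV) (\<lambda>(t,s,x,v). G t s x v) \<and>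
     (\<forall>t\<in>{0..T}. \<forall>s\<in>{0..T}. \<forall>v. periodic (\<lambda>x. G t s x v))"

definition ds_kernel :: "real \<Rightarrow> 'n::finite kernel \<Rightarrow> 'n kernel" where
  "ds_kernel T G t s x v = vector_derivative (\<lambda>r. G t r x v) (at s within {0..T})"

definition K_free :: "'n::finite kernel \<Rightarrow> (real \<Rightarrow> (real^'n) \<Rightarrow> real) \<Rightarrow> real \<Rightarrow> (real^'n) \<Rightarrow> real" where
  "K_free G H t x =
     (LINT s:{0..t}|lborel. LINT v|lborel. grad (H s) (x - (t - s) *\<^sub>R v) \<bullet> G t s x v)"

definition K_fric :: "'n::finite kernel \<Rightarrow> (real \<Rightarrow> (real^'n) \<Rightarrow> real) \<Rightarrow> real \<Rightarrow> (real^'n) \<Rightarrow> real" where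
  "K_fric G H t x =
     (LINT s:{0..t}|lborel. LINT v|lborel. grad (H s) (x + (1 - exp (t - s)) *\<^sub>R v) \<bullet> G t s x v)"

text \<open>The integrals above involve the classical gradient. For \<open>H\<close> merely in
  \<open>L\<^sup>2(0,T;L\<^sup>2)\<close> the operators are understood as extended by density:
  \<open>u\<close> is the value at \<open>H\<close> of the extension of \<open>K\<close> if \<open>K H\<^sub>n\<close> tends to \<open>u\<close> for every
  sequence of smooth functions \<open>H\<^sub>n\<close> tending to \<open>H\<close>. Such \<open>u\<close> is unique almost
  everywhere, and equal to \<open>K H\<close> if \<open>H\<close> is smooth.\<close>

definition smooth_periodic :: "real \<Rightarrow> (real \<Rightarrow> (real^'n) \<Rightarrow> real) \<Rightarrow> bool" where
  "smooth_periodic T H \<longleftrightarrow>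
     smooth_on ({0..T} \<times> UNIV) (\<lambda>(t,x). H t x) \<and> (\<forall>t\<in>{0..T}. periodic (H t))"

definition extends_to ::
    "real \<Rightarrow> ((real \<Rightarrow> (real^'n) \<Rightarrow> real) \<Rightarrow> real \<Rightarrow> (real^'n) \<Rightarrow> real) \<Rightarrow>
      (real \<Rightarrow> (real^'n) \<Rightarrow> real) \<Rightarrow> (real \<Rightarrow> (real^'n) \<Rightarrow> real) \<Rightarrow> bool" where
  "extends_to T K H u \<longleftrightarrow> u \<in> L2L2 T \<and>
     (\<forall>Hn. (\<forall>n::nat. smooth_periodic T (Hn n)) \<and>
        (\<lambda>n. L2L2_norm T (\<lambda>t x. Hn n t x - H t x)) \<longlonglongrightarrow> 0 \<longrightarrow>
        (\<lambda>n. L2L2_norm T (\<lambda>t x. K (Hn n) t x - u t x)) \<longlonglongrightarrow> 0)"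

end

(* Pair K[H] with a trigonometric polynomial and expand everything in Fourier series in x. The
   coefficients of H at k and of the test function at n are coupled, across a time gap tau = t - s, by
   k times the Fourier transform of G(t,s) in (x,v) at the frequency (k + n, theta(tau) k), where
   theta(tau) is tau for the free operator and exp(tau) - 1 for the operator with friction. Since G
   vanishes on the diagonal and has p derivatives in weighted L^2, this transform is at most a constant
   times tau (1 + |k+n|)^(-d-2) (1 + theta(tau) |k|)^(-3). The gradient in the H^1 norm costs a factor
   |n|, which is at most (1 + |k+n|) (1 + |k|). As theta(tau) >= tau, the coupling is
   dominated by (1 + |k+n|)^(-d-1) |k|^2 tau / (1 + tau |k|)^3; its integral in tau is bounded
   uniformly in k and its sum over the lattice is finite, so Schur's test bounds the bilinear form by the
   L^2 norms. Duality with trigonometric polynomials turns this into bounds for K[H] and its gradient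
   for smooth H, and density extends them to all H in L^2. *)

theory Submission
  imports Defs
begin

subsection \<open>Square-integrable functions\<close>

text \<open>The obstacle is that both operators contain the classical gradient of H, while the bound
  may see only its L2 norm. Trigonometric polynomials approximate a smooth H in L2 without any
  control of gradients, so their estimate does not pass to H by itself. The bridge is a crude bound:
  against a fixed trigonometric test function the x-derivative is integrated by parts onto the
  kernel and the test function. Hence the bilinear form is L2-continuous in H, with a constant
  depending on the test function that disappears in the limit. Exponents: of the d+2 powers of decay
  in k+n, one pays for the factor |n| and d+1 make the lattice sum converge. The powers |k|^2 come
  from the gradient of H and from the H^1 norm; with three powers of 1 + tau |k| below, the integral
  over tau is scale invariant. The condition \<sigma> > d/2 makes (1+|v|^2)^(-\<sigma>) integrable,
  so that weighted L2 bounds control L1 norms and hence Fourier transforms pointwise.\<close>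

definition sqint :: "'a measure \<Rightarrow> ('a \<Rightarrow> real) \<Rightarrow> bool" where
  "sqint M f \<longleftrightarrow> f \<in> borel_measurable M \<and> integrable M (\<lambda>x. (f x)\<^sup>2)"

text \<open>A divergent Bochner integral is 0, so the value means something only together with
  \<open>sqint\<close>. Differences and limits are handled with this real-valued norm; the extended
  norms of the statement are reached at the end.\<close>

definition l2n :: "'a measure \<Rightarrow> ('a \<Rightarrow> real) \<Rightarrow> real" where
  "l2n M f = sqrt (LINT x|M. (f x)\<^sup>2)"

lemma l2n_nonneg [simp]: "0 \<le> l2n M f"
  by (simp add: l2n_def)

lemma l2n_power2: "(l2n M f)\<^sup>2 = (LINT x|M. (f x)\<^sup>2)"
  by (simp add: l2n_def)

lemma sqint_measurable [measurable_dest]: "sqint M f \<Longrightarrow> f \<in> borel_measurable M"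
  by (simp add: sqint_def)

lemma sqintI_nn:
  assumes "f \<in> borel_measurable M" "(\<integral>\<^sup>+x. ennreal ((f x)\<^sup>2) \<partial>M) < \<infinity>"
  shows "sqint M f"
  using assms by (auto simp: sqint_def integrable_iff_bounded)

lemma sqint_nn_integral:
  "sqint M f \<Longrightarrow> (\<integral>\<^sup>+x. ennreal ((f x)\<^sup>2) \<partial>M) = ennreal ((l2n M f)\<^sup>2)"
  by (simp add: sqint_def l2n_power2 nn_integral_eq_integral)

lemma l2n_le_nn:
  assumes "(\<integral>\<^sup>+x. ennreal ((f x)\<^sup>2) \<partial>M) \<le> ennreal (A\<^sup>2)" "f \<in> borel_measurable M" "0 \<le> A"
  shows "sqint M f" "l2n M f \<le> A"
proof -
  show s: "sqint M f" using assms by (intro sqintI_nn) (auto simp: le_less_trans)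
  have "(l2n M f)\<^sup>2 \<le> A\<^sup>2" using assms(1) sqint_nn_integral[OF s] by simp
  then show "l2n M f \<le> A" using assms(3) by (rule power2_le_imp_le)
qed

lemma sqint_mult:
  assumes "sqint M f" "sqint M g"
  shows "integrable M (\<lambda>x. f x * g x)"
proof (rule Bochner_Integration.integrable_bound)
  show "integrable M (\<lambda>x. (f x)\<^sup>2 + (g x)\<^sup>2)" using assms by (auto simp: sqint_def)
  show "(\<lambda>x. f x * g x) \<in> borel_measurable M" using assms by (auto simp: sqint_def)
  have "\<bar>a * b\<bar> \<le> a\<^sup>2 + b\<^sup>2" for a b :: real
  proof -
    have "2 * \<bar>a\<bar> * \<bar>b\<bar> \<le> \<bar>a\<bar>\<^sup>2 + \<bar>b\<bar>\<^sup>2" by (rule sum_squares_bound)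
    moreover have "0 \<le> \<bar>a\<bar> * \<bar>b\<bar>" by simp
    ultimately show ?thesis unfolding abs_mult power2_abs by linarith
  qed
  then show "AE x in M. norm (f x * g x) \<le> norm ((f x)\<^sup>2 + (g x)\<^sup>2)" by simp
qed

lemma sqint_cmult: "sqint M f \<Longrightarrow> sqint M (\<lambda>x. c * f x)"
  by (auto simp: sqint_def power_mult_distrib)

lemma sqint_add:
  assumes "sqint M f" "sqint M g" shows "sqint M (\<lambda>x. f x + g x)"
  using assms sqint_mult[OF assms] by (auto simp: sqint_def power2_sum mult.assoc)

lemma sqint_diff:
  assumes "sqint M f" "sqint M g" shows "sqint M (\<lambda>x. f x - g x)"
  using sqint_add[OF assms(1) sqint_cmult[OF assms(2), of "-1"]] by simp

lemma l2n_cauchy_schwarz: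
  assumes f: "sqint M f" and g: "sqint M g"
  shows "\<bar>LINT x|M. f x * g x\<bar> \<le> l2n M f * l2n M g"
proof -
  note [measurable] = sqint_measurable[OF f] sqint_measurable[OF g]
  have "ennreal \<bar>LINT x|M. f x * g x\<bar> \<le> ennreal (LINT x|M. \<bar>f x * g x\<bar>)"
    by (intro ennreal_leI integral_abs_bound)
  also have "\<dots> = (\<integral>\<^sup>+x. ennreal \<bar>f x\<bar> * ennreal \<bar>g x\<bar> \<partial>M)"
    using integrable_abs[OF sqint_mult[OF f g]]
    by (subst nn_integral_eq_integral[symmetric]) (auto simp: abs_mult ennreal_mult)
  finally have "(ennreal \<bar>LINT x|M. f x * g x\<bar>)\<^sup>2 \<le> (\<integral>\<^sup>+x. ennreal \<bar>f x\<bar> * ennreal \<bar>g x\<bar> \<partial>M)\<^sup>2"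
    by (intro power_mono) auto
  also have "\<dots> \<le> (\<integral>\<^sup>+x. (ennreal \<bar>f x\<bar>)\<^sup>2 \<partial>M) * (\<integral>\<^sup>+x. (ennreal \<bar>g x\<bar>)\<^sup>2 \<partial>M)"
    by (rule Cauchy_Schwarz_nn_integral) auto
  also have "\<dots> = ennreal ((l2n M f)\<^sup>2) * ennreal ((l2n M g)\<^sup>2)"
    using sqint_nn_integral[OF f] sqint_nn_integral[OF g] by (simp add: ennreal_power)
  also have "\<dots> = ennreal ((l2n M f * l2n M g)\<^sup>2)"
    by (simp add: ennreal_mult power_mult_distrib)
  finally have "\<bar>LINT x|M. f x * g x\<bar>\<^sup>2 \<le> (l2n M f * l2n M g)\<^sup>2"
    by (simp add: ennreal_power)
  then show ?thesis by (rule power2_le_imp_le) simp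
qed

lemma l2n_add:
  assumes f: "sqint M f" and g: "sqint M g"
  shows "l2n M (\<lambda>x. f x + g x) \<le> l2n M f + l2n M g"
proof (rule power2_le_imp_le)
  have "(l2n M (\<lambda>x. f x + g x))\<^sup>2 = (l2n M f)\<^sup>2 + (l2n M g)\<^sup>2 + 2 * (LINT x|M. f x * g x)"
    using f g sqint_mult[OF f g] by (simp add: l2n_power2 power2_sum mult.assoc sqint_def)
  also have "\<dots> \<le> (l2n M f + l2n M g)\<^sup>2"
    using l2n_cauchy_schwarz[OF f g] by (simp add: power2_sum)
  finally show "(l2n M (\<lambda>x. f x + g x))\<^sup>2 \<le> (l2n M f + l2n M g)\<^sup>2" .
qed simp

lemma l2n_minus_commute: "l2n M (\<lambda>x. f x - g x) = l2n M (\<lambda>x. g x - f x)"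
  by (simp add: l2n_def power2_commute)

lemma l2n_triangle:
  assumes "sqint M f" "sqint M g" "sqint M h"
  shows "l2n M (\<lambda>x. f x - h x) \<le> l2n M (\<lambda>x. f x - g x) + l2n M (\<lambda>x. g x - h x)"
  using l2n_add[OF sqint_diff[OF assms(1,2)] sqint_diff[OF assms(2,3)]] by simp

lemma l2n_le_add:
  assumes "sqint M f" "sqint M g"
  shows "l2n M f \<le> l2n M (\<lambda>x. f x - g x) + l2n M g"
  using l2n_add[OF sqint_diff[OF assms] assms(2)] by simp

text \<open>Testing against some \<phi> in \<open>D\<close> close to \<open>f\<close> itself gives
  |f|^2 = <f, f - \<phi>> + <f, \<phi>>, which is at most A |f| up to an error of order e. It
  remains to let e tend to 0 and to divide by the norm of \<open>f\<close>.\<close>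

lemma l2n_dual:
  assumes f: "sqint M f" and A: "0 \<le> A"
    and dense: "\<And>e. 0 < e \<Longrightarrow> \<exists>\<phi>\<in>D. sqint M \<phi> \<and> l2n M (\<lambda>x. f x - \<phi> x) < e"
    and bound: "\<And>\<phi>. \<phi> \<in> D \<Longrightarrow> \<bar>LINT x|M. f x * \<phi> x\<bar> \<le> A * l2n M \<phi>"
  shows "l2n M f \<le> A"
proof -
  have *: "(l2n M f)\<^sup>2 \<le> A * l2n M f + e * (A + l2n M f)" if e: "0 < e" for e
  proof -
    obtain \<phi> where \<phi>: "\<phi> \<in> D" "sqint M \<phi>" "l2n M (\<lambda>x. f x - \<phi> x) < e" using dense[OF e] by blast
    have i: "integrable M (\<lambda>x. f x * (f x - \<phi> x))" "integrable M (\<lambda>x. f x * \<phi> x)"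
      using sqint_mult f sqint_diff \<phi> by blast+
    have "(l2n M f)\<^sup>2 = (LINT x|M. f x * (f x - \<phi> x) + f x * \<phi> x)"
      by (simp only: l2n_power2) (simp add: power2_eq_square algebra_simps)
    also have "\<dots> = (LINT x|M. f x * (f x - \<phi> x)) + (LINT x|M. f x * \<phi> x)"
      using i by simp
    also have "\<dots> \<le> l2n M f * l2n M (\<lambda>x. f x - \<phi> x) + A * l2n M \<phi>"
      using l2n_cauchy_schwarz[OF f sqint_diff[OF f \<phi>(2)]] bound[OF \<phi>(1)] by linarith
    also have "\<dots> \<le> l2n M f * e + A * (l2n M f + e)"
      using \<phi>(3) A l2n_le_add[OF \<phi>(2) f] l2n_minus_commute[of M f \<phi>]
      by (intro add_mono mult_left_mono) auto
    finally show ?thesis by (simp add: algebra_simps)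
  qed
  have "(l2n M f)\<^sup>2 \<le> A * l2n M f"
  proof (rule field_le_epsilon)
    fix e :: real assume "0 < e"
    moreover have "0 < A + l2n M f + 1" using A l2n_nonneg[of M f] by linarith
    ultimately have "0 < e / (A + l2n M f + 1)" by simp
    from *[OF this] show "(l2n M f)\<^sup>2 \<le> A * l2n M f + e"
    proof (rule order_trans)
      have "e / (A + l2n M f + 1) * (A + l2n M f) \<le> e"
        using \<open>0 < e\<close> \<open>0 < A + l2n M f + 1\<close> by (simp add: divide_simps)
      then show "A * l2n M f + e / (A + l2n M f + 1) * (A + l2n M f) \<le> A * l2n M f + e" by simp
    qed
  qed
  then show ?thesis
    using A l2n_nonneg[of M f] unfolding power2_eq_square
    by (cases "l2n M f = 0") (auto simp: mult_le_cancel_right)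
qed

text \<open>Riesz-Fischer. The limit is exhibited as the pointwise \<open>lim\<close> of a
  subsequence rather than as some function, so that properties holding at every point, such as
  periodicity, can be read off from the approximants.\<close>

lemma l2n_complete:
  fixes f :: "nat \<Rightarrow> 'a \<Rightarrow> real"
  assumes fin: "finite_measure M" and f: "\<And>n. sqint M (f n)"
    and cauchy: "\<And>e. 0 < e \<Longrightarrow> \<exists>N. \<forall>m\<ge>N. \<forall>n\<ge>N. l2n M (\<lambda>x. f m x - f n x) < e"
  obtains r :: "nat \<Rightarrow> nat" where "strict_mono r" "sqint M (\<lambda>x. lim (\<lambda>k. f (r k) x))"
    "(\<lambda>n. l2n M (\<lambda>x. f n x - lim (\<lambda>k. f (r k) x))) \<longlonglongrightarrow> 0"
proof -
  interpret finite_measure M by fact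
  note [measurable] = sqint_measurable[OF f]
  have "\<exists>r::nat\<Rightarrow>nat. \<forall>k. (\<forall>m\<ge>r k. \<forall>n\<ge>r k. l2n M (\<lambda>x. f m x - f n x) < (1/2)^k) \<and> r k < r (Suc k)"
  proof (rule dependent_nat_choice)
    show "\<exists>N. \<forall>m\<ge>N. \<forall>n\<ge>N. l2n M (\<lambda>x. f m x - f n x) < (1/2)^0" using cauchy[of 1] by simp
    fix x k
    obtain N where N: "\<forall>m\<ge>N. \<forall>n\<ge>N. l2n M (\<lambda>x. f m x - f n x) < (1/2)^Suc k"
      using cauchy[of "(1/2)^Suc k"] by auto
    show "\<exists>y. (\<forall>m\<ge>y. \<forall>n\<ge>y. l2n M (\<lambda>x. f m x - f n x) < (1/2)^Suc k) \<and> x < y"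
      by (rule exI[of _ "max N (Suc x)"]) (use N in auto)
  qed
  then obtain r where r: "\<And>k m n. m \<ge> r k \<Longrightarrow> n \<ge> r k \<Longrightarrow> l2n M (\<lambda>x. f m x - f n x) < (1/2)^k"
    and r2: "\<And>k. r k < r (Suc k)" by blast
  have sm: "strict_mono r" using r2 by (simp add: strict_mono_Suc_iff)
  define g where "g k = f (r k)" for k
  have [measurable]: "g k \<in> borel_measurable M" for k by (simp add: g_def)
  have gsq: "sqint M (g k)" for k using f by (simp add: g_def)
  \<comment> \<open>As the mass is finite, the L2 gaps of the subsequence are also L1 gaps up to the
    factor \<open>c\<close>; their summability gives convergence almost everywhere.\<close>
  define c where "c = l2n M (\<lambda>_. 1)"
  have one: "sqint M (\<lambda>_. 1)" by (auto simp: sqint_def)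
  have step: "(\<integral>\<^sup>+x. ennreal \<bar>g (Suc k) x - g k x\<bar> \<partial>M) \<le> ennreal (c * (1/2)^k)" for k
  proof -
    have sq: "sqint M (\<lambda>x. \<bar>g (Suc k) x - g k x\<bar>)"
      using sqint_diff[OF gsq[of "Suc k"] gsq[of k]] by (auto simp: sqint_def)
    have "(LINT x|M. \<bar>g (Suc k) x - g k x\<bar> * 1) \<le> l2n M (\<lambda>x. \<bar>g (Suc k) x - g k x\<bar>) * c"
      using l2n_cauchy_schwarz[OF sq one] unfolding c_def by linarith
    also have "\<dots> \<le> (1/2)^k * c"
      using r[of k "r (Suc k)" "r k"] less_imp_le[OF r2[of k]]
      by (intro mult_right_mono) (auto simp: g_def l2n_def c_def)
    finally show ?thesis
      using sqint_mult[OF sq one] by (subst nn_integral_eq_integral) (auto simp: mult.commute intro: ennreal_leI)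
  qed
  have "(\<integral>\<^sup>+x. (\<Sum>k. ennreal \<bar>g (Suc k) x - g k x\<bar>) \<partial>M) = (\<Sum>k. \<integral>\<^sup>+x. ennreal \<bar>g (Suc k) x - g k x\<bar> \<partial>M)"
    by (rule nn_integral_suminf) measurable
  also have "\<dots> \<le> (\<Sum>k. ennreal (c * (1/2)^k))" by (intro suminf_le step) auto
  also have "\<dots> < \<infinity>"
    by (subst suminf_ennreal2) (auto simp: c_def intro!: summable_mult)
  finally have "AE x in M. (\<Sum>k. ennreal \<bar>g (Suc k) x - g k x\<bar>) \<noteq> \<infinity>"
    by (intro nn_integral_PInf_AE) auto
  then have conv: "AE x in M. (\<lambda>k. g k x) \<longlonglongrightarrow> lim (\<lambda>k. g k x)"
  proof eventually_elim
    case (elim x)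
    then have "summable (\<lambda>k. \<bar>g (Suc k) x - g k x\<bar>)"
      by (intro summable_suminf_not_top) auto
    then have "summable (\<lambda>k. g (Suc k) x - g k x)" by (rule summable_rabs_cancel)
    then have "convergent (\<lambda>n. \<Sum>k<n. g (Suc k) x - g k x)" by (simp add: summable_iff_convergent)
    then have "convergent (\<lambda>n. g n x - g 0 x)"
      by (simp only: sum_lessThan_telescope[where f = "\<lambda>k. g k x"])
    then have "convergent (\<lambda>n. (g n x - g 0 x) + g 0 x)" by (intro convergent_add convergent_const)
    then show ?case by (simp add: convergent_LIMSEQ_iff)
  qed
  define u where "u = (\<lambda>x. lim (\<lambda>k. g k x))"
  have [measurable]: "u \<in> borel_measurable M" unfolding u_def by measurable
  \<comment> \<open>Fatou's lemma: the distance to the limit is at most the liminf of the distances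
    to later members of the subsequence.\<close>
  have close: "(\<integral>\<^sup>+x. ennreal ((f n x - u x)\<^sup>2) \<partial>M) \<le> ennreal (((1/2)^k)\<^sup>2)" if "n \<ge> r k" for n k
  proof -
    have "(\<integral>\<^sup>+x. ennreal ((f n x - u x)\<^sup>2) \<partial>M) = (\<integral>\<^sup>+x. liminf (\<lambda>j. ennreal ((f n x - g j x)\<^sup>2)) \<partial>M)"
    proof (rule nn_integral_cong_AE)
      show "AE x in M. ennreal ((f n x - u x)\<^sup>2) = liminf (\<lambda>j. ennreal ((f n x - g j x)\<^sup>2))"
        using conv
      proof eventually_elim
        case (elim x)
        then have "(\<lambda>j. ennreal ((f n x - g j x)\<^sup>2)) \<longlonglongrightarrow> ennreal ((f n x - u x)\<^sup>2)"
          unfolding u_def by (intro tendsto_intros)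
        then show ?case by (metis lim_imp_Liminf trivial_limit_sequentially)
      qed
    qed
    also have "\<dots> \<le> liminf (\<lambda>j. \<integral>\<^sup>+x. ennreal ((f n x - g j x)\<^sup>2) \<partial>M)"
      by (rule nn_integral_liminf) auto
    also have "\<dots> \<le> ennreal (((1/2)^k)\<^sup>2)"
    proof (rule Liminf_le)
      show "\<forall>\<^sub>F j in sequentially. (\<integral>\<^sup>+x. ennreal ((f n x - g j x)\<^sup>2) \<partial>M) \<le> ennreal (((1/2)^k)\<^sup>2)"
        using eventually_ge_at_top[of k]
      proof eventually_elim
        case (elim j)
        then have "r k \<le> r j" using sm by (simp add: strict_mono_less_eq)
        then have "l2n M (\<lambda>x. f n x - g j x) \<le> (1/2)^k" using r[of k n "r j"] that by (simp add: g_def)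
        then show ?case
          using sqint_nn_integral[OF sqint_diff[OF f[of n] gsq[of j]]]
          by (simp add: ennreal_leI power_mono)
      qed
    qed simp
    finally show ?thesis .
  qed
  have sd: "sqint M (\<lambda>x. f (r 0) x - u x)" by (rule l2n_le_nn(1)[OF close[of 0]]) auto
  have su: "sqint M u" using sqint_diff[OF f[of "r 0"] sd] by simp
  have lim: "(\<lambda>n. l2n M (\<lambda>x. f n x - u x)) \<longlonglongrightarrow> 0"
  proof (rule LIMSEQ_I)
    fix e :: real assume "0 < e"
    then obtain k where k: "(1/2)^k < e" using real_arch_pow_inv[of e "1/2"] by auto
    have "norm (l2n M (\<lambda>x. f n x - u x) - 0) < e" if "n \<ge> r k" for n
      using l2n_le_nn(2)[OF close[OF that]] k by simp
    then show "\<exists>no. \<forall>n\<ge>no. norm (l2n M (\<lambda>x. f n x - u x) - 0) < e" by blast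
  qed
  show thesis
    by (rule that[OF sm]) (use su lim in \<open>simp_all add: u_def g_def\<close>)
qed

subsection \<open>Integration over the torus and over phase space\<close>

definition emb :: "int^'n \<Rightarrow> real^'n" where
  "emb k = (\<chi> j. of_int (k $ j))"

lemma emb_nth [simp]: "emb k $ j = of_int (k $ j)"
  by (simp add: emb_def)

lemma borel_measurable_fst_snd [measurable]:
  "(fst :: 'a::second_countable_topology \<times> 'b::second_countable_topology \<Rightarrow> 'a) \<in> borel_measurable borel"
  "(snd :: 'a \<times> 'b \<Rightarrow> 'b) \<in> borel_measurable borel"
  by (auto intro!: borel_measurable_continuous_onI continuous_on_fst continuous_on_snd continuous_on_id)

lemma emb_simps: "emb (k + l) = emb k + emb l" "emb (- k) = - emb k" "emb (k - l) = emb k - emb l" "emb 0 = 0"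
  by (simp_all add: vec_eq_iff)

section \<open>Periodicity and the period cell\<close>

lemma periodic_add_axis:
  assumes "periodic f"
  shows "f (x + of_int m *\<^sub>R axis i (2 * pi)) = f x"
proof (induction m arbitrary: x rule: int_induct[where k = 0])
  case base show ?case by simp
next
  case (step1 m)
  have "f (x + of_int (m + 1) *\<^sub>R axis i (2 * pi)) = f ((x + of_int m *\<^sub>R axis i (2 * pi)) + axis i (2 * pi))"
    by (simp add: algebra_simps)
  also have "\<dots> = f x" using assms step1 by (simp only: periodic_def) 
  finally show ?case .
next
  case (step2 m)
  have "f (x + of_int (m - 1) *\<^sub>R axis i (2 * pi)) = f ((x + of_int (m - 1) *\<^sub>R axis i (2 * pi)) + axis i (2 * pi))"
    using assms by (simp only: periodic_def)
  also have "\<dots> = f (x + of_int m *\<^sub>R axis i (2 * pi))" by (simp add: algebra_simps)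
  finally show ?case using step2 by simp
qed

lemma periodic_add_emb:
  fixes f :: "real^'n \<Rightarrow> 'b"
  assumes "periodic f"
  shows "f (x + (2 * pi) *\<^sub>R emb k) = f x"
proof -
  have "f (x + (\<Sum>i\<in>I. of_int (k $ i) *\<^sub>R axis i (2 * pi))) = f x" if "finite I" for I :: "'n set"
    using that
  proof (induction I arbitrary: x rule: finite_induct)
    case (insert i I)
    have "f (x + (\<Sum>i\<in>insert i I. of_int (k $ i) *\<^sub>R axis i (2 * pi)))
        = f ((x + (\<Sum>i\<in>I. of_int (k $ i) *\<^sub>R axis i (2 * pi))) + of_int (k $ i) *\<^sub>R axis i (2 * pi))"
      using insert by (simp add: algebra_simps)
    also have "\<dots> = f x" using insert.IH by (simp only: periodic_add_axis[OF assms])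
    finally show ?case .
  qed simp
  from this[of UNIV] have "f (x + (\<Sum>i\<in>UNIV. of_int (k $ i) *\<^sub>R axis i (2 * pi))) = f x" by simp
  moreover have "(\<Sum>i\<in>UNIV. of_int (k $ i) *\<^sub>R axis i (2 * pi)) = (2 * pi) *\<^sub>R emb k"
    by (simp add: vec_eq_iff axis_def if_distrib[where f = "\<lambda>x. _ * x"] cong: if_cong)
  ultimately show ?thesis by simp
qed

text \<open>The half-open cell, whose translates by periods cover the space without overlap. The
  closed \<open>period_cell\<close> differs from it by a null set and supplies compactness.\<close>

definition cell :: "(real^'n) set" where
  "cell = {x. \<forall>j. 0 \<le> x $ j \<and> x $ j < 2 * pi}"

definition cell_index :: "real^'n \<Rightarrow> int^'n" where
  "cell_index x = (\<chi> j. \<lfloor>x $ j / (2 * pi)\<rfloor>)"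

definition reduce :: "real^'n \<Rightarrow> real^'n" where
  "reduce x = x - (2 * pi) *\<^sub>R emb (cell_index x)"

lemma in_cell_iff: "x - (2 * pi) *\<^sub>R emb k \<in> cell \<longleftrightarrow> k = cell_index x"
proof -
  have "(0 \<le> x $ j - 2 * pi * of_int (k $ j) \<and> x $ j - 2 * pi * of_int (k $ j) < 2 * pi)
     \<longleftrightarrow> k $ j = \<lfloor>x $ j / (2 * pi)\<rfloor>" for j
    unfolding eq_commute[of "k $ j"] floor_eq_iff by (simp add: field_simps)
  then show ?thesis by (simp add: cell_def cell_index_def vec_eq_iff)
qed

lemma reduce_in_cell: "reduce x \<in> cell"
  by (simp add: reduce_def in_cell_iff)

lemma periodic_reduce: "periodic f \<Longrightarrow> f (reduce x) = f x"
  using periodic_add_emb[of f x "- cell_index x"] by (simp add: reduce_def emb_simps)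

lemma reduce_add_axis: "reduce (x + axis i (2 * pi)) = reduce x"
proof -
  have "cell_index (x + axis i (2 * pi)) = cell_index x + axis i 1"
    by (simp add: cell_index_def vec_eq_iff axis_def add_divide_distrib)
  moreover have "emb (axis i 1) = axis i (1::real)" by (simp add: vec_eq_iff axis_def)
  ultimately show ?thesis by (simp add: reduce_def emb_simps algebra_simps axis_def vec_eq_iff)
qed

lemma cell_measurable [measurable]: "cell \<in> sets borel"
  unfolding cell_def by measurable

lemma reduce_measurable [measurable]: "reduce \<in> borel_measurable borel"
proof -
  have *: "(\<lambda>x. f x :: real^'n) \<in> borel_measurable borel"
    if "\<And>i. (\<lambda>x. f x $ i) \<in> borel_measurable borel" for f :: "real^'n \<Rightarrow> real^'n"
    by (subst borel_measurable_euclidean_space) (auto simp: Basis_vec_def inner_axis that)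
  show ?thesis by (rule *) (simp add: reduce_def cell_index_def)
qed

lemma sets_torus [measurable_cong]: "sets torus = sets borel"
  by (simp add: torus_def)

lemma space_torus [simp]: "space torus = UNIV"
  by (simp add: torus_def)

definition period_cell :: "(real^'n) set" where
  "period_cell = cbox 0 (\<chi> i. 2 * pi)"

lemma in_period_cell: "x \<in> period_cell \<longleftrightarrow> (\<forall>j. 0 \<le> x $ j \<and> x $ j \<le> 2 * pi)"
  by (auto simp: period_cell_def mem_box_cart)

lemma period_cell_measurable [measurable]: "period_cell \<in> sets borel"
  by (simp add: period_cell_def)

lemma cell_subset: "cell \<subseteq> period_cell"
  unfolding cell_def by (auto simp: in_period_cell) (meson less_imp_le)

lemma emeasure_period_cell:
  "emeasure lborel (period_cell :: (real^'n) set) = ennreal ((2 * pi) ^ CARD('n))"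
proof -
  have "(0 :: real^'n) \<in> period_cell" by (simp add: in_period_cell)
  then have "measure lborel (period_cell :: (real^'n) set) = (2 * pi) ^ CARD('n)"
    unfolding period_cell_def by (subst content_cbox_cart) auto
  moreover have "emeasure lborel (period_cell :: (real^'n) set) < \<infinity>"
    unfolding period_cell_def by (rule emeasure_lborel_cbox_finite)
  ultimately show ?thesis by (simp add: emeasure_eq_ennreal_measure less_top)
qed

lemma box_period_cell: "box 0 (\<chi> i. 2 * pi) = {x::real^'n. \<forall>j. 0 < x $ j \<and> x $ j < 2 * pi}"
  by (auto simp: mem_box_cart)

text \<open>Open and closed boxes have the same finite volume, so the faces form a null set.\<close>

lemma AE_period_cell: "AE x in lborel. x \<in> period_cell \<longrightarrow> x \<in> box (0 :: real^'n) (\<chi> i. 2 * pi)"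
proof -
  have "emeasure lborel (period_cell - box (0 :: real^'n) (\<chi> i. 2 * pi)) = 
      emeasure lborel (period_cell :: (real^'n) set) - emeasure lborel (box (0 :: real^'n) (\<chi> i. 2 * pi))"
  proof (rule emeasure_Diff)
    show "box 0 (\<chi> i. 2 * pi) \<subseteq> period_cell"
      by (simp add: period_cell_def box_subset_cbox)
    have "emeasure lborel (box (0 :: real^'n) (\<chi> i. 2 * pi)) \<le> emeasure lborel (period_cell :: (real^'n) set)"
      by (rule emeasure_mono) (simp_all add: period_cell_def box_subset_cbox)
    then show "emeasure lborel (box (0 :: real^'n) (\<chi> i. 2 * pi)) \<noteq> \<infinity>"
      by (auto simp: emeasure_period_cell top_unique)
  qed (auto simp: period_cell_def)
  also have "\<dots> = 0"
    by (simp add: period_cell_def emeasure_lborel_box_eq emeasure_lborel_cbox_eq)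
  finally have "period_cell - box (0 :: real^'n) (\<chi> i. 2 * pi) \<in> null_sets lborel"
    by (intro null_setsI) (auto simp: period_cell_def)
  from AE_not_in[OF this] show ?thesis by eventually_elim auto
qed

lemma AE_torus: "AE x in torus. x \<in> box (0 :: real^'n) (\<chi> i. 2 * pi)"
  unfolding torus_def
  using AE_period_cell by (subst AE_uniform_measure)
    (auto simp flip: period_cell_def simp: emeasure_period_cell)

lemma nn_integral_torus:
  fixes f :: "real^'n \<Rightarrow> ennreal"
  assumes [measurable]: "f \<in> borel_measurable borel"
  shows "(\<integral>\<^sup>+x. f x \<partial>torus) = (\<integral>\<^sup>+x. f x * indicator cell x \<partial>lborel) / ennreal ((2 * pi) ^ CARD('n))"
    (is "?L = _")
proof -
  have "?L = (\<integral>\<^sup>+x. f x * indicator period_cell x \<partial>lborel) / ennreal ((2 * pi) ^ CARD('n))"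
    unfolding torus_def by (subst nn_integral_uniform_measure)
      (auto simp flip: period_cell_def simp: emeasure_period_cell)
  also have "(\<integral>\<^sup>+x. f x * indicator period_cell x \<partial>lborel) = (\<integral>\<^sup>+x. f x * indicator cell x \<partial>lborel)"
  proof (rule nn_integral_cong_AE)
    have "AE x in lborel. x \<in> period_cell \<longleftrightarrow> x \<in> cell"
      using AE_period_cell
      by eventually_elim (use cell_subset in \<open>auto simp: box_period_cell cell_def less_imp_le\<close>)
    then show "AE x in lborel. f x * indicator period_cell x = f x * indicator cell x"
      by eventually_elim (auto simp: indicator_def)
  qed
  finally show ?thesis .
qed

lemma emeasure_torus: "emeasure (torus :: (real^'n) measure) UNIV = 1"
  unfolding torus_def
  by (subst emeasure_uniform_measure) (auto simp flip: period_cell_def simp: emeasure_period_cell)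

interpretation torus: finite_measure "torus :: (real^'n) measure"
  by standard (simp add: emeasure_torus)

lemma measure_torus [simp]: "measure (torus :: (real^'n) measure) UNIV = 1"
  by (simp add: measure_def emeasure_torus)

interpretation torus_lborel: pair_sigma_finite "torus :: (real^'n) measure" "lborel :: (real^'n) measure"
  by unfold_locales

section \<open>Translation invariance on the torus and on phase space\<close>

lemma nn_integral_lborel_translate:
  fixes f :: "'a::euclidean_space \<Rightarrow> ennreal"
  assumes [measurable]: "f \<in> borel_measurable borel"
  shows "(\<integral>\<^sup>+x. f (x + a) \<partial>lborel) = (\<integral>\<^sup>+x. f x \<partial>lborel)"
proof -
  have "(\<integral>\<^sup>+x. f x \<partial>lborel) = (\<integral>\<^sup>+x. f x \<partial>distr lborel borel ((+) a))"
    by (simp add: lborel_distr_plus)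
  also have "\<dots> = (\<integral>\<^sup>+x. f (a + x) \<partial>lborel)" by (subst nn_integral_distr) auto
  finally show ?thesis by (simp add: add.commute)
qed

text \<open>The translated cell is cut along the lattice of periods and reassembled.\<close>

lemma nn_integral_torus_translate:
  fixes f :: "real^'n \<Rightarrow> ennreal"
  assumes [measurable]: "f \<in> borel_measurable borel" and f: "periodic f"
  shows "(\<integral>\<^sup>+x. f (x + a) \<partial>torus) = (\<integral>\<^sup>+x. f x \<partial>torus)"
proof -
  let ?c = "indicator cell :: real^'n \<Rightarrow> ennreal"
  let ?N = "count_space (UNIV :: (int^'n) set)"
  interpret N: sigma_finite_measure ?N
    by (rule sigma_finite_measure_count_space_countable) simp
  interpret NL: pair_sigma_finite ?N "lborel :: (real^'n) measure" ..
  have tile: "(\<integral>\<^sup>+k. ?c (y - (2 * pi) *\<^sub>R emb k) \<partial>?N) = 1" for y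
  proof -
    have "?c (y - (2 * pi) *\<^sub>R emb k) = indicator {cell_index y} k" for k
      by (simp add: indicator_def in_cell_iff)
    then show ?thesis by simp
  qed
  have "(\<integral>\<^sup>+x. f (x + a) * ?c x \<partial>lborel) = (\<integral>\<^sup>+x. f x * ?c (x - a) \<partial>lborel)"
    by (subst nn_integral_lborel_translate[where a = a and f = "\<lambda>x. f x * ?c (x - a)", symmetric]) auto
  also have "\<dots> = (\<integral>\<^sup>+x. (\<integral>\<^sup>+k. f x * ?c (x - a) * ?c (x - (2 * pi) *\<^sub>R emb k) \<partial>?N) \<partial>lborel)"
    by (simp add: nn_integral_cmult tile)
  also have "\<dots> = (\<integral>\<^sup>+k. (\<integral>\<^sup>+x. f x * ?c (x - a) * ?c (x - (2 * pi) *\<^sub>R emb k) \<partial>lborel) \<partial>?N)"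
    by (rule NL.Fubini') (rule measurable_pair_measure_countable1, auto)
  also have "\<dots> = (\<integral>\<^sup>+k. (\<integral>\<^sup>+x. f x * ?c (x + (2 * pi) *\<^sub>R emb k - a) * ?c x \<partial>lborel) \<partial>?N)"
  proof (rule nn_integral_cong)
    fix k :: "int^'n"
    show "(\<integral>\<^sup>+x. f x * ?c (x - a) * ?c (x - (2 * pi) *\<^sub>R emb k) \<partial>lborel)
      = (\<integral>\<^sup>+x. f x * ?c (x + (2 * pi) *\<^sub>R emb k - a) * ?c x \<partial>lborel)"
      by (subst nn_integral_lborel_translate[where a = "(2 * pi) *\<^sub>R emb k", symmetric])
        (auto simp: periodic_add_emb[OF f])
  qed
  also have "\<dots> = (\<integral>\<^sup>+x. (\<integral>\<^sup>+k. f x * ?c (x + (2 * pi) *\<^sub>R emb k - a) * ?c x \<partial>?N) \<partial>lborel)"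
    by (rule NL.Fubini'[symmetric]) (rule measurable_pair_measure_countable1, auto)
  also have "\<dots> = (\<integral>\<^sup>+x. f x * ?c x \<partial>lborel)"
  proof (intro nn_integral_cong)
    fix x
    have "(\<integral>\<^sup>+k. ?c (x + (2 * pi) *\<^sub>R emb k - a) \<partial>?N) = (\<integral>\<^sup>+k. ?c ((x - a) - (2 * pi) *\<^sub>R emb (- k)) \<partial>?N)"
      by (simp add: emb_simps algebra_simps)
    also have "\<dots> = (\<integral>\<^sup>+k. ?c ((x - a) - (2 * pi) *\<^sub>R emb k) \<partial>?N)"
      by (rule nn_integral_bij_count_space) (rule bij_uminus)
    also have "\<dots> = 1" by (rule tile)
    finally show "(\<integral>\<^sup>+k. f x * ?c (x + (2 * pi) *\<^sub>R emb k - a) * ?c x \<partial>?N) = f x * ?c x"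
      by (simp add: nn_integral_cmult mult.assoc mult.left_commute[of _ "?c x"] nn_integral_multc)
  qed
  finally show ?thesis by (simp add: nn_integral_torus)
qed

abbreviation phase :: "((real^'n) \<times> (real^'n)) measure" where
  "phase \<equiv> torus \<Otimes>\<^sub>M lborel"

lemma sets_phase [measurable_cong]: "sets phase = sets borel"
  by (metis borel_prod sets_pair_measure_cong sets_lborel sets_torus)

lemma space_phase [simp]: "space phase = UNIV"
  by (simp add: space_pair_measure)

definition xperiodic :: "((real^'n) \<times> 'a \<Rightarrow> 'b) \<Rightarrow> bool" where
  "xperiodic h \<longleftrightarrow> (\<forall>v. periodic (\<lambda>x. h (x, v)))"

lemma nn_integral_phase_translate:
  fixes f :: "(real^'n) \<times> (real^'n) \<Rightarrow> ennreal"
  assumes [measurable]: "f \<in> borel_measurable borel" and f: "xperiodic f"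
  shows "(\<integral>\<^sup>+z. f (z + e) \<partial>phase) = (\<integral>\<^sup>+z. f z \<partial>phase)"
proof -
  have [measurable]: "f \<in> borel_measurable phase" by (simp add: measurable_cong_sets[OF sets_phase refl])
  have [measurable]: "(\<lambda>z. f (z + e)) \<in> borel_measurable borel" by measurable
  then have [measurable]: "(\<lambda>z. f (z + e)) \<in> borel_measurable phase"
    by (simp add: measurable_cong_sets[OF sets_phase refl])
  have [measurable]: "(\<lambda>x. \<integral>\<^sup>+v. f (x, v) \<partial>lborel) \<in> borel_measurable borel"
    using lborel.borel_measurable_nn_integral_fst[of f torus]
    by (simp add: measurable_cong_sets[OF sets_torus refl])
  have "(\<integral>\<^sup>+z. f (z + e) \<partial>phase) = (\<integral>\<^sup>+x. (\<integral>\<^sup>+v. f (x + fst e, v + snd e) \<partial>lborel) \<partial>torus)"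
    by (subst lborel.nn_integral_fst[symmetric]) (measurable, auto simp: plus_prod_def)
  also have "\<dots> = (\<integral>\<^sup>+x. (\<integral>\<^sup>+v. f (x + fst e, v) \<partial>lborel) \<partial>torus)"
    by (intro nn_integral_cong nn_integral_lborel_translate) measurable
  also have "\<dots> = (\<integral>\<^sup>+x. (\<integral>\<^sup>+v. f (x, v) \<partial>lborel) \<partial>torus)"
    using f by (intro nn_integral_torus_translate[where f = "\<lambda>x. \<integral>\<^sup>+v. f (x, v) \<partial>lborel"])
      (auto simp: periodic_def xperiodic_def)
  also have "\<dots> = (\<integral>\<^sup>+z. f z \<partial>phase)" by (rule lborel.nn_integral_fst) auto
  finally show ?thesis .
qed

text \<open>A translation does not preserve the measure \<open>phase\<close> on arbitrary Borel
  sets, only on those periodic in x. After pushing forward under reduction to the cell the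
  invariance becomes an equality of measures, and a periodic \<open>h\<close>, which factors through
  that reduction, inherits it for Bochner integrals.\<close>

lemma phase_translate:
  fixes h :: "(real^'n) \<times> (real^'n) \<Rightarrow> 'b::{banach, second_countable_topology}"
  assumes [measurable]: "h \<in> borel_measurable borel" and h: "xperiodic h"
  shows "(LINT z|phase. h (z + e)) = (LINT z|phase. h z)"
    and "integrable phase h \<Longrightarrow> integrable phase (\<lambda>z. h (z + e))"
proof -
  define R where "R = (\<lambda>z::(real^'n) \<times> (real^'n). (reduce (fst z), snd z))"
  have [measurable]: "R \<in> borel_measurable borel" unfolding R_def by measurable
  have Rm: "(\<lambda>z. R (z + a)) \<in> phase \<rightarrow>\<^sub>M borel" for a
    by (simp add: measurable_cong_sets[OF sets_phase refl])
  have hR: "h (R z) = h z" for z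
    using periodic_reduce[of "\<lambda>x. h (x, snd z)" "fst z"] h by (simp add: R_def xperiodic_def)
  have D: "distr phase borel (\<lambda>z. R (z + e)) = distr phase borel (\<lambda>z. R (z + 0))"
  proof (rule measure_eqI)
    fix A assume "A \<in> sets (distr phase borel (\<lambda>z. R (z + e)))"
    then have [measurable]: "A \<in> sets borel" by simp
    have em: "emeasure (distr phase borel (\<lambda>z. R (z + a))) A = (\<integral>\<^sup>+z. indicator A (R (z + a)) \<partial>phase)" for a
      by (subst nn_integral_distr[OF Rm, symmetric]) (simp_all add: nn_integral_indicator)
    have "xperiodic (\<lambda>z. indicator A (R z) :: ennreal)"
      by (simp add: xperiodic_def periodic_def R_def reduce_add_axis)
    then show "emeasure (distr phase borel (\<lambda>z. R (z + e))) A = emeasure (distr phase borel (\<lambda>z. R (z + 0))) A"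
      unfolding em by (simp add: nn_integral_phase_translate[where f = "\<lambda>z. indicator A (R z)"])
  qed simp
  show "(LINT z|phase. h (z + e)) = (LINT z|phase. h z)"
    using arg_cong[OF D, of "\<lambda>M. integral\<^sup>L M h"] by (simp add: integral_distr[OF Rm] integral_distr[OF Rm[of 0, unfolded add_0_right]] hR)
  show "integrable phase (\<lambda>z. h (z + e))" if "integrable phase h"
    using arg_cong[OF D, of "\<lambda>M. integrable M h"] that by (simp add: integrable_distr_eq[OF Rm] integrable_distr_eq[OF Rm[of 0, unfolded add_0_right]] hR)
qed

lemma torus_translate:
  fixes h :: "(real^'n) \<Rightarrow> 'b::{banach, second_countable_topology}"
  assumes [measurable]: "h \<in> borel_measurable borel" and h: "periodic h"
  shows "(LINT x|torus. h (x + a)) = (LINT x|torus. h x)"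
proof -
  have Rm: "(\<lambda>x. reduce (x + b)) \<in> torus \<rightarrow>\<^sub>M borel" for b :: "real^'n"
    by (simp add: measurable_cong_sets[OF sets_torus refl])
  have D: "distr torus borel (\<lambda>x. reduce (x + a)) = distr torus borel (\<lambda>x. reduce (x + 0))"
  proof (rule measure_eqI)
    fix A assume "A \<in> sets (distr torus borel (\<lambda>x. reduce (x + a)))"
    then have [measurable]: "A \<in> sets borel" by simp
    have em: "emeasure (distr torus borel (\<lambda>z. reduce (z + b))) A = (\<integral>\<^sup>+z. indicator A (reduce (z + b)) \<partial>torus)" for b
      by (subst nn_integral_distr[OF Rm, symmetric]) (simp_all add: nn_integral_indicator)
    have "periodic (\<lambda>z. indicator A (reduce z) :: ennreal)"
      by (simp add: periodic_def reduce_add_axis)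
    then show "emeasure (distr torus borel (\<lambda>x. reduce (x + a))) A = emeasure (distr torus borel (\<lambda>x. reduce (x + 0))) A"
      unfolding em by (simp add: nn_integral_torus_translate[where f = "\<lambda>z. indicator A (reduce z)"])
  qed simp
  show ?thesis
    using arg_cong[OF D, of "\<lambda>M. integral\<^sup>L M h"] by (simp add: integral_distr[OF Rm] integral_distr[OF Rm[of 0, unfolded add_0_right]] periodic_reduce[OF h])
qed

text \<open>Only the derivative along lines in direction \<open>e\<close> is recorded. This suffices
  for integration by parts and passes easily through products, shifts and inner products, where
  Frechet derivatives would be cumbersome.\<close>

definition has_dderiv ::
    "('a::real_normed_vector \<Rightarrow> 'b::real_normed_vector) \<Rightarrow> 'a \<Rightarrow> ('a \<Rightarrow> 'b) \<Rightarrow> bool" where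
  "has_dderiv f e f' \<longleftrightarrow> (\<forall>z. ((\<lambda>r. f (z + r *\<^sub>R e)) has_vector_derivative f' z) (at 0))"

lemma has_dderiv_at:
  assumes "has_dderiv f e f'"
  shows "((\<lambda>r. f (z + r *\<^sub>R e)) has_vector_derivative f' (z + r *\<^sub>R e)) (at r within A)"
proof -
  have "((\<lambda>q. f (z + r *\<^sub>R e + q *\<^sub>R e)) has_vector_derivative f' (z + r *\<^sub>R e)) (at (r - r))"
    using assms by (simp add: has_dderiv_def)
  then have "((\<lambda>q. f (z + r *\<^sub>R e + q *\<^sub>R e)) \<circ> (\<lambda>q. q - r) has_vector_derivative 1 *\<^sub>R f' (z + r *\<^sub>R e)) (at r)"
    by (intro vector_diff_chain_at) (auto intro!: derivative_eq_intros)
  then show ?thesis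
    by (simp add: o_def algebra_simps has_vector_derivative_at_within)
qed

text \<open>The integral of a directional derivative vanishes because \<open>h(\<cdot> + e)\<close> and \<open>h\<close> have the same
  integral, and their difference is the mean of \<open>h'(\<cdot> + u e)\<close> over \<open>u \<in> [0,1]\<close>.\<close>

lemma phase_integral_dderiv:
  fixes h h' :: "(real^'n) \<times> (real^'n) \<Rightarrow> 'b::euclidean_space"
  assumes d: "has_dderiv h e h'"
    and ih: "integrable phase h" "xperiodic h" and ih': "integrable phase h'" "xperiodic h'"
    and c: "continuous_on UNIV h" "continuous_on UNIV h'"
  shows "(LINT z|phase. h' z) = 0"
proof -
  note [measurable] = borel_measurable_continuous_onI[OF c(1)] borel_measurable_continuous_onI[OF c(2)]
  interpret P: pair_sigma_finite "phase :: ((real^'n) \<times> (real^'n)) measure" "lborel :: real measure"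
    by unfold_locales
  let ?F = "\<lambda>z u. indicator {0..1::real} u *\<^sub>R h' (z + u *\<^sub>R e)"
  have "(\<lambda>(z, u). ?F z u) \<in> borel_measurable borel" unfolding case_prod_beta by measurable
  then have m: "(\<lambda>(z, u). ?F z u) \<in> borel_measurable (phase \<Otimes>\<^sub>M lborel)"
    by (simp add: borel_prod measurable_cong_sets[OF sets_pair_measure_cong[OF sets_phase sets_lborel] refl])
  have xp: "xperiodic (\<lambda>z. ennreal (norm (h' z)))" using ih'(2) by (simp add: xperiodic_def periodic_def)
  have "(\<integral>\<^sup>+zu. ennreal (norm ((\<lambda>(z, u). ?F z u) zu)) \<partial>(phase \<Otimes>\<^sub>M lborel))
      = (\<integral>\<^sup>+u. (\<integral>\<^sup>+z. ennreal (norm (?F z u)) \<partial>phase) \<partial>lborel)"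
    by (subst P.nn_integral_snd[symmetric]) (use m in auto)
  also have "\<dots> = (\<integral>\<^sup>+u. indicator {0..1::real} u * (\<integral>\<^sup>+z. ennreal (norm (h' z)) \<partial>phase) \<partial>lborel)"
  proof (intro nn_integral_cong)
    fix u
    have "(\<integral>\<^sup>+z. ennreal (norm (?F z u)) \<partial>phase) = (\<integral>\<^sup>+z. indicator {0..1} u * ennreal (norm (h' (z + u *\<^sub>R e))) \<partial>phase)"
      by (intro nn_integral_cong) (auto simp: indicator_def)
    also have "\<dots> = indicator {0..1} u * (\<integral>\<^sup>+z. ennreal (norm (h' (z + u *\<^sub>R e))) \<partial>phase)"
      by (rule nn_integral_cmult) (simp add: measurable_cong_sets[OF sets_phase refl])
    finally show "(\<integral>\<^sup>+z. ennreal (norm (?F z u)) \<partial>phase) = indicator {0..1} u * (\<integral>\<^sup>+z. ennreal (norm (h' z)) \<partial>phase)"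
      using xp by (simp add: nn_integral_phase_translate[where f = "\<lambda>z. ennreal (norm (h' z))"])
  qed
  also have "\<dots> < \<infinity>" using ih'(1) by (simp add: nn_integral_multc integrable_iff_bounded)
  finally have int: "integrable (phase \<Otimes>\<^sub>M lborel) (\<lambda>(z, u). ?F z u)"
    using m by (simp add: integrable_iff_bounded)
  have ftc: "(LINT u|lborel. ?F z u) = h (z + e) - h z" for z
  proof -
    have "continuous_on {0..1} (\<lambda>u::real. h' (z + u *\<^sub>R e))"
      by (intro continuous_on_compose2[OF c(2)] continuous_intros) simp
    from integral_FTC_atLeastAtMost[OF _ _ this, of "\<lambda>u. h (z + u *\<^sub>R e)"] show ?thesis
      using has_dderiv_at[OF d] by simp
  qed
  have "0 = (LINT z|phase. h (z + e) - h z)"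
    using phase_translate[OF _ ih(2)] ih(1) by simp
  also have "\<dots> = (LINT z|phase. LINT u|lborel. ?F z u)" by (simp add: ftc)
  also have "\<dots> = (LINT u|lborel. LINT z|phase. ?F z u)" using P.Fubini_integral[OF int] by simp
  also have "\<dots> = (LINT u|lborel. indicator {0..1::real} u *\<^sub>R (LINT z|phase. h' z))"
    by (intro Bochner_Integration.integral_cong refl)
      (simp add: phase_translate(1)[OF _ ih'(2)])
  also have "\<dots> = (LINT z|phase. h' z)" by simp
  finally show ?thesis by simp
qed

subsection \<open>Characters\<close>

definition E :: "int^'n \<Rightarrow> real^'n \<Rightarrow> complex" where
  "E k x = cis (emb k \<bullet> x)"

lemma E_simps: "E (k + l) x = E k x * E l x" "E k (x + y) = E k x * E k y" "E 0 x = 1"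
  "E (- k) x = cnj (E k x)" "norm (E k x) = 1"
  by (simp_all add: E_def emb_simps inner_add_left inner_add_right cis_mult cis_cnj)

lemma continuous_on_E [continuous_intros]: "continuous_on S f \<Longrightarrow> continuous_on S (\<lambda>x. E k (f x))"
  unfolding E_def cis_conv_exp by (intro continuous_intros)

lemma E_measurable [measurable]: "E k \<in> borel_measurable borel"
  by (rule borel_measurable_continuous_onI) (intro continuous_intros)

lemma periodic_E: "periodic (E k)"
proof -
  have "emb k \<bullet> axis i (2 * pi) = 2 * pi * of_int (k $ i)" for i
    by (simp add: inner_axis)
  then show ?thesis
    by (simp add: periodic_def E_simps(2)) (simp add: E_def cis_multiple_2pi)
qed

text \<open>For k \<noteq> 0 some translation by half a wavelength changes the sign of the
  character, while the integral is translation invariant.\<close>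

lemma E_orthogonal: "(LINT x|torus. E k x) = (if k = 0 then 1 else 0)"
proof (cases "k = 0")
  case True
  then show ?thesis by (simp add: E_simps)
next
  case False
  then obtain j where j: "k $ j \<noteq> 0" by (auto simp: vec_eq_iff)
  let ?a = "axis j (pi / of_int (k $ j)) :: real^'a"
  have "emb k \<bullet> ?a = pi" using j by (simp add: inner_axis)
  then have a: "E k ?a = -1" by (simp add: E_def)
  have "(LINT x|torus. E k x) = (LINT x|torus. E k (x + ?a))"
    by (rule torus_translate[symmetric]) (auto simp: periodic_E)
  also have "\<dots> = - (LINT x|torus. E k x)" by (simp add: E_simps(2) a)
  finally show ?thesis using False by simp
qed

subsection \<open>Weights, lattice sums and the time kernel\<close>

definition wt :: "real \<Rightarrow> real^'n \<Rightarrow> real" where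
  "wt \<sigma> v = (1 + (norm v)\<^sup>2) powr \<sigma>"

lemma wt_pos: "0 < wt \<sigma> v"
proof -
  have "0 < 1 + (norm v)\<^sup>2" by (rule add_pos_nonneg) auto
  then show ?thesis by (simp add: wt_def)
qed

lemma wt_measurable [measurable]: "wt \<sigma> \<in> borel_measurable borel"
  unfolding wt_def by measurable

lemma nn_integral_japanese_1d:
  assumes s: "s > 1/2"
  shows "(\<integral>\<^sup>+y. ennreal (1 / (1 + y\<^sup>2) powr s) \<partial>(lborel :: real measure)) < \<infinity>"
proof -
  let ?f = "\<lambda>y::real. ennreal (1 / (1 + y\<^sup>2) powr s)"
  let ?g = "\<lambda>y::real. ennreal (y powr (- 2 * s)) * indicator {1..} y"
  have tail: "?f y \<le> ennreal (y powr (- 2 * s))" if "y \<ge> 1" for y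
  proof -
    have "y powr (2 * s) = (y\<^sup>2) powr s" using that by (simp add: powr_powr flip: powr_numeral)
    also have "\<dots> \<le> (1 + y\<^sup>2) powr s" using s by (intro powr_mono2) auto
    finally have "1 / (1 + y\<^sup>2) powr s \<le> 1 / y powr (2 * s)"
      using that add_pos_nonneg[of 1 "y\<^sup>2"] by (intro divide_left_mono mult_pos_pos) auto
    also have "\<dots> = y powr (- 2 * s)" using powr_minus_divide[of y "2 * s"] by simp
    finally show ?thesis by (rule ennreal_leI)
  qed
  have bound: "?f y \<le> indicator {-1..1} y + (?g y + ?g (- y))" for y
  proof (cases "\<bar>y\<bar> \<le> 1")
    case True
    have "(1 + y\<^sup>2) powr s \<ge> 1" using s by (intro ge_one_powr_ge_zero) auto
    then have "?f y \<le> 1" by (subst ennreal_le_1) (simp add: divide_simps)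
    moreover have "indicator {-1..1} y = (1 :: ennreal)" using True by (simp add: indicator_def abs_le_iff)
    ultimately show ?thesis by (simp add: add_increasing2)
  next
    case False
    then show ?thesis using tail[of y] tail[of "- y"] by (cases "y \<ge> 1") (auto simp: indicator_def)
  qed
  have gfin: "(\<integral>\<^sup>+y. ?g y \<partial>lborel) < \<infinity>"
  proof -
    have "(\<integral>\<^sup>+y. ?g y \<partial>lborel) = ennreal (0 - 1 powr (1 - 2 * s) / (1 - 2 * s))"
    proof (rule nn_integral_FTC_atLeast[where F = "\<lambda>y. y powr (1 - 2 * s) / (1 - 2 * s)"])
      show "((\<lambda>y. y powr (1 - 2 * s) / (1 - 2 * s)) has_real_derivative y powr (- 2 * s)) (at y)" if "1 \<le> y" for y
        using that s by (auto intro!: derivative_eq_intros)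
      have "((\<lambda>y::real. y powr (1 - 2 * s)) \<longlongrightarrow> 0) at_top"
        using s by (intro tendsto_neg_powr filterlim_ident) auto
      then show "((\<lambda>y. y powr (1 - 2 * s) / (1 - 2 * s)) \<longlongrightarrow> 0) at_top"
        by (rule tendsto_eq_intros) (use s in auto)
    qed auto
    then show ?thesis by simp
  qed
  have "(\<integral>\<^sup>+y. ?f y \<partial>lborel) \<le> (\<integral>\<^sup>+y. indicator {-1..1} y + (?g y + ?g (- y)) \<partial>lborel)"
    by (intro nn_integral_mono bound)
  also have "\<dots> = (\<integral>\<^sup>+y. indicator {-1..1::real} y \<partial>lborel) + (\<integral>\<^sup>+y. ?g y + ?g (- y) \<partial>lborel)"
    by (rule nn_integral_add) measurable
  also have "(\<integral>\<^sup>+y. ?g y + ?g (- y) \<partial>lborel) = (\<integral>\<^sup>+y. ?g y \<partial>lborel) + (\<integral>\<^sup>+y. ?g (- y) \<partial>lborel)"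
    by (rule nn_integral_add) measurable
  also have "(\<integral>\<^sup>+y. ?g (- y) \<partial>lborel) = (\<integral>\<^sup>+y. ?g y \<partial>lborel)"
    by (subst nn_integral_real_affine[where c = "-1" and t = 0 and f = "?g"]) auto
  also have "(\<integral>\<^sup>+y. indicator {-1..1::real} y \<partial>lborel) + ((\<integral>\<^sup>+y. ?g y \<partial>lborel) + (\<integral>\<^sup>+y. ?g y \<partial>lborel)) < \<infinity>"
    using gfin by simp
  finally show ?thesis .
qed

text \<open>Since each coordinate is at most |v|, the inverse weight is at most a product of d
  one-dimensional inverse weights of exponent \<open>\<sigma> / d\<close>. This exponent exceeds
  1/2, and Tonelli factorises the integral.\<close>

lemma nn_integral_inverse_wt:
  assumes s: "\<sigma> > real CARD('n::finite) / 2"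
  shows "(\<integral>\<^sup>+v. ennreal (1 / wt \<sigma> v) \<partial>(lborel :: (real^'n) measure)) < \<infinity>"
proof -
  let ?q = "\<sigma> / real CARD('n)"
  have q: "?q > 1/2" using s by (simp add: field_simps)
  have *: "1 / wt \<sigma> v \<le> (\<Prod>b\<in>Basis. 1 / (1 + (v \<bullet> b)\<^sup>2) powr ?q)" for v :: "real^'n"
  proof -
    have "(\<Prod>b\<in>Basis. (1 + (v \<bullet> b)\<^sup>2) powr ?q) \<le> (\<Prod>b\<in>(Basis :: (real^'n) set). (1 + (norm v)\<^sup>2) powr ?q)"
    proof (intro prod_mono conjI powr_mono2)
      fix b :: "real^'n" assume "b \<in> Basis"
      then show "1 + (v \<bullet> b)\<^sup>2 \<le> 1 + (norm v)\<^sup>2"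
        using Basis_le_norm[of b v] by (metis add_left_mono abs_norm_cancel abs_le_square_iff)
    qed (use q in auto)
    also have "\<dots> = wt \<sigma> v"
    proof -
      have "0 < 1 + (norm v)\<^sup>2" by (rule add_pos_nonneg) auto
      then show ?thesis unfolding wt_def by (simp add: powr_power)
    qed
    finally have le: "(\<Prod>b\<in>Basis. (1 + (v \<bullet> b)\<^sup>2) powr ?q) \<le> wt \<sigma> v" .
    have "0 < (\<Prod>b\<in>Basis. (1 + (v \<bullet> b)\<^sup>2) powr ?q)"
    proof (intro prod_pos ballI)
      fix b show "0 < (1 + (v \<bullet> b)\<^sup>2) powr ?q"
        using add_pos_nonneg[of 1 "(v \<bullet> b)\<^sup>2"] by simp
    qed
    then show ?thesis using le by (simp add: prod_dividef frac_le)
  qed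
  have "(\<integral>\<^sup>+v. ennreal (1 / wt \<sigma> v) \<partial>(lborel :: (real^'n) measure))
    \<le> (\<integral>\<^sup>+v. (\<Prod>b\<in>Basis. ennreal (1 / (1 + (v \<bullet> b)\<^sup>2) powr ?q)) \<partial>(lborel :: (real^'n) measure))"
    by (intro nn_integral_mono) (simp add: prod_ennreal * ennreal_leI)
  also have "\<dots> = (\<Prod>b\<in>(Basis :: (real^'n) set). (\<integral>\<^sup>+y. ennreal (1 / (1 + y\<^sup>2) powr ?q) \<partial>lborel))"
    by (rule nn_integral_lborel_prod) auto
  also have "\<dots> < \<infinity>"
    using nn_integral_japanese_1d[OF q] by (simp add: power_less_top_ennreal less_top)
  finally show ?thesis .
qed

text \<open>The smallest integer power of 1 + |l| whose reciprocal is summable over the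
  d-dimensional lattice.\<close>

definition lattice_wt :: "int^'n \<Rightarrow> real" where
  "lattice_wt l = 1 / (1 + norm (emb l)) ^ (CARD('n) + 1)"

lemma lattice_wt_nonneg: "0 \<le> lattice_wt l"
  by (simp add: lattice_wt_def)

lemma sum_int_powr_bounded:
  fixes q :: real
  assumes q: "q > 1"
  shows "\<exists>B\<ge>0. \<forall>N::nat. (\<Sum>m\<in>{- int N..int N}. 1 / (1 + \<bar>of_int m\<bar>) powr q) \<le> B"
proof -
  let ?g = "\<lambda>n::nat. 1 / (1 + real n) powr q"
  have "summable (\<lambda>n. real n powr (- q))" using q by (simp add: summable_real_powr_iff)
  then have "summable (\<lambda>n. real (Suc n) powr (- q))" by (subst summable_Suc_iff)
  then have sm: "summable ?g" by (simp add: powr_minus_divide)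
  have "(\<Sum>m\<in>{- int N..int N}. 1 / (1 + \<bar>of_int m\<bar>) powr q) \<le> suminf ?g + suminf ?g" for N
  proof -
    let ?h = "\<lambda>m::int. 1 / (1 + \<bar>of_int m\<bar>) powr q :: real"
    let ?A = "int ` {..N}" and ?B = "(\<lambda>n. - int n) ` {..N}"
    have "{- int N..int N} \<subseteq> ?A \<union> ?B"
    proof
      fix m assume "m \<in> {- int N..int N}"
      then have "m = int (nat m) \<and> nat m \<le> N \<or> m = - int (nat (- m)) \<and> nat (- m) \<le> N" by auto
      then show "m \<in> ?A \<union> ?B" by blast
    qed
    then have "sum ?h {- int N..int N} \<le> sum ?h (?A \<union> ?B)" by (intro sum_mono2) auto
    also have "\<dots> \<le> sum ?h ?A + sum ?h ?B"
      by (subst sum.union_inter[symmetric]) (auto intro: sum_nonneg)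
    also have "sum ?h ?A = sum ?g {..N}" by (subst sum.reindex) auto
    also have "sum ?h ?B = sum ?g {..N}" by (subst sum.reindex) (auto simp: inj_on_def)
    also have "sum ?g {..N} \<le> suminf ?g" by (rule sum_le_suminf[OF sm]) auto
    finally show ?thesis by simp
  qed
  moreover have "0 \<le> suminf ?g" by (rule suminf_nonneg[OF sm]) auto
  ultimately show ?thesis by (intro exI[of _ "suminf ?g + suminf ?g"]) auto
qed

text \<open>The weight is split over the coordinates with exponent q = 1 + 1/d each, chosen so that
  q d = d + 1 while q > 1. A uniform bound on finite sums is the form in which Schur's test meets
  the supports of trigonometric polynomials.\<close>

lemma lattice_sum_bounded:
  "\<exists>S\<ge>0. \<forall>F. finite F \<longrightarrow> (\<Sum>l\<in>F. lattice_wt (l :: int^'n)) \<le> S"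
proof -
  let ?q = "1 + 1 / real CARD('n)"
  let ?h = "\<lambda>m::int. 1 / (1 + \<bar>of_int m\<bar>) powr ?q :: real"
  have "?q > 1" by simp
  from sum_int_powr_bounded[OF this] obtain B where
    B: "B \<ge> 0" "\<And>N. (\<Sum>m\<in>{- int N..int N}. ?h m) \<le> B" by blast
  have le: "lattice_wt l \<le> (\<Prod>j\<in>UNIV. ?h (l $ j))" for l :: "int^'n"
  proof -
    have "(\<Prod>j\<in>UNIV. (1 + \<bar>of_int (l $ j)\<bar>) powr ?q) \<le> (\<Prod>j\<in>(UNIV::'n set). (1 + norm (emb l)) powr ?q)"
      using component_le_norm_cart[of "emb l"] by (intro prod_mono conjI powr_mono2) auto
    also have "\<dots> = ((1 + norm (emb l)) powr ?q) ^ CARD('n)" by simp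
    also have "\<dots> = (1 + norm (emb l)) powr (?q * real CARD('n))"
    proof -
      have "1 + norm (emb l) \<noteq> 0" using norm_ge_zero[of "emb l"] by linarith
      then show ?thesis by (simp add: powr_power mult.commute)
    qed
    also have "?q * real CARD('n) = real (CARD('n) + 1)" by (simp add: field_simps)
    also have "(1 + norm (emb l)) powr real (CARD('n) + 1) = (1 + norm (emb l)) ^ (CARD('n) + 1)"
      by (rule powr_realpow) (simp add: add_pos_nonneg)
    finally have "(\<Prod>j\<in>UNIV. (1 + \<bar>of_int (l $ j)\<bar>) powr ?q) \<le> (1 + norm (emb l)) ^ (CARD('n) + 1)" .
    moreover have "0 < (\<Prod>j\<in>UNIV. (1 + \<bar>of_int (l $ j)\<bar>) powr ?q :: real)"
      by (intro prod_pos ballI) (simp add: add_pos_nonneg)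
    ultimately show ?thesis by (simp add: lattice_wt_def prod_dividef frac_le)
  qed
  have "(\<Sum>l\<in>F. lattice_wt l) \<le> B ^ CARD('n)" if F: "finite F" for F :: "(int^'n) set"
  proof -
    have "finite ((\<lambda>(l, j). \<bar>l $ j\<bar>) ` (F \<times> UNIV))" using F by simp
    then obtain M where M: "\<And>l j. l \<in> F \<Longrightarrow> \<bar>l $ j\<bar> \<le> M"
      using bdd_above_finite[of "(\<lambda>(l, j). \<bar>l $ j\<bar>) ` (F \<times> UNIV)"] by (auto simp: bdd_above_def)
    define N where "N = nat M"
    have N: "l $ j \<in> {- int N..int N}" if "l \<in> F" for l j using M[OF that, of j] by (auto simp: N_def)
    let ?P = "Pi\<^sub>E (UNIV :: 'n set) (\<lambda>_. {- int N..int N})"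
    have fP: "finite ?P" by (intro finite_PiE) auto
    have sub: "F \<subseteq> vec_lambda ` ?P"
    proof
      fix l assume "l \<in> F"
      then have "l = vec_lambda (($) l)" "($) l \<in> ?P" using N by (auto simp: PiE_def Pi_def)
      then show "l \<in> vec_lambda ` ?P" by blast
    qed
    have "(\<Sum>l\<in>F. lattice_wt l) \<le> (\<Sum>l\<in>F. \<Prod>j\<in>UNIV. ?h (l $ j))" by (intro sum_mono le)
    also have "\<dots> \<le> (\<Sum>l\<in>vec_lambda ` ?P. \<Prod>j\<in>UNIV. ?h (l $ j))"
      using sub fP by (intro sum_mono2) (auto intro: prod_nonneg)
    also have "\<dots> = (\<Sum>f\<in>?P. \<Prod>j\<in>UNIV. ?h (f j))"
      by (subst sum.reindex) (auto simp: inj_on_def vec_lambda_inject)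
    also have "\<dots> = (\<Prod>j\<in>(UNIV::'n set). \<Sum>m\<in>{- int N..int N}. ?h m)"
      by (rule prod_sum_PiE[symmetric]) auto
    also have "\<dots> = (\<Sum>m\<in>{- int N..int N}. ?h m) ^ CARD('n)" by simp
    also have "\<dots> \<le> B ^ CARD('n)" by (intro power_mono B sum_nonneg) auto
    finally show ?thesis .
  qed
  then show ?thesis using B(1) by (intro exI[of _ "B ^ CARD('n)"]) auto
qed

text \<open>The time dependence left in the coupling of two Fourier modes, with r = |k|. Writing y =
  r \<tau> it is r y / (1 + y)^3, so its integral over all \<tau> \<ge> 0 is the same for every r >
  0.\<close>

definition time_kernel :: "real \<Rightarrow> real \<Rightarrow> real" where
  "time_kernel r \<tau> = r\<^sup>2 * \<tau> / (1 + r * \<tau>) ^ 3"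

lemma time_kernel_nonneg: "0 \<le> r \<Longrightarrow> 0 \<le> \<tau> \<Longrightarrow> 0 \<le> time_kernel r \<tau>"
  by (simp add: time_kernel_def)

lemma time_kernel_measurable [measurable]: "time_kernel r \<in> borel_measurable borel"
  unfolding time_kernel_def by measurable

lemma nn_integral_time_kernel:
  assumes r: "0 \<le> r"
  shows "(\<integral>\<^sup>+\<tau>. ennreal (time_kernel r \<tau>) * indicator {0..t} \<tau> \<partial>lborel) \<le> ennreal (1/2)"
proof (cases "0 \<le> t")
  case True
  let ?g = "\<lambda>\<tau>. 1 / (1 + r * \<tau>)"
  \<comment> \<open>As r^2 \<tau> = r (1 + r \<tau>) - r, the kernel is r / (1 + r \<tau>)^2 - r /
    (1 + r \<tau>)^3, with primitives -\<open>?g\<close> and \<open>?g\<close>^2 / 2. The value of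
    \<open>?F\<close> at 0 is -1/2, which is the origin of the bound, and \<open>?F\<close> is
    nonpositive at \<open>t\<close>.\<close>
  let ?F = "\<lambda>\<tau>. - ?g \<tau> + (?g \<tau>)\<^sup>2 / 2"
  have "(\<integral>\<^sup>+\<tau>. ennreal (time_kernel r \<tau>) * indicator {0..t} \<tau> \<partial>lborel) = ennreal (?F t - ?F 0)"
  proof (rule nn_integral_FTC_Icc)
    fix \<tau> :: real assume \<tau>: "\<tau> \<in> {0..t}"
    then have p: "1 + r * \<tau> > 0" using r by (simp add: add_pos_nonneg)
    have g: "(?g has_real_derivative - r / (1 + r * \<tau>)\<^sup>2) (at \<tau>)"
      using p by (auto intro!: derivative_eq_intros simp: power2_eq_square)
    have "(?F has_real_derivative r / (1 + r * \<tau>)\<^sup>2 + ?g \<tau> * (- r / (1 + r * \<tau>)\<^sup>2)) (at \<tau>)"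
      by (rule DERIV_cong[OF DERIV_add[OF DERIV_minus[OF g] DERIV_cdivide[OF DERIV_power[OF g, of 2], of 2]]]) simp
    also have "r / (1 + r * \<tau>)\<^sup>2 + ?g \<tau> * (- r / (1 + r * \<tau>)\<^sup>2) = (r * (1 + r * \<tau>) - r) / (1 + r * \<tau>) ^ 3"
      using p by (simp add: diff_divide_distrib power2_eq_square power3_eq_cube)
    also have "\<dots> = time_kernel r \<tau>" by (simp add: time_kernel_def algebra_simps power2_eq_square)
    finally show "(?F has_real_derivative time_kernel r \<tau>) (at \<tau>)" .
  qed (use True r in \<open>simp_all add: time_kernel_nonneg\<close>)
  also have "?F t - ?F 0 \<le> 1 / 2"
  proof -
    have "0 \<le> r * t" using True r by simp
    then have "0 \<le> ?g t" "?g t \<le> 1" by (auto simp: divide_simps)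
    then have "(?g t)\<^sup>2 \<le> ?g t * 1" unfolding power2_eq_square by (intro mult_left_mono)
    then have "?F t \<le> 0" using \<open>0 \<le> ?g t\<close> by linarith
    then show ?thesis by simp
  qed
  finally show ?thesis by (simp add: ennreal_leI)
qed simp

subsection \<open>Decay of Fourier transforms\<close>

text \<open>The type argument carries the dimension, which \<open>\<sigma>\<close> alone does not
  determine.\<close>

definition wt_mass :: "'n::finite itself \<Rightarrow> real \<Rightarrow> real" where
  "wt_mass _ \<sigma> = enn2real (\<integral>\<^sup>+v. ennreal (1 / wt \<sigma> v) \<partial>(lborel :: (real^'n) measure))"

lemma wt_mass_nonneg [simp]: "0 \<le> wt_mass TYPE('n::finite) \<sigma>"
  by (simp add: wt_mass_def)

lemma ennreal_wt_mass:
  assumes "\<sigma> > real CARD('n::finite) / 2"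
  shows "(\<integral>\<^sup>+v. ennreal (1 / wt \<sigma> v) \<partial>(lborel :: (real^'n) measure)) = ennreal (wt_mass TYPE('n) \<sigma>)"
  using nn_integral_inverse_wt[OF assms] by (simp add: wt_mass_def less_top)

lemma nn_integral_cauchy_schwarz_wt:
  fixes f :: "'a \<Rightarrow> ennreal" and w :: "'a \<Rightarrow> real"
  assumes [measurable]: "f \<in> borel_measurable M" "w \<in> borel_measurable M" and w: "\<And>z. 0 < w z"
  shows "(\<integral>\<^sup>+z. f z \<partial>M)\<^sup>2 \<le> (\<integral>\<^sup>+z. ennreal (1 / w z) \<partial>M) * (\<integral>\<^sup>+z. ennreal (w z) * (f z)\<^sup>2 \<partial>M)"
proof -
  have e: "ennreal (1 / sqrt (w z)) * (ennreal (sqrt (w z)) * f z) = f z" for z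
    using w[of z] by (simp add: mult.assoc[symmetric] ennreal_mult'[symmetric])
  have "(\<integral>\<^sup>+z. f z \<partial>M)\<^sup>2 = (\<integral>\<^sup>+z. ennreal (1 / sqrt (w z)) * (ennreal (sqrt (w z)) * f z) \<partial>M)\<^sup>2"
    by (simp add: e)
  also have "\<dots> \<le> (\<integral>\<^sup>+z. (ennreal (1 / sqrt (w z)))\<^sup>2 \<partial>M) * (\<integral>\<^sup>+z. (ennreal (sqrt (w z)) * f z)\<^sup>2 \<partial>M)"
    by (rule Cauchy_Schwarz_nn_integral) measurable
  also have "(\<lambda>z. (ennreal (1 / sqrt (w z)))\<^sup>2) = (\<lambda>z. ennreal (1 / w z))"
    using w by (intro ext) (simp add: ennreal_power power_divide less_imp_le)
  also have "(\<lambda>z. (ennreal (sqrt (w z)) * f z)\<^sup>2) = (\<lambda>z. ennreal (w z) * (f z)\<^sup>2)"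
    using w by (intro ext) (simp add: power_mult_distrib ennreal_power less_imp_le)
  finally show ?thesis .
qed

lemma power2_le_imp_le_ennreal: "(x::ennreal)\<^sup>2 \<le> y\<^sup>2 \<Longrightarrow> x \<le> y"
proof (cases x; cases y)
  fix r s assume "x\<^sup>2 \<le> y\<^sup>2" "x = ennreal r" "y = ennreal s" "0 \<le> r" "0 \<le> s"
  then show "x \<le> y" using power2_le_imp_le[of r s] by (simp add: ennreal_power)
qed (auto simp: top_power_ennreal ennreal_power top_unique)

lemma nn_integral_phase_inverse_wt:
  assumes "\<sigma> > real CARD('n::finite) / 2"
  shows "(\<integral>\<^sup>+z. ennreal (1 / wt \<sigma> (snd z)) \<partial>(phase :: ((real^'n) \<times> (real^'n)) measure)) = ennreal (wt_mass TYPE('n) \<sigma>)"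
  by (subst lborel.nn_integral_fst[symmetric]) (measurable, simp add: ennreal_wt_mass[OF assms] emeasure_torus)

text \<open>Cauchy-Schwarz against the inverse weight, whose mass on phase space is
  \<open>wt_mass\<close> because the torus has mass one. This is where the condition on
  \<open>\<sigma>\<close> takes effect.\<close>

lemma weighted_L2_imp_L1:
  fixes f :: "(real^'n) \<times> (real^'n) \<Rightarrow> 'b::euclidean_space"
  assumes s: "\<sigma> > real CARD('n) / 2" and [measurable]: "f \<in> borel_measurable borel"
    and Q: "(\<integral>\<^sup>+z. ennreal (wt \<sigma> (snd z) * (norm (f z))\<^sup>2) \<partial>phase) \<le> ennreal (Q\<^sup>2)" "0 \<le> Q"
  shows "(\<integral>\<^sup>+z. ennreal (norm (f z)) \<partial>phase) \<le> ennreal (sqrt (wt_mass TYPE('n) \<sigma>) * Q)"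
    and "integrable phase f"
proof -
  have "(\<integral>\<^sup>+z. ennreal (norm (f z)) \<partial>phase)\<^sup>2
     \<le> ennreal (wt_mass TYPE('n) \<sigma>) * (\<integral>\<^sup>+z. ennreal (wt \<sigma> (snd z)) * (ennreal (norm (f z)))\<^sup>2 \<partial>phase)"
    unfolding nn_integral_phase_inverse_wt[OF s, symmetric]
    by (rule nn_integral_cauchy_schwarz_wt) (simp_all add: measurable_cong_sets[OF sets_phase refl] wt_pos)
  also have "\<dots> \<le> ennreal (wt_mass TYPE('n) \<sigma>) * ennreal (Q\<^sup>2)"
    using Q(1) by (intro mult_left_mono) (auto simp: ennreal_mult' ennreal_power wt_pos less_imp_le)
  also have "\<dots> = (ennreal (sqrt (wt_mass TYPE('n) \<sigma>) * Q))\<^sup>2"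
    using Q(2) by (simp add: ennreal_power power_mult_distrib ennreal_mult)
  finally show le: "(\<integral>\<^sup>+z. ennreal (norm (f z)) \<partial>phase) \<le> ennreal (sqrt (wt_mass TYPE('n) \<sigma>) * Q)"
    by (rule power2_le_imp_le_ennreal)
  then show "integrable phase f"
    by (simp add: integrable_iff_bounded measurable_cong_sets[OF sets_phase refl] le_less_trans)
qed

section \<open>Iterated derivatives and integration by parts against characters\<close>

abbreviation iter_deriv :: "'a::euclidean_space list \<Rightarrow> ('a \<Rightarrow> 'b::real_normed_vector) \<Rightarrow> 'a \<Rightarrow> 'b" where
  "iter_deriv es f \<equiv> foldr (dir_deriv UNIV) es f"

lemma has_dderiv_dir_deriv:
  assumes "f differentiable_on UNIV"
  shows "has_dderiv f e (dir_deriv UNIV e f)"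
  unfolding has_dderiv_def
proof
  fix z
  have "(f has_derivative frechet_derivative f (at z)) (at (z + 0 *\<^sub>R e))"
    using assms by (simp add: differentiable_on_def frechet_derivative_works)
  moreover have "((\<lambda>r. z + r *\<^sub>R e) has_derivative (\<lambda>r. r *\<^sub>R e)) (at 0)"
    by (auto intro!: derivative_eq_intros)
  ultimately have "(f \<circ> (\<lambda>r. z + r *\<^sub>R e) has_derivative frechet_derivative f (at z) \<circ> (\<lambda>r. r *\<^sub>R e)) (at 0)"
    by (intro diff_chain_at)
  then have "((\<lambda>r. f (z + r *\<^sub>R e)) has_derivative (\<lambda>r. frechet_derivative f (at z) (r *\<^sub>R e))) (at 0)"
    by (simp add: o_def)
  moreover have "frechet_derivative f (at z) (r *\<^sub>R e) = r *\<^sub>R frechet_derivative f (at z) e" for r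
    using assms by (simp add: differentiable_on_def linear_frechet_derivative linear_cmul)
  ultimately show "((\<lambda>r. f (z + r *\<^sub>R e)) has_vector_derivative dir_deriv UNIV e f z) (at 0)"
    by (simp add: has_vector_derivative_def dir_deriv_def)
qed

lemma has_dderiv_unique: "has_dderiv f e g \<Longrightarrow> has_dderiv f e h \<Longrightarrow> g = h"
  unfolding has_dderiv_def by (blast intro: vector_derivative_unique_at)

lemma has_dderiv_xperiodic:
  fixes f :: "(real^'n) \<times> ('a::real_normed_vector) \<Rightarrow> 'b::real_normed_vector"
  assumes d: "has_dderiv f e f'" and p: "xperiodic f"
  shows "xperiodic f'"
  unfolding xperiodic_def periodic_def
proof (intro allI)
  fix v x i
  let ?c = "(axis i (2 * pi), 0) :: (real^'n) \<times> 'a"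
  have "((\<lambda>r. f ((x, v) + ?c + r *\<^sub>R e)) has_vector_derivative f' ((x, v) + ?c)) (at 0)"
    using d by (simp add: has_dderiv_def)
  moreover have "f ((x, v) + ?c + r *\<^sub>R e) = f ((x, v) + r *\<^sub>R e)" for r
    using p[unfolded xperiodic_def periodic_def, rule_format, of "x + r *\<^sub>R fst e" i "v + r *\<^sub>R snd e"]
    by (cases e) (simp add: algebra_simps)
  ultimately have "((\<lambda>r. f ((x, v) + r *\<^sub>R e)) has_vector_derivative f' ((x, v) + ?c)) (at 0)"
    by simp
  moreover have "((\<lambda>r. f ((x, v) + r *\<^sub>R e)) has_vector_derivative f' (x, v)) (at 0)"
    using d by (simp add: has_dderiv_def)
  ultimately show "f' (x + axis i (2 * pi), v) = f' (x, v)"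
    by (simp add: vector_derivative_unique_at)
qed

lemma smooth_on_UNIV_iter:
  assumes "smooth_on UNIV f" "es \<in> lists Basis"
  shows "iter_deriv es f differentiable_on UNIV" "continuous_on UNIV (iter_deriv es f)"
    "has_dderiv (iter_deriv es f) e (dir_deriv UNIV e (iter_deriv es f))"
  using assms by (auto simp: smooth_on_def intro!: differentiable_imp_continuous_on has_dderiv_dir_deriv)

lemma xperiodic_iter:
  assumes "smooth_on UNIV f" "es \<in> lists Basis" "xperiodic f"
  shows "xperiodic (iter_deriv es f)"
  using assms(2)
proof (induction es)
  case (Cons e es)
  then show ?case using has_dderiv_xperiodic[OF smooth_on_UNIV_iter(3)[OF assms(1)]] by simp
qed (use assms in simp)

text \<open>An integer frequency in x and a real one in v. The minus sign fits the shift along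
  characteristics: \<open>E k (x - c *\<^sub>R v) * E n x\<close> is the character with
  \<open>l = k + n\<close> and \<open>\<xi> = c *\<^sub>R emb k\<close>.\<close>

definition phase_char :: "int^'n \<Rightarrow> real^'n \<Rightarrow> (real^'n) \<times> (real^'n) \<Rightarrow> complex" where
  "phase_char l \<xi> z = E l (fst z) * cis (- (\<xi> \<bullet> snd z))"

lemma norm_phase_char [simp]: "norm (phase_char l \<xi> z) = 1"
  by (simp add: phase_char_def norm_mult E_simps)

lemma phase_char_add: "phase_char l \<xi> (z + e) = phase_char l \<xi> z * phase_char l \<xi> e"
  by (simp add: phase_char_def E_simps(2) cis_mult inner_add_right algebra_simps)

lemma continuous_on_phase_char: "continuous_on S (phase_char l \<xi>)"
  unfolding phase_char_def E_def cis_conv_exp by (intro continuous_intros)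

lemma phase_char_measurable [measurable]: "phase_char l \<xi> \<in> borel_measurable borel"
  by (rule borel_measurable_continuous_onI continuous_on_phase_char)+

lemma xperiodic_phase_char: "xperiodic (phase_char l \<xi>)"
  using periodic_E[of l] by (simp add: xperiodic_def periodic_def phase_char_def)

lemma has_dderiv_phase_char:
  "has_dderiv (phase_char l \<xi>) e (\<lambda>z. \<i> * of_real (emb l \<bullet> fst e - \<xi> \<bullet> snd e) * phase_char l \<xi> z)"
  unfolding has_dderiv_def
proof
  fix z
  let ?c = "emb l \<bullet> fst e - \<xi> \<bullet> snd e"
  have eq: "phase_char l \<xi> (z + r *\<^sub>R e) = phase_char l \<xi> z * exp (r *\<^sub>R (\<i> * of_real ?c))" for r
  proof -
    have "phase_char l \<xi> (r *\<^sub>R e) = cis (r * ?c)"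
      by (simp add: phase_char_def E_def cis_mult algebra_simps)
    also have "\<dots> = exp (r *\<^sub>R (\<i> * of_real ?c))"
      by (simp only: cis_conv_exp scaleR_conv_of_real of_real_mult mult.left_commute)
    finally show ?thesis by (simp only: phase_char_add)
  qed
  have "((\<lambda>r. phase_char l \<xi> z * exp (r *\<^sub>R (\<i> * of_real ?c))) has_vector_derivative
     phase_char l \<xi> z * (exp (0 *\<^sub>R (\<i> * of_real ?c)) * (\<i> * of_real ?c))) (at 0)"
    by (intro has_vector_derivative_mult_right exp_scaleR_has_vector_derivative_right)
  then show "((\<lambda>r. phase_char l \<xi> (z + r *\<^sub>R e)) has_vector_derivative \<i> * of_real ?c * phase_char l \<xi> z) (at 0)"
    unfolding eq by (simp add: mult.commute)
qed

text \<open>The integral of the e-derivative of f times the character vanishes. Taking norms removes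
  the factor i and the sign.\<close>

lemma phase_fourier_dderiv:
  fixes f f' :: "(real^'n) \<times> (real^'n) \<Rightarrow> real"
  assumes d: "has_dderiv f e f'" and i: "integrable phase f" "integrable phase f'"
    and c: "continuous_on UNIV f" "continuous_on UNIV f'" and p: "xperiodic f"
  shows "norm (LINT z|phase. of_real (f' z) * phase_char l \<xi> z)
    = \<bar>emb l \<bullet> fst e - \<xi> \<bullet> snd e\<bar> * norm (LINT z|phase. of_real (f z) * phase_char l \<xi> z)"
proof -
  let ?\<chi> = "phase_char l \<xi>" and ?c = "emb l \<bullet> fst e - \<xi> \<bullet> snd e"
  let ?h = "\<lambda>z. of_real (f z) * ?\<chi> z"
  let ?h' = "\<lambda>z. of_real (f' z) * ?\<chi> z + \<i> * of_real ?c * (of_real (f z) * ?\<chi> z)"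
  have int: "integrable phase (\<lambda>z. of_real (g z) * ?\<chi> z)"
    if g: "integrable phase g" "continuous_on UNIV g" for g :: "(real^'n) \<times> (real^'n) \<Rightarrow> real"
  proof -
    note [measurable] = borel_measurable_continuous_onI[OF g(2)]
    show ?thesis
      by (rule Bochner_Integration.integrable_bound[OF g(1)])
        (auto simp: norm_mult measurable_cong_sets[OF sets_phase refl])
  qed
  have "(LINT z|phase. ?h' z) = 0"
  proof (rule phase_integral_dderiv)
    have cr: "((\<lambda>r. of_real (f (z + r *\<^sub>R e)) :: complex) has_vector_derivative of_real (f' z)) (at 0)" for z
      using d[unfolded has_dderiv_def] bounded_linear.has_vector_derivative[OF bounded_linear_of_real]
      by blast
    show "has_dderiv ?h e ?h'"
      unfolding has_dderiv_def
    proof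
      fix z
      show "((\<lambda>r. ?h (z + r *\<^sub>R e)) has_vector_derivative ?h' z) (at 0)"
        using has_vector_derivative_mult[OF cr[of z] has_dderiv_phase_char[unfolded has_dderiv_def, rule_format, of l \<xi> z e]]
        by (simp add: algebra_simps)
    qed
    show "integrable phase ?h" using int i c by blast
    show "integrable phase ?h'" using int[OF i(1) c(1)] int[OF i(2) c(2)] by auto
    have p': "xperiodic f'" by (rule has_dderiv_xperiodic[OF d p])
    show "xperiodic ?h" "xperiodic ?h'"
      using p p' xperiodic_phase_char[of l \<xi>] by (simp_all add: xperiodic_def periodic_def)
    show "continuous_on UNIV ?h" "continuous_on UNIV ?h'"
      by (intro continuous_intros c continuous_on_phase_char)+
  qed
  then have "(LINT z|phase. of_real (f' z) * ?\<chi> z) + \<i> * of_real ?c * (LINT z|phase. of_real (f z) * ?\<chi> z) = 0"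
    using int[OF i(1) c(1)] int[OF i(2) c(2)] by (subst (asm) Bochner_Integration.integral_add) auto
  then have "(LINT z|phase. of_real (f' z) * ?\<chi> z) = - (\<i> * of_real ?c * (LINT z|phase. of_real (f z) * ?\<chi> z))"
    by (simp add: add_eq_0_iff2)
  then show ?thesis by (simp only: norm_minus_cancel norm_mult norm_ii norm_of_real mult_1)
qed

lemma foldr_single:
  assumes "distinct L" "\<And>k. k \<noteq> i \<Longrightarrow> F k = id"
  shows "foldr (\<lambda>k D. F k \<circ> D) L id = (if i \<in> set L then F i else id)"
  using assms(1)
proof (induction L)
  case (Cons k L)
  then show ?case by (cases "k = i") (auto simp: assms(2) o_def fun_eq_iff)
qed simp

text \<open>Multi-indices supported on one coordinate suffice for the decay estimate. For them the
  unspecified order of \<open>index_list\<close> drops out, so symmetry of mixed derivatives is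
  never invoked.\<close>

lemma multi_deriv_single:
  fixes e :: "'n::finite \<Rightarrow> 'a::euclidean_space" and f :: "'a \<Rightarrow> 'b::real_normed_vector"
  shows
  "multi_deriv e (\<lambda>k. if k = i then b else 0) f = iter_deriv (replicate b (e i)) f"
proof -
  have "\<exists>L::'n list. distinct L \<and> set L = UNIV" using finite_distinct_list[of "UNIV :: 'n set"] by auto
  from someI_ex[OF this] have L: "distinct (index_list :: 'n list)" "set (index_list :: 'n list) = UNIV"
    unfolding index_list_def by auto
  have "multi_deriv e (\<lambda>k. if k = i then b else 0) = (dir_deriv UNIV (e i) ^^ b :: ('a \<Rightarrow> 'b) \<Rightarrow> _)"
    unfolding multi_deriv_def by (subst foldr_single[where i = i]) (auto simp: L)
  moreover have "(dir_deriv UNIV (e i) ^^ b) f = foldr (dir_deriv UNIV) (replicate b (e i)) f"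
    by (induction b) auto
  ultimately show ?thesis by simp
qed

lemma Basis_phase: "(axis j 1, 0) \<in> (Basis :: ((real^'n) \<times> (real^'m)) set)" "(0, axis i 1) \<in> (Basis :: ((real^'n) \<times> (real^'m)) set)"
  by (auto simp: Basis_prod_def Basis_vec_def)

text \<open>Over an infinite index set the sum in \<open>H_norm\<close> would take its default value
  0 and control nothing.\<close>

lemma finite_multi_indices: "finite {(\<alpha> :: 'n::finite \<Rightarrow> nat, \<beta> :: 'n \<Rightarrow> nat). sum \<alpha> UNIV + sum \<beta> UNIV \<le> p}"
proof -
  have "finite (Pi\<^sub>E (UNIV::'n set) (\<lambda>_. {..p}) \<times> Pi\<^sub>E (UNIV::'n set) (\<lambda>_. {..p}))"
    by (intro finite_cartesian_product finite_PiE) auto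
  moreover have "\<alpha> i \<le> sum \<alpha> UNIV" for \<alpha> :: "'n \<Rightarrow> nat" and i
    by (rule member_le_sum) auto
  then have "{(\<alpha> :: 'n \<Rightarrow> nat, \<beta> :: 'n \<Rightarrow> nat). sum \<alpha> UNIV + sum \<beta> UNIV \<le> p}
     \<subseteq> Pi\<^sub>E (UNIV::'n set) (\<lambda>_. {..p}) \<times> Pi\<^sub>E (UNIV::'n set) (\<lambda>_. {..p})"
    by (fastforce simp: PiE_def Pi_def intro: order_trans)
  ultimately show ?thesis by (rule rev_finite_subset)
qed

lemma sqrt_ennreal_le:
  assumes "0 \<le> Q"
  shows "sqrt_ennreal X \<le> ennreal Q \<longleftrightarrow> X \<le> ennreal (Q\<^sup>2)"
proof (cases X)
  case (real r)
  have "sqrt r \<le> Q \<longleftrightarrow> r \<le> Q\<^sup>2"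
    using assms real_le_lsqrt[of Q r] sqrt_le_D[of r Q] by blast
  then show ?thesis using real assms by (simp add: sqrt_ennreal_def)
qed (auto simp: sqrt_ennreal_def top_unique)

text \<open>A single summand of the Sobolev norm, that of a pure power in one x-direction and one
  v-direction, with the iterated integral rewritten over \<open>phase\<close>.\<close>

lemma H_norm_imp_weighted:
  fixes f :: "(real^'n) \<times> (real^'n) \<Rightarrow> 'b::euclidean_space"
  assumes f: "smooth_on UNIV f" and H: "H_norm p \<sigma> f \<le> ennreal Q" "0 \<le> Q" and ab: "a + b \<le> p"
  shows "(\<integral>\<^sup>+z. ennreal (wt \<sigma> (snd z) *
     (norm (iter_deriv (replicate a (axis j 1, 0) @ replicate b (0, axis i 1)) f z))\<^sup>2) \<partial>phase) \<le> ennreal (Q\<^sup>2)"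
proof -
  let ?es = "replicate a (axis j 1, 0) @ replicate b (0, axis i 1) :: ((real^'n) \<times> (real^'n)) list"
  let ?\<alpha> = "\<lambda>k. if k = j then a else 0" and ?\<beta> = "\<lambda>k. if k = i then b else 0"
  let ?I = "{(\<alpha> :: 'n \<Rightarrow> nat, \<beta> :: 'n \<Rightarrow> nat). sum \<alpha> UNIV + sum \<beta> UNIV \<le> p}"
  let ?T = "\<lambda>(\<alpha>, \<beta>). \<integral>\<^sup>+x. (\<integral>\<^sup>+v. ennreal ((1 + (norm v)\<^sup>2) powr \<sigma> * (norm (dx_dv \<alpha> \<beta> f (x,v)))\<^sup>2) \<partial>lborel) \<partial>torus"
  have es: "?es \<in> lists Basis" by (auto simp: Basis_phase)
  have [measurable]: "iter_deriv ?es f \<in> borel_measurable borel"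
    by (rule borel_measurable_continuous_onI[OF smooth_on_UNIV_iter(2)[OF f es]])
  have "?T (?\<alpha>, ?\<beta>) \<le> sum ?T ?I"
    using ab by (intro member_le_sum finite_multi_indices) auto
  also have "\<dots> \<le> ennreal (Q\<^sup>2)"
    using H by (simp add: H_norm_def sqrt_ennreal_le)
  finally have "?T (?\<alpha>, ?\<beta>) \<le> ennreal (Q\<^sup>2)" .
  moreover define g where "g = iter_deriv ?es f"
  moreover have [measurable]: "g \<in> borel_measurable borel" by (simp only: g_def) measurable
  moreover have "dx_dv ?\<alpha> ?\<beta> f = g"
    by (simp add: dx_dv_def multi_deriv_single g_def)
  ultimately have "(\<integral>\<^sup>+x. (\<integral>\<^sup>+v. ennreal (wt \<sigma> v * (norm (g (x,v)))\<^sup>2) \<partial>lborel) \<partial>torus) \<le> ennreal (Q\<^sup>2)"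
    by (simp add: wt_def)
  then have "(\<integral>\<^sup>+z. ennreal (wt \<sigma> (snd z) * (norm (g z))\<^sup>2) \<partial>phase) \<le> ennreal (Q\<^sup>2)"
    by (subst lborel.nn_integral_fst[symmetric]) (simp_all add: measurable_cong_sets[OF sets_phase refl])
  then show ?thesis by (simp only: g_def)
qed

text \<open>A power of 1 + |v| is traded for the same power of the largest coordinate, which
  corresponds to derivatives in a single direction. The exponent 0 serves the case where that
  coordinate is at most 1 and its powers may be small.\<close>

lemma one_add_norm_power_le:
  fixes v :: "real^'n"
  shows "\<exists>j. \<exists>a'\<in>{0, a}. (1 + norm v) ^ a \<le> (1 + real CARD('n)) ^ a * \<bar>v $ j\<bar> ^ a'"
proof -
  let ?R = "range (\<lambda>i. \<bar>v $ i\<bar>)"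
  have "Max ?R \<in> ?R" by (rule Max_in) auto
  then obtain j where "Max ?R = \<bar>v $ j\<bar>" by blast
  then have j: "\<bar>v $ i\<bar> \<le> \<bar>v $ j\<bar>" for i using Max_ge[of ?R "\<bar>v $ i\<bar>"] by simp
  have n: "norm v \<le> real CARD('n) * \<bar>v $ j\<bar>"
    using order_trans[OF norm_le_l1_cart[of v] sum_bounded_above[of UNIV "\<lambda>i. \<bar>v $ i\<bar>" "\<bar>v $ j\<bar>"]] j by simp
  show ?thesis
  proof (cases "\<bar>v $ j\<bar> \<le> 1")
    case True
    then have "real CARD('n) * \<bar>v $ j\<bar> \<le> real CARD('n) * 1" by (intro mult_left_mono) auto
    then have "norm v \<le> real CARD('n)" using n by linarith
    then have "(1 + norm v) ^ a \<le> (1 + real CARD('n)) ^ a" by (intro power_mono) auto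
    then show ?thesis by (intro exI[of _ j] bexI[of _ 0]) auto
  next
    case False
    then have "1 + norm v \<le> (1 + real CARD('n)) * \<bar>v $ j\<bar>" using n by (simp add: algebra_simps)
    then have "(1 + norm v) ^ a \<le> ((1 + real CARD('n)) * \<bar>v $ j\<bar>) ^ a" by (intro power_mono) auto
    then show ?thesis by (intro exI[of _ j] bexI[of _ a]) (auto simp: power_mult_distrib)
  qed
qed

text \<open>Each derivative along a coordinate multiplies the transform by the corresponding
  frequency component, and the transform of any derivative is bounded by its L1 norm. Choosing the
  largest components of \<open>emb l\<close> and \<open>\<xi>\<close> turns this into decay in their
  norms.\<close>

lemma fourier_decay:
  fixes f :: "(real^'n) \<times> (real^'n) \<Rightarrow> real^'n"
  assumes s: "\<sigma> > real CARD('n) / 2" and f: "smooth_on UNIV f" "xperiodic f"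
    and H: "H_norm p \<sigma> f \<le> ennreal Q" "0 \<le> Q" and ab: "a + b \<le> p"
  shows "(1 + norm (emb l)) ^ a * (1 + norm \<xi>) ^ b *
      norm (LINT z|phase. of_real (f z \<bullet> y) * phase_char l \<xi> z)
    \<le> (1 + real CARD('n)) ^ (a + b) * (norm y * (sqrt (wt_mass TYPE('n) \<sigma>) * Q))"
proof -
  define F where "F es = norm (LINT z|phase. of_real (iter_deriv es f z \<bullet> y) * phase_char l \<xi> z)" for es
  have L1: "norm (F es) \<le> norm y * (sqrt (wt_mass TYPE('n) \<sigma>) * Q) \<and> integrable phase (\<lambda>z. iter_deriv es f z \<bullet> y)"
    if es: "es = replicate a' (axis j 1, 0) @ replicate b' (0, axis i 1)" "a' + b' \<le> p" for es a' b' j i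
  proof -
    have esB: "es \<in> lists Basis" using es(1) by (auto simp: Basis_phase)
    have [measurable]: "iter_deriv es f \<in> borel_measurable borel"
      by (rule borel_measurable_continuous_onI[OF smooth_on_UNIV_iter(2)[OF f(1) esB]])
    note W = weighted_L2_imp_L1[OF s _ H_norm_imp_weighted[OF f(1) H es(2), of j i, folded es(1)] H(2)]
    have "ennreal (F es) \<le> (\<integral>\<^sup>+z. ennreal (norm y) * ennreal (norm (iter_deriv es f z)) \<partial>phase)"
    proof -
      have "ennreal (F es) \<le> (\<integral>\<^sup>+z. norm (of_real (iter_deriv es f z \<bullet> y) * phase_char l \<xi> z) \<partial>phase)"
        unfolding F_def by (rule integral_norm_bound_ennreal)
          (rule Bochner_Integration.integrable_bound[OF integrable_inner_left[OF W(2), of y]],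
            auto simp: norm_mult measurable_cong_sets[OF sets_phase refl])
      also have "\<dots> \<le> (\<integral>\<^sup>+z. ennreal (norm y) * ennreal (norm (iter_deriv es f z)) \<partial>phase)"
        by (intro nn_integral_mono)
          (auto simp: norm_mult ennreal_mult[symmetric] mult.commute[of "norm y"] intro!: ennreal_leI Cauchy_Schwarz_ineq2)
      finally show ?thesis .
    qed
    also have "\<dots> = ennreal (norm y) * (\<integral>\<^sup>+z. ennreal (norm (iter_deriv es f z)) \<partial>phase)"
      by (rule nn_integral_cmult) (simp add: measurable_cong_sets[OF sets_phase refl])
    also have "\<dots> \<le> ennreal (norm y) * ennreal (sqrt (wt_mass TYPE('n) \<sigma>) * Q)"
      by (intro mult_left_mono W(1)) auto
    finally have "F es \<le> norm y * (sqrt (wt_mass TYPE('n) \<sigma>) * Q)"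
      using H(2) by (simp add: ennreal_mult'[symmetric])
    then show ?thesis using W(2) by (auto simp: F_def)
  qed
  have step: "F (e # es) = \<bar>emb l \<bullet> fst e - \<xi> \<bullet> snd e\<bar> * F es"
    if e: "e \<in> Basis" "es \<in> lists Basis"
      "integrable phase (\<lambda>z. iter_deriv es f z \<bullet> y)" "integrable phase (\<lambda>z. iter_deriv (e # es) f z \<bullet> y)" for e es
    unfolding F_def
  proof (rule phase_fourier_dderiv[OF _ e(3,4)])
    have "has_dderiv (iter_deriv es f) e (iter_deriv (e # es) f)"
      using smooth_on_UNIV_iter(3)[OF f(1) e(2)] by simp
    then show "has_dderiv (\<lambda>z. iter_deriv es f z \<bullet> y) e (\<lambda>z. iter_deriv (e # es) f z \<bullet> y)"
      unfolding has_dderiv_def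
      using bounded_linear.has_vector_derivative[OF bounded_linear_inner_left[of y]] by blast
    have ee: "e # es \<in> lists Basis" using e by auto
    show "continuous_on UNIV (\<lambda>z. iter_deriv es f z \<bullet> y)" "continuous_on UNIV (\<lambda>z. iter_deriv (e # es) f z \<bullet> y)"
      by (intro continuous_on_inner continuous_on_const smooth_on_UNIV_iter(2)[OF f(1)] ee e(2))+
    show "xperiodic (\<lambda>z. iter_deriv es f z \<bullet> y)"
      using xperiodic_iter[OF f(1) e(2) f(2)] by (simp add: xperiodic_def periodic_def)
  qed
  have vpow: "F (replicate b' (0, axis i 1)) = \<bar>\<xi> $ i\<bar> ^ b' * F []" if "b' \<le> p" for b' i
    using that
  proof (induction b')
    case (Suc b')
    \<comment> \<open>Without x-derivatives the x-direction in the auxiliary bound is arbitrary,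
      hence \<open>undefined\<close>.\<close>
    have "F ((0, axis i 1) # replicate b' (0, axis i 1)) = \<bar>\<xi> $ i\<bar> * F (replicate b' (0, axis i 1))"
      using Suc.prems L1[of _ 0 undefined b' i] L1[of _ 0 undefined "Suc b'" i]
      by (subst step) (auto simp: Basis_phase inner_axis)
    then show ?case using Suc by simp
  qed simp
  have xpow: "F (replicate a' (axis j 1, 0) @ replicate b' (0, axis i 1)) = \<bar>emb l $ j\<bar> ^ a' * F (replicate b' (0, axis i 1))"
    if "a' + b' \<le> p" for a' b' i j
    using that
  proof (induction a')
    case (Suc a')
    have "F ((axis j 1, 0) # (replicate a' (axis j 1, 0) @ replicate b' (0, axis i 1)))
       = \<bar>emb l $ j\<bar> * F (replicate a' (axis j 1, 0) @ replicate b' (0, axis i 1))"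
      using Suc.prems L1[of _ a' j b' i] L1[of _ "Suc a'" j b' i]
      by (subst step) (auto simp: Basis_phase inner_axis)
    then show ?case using Suc by simp
  qed simp
  obtain j a' where j: "a' \<in> {0, a}" "(1 + norm (emb l)) ^ a \<le> (1 + real CARD('n)) ^ a * \<bar>emb l $ j\<bar> ^ a'"
    using one_add_norm_power_le[of a "emb l"] by blast
  obtain i b' where i: "b' \<in> {0, b}" "(1 + norm \<xi>) ^ b \<le> (1 + real CARD('n)) ^ b * \<bar>\<xi> $ i\<bar> ^ b'"
    using one_add_norm_power_le[of b \<xi>] by blast
  have abp: "a' + b' \<le> p" using ab i j by auto
  have F0: "0 \<le> F es" for es by (simp add: F_def)
  have "(1 + norm (emb l)) ^ a * (1 + norm \<xi>) ^ b * F []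
    \<le> ((1 + real CARD('n)) ^ a * \<bar>emb l $ j\<bar> ^ a') * ((1 + real CARD('n)) ^ b * \<bar>\<xi> $ i\<bar> ^ b') * F []"
    by (intro mult_right_mono mult_mono i j F0) auto
  also have "\<dots> = (1 + real CARD('n)) ^ (a + b) * F (replicate a' (axis j 1, 0) @ replicate b' (0, axis i 1))"
    using abp by (simp add: xpow vpow power_add)
  also have "\<dots> \<le> (1 + real CARD('n)) ^ (a + b) * (norm y * (sqrt (wt_mass TYPE('n) \<sigma>) * Q))"
    using L1[OF refl abp, of j i] F0 by (intro mult_left_mono) (auto simp: abs_le_iff)
  finally show ?thesis by (simp add: F_def)
qed

subsection \<open>Kernels\<close>

text \<open>Meant for affine slices: the derivative of \<open>\<iota>\<close> is the same at all
  points. Derivatives within \<open>A\<close> then become ordinary derivatives on the whole space,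
  where they are unique whatever the shape of \<open>A\<close>.\<close>

lemma dir_deriv_compose:
  fixes f :: "'a::euclidean_space \<Rightarrow> 'b::real_normed_vector" and \<iota> :: "'c::euclidean_space \<Rightarrow> 'a"
  assumes f: "f differentiable_on A" and A: "\<And>z. \<iota> z \<in> A" and d: "\<And>z. (\<iota> has_derivative L) (at z)"
  shows "(\<lambda>z. f (\<iota> z)) differentiable_on UNIV"
    and "dir_deriv UNIV e (\<lambda>z. f (\<iota> z)) = (\<lambda>z. dir_deriv A (L e) f (\<iota> z))"
proof -
  have D: "((\<lambda>z. f (\<iota> z)) has_derivative (\<lambda>h. frechet_derivative f (at (\<iota> z) within A) (L h))) (at z)" for z
  proof -
    have "(f has_derivative frechet_derivative f (at (\<iota> z) within A)) (at (\<iota> z) within A)"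
      using f A by (simp add: differentiable_on_def frechet_derivative_works)
    then have "(f has_derivative frechet_derivative f (at (\<iota> z) within A)) (at (\<iota> z) within range \<iota>)"
      by (rule has_derivative_subset) (use A in auto)
    from diff_chain_within[OF d this] show ?thesis by (simp add: o_def)
  qed
  then show "(\<lambda>z. f (\<iota> z)) differentiable_on UNIV"
    by (auto simp: differentiable_on_def differentiable_def)
  show "dir_deriv UNIV e (\<lambda>z. f (\<iota> z)) = (\<lambda>z. dir_deriv A (L e) f (\<iota> z))"
    by (intro ext) (simp add: dir_deriv_def frechet_derivative_at[OF D, symmetric])
qed

abbreviation kernel_dom :: "real \<Rightarrow> (real \<times> real \<times> 'a) set" where
  "kernel_dom T \<equiv> {0..T} \<times> {0..T} \<times> UNIV"

lemma smooth_on_iter: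
  assumes "smooth_on A f" "es \<in> lists Basis"
  shows "foldr (dir_deriv A) es f differentiable_on A" "continuous_on A (foldr (dir_deriv A) es f)"
proof -
  show "foldr (dir_deriv A) es f differentiable_on A" using assms by (auto simp: smooth_on_def)
  then show "continuous_on A (foldr (dir_deriv A) es f)" by (rule differentiable_imp_continuous_on)
qed


lemma Basis_kernel:
  "(0, 1, 0) \<in> (Basis :: (real \<times> real \<times> 'a::euclidean_space) set)"
  "e \<in> Basis \<Longrightarrow> (0, 0, e) \<in> (Basis :: (real \<times> real \<times> 'a::euclidean_space) set)"
proof -
  have Pair_Basis: "u \<in> Basis \<Longrightarrow> (u, 0) \<in> (Basis :: ('c::euclidean_space \<times> 'd::euclidean_space) set)"
    "v \<in> Basis \<Longrightarrow> (0, v) \<in> (Basis :: ('c \<times> 'd) set)" for u v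
    by (auto simp: Basis_prod_def)
  show "(0, 1, 0) \<in> (Basis :: (real \<times> real \<times> 'a) set)" by (intro Pair_Basis) simp
  show "e \<in> Basis \<Longrightarrow> (0, 0, e) \<in> (Basis :: (real \<times> real \<times> 'a) set)" by (intro Pair_Basis)
qed


text \<open>The list \<open>fs\<close> of derivatives taken beforehand makes the statement apply
  both to the kernel itself and to its derivative in s.\<close>

lemma kernel_slice:
  fixes F :: "real \<times> real \<times> 'a::euclidean_space \<Rightarrow> 'b::real_normed_vector"
  assumes F: "smooth_on (kernel_dom T) F" and fs: "fs \<in> lists Basis" and ts: "t \<in> {0..T}" "s \<in> {0..T}"
  shows "es \<in> lists Basis \<Longrightarrow> iter_deriv es (\<lambda>z. foldr (dir_deriv (kernel_dom T)) fs F (t, s, z))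
     = (\<lambda>z. foldr (dir_deriv (kernel_dom T)) (map (\<lambda>e. (0, 0, e)) es @ fs) F (t, s, z))"
proof (induction es)
  case (Cons e es)
  have "e \<in> Basis" "es \<in> lists Basis" using Cons.prems by auto
  then have B: "map (\<lambda>e. (0, 0, e)) es @ fs \<in> lists Basis"
    using fs by (auto simp: in_lists_conv_set intro!: Basis_kernel(2))
  have "((\<lambda>z. (t, s, z)) has_derivative (\<lambda>h. (0, 0, h))) (at z)" for z :: 'a
    by (auto intro!: derivative_eq_intros)
  from dir_deriv_compose(2)[OF smooth_on_iter(1)[OF F B] _ this, of e] show ?case
    using Cons.IH[OF \<open>es \<in> lists Basis\<close>] ts by simp
qed simp

lemma smooth_kernel_slice:
  fixes F :: "real \<times> real \<times> 'a::euclidean_space \<Rightarrow> 'b::real_normed_vector"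
  assumes F: "smooth_on (kernel_dom T) F" and fs: "fs \<in> lists Basis" and ts: "t \<in> {0..T}" "s \<in> {0..T}"
  shows "smooth_on UNIV (\<lambda>z. foldr (dir_deriv (kernel_dom T)) fs F (t, s, z))"
  unfolding smooth_on_def
proof
  fix es :: "'a list" assume es: "es \<in> lists Basis"
  have B: "map (\<lambda>e. (0, 0, e)) es @ fs \<in> lists Basis"
    using es fs by (auto simp: in_lists_conv_set intro!: Basis_kernel(2))
  have "((\<lambda>z. (t, s, z)) has_derivative (\<lambda>h. (0, 0, h))) (at z)" for z :: 'a
    by (auto intro!: derivative_eq_intros)
  from dir_deriv_compose(1)[OF smooth_on_iter(1)[OF F B] _ this] show
    "iter_deriv es (\<lambda>z. foldr (dir_deriv (kernel_dom T)) fs F (t, s, z)) differentiable_on UNIV"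
    unfolding kernel_slice[OF F fs ts es] using ts by simp
qed

lemma kernel_time_deriv:
  fixes F :: "real \<times> real \<times> 'a::euclidean_space \<Rightarrow> 'b::real_normed_vector"
  assumes F: "smooth_on (kernel_dom T) F" and ts: "t \<in> {0..T}" "s \<in> {0..T}"
  shows "((\<lambda>r. F (t, r, z)) has_vector_derivative dir_deriv (kernel_dom T) (0, 1, 0) F (t, s, z)) (at s within {0..T})"
proof -
  let ?A = "kernel_dom T :: (real \<times> real \<times> 'a) set"
  let ?F' = "frechet_derivative F (at (t, s, z) within ?A)"
  have dF: "F differentiable (at (t, s, z) within ?A)"
    using smooth_on_iter(1)[OF F, of "[]"] ts by (simp add: differentiable_on_def)
  have D: "(F has_derivative ?F') (at (t, s, z) within ?A)"
    using dF by (simp add: frechet_derivative_works)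
  have sub: "(F has_derivative ?F') (at (t, s, z) within (\<lambda>r. (t, r, z)) ` {0..T})"
    by (rule has_derivative_subset[OF D]) (use ts in auto)
  have "((\<lambda>r. (t, r, z)) has_derivative (\<lambda>h. (0, h, 0))) (at s within {0..T})"
    by (auto intro!: derivative_eq_intros)
  from diff_chain_within[OF this sub]
  have "((\<lambda>r. F (t, r, z)) has_derivative (\<lambda>h. ?F' (0, h, 0))) (at s within {0..T})"
    by (simp add: o_def)
  moreover have "(\<lambda>h. ?F' (0, h, 0)) = (\<lambda>h. h *\<^sub>R ?F' (0, 1, 0))"
  proof
    fix h show "?F' (0, h, 0) = h *\<^sub>R ?F' (0, 1, 0)"
      using linear_cmul[OF linear_frechet_derivative[OF dF], of h "(0, 1, 0)"] by simp
  qed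
  ultimately show ?thesis by (simp only: has_vector_derivative_def dir_deriv_def)
qed

section \<open>Averages over time\<close>

lemma sets_pair_borel:
  fixes M :: "'a::second_countable_topology measure" and N :: "'b::second_countable_topology measure"
  assumes "sets M = sets borel" "sets N = sets borel"
  shows "sets (M \<Otimes>\<^sub>M N) = sets borel"
  using sets_pair_measure_cong[OF assms] unfolding borel_prod .


lemma borel_measurable_continuous_closed:
  fixes f :: "'a::topological_space \<Rightarrow> 'b::real_normed_vector"
  assumes "closed A" "continuous_on A f"
  shows "(\<lambda>x. indicator A x *\<^sub>R f x) \<in> borel_measurable borel"
  using assms by (intro borel_measurable_continuous_on_indicator borel_closed)


lemma time_average_measurable:
  fixes P :: "real \<Rightarrow> 'a::euclidean_space \<Rightarrow> 'b::euclidean_space"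
  assumes "continuous_on ({s..t} \<times> UNIV) (\<lambda>(r, z). P r z)"
  shows "(\<lambda>(r, z). indicator {s..t} r *\<^sub>R P r z) \<in> borel_measurable borel"
proof -
  have "(\<lambda>x. indicator ({s..t} \<times> UNIV) x *\<^sub>R (case x of (r, z) \<Rightarrow> P r z)) \<in> borel_measurable borel"
    by (intro borel_measurable_continuous_closed assms closed_Times) auto
  moreover have "(\<lambda>x. indicator ({s..t} \<times> UNIV) x *\<^sub>R (case x of (r, z) \<Rightarrow> P r z)) = (\<lambda>(r, z). indicator {s..t} r *\<^sub>R P r z)"
    by (auto simp: fun_eq_iff indicator_def)
  ultimately show ?thesis by simp
qed

text \<open>One factor t - s comes from Cauchy-Schwarz in r, the other from integrating the constant
  bound over [s,t] after exchanging the integrals.\<close>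

lemma time_average_weighted:
  fixes P :: "real \<Rightarrow> (real^'n) \<times> (real^'n) \<Rightarrow> 'b::euclidean_space"
  assumes st: "s \<le> t" and P: "continuous_on ({s..t} \<times> UNIV) (\<lambda>(r, z). P r z)" and M: "0 \<le> M"
    and b: "\<And>r. r \<in> {s..t} \<Longrightarrow> (\<integral>\<^sup>+z. ennreal (wt \<sigma> (snd z) * (norm (P r z))\<^sup>2) \<partial>phase) \<le> ennreal (M\<^sup>2)"
  shows "(\<integral>\<^sup>+z. ennreal (wt \<sigma> (snd z) * (norm (LINT r|lborel. indicator {s..t} r *\<^sub>R P r z))\<^sup>2) \<partial>phase)
    \<le> ennreal (((t - s) * M)\<^sup>2)"
proof -
  interpret R: pair_sigma_finite "lborel :: real measure" "phase :: ((real^'n) \<times> (real^'n)) measure"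
    by unfold_locales
  note sRP = sets_pair_borel[OF sets_lborel sets_phase]
  define Q where "Q r z = indicator {s..t} r *\<^sub>R P r z" for r z
  have Qb: "(\<lambda>(r, z). Q r z) \<in> borel_measurable borel"
    unfolding Q_def by (rule time_average_measurable[OF P])
  then have [measurable]: "(\<lambda>(r, z). Q r z) \<in> borel_measurable (lborel \<Otimes>\<^sub>M phase)"
    by (simp add: measurable_cong_sets[OF sRP refl])
  have Qz [measurable]: "(\<lambda>r. Q r z) \<in> borel_measurable borel" for z
    using measurable_compose[OF _ Qb, of "\<lambda>r. (r, z)" borel] by simp
  let ?I = "\<lambda>r. indicator {s..t} r :: ennreal"
  have pt: "ennreal (wt \<sigma> (snd z) * (norm (LINT r|lborel. Q r z))\<^sup>2)
     \<le> ennreal (t - s) * (\<integral>\<^sup>+r. ennreal (wt \<sigma> (snd z) * (norm (Q r z))\<^sup>2) \<partial>lborel)" for z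
  proof -
    have "ennreal (norm (LINT r|lborel. Q r z)) \<le> (\<integral>\<^sup>+r. ennreal (norm (Q r z)) \<partial>lborel)"
      by (cases "integrable lborel (\<lambda>r. Q r z)") (auto intro: integral_norm_bound_ennreal simp: not_integrable_integral_eq)
    also have "\<dots> = (\<integral>\<^sup>+r. ?I r * ennreal (norm (Q r z)) \<partial>lborel)"
      by (intro nn_integral_cong) (auto simp: Q_def indicator_def)
    finally have "(ennreal (norm (LINT r|lborel. Q r z)))\<^sup>2 \<le> (\<integral>\<^sup>+r. ?I r * ennreal (norm (Q r z)) \<partial>lborel)\<^sup>2"
      by (rule power_mono) simp
    also have "\<dots> \<le> (\<integral>\<^sup>+r. (?I r)\<^sup>2 \<partial>lborel) * (\<integral>\<^sup>+r. (ennreal (norm (Q r z)))\<^sup>2 \<partial>lborel)"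
      by (rule Cauchy_Schwarz_nn_integral) measurable
    also have "(\<integral>\<^sup>+r. (?I r)\<^sup>2 \<partial>lborel) = ennreal (t - s)"
      using st by (simp add: power2_eq_square flip: indicator_inter_arith)
    finally have *: "(ennreal (norm (LINT r|lborel. Q r z)))\<^sup>2 \<le> ennreal (t - s) * (\<integral>\<^sup>+r. ennreal ((norm (Q r z))\<^sup>2) \<partial>lborel)"
      by (simp add: ennreal_power)
    have "ennreal (wt \<sigma> (snd z) * (norm (LINT r|lborel. Q r z))\<^sup>2) = ennreal (wt \<sigma> (snd z)) * (ennreal (norm (LINT r|lborel. Q r z)))\<^sup>2"
      by (simp add: ennreal_mult' wt_pos less_imp_le ennreal_power)
    also have "\<dots> \<le> ennreal (wt \<sigma> (snd z)) * (ennreal (t - s) * (\<integral>\<^sup>+r. ennreal ((norm (Q r z))\<^sup>2) \<partial>lborel))"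
      by (intro mult_left_mono *) simp
    also have "\<dots> = ennreal (t - s) * (\<integral>\<^sup>+r. ennreal (wt \<sigma> (snd z)) * ennreal ((norm (Q r z))\<^sup>2) \<partial>lborel)"
      by (subst nn_integral_cmult) (auto simp: mult_ac)
    finally show ?thesis by (simp add: ennreal_mult' wt_pos less_imp_le)
  qed
  have "(\<integral>\<^sup>+z. ennreal (wt \<sigma> (snd z) * (norm (LINT r|lborel. Q r z))\<^sup>2) \<partial>phase)
    \<le> (\<integral>\<^sup>+z. ennreal (t - s) * (\<integral>\<^sup>+r. ennreal (wt \<sigma> (snd z) * (norm (Q r z))\<^sup>2) \<partial>lborel) \<partial>phase)"
    by (intro nn_integral_mono pt)
  also have "\<dots> = ennreal (t - s) * (\<integral>\<^sup>+z. (\<integral>\<^sup>+r. ennreal (wt \<sigma> (snd z) * (norm (Q r z))\<^sup>2) \<partial>lborel) \<partial>phase)"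
    by (rule nn_integral_cmult) measurable
  also have "(\<integral>\<^sup>+z. (\<integral>\<^sup>+r. ennreal (wt \<sigma> (snd z) * (norm (Q r z))\<^sup>2) \<partial>lborel) \<partial>phase)
     = (\<integral>\<^sup>+r. (\<integral>\<^sup>+z. ennreal (wt \<sigma> (snd z) * (norm (Q r z))\<^sup>2) \<partial>phase) \<partial>lborel)"
    by (rule R.Fubini') measurable
  also have "ennreal (t - s) * \<dots> \<le> ennreal (t - s) * (\<integral>\<^sup>+r. ennreal (M\<^sup>2) * ?I r \<partial>lborel)"
  proof (intro mult_left_mono nn_integral_mono)
    fix r show "(\<integral>\<^sup>+z. ennreal (wt \<sigma> (snd z) * (norm (Q r z))\<^sup>2) \<partial>phase) \<le> ennreal (M\<^sup>2) * ?I r"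
      using b[of r] by (cases "r \<in> {s..t}") (auto simp: Q_def)
  qed simp
  also have "\<dots> = ennreal (((t - s) * M)\<^sup>2)"
    using st by (simp add: nn_integral_cmult ennreal_mult'[symmetric] power2_eq_square mult_ac)
  finally show ?thesis by (simp add: Q_def)
qed

text \<open>The Fourier transform is moved inside the time integral. The weighted bound justifies
  Fubini through L1; the size of the result comes from \<open>K\<close>.\<close>

lemma time_average_fourier:
  fixes P :: "real \<Rightarrow> (real^'n) \<times> (real^'n) \<Rightarrow> real^'n"
  assumes s: "\<sigma> > real CARD('n) / 2"
    and st: "s \<le> t" and P: "continuous_on ({s..t} \<times> UNIV) (\<lambda>(r, z). P r z)" and M: "0 \<le> M"
    and b: "\<And>r. r \<in> {s..t} \<Longrightarrow> (\<integral>\<^sup>+z. ennreal (wt \<sigma> (snd z) * (norm (P r z))\<^sup>2) \<partial>phase) \<le> ennreal (M\<^sup>2)"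
    and K: "0 \<le> K" "\<And>r. r \<in> {s..t} \<Longrightarrow> norm (LINT z|phase. of_real (P r z \<bullet> y) * phase_char l \<xi> z) \<le> K"
  shows "norm (LINT z|phase. of_real ((LINT r|lborel. indicator {s..t} r *\<^sub>R P r z) \<bullet> y) * phase_char l \<xi> z) \<le> (t - s) * K"
proof -
  interpret R: pair_sigma_finite "lborel :: real measure" "phase :: ((real^'n) \<times> (real^'n)) measure"
    by unfold_locales
  note sRP = sets_pair_borel[OF sets_lborel sets_phase]
  define Q where "Q r z = indicator {s..t} r *\<^sub>R P r z" for r z
  have Qb: "(\<lambda>(r, z). Q r z) \<in> borel_measurable borel"
    unfolding Q_def by (rule time_average_measurable[OF P])
  then have [measurable]: "(\<lambda>(r, z). Q r z) \<in> borel_measurable (lborel \<Otimes>\<^sub>M phase)"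
    by (simp add: measurable_cong_sets[OF sRP refl])
  have Qr [measurable]: "(\<lambda>z. Q r z) \<in> borel_measurable borel" for r
    using measurable_compose[OF _ Qb, of "\<lambda>z. (r, z)" borel] by simp
  have [measurable]: "phase_char l \<xi> \<in> borel_measurable phase"
    by (simp add: measurable_cong_sets[OF sets_phase refl])
  let ?f = "\<lambda>r z. of_real (Q r z \<bullet> y) * phase_char l \<xi> z"
  define L where "L = sqrt (wt_mass TYPE('n) \<sigma>) * M"
  have L: "0 \<le> L" using M by (simp add: L_def)
  have Q1: "(\<integral>\<^sup>+z. ennreal (norm (Q r z)) \<partial>phase) \<le> ennreal L * indicator {s..t} r" for r
  proof (cases "r \<in> {s..t}")
    case True
    then have "Q r = P r" by (simp add: Q_def fun_eq_iff)
    then show ?thesis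
      using weighted_L2_imp_L1(1)[OF s Qr, of r M] b[OF True] M True by (simp add: L_def)
  qed (simp add: Q_def)
  have "(\<integral>\<^sup>+rz. ennreal (norm ((\<lambda>(r, z). Q r z) rz)) \<partial>(lborel \<Otimes>\<^sub>M phase)) = (\<integral>\<^sup>+r. (\<integral>\<^sup>+z. ennreal (norm (Q r z)) \<partial>phase) \<partial>lborel)"
    by (subst torus_lborel.P.nn_integral_fst[symmetric]) auto
  also have "\<dots> \<le> (\<integral>\<^sup>+r. ennreal L * indicator {s..t} r \<partial>lborel)" by (intro nn_integral_mono Q1)
  also have "\<dots> < \<infinity>" using st by (simp add: nn_integral_cmult ennreal_mult_less_top)
  finally have intQ: "integrable (lborel \<Otimes>\<^sub>M phase) (\<lambda>(r, z). Q r z)"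
    by (simp add: integrable_iff_bounded)
  have intf: "integrable (lborel \<Otimes>\<^sub>M phase) (\<lambda>(r, z). ?f r z)"
    by (rule Bochner_Integration.integrable_bound[OF integrable_scaleR_right[OF intQ, of "norm y"]])
      (auto simp: norm_mult mult.commute[of "norm y"] intro!: Cauchy_Schwarz_ineq2)
  have aez: "AE z in phase. integrable lborel (\<lambda>r. Q r z)"
    using R.AE_integrable_snd[OF intQ] by simp
  have "(LINT z|phase. of_real ((LINT r|lborel. Q r z) \<bullet> y) * phase_char l \<xi> z) = (LINT z|phase. LINT r|lborel. ?f r z)"
  proof (rule integral_cong_AE)
    show "AE z in phase. of_real ((LINT r|lborel. Q r z) \<bullet> y) * phase_char l \<xi> z = (LINT r|lborel. ?f r z)"
      using aez
    proof eventually_elim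
      case (elim z)
      have "(LINT r|lborel. ?f r z) = (LINT r|lborel. of_real (Q r z \<bullet> y)) * phase_char l \<xi> z" by simp
      also have "(LINT r|lborel. of_real (Q r z \<bullet> y)) = (of_real ((LINT r|lborel. Q r z) \<bullet> y) :: complex)"
        using elim by (simp add: integral_of_real)
      finally show ?case by (rule sym)
    qed
  qed measurable
  also have "\<dots> = (LINT r|lborel. LINT z|phase. ?f r z)" using R.Fubini_integral[OF intf] .
  finally have eq: "(LINT z|phase. of_real ((LINT r|lborel. Q r z) \<bullet> y) * phase_char l \<xi> z) = (LINT r|lborel. LINT z|phase. ?f r z)" .
  have "norm (LINT r|lborel. LINT z|phase. ?f r z) \<le> (LINT r|lborel. norm (LINT z|phase. ?f r z))"
    by (rule integral_norm_bound)
  also have "\<dots> \<le> (LINT r|lborel. indicator {s..t} r * K)"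
  proof (rule integral_mono)
    show "integrable lborel (\<lambda>r. norm (LINT z|phase. ?f r z))"
      using integrable_norm[OF R.integrable_fst'[OF intf]] by simp
    show "integrable lborel (\<lambda>r. indicator {s..t} r * K)" using st by (simp add: integrable_real_indicator)
    show "norm (LINT z|phase. ?f r z) \<le> indicator {s..t} r * K" for r
      using K(2)[of r] by (cases "r \<in> {s..t}") (auto simp: Q_def)
  qed
  also have "\<dots> = (t - s) * K" using st by simp
  finally show ?thesis using eq by (simp add: Q_def)
qed

text \<open>Both operators are instances: x + (1 - e^(t-s)) v is x - \<theta>(t-s) v with
  \<theta>(\<tau>) = e^\<tau> - 1, and the free case has \<theta>(\<tau>) = \<tau>. The constant
  \<open>B\<close> secures integrability and crude continuity; only \<open>K\<close>, from the decay
  of the transform, enters the smoothing estimate. The exponents are those at which the lattice sum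
  and the time integral converge.\<close>

locale avg_kernel =
  fixes T \<sigma> B K :: real and \<theta> :: "real \<Rightarrow> real"
    and g :: "real \<Rightarrow> real \<Rightarrow> (real^'n) \<times> (real^'n) \<Rightarrow> real^'n"
    and gj :: "'n \<Rightarrow> real \<Rightarrow> real \<Rightarrow> (real^'n) \<times> (real^'n) \<Rightarrow> real^'n"
  assumes T: "0 < T" and sigma: "\<sigma> > real CARD('n) / 2" and B: "0 \<le> B" and K: "0 \<le> K"
    and theta: "continuous_on UNIV \<theta>" "\<And>\<tau>. 0 \<le> \<tau> \<Longrightarrow> \<tau> \<le> \<theta> \<tau>"
    and cont: "continuous_on (kernel_dom T) (\<lambda>(t, s, z). g t s z)"
      "\<And>j. continuous_on (kernel_dom T) (\<lambda>(t, s, z). gj j t s z)"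
    and per: "\<And>t s. t \<in> {0..T} \<Longrightarrow> s \<in> {0..T} \<Longrightarrow> xperiodic (g t s)"
    and deriv: "\<And>t s j. t \<in> {0..T} \<Longrightarrow> s \<in> {0..T} \<Longrightarrow> has_dderiv (g t s) (axis j 1, 0) (gj j t s)"
    and bound: "\<And>t s. 0 \<le> s \<Longrightarrow> s \<le> t \<Longrightarrow> t \<le> T \<Longrightarrow>
        (\<integral>\<^sup>+z. ennreal (wt \<sigma> (snd z) * (norm (g t s z))\<^sup>2) \<partial>phase) \<le> ennreal (B\<^sup>2)"
      "\<And>t s j. 0 \<le> s \<Longrightarrow> s \<le> t \<Longrightarrow> t \<le> T \<Longrightarrow>
        (\<integral>\<^sup>+z. ennreal (wt \<sigma> (snd z) * (norm (gj j t s z))\<^sup>2) \<partial>phase) \<le> ennreal (B\<^sup>2)"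
    and decay: "\<And>t s l \<xi> y. 0 \<le> s \<Longrightarrow> s \<le> t \<Longrightarrow> t \<le> T \<Longrightarrow>
        (1 + norm (emb l)) ^ (CARD('n) + 2) * (1 + norm \<xi>) ^ 3 *
          norm (LINT z|phase. of_real (g t s z \<bullet> y) * phase_char l \<xi> z) \<le> K * (t - s) * norm y"

text \<open>The constant of \<open>fourier_decay\<close> for a = d + 2 and b = 3; the square root is
  the cost of passing from weighted L2 to L1.\<close>

definition decay_const :: "'n::finite itself \<Rightarrow> real \<Rightarrow> real" where
  "decay_const _ \<sigma> = (1 + real CARD('n)) ^ (CARD('n) + 5) * sqrt (wt_mass TYPE('n) \<sigma>)"

lemma decay_const_nonneg [simp]: "0 \<le> decay_const TYPE('n::finite) \<sigma>"
  by (simp add: decay_const_def)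

text \<open>Since \<open>G\<close> vanishes on the diagonal, it is the time average of \<open>\<partial>\<^sub>s G\<close> over \<open>[s,t]\<close>, which is
  where the factor \<open>t - s\<close> in the decay estimate comes from.\<close>

lemma smooth_kernel_avg_kernel:
  fixes G :: "'n::finite kernel"
  assumes T: "0 < T" and s: "\<sigma> > real CARD('n) / 2" and p: "p \<ge> CARD('n) + 5"
    and theta: "continuous_on UNIV \<theta>" "\<And>\<tau>. 0 \<le> \<tau> \<Longrightarrow> \<tau> \<le> \<theta> \<tau>"
    and G: "smooth_kernel T G" and diag: "\<And>t x v. t \<in> {0..T} \<Longrightarrow> G t t x v = 0"
    and M: "0 \<le> M" "\<And>t s. t \<in> {0..T} \<Longrightarrow> s \<in> {0..T} \<Longrightarrow> H_norm p \<sigma> (\<lambda>(x, v). ds_kernel T G t s x v) \<le> ennreal M"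
  shows "\<exists>gj. avg_kernel T \<sigma> (T * M) (decay_const TYPE('n) \<sigma> * M) \<theta> (\<lambda>t s z. G t s (fst z) (snd z)) gj"
proof -
  let ?A = "kernel_dom T :: (real \<times> real \<times> (real^'n) \<times> (real^'n)) set"
  define F where "F = (\<lambda>(t, s, x, v). G t s x v)"
  have F: "smooth_on ?A F" using G by (simp add: smooth_kernel_def F_def)
  define D where "D = dir_deriv ?A (0, 1, 0) F"
  let ?e = "\<lambda>j::'n. (axis j 1, 0) :: (real^'n) \<times> (real^'n)"
  define Gj where "Gj j = dir_deriv ?A (0, 0, ?e j) F" for j
  define Dj where "Dj j = dir_deriv ?A (0, 0, ?e j) D" for j
  have B: "(0, 1, 0) \<in> (Basis :: (real \<times> real \<times> (real^'n) \<times> (real^'n)) set)"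
    "(0, 0, ?e j) \<in> (Basis :: (real \<times> real \<times> (real^'n) \<times> (real^'n)) set)" for j
    by (simp_all add: Basis_kernel Basis_phase)
  have cF: "continuous_on ?A F" and cD: "continuous_on ?A D"
    and cGj: "continuous_on ?A (Gj j)" and cDj: "continuous_on ?A (Dj j)" for j
  proof -
    have "continuous_on ?A (foldr (dir_deriv ?A) es F)" if "set es \<subseteq> Basis" for es
      using that by (intro smooth_on_iter(2)[OF F]) (auto simp: in_lists_conv_set)
    note * = this[of "[]"] this[of "[(0,1,0)]"] this[of "[(0, 0, ?e j)]"] this[of "[(0, 0, ?e j), (0, 1, 0)]"]
    show "continuous_on ?A F" "continuous_on ?A D" "continuous_on ?A (Gj j)" "continuous_on ?A (Dj j)"
      using * B by (simp_all add: D_def Gj_def Dj_def)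
  qed
  \<comment> \<open>As 0 < T, derivatives within [0,T] are unique, so the vector derivative in
    \<open>ds_kernel\<close> is the partial derivative \<open>D\<close>.\<close>
  have ds: "ds_kernel T G t s x v = D (t, s, x, v)" if "t \<in> {0..T}" "s \<in> {0..T}" for t s x v
  proof -
    have "vector_derivative (\<lambda>r. F (t, r, (x, v))) (at s within {0..T}) = D (t, s, (x, v))"
      unfolding D_def
      using vector_derivative_within_cbox[of 0 T s "\<lambda>r. F (t, r, (x, v))"] kernel_time_deriv[OF F that] T that
      by simp
    then show ?thesis by (simp add: ds_kernel_def F_def)
  qed
  have smD: "smooth_on UNIV (\<lambda>z. D (t, s, z))" if "t \<in> {0..T}" "s \<in> {0..T}" for t s
    using smooth_kernel_slice[OF F _ that, of "[(0,1,0)]"] B by (simp add: D_def)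
  have smF: "smooth_on UNIV (\<lambda>z. F (t, s, z))" if "t \<in> {0..T}" "s \<in> {0..T}" for t s
    using smooth_kernel_slice[OF F _ that, of "[]"] by simp
  have djD: "iter_deriv [?e j] (\<lambda>z. D (t, s, z)) = (\<lambda>z. Dj j (t, s, z))" if "t \<in> {0..T}" "s \<in> {0..T}" for t s j
    using kernel_slice[OF F _ that, of "[(0,1,0)]" "[?e j]"] B by (simp add: D_def Dj_def Basis_phase)
  have djF: "iter_deriv [?e j] (\<lambda>z. F (t, s, z)) = (\<lambda>z. Gj j (t, s, z))" if "t \<in> {0..T}" "s \<in> {0..T}" for t s j
    using kernel_slice[OF F _ that, of "[]" "[?e j]"] by (simp add: Gj_def Basis_phase)
  have dD: "has_dderiv (\<lambda>z. D (t, s, z)) (?e j) (\<lambda>z. Dj j (t, s, z))" if "t \<in> {0..T}" "s \<in> {0..T}" for t s j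
    using smooth_on_UNIV_iter(3)[OF smD[OF that], of "[]" "?e j"] djD[OF that, of j] by simp
  have dF: "has_dderiv (\<lambda>z. F (t, s, z)) (?e j) (\<lambda>z. Gj j (t, s, z))" if "t \<in> {0..T}" "s \<in> {0..T}" for t s j
    using smooth_on_UNIV_iter(3)[OF smF[OF that], of "[]" "?e j"] djF[OF that, of j] by simp
  have HD: "H_norm p \<sigma> (\<lambda>z. D (t, s, z)) \<le> ennreal M" if "t \<in> {0..T}" "s \<in> {0..T}" for t s
  proof -
    have "(\<lambda>(x, v). ds_kernel T G t s x v) = (\<lambda>z. D (t, s, z))" by (auto simp: fun_eq_iff ds[OF that])
    then show ?thesis using M(2)[OF that] by simp
  qed
  have wD: "(\<integral>\<^sup>+z. ennreal (wt \<sigma> (snd z) * (norm (D (t, s, z)))\<^sup>2) \<partial>phase) \<le> ennreal (M\<^sup>2)"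
    if "t \<in> {0..T}" "s \<in> {0..T}" for t s
    using H_norm_imp_weighted[OF smD[OF that] HD[OF that] M(1), of 0 0] by simp
  have wDj: "(\<integral>\<^sup>+z. ennreal (wt \<sigma> (snd z) * (norm (Dj j (t, s, z)))\<^sup>2) \<partial>phase) \<le> ennreal (M\<^sup>2)"
    if "t \<in> {0..T}" "s \<in> {0..T}" for t s j
    using H_norm_imp_weighted[OF smD[OF that] HD[OF that] M(1), of 1 0 j] p djD[OF that, of j] by simp
  have sub: "(t, r, z) \<in> ?A" if "0 \<le> s" "s \<le> t" "t \<le> T" "r \<in> {s..t}" for s t r z using that by auto
  have cs: "continuous_on ({s..t} \<times> UNIV) (\<lambda>(r, z). H (t, r, z))"
    if "continuous_on ?A H" "0 \<le> s" "s \<le> t" "t \<le> T" for H :: "_ \<Rightarrow> real^'n" and s t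
    unfolding case_prod_beta
    by (rule continuous_on_compose2[OF that(1)]) (use that in \<open>auto intro!: continuous_intros\<close>)
  have FD: "F (t, s, z) = - (LINT r|lborel. indicator {s..t} r *\<^sub>R D (t, r, z))"
    if "0 \<le> s" "s \<le> t" "t \<le> T" for t s z
  proof -
    have "(LINT r|lborel. indicator {s..t} r *\<^sub>R D (t, r, z)) = F (t, t, z) - F (t, s, z)"
    proof (rule integral_FTC_atLeastAtMost)
      show "((\<lambda>r. F (t, r, z)) has_vector_derivative D (t, r, z)) (at r within {s..t})" if "s \<le> r" "r \<le> t" for r
        using kernel_time_deriv[OF F, of t r z] that \<open>0 \<le> s\<close> \<open>s \<le> t\<close> \<open>t \<le> T\<close>
        by (auto simp: D_def intro: has_vector_derivative_within_subset)
      show "continuous_on {s..t} (\<lambda>r. D (t, r, z))"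
        by (rule continuous_on_compose2[OF cD]) (use that in \<open>auto intro!: continuous_intros\<close>)
    qed (use that in auto)
    moreover have "F (t, t, z) = 0" using diag[of t] that by (simp add: F_def case_prod_beta)
    ultimately show ?thesis by simp
  qed
  \<comment> \<open>The x-derivative is taken under the time integral by Leibniz' rule and compared
    with \<open>Gj\<close> by uniqueness. This way the derivatives in s and x need not be
    interchanged.\<close>
  have GjD: "Gj j (t, s, z) = - (LINT r|lborel. indicator {s..t} r *\<^sub>R Dj j (t, r, z))"
    if "0 \<le> s" "s \<le> t" "t \<le> T" for t s z j
  proof -
    have i: "set_integrable lborel {s..t} (\<lambda>r. H (t, r, z))" if "continuous_on ?A H" for H :: "_ \<Rightarrow> real^'n" and z
      unfolding set_integrable_def
      by (intro borel_integrable_compact continuous_on_compose2[OF that])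
        (use \<open>0 \<le> s\<close> \<open>s \<le> t\<close> \<open>t \<le> T\<close> in \<open>auto intro!: continuous_intros\<close>)
    have HK: "(LINT r|lborel. indicator {s..t} r *\<^sub>R H (t, r, z)) = integral (cbox s t) (\<lambda>r. H (t, r, z))"
      if "continuous_on ?A H" for H :: "_ \<Rightarrow> real^'n" and z
      using set_borel_integral_eq_integral(2)[OF i[OF that]] by (simp add: set_lebesgue_integral_def)
    have "((\<lambda>u. integral (cbox s t) (\<lambda>r. D (t, r, z + u *\<^sub>R ?e j))) has_vector_derivative
       integral (cbox s t) (\<lambda>r. Dj j (t, r, z + 0 *\<^sub>R ?e j))) (at 0 within UNIV)"
    proof (rule leibniz_rule_vector_derivative)
      show "((\<lambda>u. D (t, r, z + u *\<^sub>R ?e j)) has_vector_derivative Dj j (t, r, z + u *\<^sub>R ?e j)) (at u within UNIV)"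
        if "r \<in> cbox s t" for u r
        using has_dderiv_at[OF dD[of t r j], of z u] that \<open>0 \<le> s\<close> \<open>s \<le> t\<close> \<open>t \<le> T\<close> by simp
      show "(\<lambda>r. D (t, r, z + u *\<^sub>R ?e j)) integrable_on cbox s t" for u
        using set_borel_integral_eq_integral(1)[OF i[OF cD]] by simp
      show "continuous_on (UNIV \<times> cbox s t) (\<lambda>(u, r). Dj j (t, r, z + u *\<^sub>R ?e j))"
        unfolding case_prod_beta
        by (rule continuous_on_compose2[OF cDj]) (use that in \<open>auto intro!: continuous_intros\<close>)
    qed auto
    then have "((\<lambda>u. F (t, s, z + u *\<^sub>R ?e j)) has_vector_derivative
       - (LINT r|lborel. indicator {s..t} r *\<^sub>R Dj j (t, r, z))) (at 0)"
      unfolding FD[OF that] HK[OF cD] HK[OF cDj]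
      by (intro has_vector_derivative_minus) (simp add: zero_prod_def[symmetric])
    moreover have "((\<lambda>u. F (t, s, z + u *\<^sub>R ?e j)) has_vector_derivative Gj j (t, s, z)) (at 0)"
      using dF[of t s j, unfolded has_dderiv_def, rule_format, of z] that by simp
    ultimately show ?thesis by (rule vector_derivative_unique_at[symmetric])
  qed
  have TM: "((t - s) * M)\<^sup>2 \<le> (T * M)\<^sup>2" if "0 \<le> s" "s \<le> t" "t \<le> T" for s t
    using that M(1) by (intro power_mono mult_right_mono) auto
  have "avg_kernel T \<sigma> (T * M) (decay_const TYPE('n) \<sigma> * M) \<theta> (\<lambda>t s z. G t s (fst z) (snd z)) (\<lambda>j t s z. Gj j (t, s, z))"
  proof
    show "continuous_on ?A (\<lambda>(t, s, z). G t s (fst z) (snd z))" using cF by (simp add: F_def case_prod_beta)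
    show "continuous_on ?A (\<lambda>(t, s, z). Gj j (t, s, z))" for j using cGj[of j] by simp
    show "xperiodic (\<lambda>z. G t s (fst z) (snd z))" if "t \<in> {0..T}" "s \<in> {0..T}" for t s
      using G that by (simp add: smooth_kernel_def xperiodic_def)
    show "has_dderiv (\<lambda>z. G t s (fst z) (snd z)) (?e j) (\<lambda>z. Gj j (t, s, z))" if "t \<in> {0..T}" "s \<in> {0..T}" for t s j
      using dF[OF that, of j] by (simp add: F_def case_prod_beta)
    fix t s :: real assume st: "0 \<le> s" "s \<le> t" "t \<le> T"
    have GF: "G t s (fst z) (snd z) = - (LINT r|lborel. indicator {s..t} r *\<^sub>R D (t, r, z))" for z
      using FD[OF st, of z] by (simp add: F_def case_prod_beta)
    show "(\<integral>\<^sup>+z. ennreal (wt \<sigma> (snd z) * (norm (G t s (fst z) (snd z)))\<^sup>2) \<partial>phase) \<le> ennreal ((T * M)\<^sup>2)"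
      unfolding GF norm_minus_cancel
      by (rule order_trans[OF time_average_weighted[OF st(2) cs[OF cD st] M(1) wD] ennreal_leI[OF TM[OF st]]])
        (use st in auto)
    show "(\<integral>\<^sup>+z. ennreal (wt \<sigma> (snd z) * (norm (Gj j (t, s, z)))\<^sup>2) \<partial>phase) \<le> ennreal ((T * M)\<^sup>2)" for j
      unfolding GjD[OF st] norm_minus_cancel
      by (rule order_trans[OF time_average_weighted[OF st(2) cs[OF cDj st] M(1) wDj] ennreal_leI[OF TM[OF st]]])
        (use st in auto)
    fix l :: "int^'n" and \<xi> y :: "real^'n"
    let ?w = "(1 + norm (emb l)) ^ (CARD('n) + 2) * (1 + norm \<xi>) ^ 3"
    have w: "0 < ?w" by (intro mult_pos_pos zero_less_power add_pos_nonneg) auto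
    let ?C = "decay_const TYPE('n) \<sigma> * M * norm y"
    have "norm (LINT z|phase. of_real (D (t, r, z) \<bullet> y) * phase_char l \<xi> z) \<le> ?C / ?w" if r: "r \<in> {s..t}" for r
    proof -
      have tr: "t \<in> {0..T}" "r \<in> {0..T}" using r st by auto
      \<comment> \<open>Translating x by a period does not change the kernel at any time in [0,T],
        so both time derivatives are derivatives of the same function within that interval.\<close>
      have xp: "xperiodic (\<lambda>z. D (t, r, z))"
        unfolding xperiodic_def periodic_def
      proof (intro allI)
        fix v x i
        have "F (t, q, x + axis i (2 * pi), v) = F (t, q, x, v)" if "q \<in> {0..T}" for q
          using G that tr by (simp add: smooth_kernel_def periodic_def F_def)
        then have "((\<lambda>q. F (t, q, x, v)) has_vector_derivative D (t, r, x + axis i (2 * pi), v)) (at r within {0..T})"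
          using has_vector_derivative_transform[OF tr(2) _ kernel_time_deriv[OF F tr, of "(x + axis i (2 * pi), v)"]]
          by (simp add: D_def)
        from vector_derivative_unique_within_closed_interval[of 0 T r, OF T _ this[folded cbox_interval] kernel_time_deriv[OF F tr, folded cbox_interval]]
        show "D (t, r, x + axis i (2 * pi), v) = D (t, r, x, v)" using tr by (simp add: D_def)
      qed
      have "?w * norm (LINT z|phase. of_real (D (t, r, z) \<bullet> y) * phase_char l \<xi> z)
        \<le> (1 + real CARD('n)) ^ (CARD('n) + 2 + 3) * (norm y * (sqrt (wt_mass TYPE('n) \<sigma>) * M))"
        by (rule fourier_decay[OF s smD[OF tr] xp HD[OF tr] M(1)]) (use p in auto)
      also have "\<dots> = ?C" by (simp add: decay_const_def)
      finally show ?thesis using w by (simp add: pos_le_divide_eq mult.commute)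
    qed
    from time_average_fourier[OF s st(2) cs[OF cD st] M(1) wD _ this]
    have "norm (LINT z|phase. of_real (G t s (fst z) (snd z) \<bullet> y) * phase_char l \<xi> z) \<le> (t - s) * (?C / ?w)"
      unfolding GF using st M(1) w by auto
    then have "?w * norm (LINT z|phase. of_real (G t s (fst z) (snd z) \<bullet> y) * phase_char l \<xi> z) \<le> ?w * ((t - s) * (?C / ?w))"
      by (rule mult_left_mono) (use w in auto)
    also have "\<dots> = decay_const TYPE('n) \<sigma> * M * (t - s) * norm y"
    proof -
      have "W * ((t - s) * (?C / W)) = decay_const TYPE('n) \<sigma> * M * (t - s) * norm y" if "0 < W" for W
        using that by simp
      from this[OF w] show ?thesis .
    qed
    finally show "?w * norm (LINT z|phase. of_real (G t s (fst z) (snd z) \<bullet> y) * phase_char l \<xi> z)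
      \<le> decay_const TYPE('n) \<sigma> * M * (t - s) * norm y" .
  next
    show "0 \<le> T * M" "0 \<le> decay_const TYPE('n) \<sigma> * M" using T M(1) by simp_all
    show "\<tau> \<le> \<theta> \<tau>" if "0 \<le> \<tau>" for \<tau> by (rule theta(2)[OF that])
  qed (fact T s theta(1))+
  then show ?thesis by blast
qed

subsection \<open>Trigonometric polynomials\<close>

text \<open>Polynomial coefficients in t make one algebra that is smooth up to the boundary in time
  and rich enough to be dense on the whole space-time cylinder.\<close>

definition trig_sum :: "(int^'n) set \<Rightarrow> (int^'n \<Rightarrow> complex poly) \<Rightarrow> real \<Rightarrow> real^'n \<Rightarrow> complex" where
  "trig_sum F p t x = (\<Sum>k\<in>F. poly (p k) (of_real t) * E k x)"

text \<open>The function is real valued while its coefficients are complex. Frequencies and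
  coefficients are kept visible because Schur's test acts on them.\<close>

definition trig_rep :: "(int^'n) set \<Rightarrow> (int^'n \<Rightarrow> complex poly) \<Rightarrow> (real \<Rightarrow> real^'n \<Rightarrow> real) \<Rightarrow> bool" where
  "trig_rep F p f \<longleftrightarrow> finite F \<and> (\<forall>t x. of_real (f t x) = trig_sum F p t x)"

definition trig :: "(real \<Rightarrow> real^'n \<Rightarrow> real) \<Rightarrow> bool" where
  "trig f \<longleftrightarrow> (\<exists>F p. trig_rep F p f)"

lemma trig_const: "trig (\<lambda>t x. c)"
  unfolding trig_def trig_rep_def trig_sum_def
  by (rule exI[of _ "{0}"], rule exI[of _ "\<lambda>_. [:of_real c:]"]) (simp add: E_simps)

lemma trig_time: "trig (\<lambda>t x. t)"
  unfolding trig_def trig_rep_def trig_sum_def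
  by (rule exI[of _ "{0}"], rule exI[of _ "\<lambda>_. [:0, 1:]"]) (simp add: E_simps)

lemma emb_axis_inner: "emb (axis j m) \<bullet> x = of_int m * x $ j"
proof -
  have "emb (axis j m) = axis j (of_int m :: real)" by (simp add: vec_eq_iff axis_def)
  then show ?thesis by (simp add: inner_axis' )
qed

lemma axis_one_neq: "axis j (1::int) \<noteq> axis j (- 1)"
  by (simp add: axis_eq_axis)

lemma trig_cos: "trig (\<lambda>t x. cos (x $ j))"
  unfolding trig_def trig_rep_def trig_sum_def
  by (rule exI[of _ "{axis j 1, axis j (- 1)}"], rule exI[of _ "\<lambda>_. [:1/2:]"])
    (simp add: axis_one_neq E_def emb_axis_inner complex_eq_iff)

lemma trig_sin: "trig (\<lambda>t x. sin (x $ j))"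
  unfolding trig_def trig_rep_def trig_sum_def
  by (rule exI[of _ "{axis j 1, axis j (- 1)}"], rule exI[of _ "\<lambda>k. if k = axis j 1 then [:- \<i>/2:] else [:\<i>/2:]"])
    (simp add: axis_one_neq axis_one_neq[symmetric] E_def emb_axis_inner complex_eq_iff)

lemma trig_rep_mono:
  assumes "trig_rep F p f" "F \<subseteq> F'" "finite F'"
  shows "trig_rep F' (\<lambda>k. if k \<in> F then p k else 0) f"
proof -
  have "trig_sum F' (\<lambda>k. if k \<in> F then p k else 0) t x = trig_sum F p t x" for t x
    unfolding trig_sum_def using assms by (intro sum.mono_neutral_cong_right) auto
  then show ?thesis using assms by (simp add: trig_rep_def)
qed

lemma trig_add:
  assumes "trig f" "trig g"
  shows "trig (\<lambda>t x. f t x + g t x)"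
proof -
  obtain F p G q where f: "trig_rep F p f" and g: "trig_rep G q g" using assms by (auto simp: trig_def)
  let ?p = "\<lambda>k. if k \<in> F then p k else 0" and ?q = "\<lambda>k. if k \<in> G then q k else 0"
  have "trig_rep (F \<union> G) ?p f"
    by (rule trig_rep_mono[OF f]) (use f g in \<open>auto simp: trig_rep_def\<close>)
  moreover have "trig_rep (F \<union> G) ?q g"
    by (rule trig_rep_mono[OF g]) (use f g in \<open>auto simp: trig_rep_def\<close>)
  ultimately have "trig_rep (F \<union> G) (\<lambda>k. ?p k + ?q k) (\<lambda>t x. f t x + g t x)"
    unfolding trig_rep_def trig_sum_def by (simp only: poly_add distrib_right sum.distrib of_real_add) blast
  then show ?thesis unfolding trig_def by blast
qed

lemma trig_mult:
  assumes "trig f" "trig g"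
  shows "trig (\<lambda>t x. f t x * g t x)"
proof -
  obtain F p G q where f: "trig_rep F p f" and g: "trig_rep G q g" using assms by (auto simp: trig_def)
  let ?S = "F \<times> G" and ?s = "\<lambda>(k, l). k + l"
  let ?r = "\<lambda>m. \<Sum>(k, l)\<in>{kl\<in>?S. ?s kl = m}. p k * q l"
  have fin: "finite F" "finite G" using f g by (auto simp: trig_rep_def)
  have "trig_sum (?s ` ?S) ?r t x = trig_sum F p t x * trig_sum G q t x" for t x
  proof -
    let ?h = "\<lambda>(k, l). (poly (p k) (of_real t) * E k x) * (poly (q l) (of_real t) * E l x)"
    have "trig_sum (?s ` ?S) ?r t x = (\<Sum>m\<in>?s ` ?S. \<Sum>kl\<in>{kl\<in>?S. ?s kl = m}. ?h kl)"
      unfolding trig_sum_def poly_sum sum_distrib_right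
      by (intro sum.cong refl) (auto simp: E_simps(1) mult_ac)
    also have "\<dots> = sum ?h ?S" by (rule sum.group) (use fin in auto)
    also have "\<dots> = trig_sum F p t x * trig_sum G q t x"
      by (simp add: trig_sum_def sum_product sum.cartesian_product)
    finally show ?thesis .
  qed
  then have "trig_rep (?s ` ?S) ?r (\<lambda>t x. f t x * g t x)"
    using f g by (simp add: trig_rep_def)
  then show ?thesis unfolding trig_def by blast
qed

lemma trig_eq_Re: "trig_rep F p f \<Longrightarrow> f t x = Re (trig_sum F p t x)"
  by (metis Re_complex_of_real trig_rep_def)

lemma periodic_trig:
  assumes "trig f" shows "periodic (f t)"
proof -
  obtain F p where "trig_rep F p f" using assms by (auto simp: trig_def)
  moreover have "trig_sum F p t (x + axis i (2 * pi)) = trig_sum F p t x" for x i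
    by (simp add: trig_sum_def periodic_E[unfolded periodic_def, rule_format])
  ultimately show ?thesis by (simp add: periodic_def trig_eq_Re)
qed

lemma continuous_on_trig_sum: "continuous_on S (\<lambda>z. trig_sum F p (fst z) (snd z))"
  unfolding trig_sum_def
  by (intro continuous_intros)

lemma continuous_on_trig:
  assumes "trig f" shows "continuous_on S (\<lambda>z. f (fst z) (snd z))"
proof -
  obtain F p where "trig_rep F p f" using assms by (auto simp: trig_def)
  then show ?thesis by (simp add: trig_eq_Re continuous_on_Re continuous_on_trig_sum)
qed

lemma has_derivative_trig_sum:
  "((\<lambda>z. trig_sum F p (fst z) (snd z)) has_derivative
    (\<lambda>h. of_real (fst h) * trig_sum F (\<lambda>k. pderiv (p k)) (fst z) (snd z) +
      (\<Sum>k\<in>F. \<i> * of_real (emb k \<bullet> snd h) * (poly (p k) (of_real (fst z)) * E k (snd z))))) (at z)"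
proof -
  have E: "((\<lambda>z. E k (snd z)) has_derivative (\<lambda>h. E k (snd z) * (\<i> * of_real (emb k \<bullet> snd h)))) (at z)" for k
  proof -
    have "((\<lambda>z::real \<times> (real^'a). \<i> * of_real (emb k \<bullet> snd z)) has_derivative (\<lambda>h. \<i> * of_real (emb k \<bullet> snd h))) (at z)"
      by (intro bounded_linear_imp_has_derivative bounded_linear_compose[OF bounded_linear_mult_right]
          bounded_linear_compose[OF bounded_linear_of_real] bounded_linear_compose[OF bounded_linear_inner_right]
          bounded_linear_snd)
    moreover have "(exp has_derivative (*) (exp (\<i> * of_real (emb k \<bullet> snd z)))) (at (\<i> * of_real (emb k \<bullet> snd z)))"
      using DERIV_exp by (rule has_field_derivative_imp_has_derivative)
    ultimately show ?thesis
      unfolding E_def cis_conv_exp by (rule has_derivative_compose)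
  qed
  have P: "((\<lambda>z. poly (p k) (of_real (fst z))) has_derivative (\<lambda>h. poly (pderiv (p k)) (of_real (fst z)) * of_real (fst h))) (at z)" for k
  proof -
    have "((\<lambda>z::real \<times> (real^'a). of_real (fst z) :: complex) has_derivative (\<lambda>h. of_real (fst h))) (at z)"
      by (intro bounded_linear_imp_has_derivative bounded_linear_compose[OF bounded_linear_of_real] bounded_linear_fst)
    moreover have "(poly (p k) has_derivative (*) (poly (pderiv (p k)) (of_real (fst z)))) (at (of_real (fst z)))"
      using poly_DERIV by (rule has_field_derivative_imp_has_derivative)
    ultimately show ?thesis by (rule has_derivative_compose)
  qed
  show ?thesis
    unfolding trig_sum_def
    by (rule has_derivative_eq_rhs, rule has_derivative_sum, rule has_derivative_mult[OF P E])
      (simp only: sum_distrib_left sum.distrib[symmetric], intro ext sum.cong refl, simp add: algebra_simps)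
qed

text \<open>The condition under which Frechet derivatives within the slab are unique. In time one
  moves inward: forward from the lower half of the interval, backward from the upper half.\<close>

lemma slab_directions:
  fixes z i :: "real \<times> 'a::euclidean_space"
  assumes T: "0 < T" and z: "z \<in> {0..T} \<times> UNIV" and i: "i \<in> Basis" and e: "0 < e"
  shows "\<exists>d. 0 < \<bar>d\<bar> \<and> \<bar>d\<bar> < e \<and> z + d *\<^sub>R i \<in> {0..T} \<times> UNIV"
proof -
  obtain t x where tx: "z = (t, x)" by (cases z)
  let ?d = "min (e / 2) (T / 2)"
  from i consider "i = (1, 0)" | y where "i = (0, y)" by (auto simp: Basis_prod_def)
  then show ?thesis
  proof cases
    case 1
    then show ?thesis
      using assms tx by (cases "t \<le> T / 2") (rule exI[of _ ?d], force, rule exI[of _ "- ?d"], force)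
  next
    case 2
    then show ?thesis using assms tx by (intro exI[of _ "e / 2"]) auto
  qed
qed

lemma dir_deriv_slab:
  fixes f g :: "real \<times> 'a::euclidean_space \<Rightarrow> 'b::real_normed_vector"
  assumes T: "0 < T" and z: "z \<in> {0..T} \<times> UNIV" and d: "(g has_derivative L) (at z)"
    and eq: "\<And>z. z \<in> {0..T} \<times> UNIV \<Longrightarrow> f z = g z"
  shows "f differentiable at z within {0..T} \<times> UNIV" "dir_deriv ({0..T} \<times> UNIV) e f z = L e"
proof -
  have D: "(f has_derivative L) (at z within {0..T} \<times> UNIV)"
    by (rule has_derivative_transform[OF z eq has_derivative_at_withinI[OF d]])
  then show 1: "f differentiable at z within {0..T} \<times> UNIV" by (auto simp: differentiable_def)
  have "frechet_derivative f (at z within {0..T} \<times> UNIV) = L"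
    by (rule frechet_derivative_unique_within[OF _ D slab_directions[OF T z]])
      (use 1 in \<open>simp add: frechet_derivative_works\<close>)
  then show "dir_deriv ({0..T} \<times> UNIV) e f z = L e" by (simp add: dir_deriv_def)
qed

text \<open>On the slab every iterated derivative is again the real part of a trigonometric sum over
  the same frequencies: the time derivative acts by \<open>pderiv\<close> on the coefficients, the
  j-th space derivative by multiplication with i k_j.\<close>

lemma smooth_on_trig:
  fixes f :: "real \<Rightarrow> real^'n \<Rightarrow> real"
  assumes T: "0 < T" and f: "trig_rep F p f"
  shows "smooth_on ({0..T} \<times> UNIV) (\<lambda>(t, x). f t x)"
proof -
  let ?A = "{0..T} \<times> (UNIV :: (real^'n) set)"
  have D: "((\<lambda>z. Re (trig_sum F q (fst z) (snd z))) has_derivative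
    (\<lambda>h. Re (of_real (fst h) * trig_sum F (\<lambda>k. pderiv (q k)) (fst z) (snd z) +
      (\<Sum>k\<in>F. \<i> * of_real (emb k \<bullet> snd h) * (poly (q k) (of_real (fst z)) * E k (snd z)))))) (at z)" for q z
    by (rule bounded_linear.has_derivative[OF bounded_linear_Re has_derivative_trig_sum])
  have *: "\<exists>q. \<forall>z\<in>?A. foldr (dir_deriv ?A) es (\<lambda>(t, x). f t x) z = Re (trig_sum F q (fst z) (snd z))"
    if "es \<in> lists Basis" for es
    using that
  proof (induction es)
    case Nil
    show ?case using trig_eq_Re[OF f] by (intro exI[of _ p]) auto
  next
    case (Cons e es)
    then obtain q where q: "\<And>z. z \<in> ?A \<Longrightarrow> foldr (dir_deriv ?A) es (\<lambda>(t, x). f t x) z = Re (trig_sum F q (fst z) (snd z))"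
      by auto
    from Cons.hyps(1) consider "e = (1, 0)" | j where "e = (0, axis j 1)"
      by (auto simp: Basis_prod_def Basis_vec_def)
    then show ?case
    proof cases
      case 1
      show ?thesis
        by (rule exI[of _ "\<lambda>k. pderiv (q k)"]) (use dir_deriv_slab(2)[OF T _ D q, of _ e] 1 in simp)
    next
      case 2
      show ?thesis
        by (rule exI[of _ "\<lambda>k. smult (\<i> * of_int (k $ j)) (q k)"])
          (use dir_deriv_slab(2)[OF T _ D q, of _ e] 2 in \<open>simp add: trig_sum_def inner_axis mult.assoc\<close>)
    qed
  qed
  show ?thesis
    unfolding smooth_on_def
  proof
    fix es :: "(real \<times> (real^'n)) list" assume "es \<in> lists Basis"
    from *[OF this] obtain q where
      q: "\<And>z. z \<in> ?A \<Longrightarrow> foldr (dir_deriv ?A) es (\<lambda>(t, x). f t x) z = Re (trig_sum F q (fst z) (snd z))" by auto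
    show "foldr (dir_deriv ?A) es (\<lambda>(t, x). f t x) differentiable_on ?A"
      unfolding differentiable_on_def using dir_deriv_slab(1)[OF T _ D q] by blast
  qed
qed

lemma trig_smooth_periodic:
  assumes "0 < T" "trig f" shows "smooth_periodic T f"
proof -
  obtain F p where "trig_rep F p f" using assms(2) by (auto simp: trig_def)
  then show ?thesis
    using smooth_on_trig[OF assms(1)] periodic_trig[OF assms(2)] unfolding smooth_periodic_def by blast
qed

text \<open>That the differentiated sum is again real follows from uniqueness: it is the derivative
  of the complexification of the real function \<open>f\<close>.\<close>

lemma trig_dderiv:
  assumes "trig_rep F p f"
  shows "\<exists>f'. trig_rep F (\<lambda>k. smult (\<i> * of_int (k $ j)) (p k)) f' \<and> (\<forall>t. has_dderiv (f t) (axis j 1) (f' t))"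
proof -
  let ?q = "\<lambda>k. smult (\<i> * of_int (k $ j)) (p k)"
  let ?f' = "\<lambda>t x. Re (trig_sum F ?q t x)"
  have D: "((\<lambda>r. trig_sum F p t (x + r *\<^sub>R axis j 1)) has_vector_derivative trig_sum F ?q t x) (at 0)" for t x
  proof -
    have "((\<lambda>r. (t, x + r *\<^sub>R axis j 1)) has_derivative (\<lambda>h. (0, h *\<^sub>R axis j 1))) (at 0)"
      by (auto intro!: derivative_eq_intros)
    note D = has_derivative_compose[OF this, OF has_derivative_trig_sum[of F p], unfolded fst_conv snd_conv]
    show ?thesis
      unfolding has_vector_derivative_def
      by (rule has_derivative_eq_rhs[OF D])
        (simp add: fun_eq_iff trig_sum_def inner_axis sum_distrib_left scaleR_conv_of_real[where 'a = complex] mult_ac)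
  qed
  have eq: "(\<lambda>r. trig_sum F p t (x + r *\<^sub>R axis j 1)) = (\<lambda>r. of_real (f t (x + r *\<^sub>R axis j 1)))" for t x
    using assms by (simp add: trig_rep_def)
  have dR: "((\<lambda>r. f t (x + r *\<^sub>R axis j 1)) has_vector_derivative ?f' t x) (at 0)" for t x
    using bounded_linear.has_vector_derivative[OF bounded_linear_Re D[of t x]] by (simp only: trig_eq_Re[OF assms])
  have "((\<lambda>r. of_real (f t (x + r *\<^sub>R axis j 1)) :: complex) has_vector_derivative of_real (?f' t x)) (at 0)" for t x
    using bounded_linear.has_vector_derivative[OF bounded_linear_of_real dR] .
  then have "trig_sum F ?q t x = of_real (?f' t x)" for t x
    using D[of t x] unfolding eq by (blast intro: vector_derivative_unique_at)
  then show ?thesis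
    using assms dR by (intro exI[of _ ?f']) (auto simp: trig_rep_def has_dderiv_def)
qed

lemma trig_parseval:
  fixes f :: "real \<Rightarrow> real^'n \<Rightarrow> real"
  assumes "trig_rep F p f"
  shows "(LINT x|torus. (f t x)\<^sup>2) = (\<Sum>k\<in>F. (norm (poly (p k) (of_real t)))\<^sup>2)"
proof -
  let ?c = "\<lambda>k. poly (p k) (of_real t)"
  have fin: "finite F" using assms by (simp add: trig_rep_def)
  have iE: "integrable torus (E m)" for m :: "int^'n"
    by (rule torus.integrable_const_bound[of _ 1]) (auto simp: E_simps measurable_cong_sets[OF sets_torus refl])
  have "of_real ((f t x)\<^sup>2) = (\<Sum>k\<in>F. \<Sum>l\<in>F. ?c k * cnj (?c l) * E (k - l) x)" for x
  proof -
    have "of_real ((f t x)\<^sup>2) = trig_sum F p t x * cnj (trig_sum F p t x)"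
      using assms by (metis complex_cnj_complex_of_real of_real_mult power2_eq_square trig_rep_def)
    also have "\<dots> = (\<Sum>k\<in>F. \<Sum>l\<in>F. ?c k * cnj (?c l) * E (k + - l) x)"
      by (simp only: trig_sum_def cnj_sum complex_cnj_mult sum_product E_simps mult_ac)
    finally show ?thesis by simp
  qed
  moreover have "of_real (LINT x|torus. (f t x)\<^sup>2) = (LINT x|torus. of_real ((f t x)\<^sup>2) :: complex)"
    by (rule integral_complex_of_real[symmetric])
  ultimately have "of_real (LINT x|torus. (f t x)\<^sup>2) = (LINT x|torus. (\<Sum>k\<in>F. \<Sum>l\<in>F. ?c k * cnj (?c l) * E (k - l) x))"
    by (simp only:)
  also have "\<dots> = (\<Sum>k\<in>F. \<Sum>l\<in>F. ?c k * cnj (?c l) * (if k - l = 0 then 1 else 0))"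
    using iE by (simp add: Bochner_Integration.integral_sum E_orthogonal)
  also have "\<dots> = (\<Sum>k\<in>F. ?c k * cnj (?c k))"
    using fin by (intro sum.cong refl) (simp add: if_distrib[where f = "\<lambda>x. _ * x"] sum.delta' cong: if_cong)
  also have "\<dots> = of_real (\<Sum>k\<in>F. (norm (?c k))\<^sup>2)"
    by (simp only: complex_norm_square of_real_sum)
  finally show ?thesis by (simp only: of_real_eq_iff)
qed

subsection \<open>Density of trigonometric polynomials\<close>

text \<open>The interval enters through a density, so that the measure lives on all of the line and
  \<open>cyl\<close> has exactly the Borel sets as its measurable sets.\<close>

definition time_measure :: "real \<Rightarrow> real measure" where
  "time_measure T = density lborel (indicator {0<..<T})"

lemma AE_time_measure: "AE t in time_measure T. t \<in> {0<..<T}"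
  unfolding time_measure_def by (subst AE_density) (auto simp: indicator_def)

definition cyl :: "real \<Rightarrow> (real \<times> (real^'n)) measure" where
  "cyl T = time_measure T \<Otimes>\<^sub>M torus"

lemma sets_time_measure [measurable_cong]: "sets (time_measure T) = sets borel"
  by (simp add: time_measure_def)

lemma space_time_measure [simp]: "space (time_measure T) = UNIV"
  by (simp add: time_measure_def)

lemma sets_cyl [measurable_cong]: "sets (cyl T) = sets borel"
  unfolding cyl_def by (rule sets_pair_borel[OF sets_time_measure sets_torus])

lemma space_cyl [simp]: "space (cyl T) = UNIV"
  by (simp add: cyl_def space_pair_measure)

lemma nn_integral_time_measure:
  "f \<in> borel_measurable borel \<Longrightarrow> (\<integral>\<^sup>+t. f t \<partial>time_measure T) = (\<integral>\<^sup>+t\<in>{0<..<T}. f t \<partial>lborel)"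
  unfolding time_measure_def by (subst nn_integral_density) (auto simp: mult.commute)

lemma emeasure_time_measure: "emeasure (time_measure T) UNIV = ennreal T"
proof -
  have "emeasure (time_measure T) UNIV = emeasure lborel {0<..<T}"
    unfolding time_measure_def by (subst emeasure_density) auto
  then show ?thesis by (cases "0 \<le> T") (auto simp: ennreal_neg)
qed

lemma finite_measure_time: "finite_measure (time_measure T)"
  by standard (simp add: emeasure_time_measure)

lemma nn_integral_cyl:
  fixes f :: "real \<times> (real^'n) \<Rightarrow> ennreal"
  assumes "f \<in> borel_measurable borel"
  shows "(\<integral>\<^sup>+z. f z \<partial>cyl T) = (\<integral>\<^sup>+t\<in>{0<..<T}. (\<integral>\<^sup>+x. f (t, x) \<partial>torus) \<partial>lborel)"
proof -
  have "f \<in> borel_measurable (time_measure T \<Otimes>\<^sub>M torus)"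
    using assms by (simp add: measurable_cong_sets[OF sets_cyl[unfolded cyl_def] refl])
  note * = torus.nn_integral_fst[OF this] torus.borel_measurable_nn_integral_fst[OF this]
  show ?thesis
    unfolding cyl_def *(1)[symmetric]
    by (rule nn_integral_time_measure) (use *(2) in \<open>simp add: measurable_cong_sets[OF sets_time_measure refl]\<close>)
qed

lemma emeasure_cyl: "emeasure (cyl T :: (real \<times> (real^'n)) measure) UNIV = ennreal T"
proof -
  have "emeasure (cyl T :: (real \<times> (real^'n)) measure) (UNIV \<times> UNIV) = ennreal T"
    unfolding cyl_def by (subst torus.emeasure_pair_measure_Times)
      (auto simp: emeasure_time_measure emeasure_torus sets_time_measure sets_torus)
  then show ?thesis by simp
qed

lemma finite_measure_cyl: "finite_measure (cyl T :: (real \<times> (real^'n)) measure)"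
  by standard (simp add: emeasure_cyl)

text \<open>Absolute continuity of the cylinder measure, seen slice by slice. It transports almost
  everywhere convergence of continuous approximants from Lebesgue measure to the cylinder.\<close>

lemma AE_cyl_lborel:
  assumes "AE z in (lborel :: (real \<times> (real^'n)) measure). P z"
  shows "AE z in cyl T. P z"
proof -
  obtain N where N: "{z. \<not> P z} \<subseteq> N" "N \<in> sets borel" "emeasure lborel N = 0"
    using assms by (auto elim!: AE_E)
  note [measurable] = N(2)
  have "emeasure (cyl T) N = (\<integral>\<^sup>+z. indicator N z \<partial>cyl T)"
    by (simp add: sets_cyl)
  also have "\<dots> = (\<integral>\<^sup>+t\<in>{0<..<T}. (\<integral>\<^sup>+x. indicator N (t, x) \<partial>torus) \<partial>lborel)"
    by (rule nn_integral_cyl) measurable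
  also have "\<dots> = 0"
  proof -
    have "(\<integral>\<^sup>+z. indicator N z \<partial>(lborel \<Otimes>\<^sub>M lborel)) = 0" using N(3) by (simp add: lborel_prod)
    then have "(\<integral>\<^sup>+t. (\<integral>\<^sup>+x. indicator N (t, x) \<partial>lborel) \<partial>lborel) = 0"
      by (subst lborel.nn_integral_fst) (auto simp: lborel_prod)
    then have "AE t in lborel. (\<integral>\<^sup>+x. indicator N (t, x) \<partial>(lborel :: (real^'n) measure)) = 0"
      by (subst (asm) nn_integral_0_iff_AE) auto
    then have "AE t in lborel. (\<integral>\<^sup>+x. indicator N (t, x) \<partial>torus) * indicator {0<..<T} t = (0::ennreal)"
    proof eventually_elim
      case (elim t)
      have "(\<integral>\<^sup>+x. indicator N (t, x) * indicator cell x \<partial>lborel) \<le> (\<integral>\<^sup>+x. indicator N (t, x) \<partial>(lborel :: (real^'n) measure))"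
        by (intro nn_integral_mono) (auto simp: indicator_def)
      then show ?case using elim by (subst nn_integral_torus) auto
    qed
    then show ?thesis by (subst nn_integral_cong_AE[where v = "\<lambda>_. 0"]) auto
  qed
  finally have "N \<in> null_sets (cyl T)" by (intro null_setsI) (auto simp: sets_cyl)
  then show ?thesis by (rule AE_I') (use N(1) in auto)
qed

lemma AE_cyl: "AE z in cyl T. fst z \<in> {0<..<T} \<and> snd z \<in> box (0 :: real^'n) (\<chi> i. 2 * pi)"
proof (rule AE_I')
  let ?N = "- ({0<..<T} \<times> box (0 :: real^'n) (\<chi> i. 2 * pi))"
  have [measurable]: "?N \<in> sets borel" by (intro borel_comp borel_open open_Times) auto
  have "emeasure (cyl T) ?N = (\<integral>\<^sup>+z. indicator ?N z \<partial>cyl T)"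
    by (rule nn_integral_indicator[symmetric]) (simp only: sets_cyl, measurable)
  also have "\<dots> = (\<integral>\<^sup>+t\<in>{0<..<T}. (\<integral>\<^sup>+x. indicator ?N (t, x) \<partial>torus) \<partial>lborel)"
    by (rule nn_integral_cyl) measurable
  also have "\<dots> = (\<integral>\<^sup>+t. 0 \<partial>(lborel :: real measure))"
  proof (rule nn_integral_cong)
    fix t
    show "(\<integral>\<^sup>+x. indicator ?N (t, x) \<partial>torus) * indicator {0<..<T} t = (0::ennreal)"
    proof (cases "t \<in> {0<..<T}")
      case True
      have "(\<integral>\<^sup>+x. indicator ?N (t, x) \<partial>torus) = (\<integral>\<^sup>+x. 0 \<partial>(torus :: (real^'n) measure))"
      proof (rule nn_integral_cong_AE)
        show "AE x in torus. indicator ?N (t, x) = (0::ennreal)"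
          using AE_torus by eventually_elim (use True in auto)
      qed
      then show ?thesis by simp
    qed simp
  qed
  finally show "?N \<in> null_sets (cyl T)" by (intro null_setsI) (auto simp: sets_cyl)
qed auto

text \<open>On the closed cell opposite faces are identified, so Stone--Weierstrass is applied on the image
  of the cell under \<open>x \<mapsto> (cos x, sin x)\<close>, to which \<open>h\<close> descends because it vanishes on the faces.\<close>

lemma trig_uniform_approx:
  fixes h :: "real \<times> (real^'n) \<Rightarrow> real"
  assumes h: "continuous_on UNIV h" and 0: "\<And>t x. x \<notin> box 0 (\<chi> i. 2 * pi) \<Longrightarrow> h (t, x) = 0" and e: "0 < e"
  shows "\<exists>\<phi>. trig \<phi> \<and> (\<forall>t\<in>{0..T}. \<forall>x\<in>period_cell. \<bar>h (t, x) - \<phi> t x\<bar> < e)"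
proof -
  define dom where "dom = {0..T} \<times> (period_cell :: (real^'n) set)"
  define \<Phi> :: "real \<times> (real^'n) \<Rightarrow> real \<times> (real^'n) \<times> (real^'n)"
    where "\<Phi> = (\<lambda>z. (fst z, (\<chi> j. cos (snd z $ j)), (\<chi> j. sin (snd z $ j))))"
  define S where "S = \<Phi> ` dom"
  define k where "k = h \<circ> inv_into dom \<Phi>"
  have cdom: "compact dom" by (simp add: dom_def period_cell_def compact_Times)
  have c\<Phi>: "continuous_on A \<Phi>" for A
    unfolding \<Phi>_def by (intro continuous_intros)
  have cS: "compact S" unfolding S_def by (rule compact_continuous_image[OF c\<Phi> cdom])
  have fiber: "h z = h z'" if "z \<in> dom" "z' \<in> dom" "\<Phi> z = \<Phi> z'" for z z'
  proof (cases "snd z = snd z'")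
    case True
    then have "z = z'" using that(3) by (simp add: \<Phi>_def prod_eqI)
    then show ?thesis by simp
  next
    case False
    then obtain j where j: "snd z $ j \<noteq> snd z' $ j" by (auto simp: vec_eq_iff)
    have "cos (snd z $ j) = cos (snd z' $ j)" "sin (snd z $ j) = sin (snd z' $ j)"
      using that(3) by (simp_all add: \<Phi>_def vec_eq_iff)
    then obtain n where "snd z $ j = snd z' $ j + 2 * pi * of_int n"
      by (metis sin_cos_eq_iff)
    moreover have "n \<noteq> 0" using calculation j by auto
    moreover have "0 \<le> snd z $ j" "snd z $ j \<le> 2 * pi" "0 \<le> snd z' $ j" "snd z' $ j \<le> 2 * pi"
      using that(1,2) by (auto simp: dom_def in_period_cell)
    moreover have "of_int n \<ge> (1::real) \<or> of_int n \<le> (-1::real)" using \<open>n \<noteq> 0\<close> by linarith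
    then have "2 * pi * of_int n \<ge> 2 * pi * 1 \<or> 2 * pi * of_int n \<le> 2 * pi * (- 1)"
      by (elim disj_forward) (intro mult_left_mono; simp)+
    ultimately have "snd z $ j = 0 \<or> snd z $ j = 2 * pi" "snd z' $ j = 0 \<or> snd z' $ j = 2 * pi"
      by linarith+
    then have "snd z \<notin> box 0 (\<chi> i. 2 * pi)" "snd z' \<notin> box 0 (\<chi> i. 2 * pi)"
      by (auto simp: box_period_cell intro!: exI[of _ j])
    then show ?thesis using 0[of "snd z" "fst z"] 0[of "snd z'" "fst z'"] by simp
  qed
  have k\<Phi>: "k (\<Phi> z) = h z" if "z \<in> dom" for z
  proof -
    have "\<Phi> z \<in> \<Phi> ` dom" using that by blast
    from f_inv_into_f[OF this] inv_into_into[OF this] show ?thesis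
      unfolding k_def comp_def using that by (intro fiber)
  qed
  \<comment> \<open>A continuous map from a compact set to a Hausdorff space is closed, so
    \<open>\<Phi>\<close> is a quotient map onto \<open>S\<close> and continuity of \<open>h\<close>
    descends to \<open>k\<close>.\<close>
  have ck: "continuous_on S k"
    unfolding continuous_on_closed_vimage[OF compact_imp_closed[OF cS]]
  proof (intro allI impI)
    fix C :: "real set" assume C: "closed C"
    have "k -` C \<inter> S = \<Phi> ` (h -` C \<inter> dom)" using k\<Phi> by (auto simp: S_def)
    moreover have "closed (h -` C)" using continuous_closed_vimage[OF C, of h] h by (auto simp: continuous_on_eq_continuous_at)
    then have "compact (h -` C \<inter> dom)" using cdom by (simp add: closed_Int_compact)
    then have "compact (\<Phi> ` (h -` C \<inter> dom))" by (rule compact_continuous_image[OF c\<Phi>])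
    ultimately show "closed (k -` C \<inter> S)" by (simp add: compact_imp_closed)
  qed
  \<comment> \<open>The functions on \<open>S\<close> whose pullback is a trigonometric polynomial.
    The coordinates of \<open>S\<close> pull back to t, cos x_j and sin x_j, hence lie in
    \<open>R\<close> and separate points.\<close>
  define R where "R = {u. continuous_on S u \<and> (\<exists>\<phi>. trig \<phi> \<and> (\<forall>t x. u (\<Phi> (t, x)) = \<phi> t x))}"
  interpret function_ring_on R S
  proof
    show "compact S" by (rule cS)
    show "u \<in> R \<Longrightarrow> continuous_on S u" for u by (simp add: R_def)
    show "(\<lambda>x. u x + w x) \<in> R" "(\<lambda>x. u x * w x) \<in> R" if "u \<in> R" "w \<in> R" for u w
    proof -
      obtain a b where ab: "trig a" "\<And>t x. u (\<Phi> (t, x)) = a t x" "trig b" "\<And>t x. w (\<Phi> (t, x)) = b t x"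
        and c: "continuous_on S u" "continuous_on S w"
        using \<open>u \<in> R\<close> \<open>w \<in> R\<close> by (auto simp: R_def)
      have "\<exists>\<phi>. trig \<phi> \<and> (\<forall>t x. u (\<Phi> (t, x)) + w (\<Phi> (t, x)) = \<phi> t x)"
        by (rule exI[of _ "\<lambda>t x. a t x + b t x"]) (simp add: ab trig_add)
      then show "(\<lambda>x. u x + w x) \<in> R" using c by (simp add: R_def continuous_on_add)
      have "\<exists>\<phi>. trig \<phi> \<and> (\<forall>t x. u (\<Phi> (t, x)) * w (\<Phi> (t, x)) = \<phi> t x)"
        by (rule exI[of _ "\<lambda>t x. a t x * b t x"]) (simp add: ab trig_mult)
      then show "(\<lambda>x. u x * w x) \<in> R" using c by (simp add: R_def continuous_on_mult)
    qed
    have RI: "u \<in> R" if "continuous_on S u" "trig \<phi>" "\<And>t x. u (\<Phi> (t, x)) = \<phi> t x" for u \<phi>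
      using that unfolding R_def by blast
    show "(\<lambda>_. c) \<in> R" for c by (rule RI[OF _ trig_const[of c]]) auto
    have cos: "(\<lambda>y. fst (snd y) $ j) \<in> R" for j
      by (rule RI[OF _ trig_cos[of j]]) (auto simp: \<Phi>_def intro!: continuous_intros)
    have sin: "(\<lambda>y. snd (snd y) $ j) \<in> R" for j
      by (rule RI[OF _ trig_sin[of j]]) (auto simp: \<Phi>_def intro!: continuous_intros)
    have time: "fst \<in> R"
      by (rule RI[OF _ trig_time]) (auto simp: \<Phi>_def intro!: continuous_intros)
    show "\<exists>u\<in>R. u x \<noteq> u y" if "x \<noteq> y" for x y
    proof -
      from that consider "fst x \<noteq> fst y" | j where "fst (snd x) $ j \<noteq> fst (snd y) $ j" | j where "snd (snd x) $ j \<noteq> snd (snd y) $ j"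
        by (auto simp: prod_eq_iff vec_eq_iff)
      then show ?thesis
        by cases (rule bexI[OF _ time], assumption, rule bexI[OF _ cos], assumption, rule bexI[OF _ sin], assumption)
    qed
  qed
  obtain u where u: "u \<in> R" "\<forall>y\<in>S. \<bar>k y - u y\<bar> < e"
    using Stone_Weierstrass_basic[OF ck e] by blast
  from u(1) obtain \<phi> where \<phi>: "trig \<phi>" "\<And>t x. u (\<Phi> (t, x)) = \<phi> t x" unfolding R_def by blast
  have "\<bar>h (t, x) - \<phi> t x\<bar> < e" if "t \<in> {0..T}" "x \<in> period_cell" for t x
  proof -
    have d: "(t, x) \<in> dom" using that by (simp add: dom_def)
    then have "\<Phi> (t, x) \<in> S" unfolding S_def by (rule imageI)
    from u(2)[rule_format, OF this] show ?thesis by (simp only: k\<Phi>[OF d] \<phi>(2))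
  qed
  then show ?thesis using \<phi>(1) by blast
qed

lemma l2n_cyl_bounded:
  fixes f :: "real \<times> (real^'n) \<Rightarrow> real"
  assumes "f \<in> borel_measurable borel" "0 \<le> b" "0 \<le> T"
    and "AE z in cyl T. \<bar>f z\<bar> \<le> b"
  shows "sqint (cyl T) f" "l2n (cyl T) f \<le> b * sqrt T"
proof -
  have "(\<integral>\<^sup>+z. ennreal ((f z)\<^sup>2) \<partial>cyl T) \<le> (\<integral>\<^sup>+z. ennreal (b\<^sup>2) \<partial>(cyl T :: (real \<times> (real^'n)) measure))"
  proof (rule nn_integral_mono_AE)
    show "AE z in cyl T. ennreal ((f z)\<^sup>2) \<le> ennreal (b\<^sup>2)"
      using assms(4) by eventually_elim (use assms(2) in \<open>simp add: abs_le_square_iff[symmetric]\<close>)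
  qed
  also have "\<dots> = ennreal ((b * sqrt T)\<^sup>2)"
    using assms by (simp add: emeasure_cyl power_mult_distrib ennreal_mult)
  finally have le: "(\<integral>\<^sup>+z. ennreal ((f z)\<^sup>2) \<partial>cyl T) \<le> ennreal ((b * sqrt T)\<^sup>2)" .
  show "sqint (cyl T) f" "l2n (cyl T) f \<le> b * sqrt T"
    by (rule l2n_le_nn[OF le]; use assms in \<open>simp add: measurable_cong_sets[OF sets_cyl refl]\<close>)+
qed

lemma l2n_tendsto_0:
  assumes fin: "finite_measure M" and [measurable]: "\<And>n::nat. f n \<in> borel_measurable M" and w: "integrable M w"
    and b: "\<And>n. AE z in M. (f n z)\<^sup>2 \<le> w z" and l: "AE z in M. (\<lambda>n. f n z) \<longlonglongrightarrow> 0"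
  shows "(\<lambda>n. l2n M (f n)) \<longlonglongrightarrow> 0"
proof -
  have "(\<lambda>n. LINT z|M. (f n z)\<^sup>2) \<longlonglongrightarrow> (LINT z|M. 0)"
  proof (rule integral_dominated_convergence[OF _ _ w])
    show "AE z in M. (\<lambda>n. (f n z)\<^sup>2) \<longlonglongrightarrow> 0"
      using l by eventually_elim (auto intro: tendsto_eq_intros)
    show "AE z in M. norm ((f n z)\<^sup>2) \<le> w z" for n using b[of n] by eventually_elim simp
  qed auto
  then have "(\<lambda>n. sqrt (LINT z|M. (f n z)\<^sup>2)) \<longlonglongrightarrow> sqrt 0" by (intro tendsto_real_sqrt) simp
  then show ?thesis by (simp add: l2n_def)
qed

text \<open>Vanishing outside the open cell is what makes the approximant compatible with
  identifying opposite faces. Clipping at \<open>b\<close> provides a dominating constant, and at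
  each interior point the cutoff factor equals 1 from some index on.\<close>

lemma cutoff_approx:
  fixes f :: "real \<times> (real^'n) \<Rightarrow> real"
  assumes T: "0 \<le> T" and f: "f \<in> borel_measurable borel" and b: "\<And>z. \<bar>f z\<bar> \<le> b" and e: "0 < e"
  shows "\<exists>h. continuous_on UNIV h \<and> (\<forall>t x. x \<notin> box 0 (\<chi> i. 2 * pi) \<longrightarrow> h (t, x) = 0) \<and>
    sqint (cyl T) h \<and> l2n (cyl T) (\<lambda>z. f z - h z) < e"
proof -
  let ?U = "box (0 :: real^'n) (\<chi> i. 2 * pi)"
  have b0: "0 \<le> b" using b[of undefined] by linarith
  have "f measurable_on UNIV"
    by (rule lebesgue_measurable_imp_measurable_on)
      (use f in \<open>auto simp: measurable_completion\<close>)
  then obtain N g where N: "negligible N" and g: "\<And>n::nat. continuous_on UNIV (g n)"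
    and lim: "\<And>z. z \<notin> N \<Longrightarrow> (\<lambda>n. g n z) \<longlonglongrightarrow> f z"
    by (auto simp: measurable_on_def)
  have AE: "AE z in cyl T. (\<lambda>n. g n z) \<longlonglongrightarrow> f z"
  proof (rule AE_cyl_lborel)
    have "AE z in lebesgue. z \<notin> N" using N by (simp add: negligible_iff_null_sets AE_not_in)
    then have "AE z in lborel. z \<notin> N" by (simp add: AE_completion_iff)
    then show "AE z in lborel. (\<lambda>n. g n z) \<longlonglongrightarrow> f z" by eventually_elim (rule lim)
  qed
  define h where "h n z = max (- b) (min b (g n z)) * min 1 (real n * infdist (snd z) (- ?U))" for n z
  have ne: "- ?U \<noteq> {}"
    using bounded_box[of "0 :: real^'n"] not_bounded_UNIV[where 'a = "real^'n"] by (metis Compl_empty_eq double_compl)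
  have ch: "continuous_on UNIV (h n)" for n
    unfolding h_def by (intro continuous_intros g)
  have hb: "\<bar>h n z\<bar> \<le> b" for n z
  proof -
    have "\<bar>max (- b) (min b (g n z))\<bar> \<le> b" using b0 by (auto simp: max_def min_def)
    moreover have "\<bar>min 1 (real n * infdist (snd z) (- ?U))\<bar> \<le> 1" by (simp add: infdist_nonneg)
    ultimately have "\<bar>h n z\<bar> \<le> b * 1" unfolding h_def abs_mult by (intro mult_mono) auto
    then show ?thesis by simp
  qed
  note [measurable] = f borel_measurable_continuous_onI[OF ch]
  have lim0: "(\<lambda>n. l2n (cyl T) (\<lambda>z. f z - h n z)) \<longlonglongrightarrow> 0"
  proof (rule l2n_tendsto_0[OF finite_measure_cyl])
    show "(\<lambda>z. f z - h n z) \<in> borel_measurable (cyl T)" for n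
      by (simp add: measurable_cong_sets[OF sets_cyl refl])
    show "integrable (cyl T) (\<lambda>z :: real \<times> (real^'n). (2 * b)\<^sup>2)"
      by (rule finite_measure.integrable_const[OF finite_measure_cyl])
    have "(f z - h n z)\<^sup>2 \<le> (2 * b)\<^sup>2" for n z
      using b[of z] hb[of n z] b0 by (intro abs_le_square_iff[THEN iffD1]) linarith
    then show "AE z in cyl T. (f z - h n z)\<^sup>2 \<le> (2 * b)\<^sup>2" for n by simp
    show "AE z in cyl T. (\<lambda>n. f z - h n z) \<longlonglongrightarrow> 0"
      using AE AE_cyl[of T]
    proof eventually_elim
      case (elim z)
      have pos: "0 < infdist (snd z) (- ?U)"
      proof -
        have "infdist (snd z) (- ?U) \<noteq> 0"
          using in_closed_iff_infdist_zero[OF _ ne, of "snd z"] elim by auto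
        then show ?thesis using infdist_nonneg[of "snd z" "- ?U"] by linarith
      qed
      have l1: "(\<lambda>n. max (- b) (min b (g n z))) \<longlonglongrightarrow> max (- b) (min b (f z))"
        using elim by (intro tendsto_intros) auto
      have fz: "max (- b) (min b (f z)) = f z" using b[of z] by (auto simp: max_def min_def abs_le_iff)
      have l2: "(\<lambda>n. min 1 (real n * infdist (snd z) (- ?U))) \<longlonglongrightarrow> 1"
      proof (rule tendsto_eventually)
        obtain n0 :: nat where n0: "1 < real n0 * infdist (snd z) (- ?U)" using reals_Archimedean3[OF pos] by blast
        show "\<forall>\<^sub>F n in sequentially. min 1 (real n * infdist (snd z) (- ?U)) = 1"
          using eventually_ge_at_top[of n0]
        proof eventually_elim
          case (elim n)
          then have "real n0 * infdist (snd z) (- ?U) \<le> real n * infdist (snd z) (- ?U)"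
            using pos by (intro mult_right_mono) auto
          then show ?case using n0 by simp
        qed
      qed
      have "(\<lambda>n. h n z) \<longlonglongrightarrow> f z * 1" unfolding h_def by (rule tendsto_mult[OF l1[unfolded fz] l2])
      then have "(\<lambda>n. f z - h n z) \<longlonglongrightarrow> f z - f z * 1" by (intro tendsto_intros)
      then show ?case by simp
    qed
  qed
  then obtain n where n: "l2n (cyl T) (\<lambda>z. f z - h n z) < e"
    using order_tendstoD(2)[OF lim0 e] by (auto simp: eventually_sequentially)
  have "h n (t, x) = 0" if "x \<notin> ?U" for t x
    using that by (simp add: h_def)
  moreover have "sqint (cyl T) (h n)"
    by (rule l2n_cyl_bounded(1)[OF _ b0 T]) (auto simp: hb)
  ultimately show ?thesis using n ch by blast
qed

text \<open>Three steps with error below e/3 each: truncation of the values, a continuous function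
  vanishing on the faces, and uniform approximation of that function.\<close>

lemma trig_dense:
  fixes f :: "real \<times> (real^'n) \<Rightarrow> real"
  assumes T: "0 < T" and f: "sqint (cyl T) f" and e: "0 < e"
  shows "\<exists>\<phi>. trig \<phi> \<and> sqint (cyl T) (\<lambda>z. \<phi> (fst z) (snd z)) \<and> l2n (cyl T) (\<lambda>z. f z - \<phi> (fst z) (snd z)) < e"
proof -
  have [measurable]: "f \<in> borel_measurable borel"
    using f by (simp add: sqint_def measurable_cong_sets[OF sets_cyl refl])
  define c where "c n z = max (- real n) (min (real n) (f z))" for n z
  have [measurable]: "c n \<in> borel_measurable borel" for n unfolding c_def by measurable
  have lim: "(\<lambda>n. l2n (cyl T) (\<lambda>z. f z - c n z)) \<longlonglongrightarrow> 0"
  proof (rule l2n_tendsto_0[OF finite_measure_cyl])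
    show "(\<lambda>z. f z - c n z) \<in> borel_measurable (cyl T)" for n
      by (simp add: measurable_cong_sets[OF sets_cyl refl])
    show "integrable (cyl T) (\<lambda>z. (f z)\<^sup>2)" using f by (simp add: sqint_def)
    have "(f z - c n z)\<^sup>2 \<le> (f z)\<^sup>2" for n z
      by (intro abs_le_square_iff[THEN iffD1]) (auto simp: c_def max_def min_def)
    then show "AE z in cyl T. (f z - c n z)\<^sup>2 \<le> (f z)\<^sup>2" for n by simp
    have "(\<lambda>n. f z - c n z) \<longlonglongrightarrow> 0" for z
    proof (rule tendsto_eventually)
      obtain n0 :: nat where "\<bar>f z\<bar> \<le> real n0" using real_arch_simple by blast
      show "\<forall>\<^sub>F n in sequentially. f z - c n z = 0"
        using eventually_ge_at_top[of n0]
      proof eventually_elim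
        case (elim n)
        then have "\<bar>f z\<bar> \<le> real n" using \<open>\<bar>f z\<bar> \<le> real n0\<close> by linarith
        then show ?case by (simp add: c_def max_def min_def abs_le_iff)
      qed
    qed
    then show "AE z in cyl T. (\<lambda>n. f z - c n z) \<longlonglongrightarrow> 0" by simp
  qed
  have "\<forall>\<^sub>F n in sequentially. l2n (cyl T) (\<lambda>z. f z - c n z) < e / 3"
    by (rule order_tendstoD(2)[OF lim]) (use e in simp)
  then obtain n where n: "l2n (cyl T) (\<lambda>z. f z - c n z) < e / 3"
    by (auto simp: eventually_sequentially)
  have cb: "\<bar>c n z\<bar> \<le> real n" for z by (auto simp: c_def max_def min_def)
  obtain h where h: "continuous_on UNIV h" "\<And>t x. x \<notin> box 0 (\<chi> i. 2 * pi) \<Longrightarrow> h (t, x) = 0"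
    "sqint (cyl T) h" "l2n (cyl T) (\<lambda>z. c n z - h z) < e / 3"
    using cutoff_approx[of T "c n" "real n" "e / 3"] T cb e by auto
  \<comment> \<open>A uniform error \<open>d\<close> costs at most \<open>d * sqrt T\<close> in L2,
    because the cylinder has mass T. This choice makes the cost at most e/6.\<close>
  define d where "d = e / 6 / (sqrt T + 1)"
  have sT: "0 < sqrt T + 1" using T by (simp add: add_pos_nonneg)
  then have d: "0 < d" using e by (simp add: d_def)
  obtain \<phi> where \<phi>: "trig \<phi>" "\<And>t x. t \<in> {0..T} \<Longrightarrow> x \<in> period_cell \<Longrightarrow> \<bar>h (t, x) - \<phi> t x\<bar> < d"
    using trig_uniform_approx[OF h(1,2) d, of T] by blast
  let ?\<phi> = "\<lambda>z. \<phi> (fst z) (snd z)"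
  note [measurable] = borel_measurable_continuous_onI[OF h(1)] borel_measurable_continuous_onI[OF continuous_on_trig[OF \<phi>(1)]]
  have "AE z in cyl T. \<bar>h z - ?\<phi> z\<bar> \<le> d"
    using AE_cyl[of T]
  proof eventually_elim
    case (elim z)
    then have "snd z \<in> period_cell" "fst z \<in> {0..T}" by (auto simp: box_period_cell in_period_cell less_imp_le)
    from \<phi>(2)[OF this(2,1)] show ?case by simp
  qed
  note hd = l2n_cyl_bounded[OF _ less_imp_le[OF d] less_imp_le[OF T] this]
  have sq: "sqint (cyl T) (\<lambda>z. h z - ?\<phi> z)" and "l2n (cyl T) (\<lambda>z. h z - ?\<phi> z) \<le> d * sqrt T"
    using hd by auto
  moreover have "d * sqrt T < e / 3"
  proof -
    have "d * sqrt T \<le> d * (sqrt T + 1)" using d by (intro mult_left_mono) auto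
    also have "\<dots> = e / 6"
      unfolding d_def by (rule nonzero_eq_divide_eq[THEN iffD1]) (use sT in auto)
    finally show ?thesis using e by simp
  qed
  ultimately have "l2n (cyl T) (\<lambda>z. h z - ?\<phi> z) < e / 3" by simp
  have sc: "sqint (cyl T) (c n)"
    by (rule l2n_cyl_bounded(1)[of _ "real n"]) (use T cb in auto)
  have s\<phi>: "sqint (cyl T) ?\<phi>" using sqint_diff[OF h(3) sq] by simp
  have "l2n (cyl T) (\<lambda>z. f z - ?\<phi> z) \<le> l2n (cyl T) (\<lambda>z. f z - c n z) + (l2n (cyl T) (\<lambda>z. c n z - h z) + l2n (cyl T) (\<lambda>z. h z - ?\<phi> z))"
    using l2n_triangle[OF f sc s\<phi>] l2n_triangle[OF sc h(3) s\<phi>] by linarith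
  also have "\<dots> < e" using n h(4) \<open>l2n (cyl T) (\<lambda>z. h z - ?\<phi> z) < e / 3\<close> by linarith
  finally show ?thesis using \<phi>(1) s\<phi> by blast
qed

subsection \<open>Averaging operators\<close>

text \<open>The integrand is left general, so that the operator and its x-derivatives are averages
  of the same kind.\<close>

definition avg :: "(real \<Rightarrow> real \<Rightarrow> (real^'n) \<times> (real^'n) \<Rightarrow> real) \<Rightarrow> real \<Rightarrow> real^'n \<Rightarrow> real" where
  "avg U t x = (LINT s:{0..t}|lborel. LINT v|lborel. U t s (x, v))"

lemma ennreal_abs_integral_le:
  fixes f :: "'a \<Rightarrow> real"
  shows "ennreal \<bar>integral\<^sup>L M f\<bar> \<le> (\<integral>\<^sup>+x. ennreal \<bar>f x\<bar> \<partial>M)"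
  using integral_norm_bound_ennreal[of M f]
  by (cases "integrable M f") (simp_all add: not_integrable_integral_eq)

context avg_kernel
begin

text \<open>Integrands for which the exchanges of integrals below are legitimate: continuity gives
  joint measurability, and the weighted bound gives integrability over phase space. Later only the
  existence of some \<open>W\<close> matters.\<close>

definition adm :: "(real \<Rightarrow> real \<Rightarrow> (real^'n) \<times> (real^'n) \<Rightarrow> real) \<Rightarrow> real \<Rightarrow> bool" where
  "adm U W \<longleftrightarrow> 0 \<le> W \<and> continuous_on (kernel_dom T) (\<lambda>(t, s, z). U t s z) \<and>
    (\<forall>t s. 0 \<le> s \<longrightarrow> s \<le> t \<longrightarrow> t \<le> T \<longrightarrow>
      (\<integral>\<^sup>+z. ennreal (wt \<sigma> (snd z) * (U t s z)\<^sup>2) \<partial>phase) \<le> ennreal (W\<^sup>2))"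

lemma adm_slice:
  assumes "adm U W" "0 \<le> s" "s \<le> t" "t \<le> T"
  shows "continuous_on UNIV (U t s)" "U t s \<in> borel_measurable borel" "integrable phase (U t s)"
    "(\<integral>\<^sup>+z. ennreal \<bar>U t s z\<bar> \<partial>phase) \<le> ennreal (sqrt (wt_mass TYPE('n) \<sigma>) * W)"
proof -
  have "continuous_on (kernel_dom T) (\<lambda>(t, s, z). U t s z)" using assms by (simp add: adm_def)
  then have "continuous_on UNIV (\<lambda>z. (\<lambda>(t, s, z). U t s z) (t, s, z))"
    by (rule continuous_on_compose2) (use assms in \<open>auto intro!: continuous_intros\<close>)
  then show c: "continuous_on UNIV (U t s)" by simp
  then show m: "U t s \<in> borel_measurable borel" by (rule borel_measurable_continuous_onI)
  show "integrable phase (U t s)" "(\<integral>\<^sup>+z. ennreal \<bar>U t s z\<bar> \<partial>phase) \<le> ennreal (sqrt (wt_mass TYPE('n) \<sigma>) * W)"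
    using weighted_L2_imp_L1[OF sigma m, of W] assms by (auto simp: adm_def)
qed

lemma avg_eq:
  assumes "t \<in> {0..T}"
  shows "avg U t x = (LINT s|lborel. LINT v|lborel. indicator {0..t} s * U t s (x, v))"
  unfolding avg_def set_lebesgue_integral_def by simp

text \<open>The nesting of the tuple mirrors the order of integration: the last component v is
  integrated out first, then s. The integrand is a continuous function cut off to a closed
  set.\<close>

lemma adm_measurable:
  assumes "adm U W"
  shows "(\<lambda>(((t, x), s), v). indicator {0..T} t * (indicator {0..t} s * U t s (x, v))) \<in> borel_measurable borel"
proof -
  have cU: "continuous_on (kernel_dom T) (\<lambda>(t, s, z). U t s z)" using assms by (simp add: adm_def)
  let ?A = "{(((t, x), s), v). 0 \<le> t \<and> t \<le> T \<and> 0 \<le> s \<and> s \<le> t} :: (((real \<times> (real^'n)) \<times> real) \<times> (real^'n)) set"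
  have A: "?A = {p. 0 \<le> fst (fst (fst p)) \<and> fst (fst (fst p)) \<le> T \<and> 0 \<le> snd (fst p) \<and> snd (fst p) \<le> fst (fst (fst p))}"
    by auto
  have "closed ?A" unfolding A
    by (intro closed_Collect_conj closed_Collect_le continuous_intros)
  moreover have "continuous_on ?A (\<lambda>p. (\<lambda>(t, s, z). U t s z) (fst (fst (fst p)), snd (fst p), (snd (fst (fst p)), snd p)))"
    by (rule continuous_on_compose2[OF cU]) (auto intro!: continuous_intros)
  ultimately have "(\<lambda>p. indicator ?A p *\<^sub>R (\<lambda>(t, s, z). U t s z) (fst (fst (fst p)), snd (fst p), (snd (fst (fst p)), snd p))) \<in> borel_measurable borel"
    by (rule borel_measurable_continuous_closed)
  moreover have "(\<lambda>p. indicator ?A p *\<^sub>R (\<lambda>(t, s, z). U t s z) (fst (fst (fst p)), snd (fst p), (snd (fst (fst p)), snd p)))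
     = (\<lambda>(((t, x), s), v). indicator {0..T} t * (indicator {0..t} s * U t s (x, v)))"
    by (auto simp: fun_eq_iff indicator_def)
  ultimately show ?thesis by simp
qed

lemma inner_measurable:
  assumes "adm U W"
  shows "(\<lambda>((t, x), s). LINT v|lborel. indicator {0..T} t * (indicator {0..t} s * U t s (x, v))) \<in> borel_measurable borel"
proof -
  let ?f = "\<lambda>p v. indicator {0..T} (fst (fst p)) * (indicator {0..fst (fst p)} (snd p) * U (fst (fst p)) (snd p) (snd (fst p), v))"
  have "(\<lambda>(p, v). ?f p v) \<in> borel_measurable (borel \<Otimes>\<^sub>M lborel)"
    using adm_measurable[OF assms]
    by (simp add: measurable_cong_sets[OF sets_pair_borel[OF refl sets_lborel] refl] case_prod_unfold)
  then have "(\<lambda>p. LINT v|lborel. ?f p v) \<in> borel_measurable borel"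
    by (rule lborel.borel_measurable_lebesgue_integral)
  then show ?thesis by (simp add: case_prod_unfold)
qed

lemma avg_measurable:
  assumes "adm U W"
  shows "(\<lambda>(t, x). indicator {0..T} t * avg U t x) \<in> borel_measurable borel"
proof -
  let ?f = "\<lambda>q s. LINT v|lborel. indicator {0..T} (fst q) * (indicator {0..fst q} s * U (fst q) s (snd q, v))"
  have "(\<lambda>(q, s). ?f q s) \<in> borel_measurable (borel \<Otimes>\<^sub>M lborel)"
    using inner_measurable[OF assms]
    by (simp add: measurable_cong_sets[OF sets_pair_borel[OF refl sets_lborel] refl] case_prod_unfold)
  then have "(\<lambda>q. LINT s|lborel. ?f q s) \<in> borel_measurable borel"
    by (rule lborel.borel_measurable_lebesgue_integral)
  moreover have "(LINT s|lborel. ?f q s) = (\<lambda>(t, x). indicator {0..T} t * avg U t x) q" for q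
    by (cases q) (auto simp: avg_eq indicator_def)
  ultimately show ?thesis by simp
qed

lemma avg_measurable_slice:
  assumes "adm U W" "t \<in> {0..T}"
  shows "avg U t \<in> borel_measurable borel"
proof -
  have "(\<lambda>x. (\<lambda>(t, x). indicator {0..T} t * avg U t x) (t, x)) \<in> borel_measurable borel"
    by (rule measurable_compose[OF _ avg_measurable[OF assms(1)]]) measurable
  then show ?thesis using assms(2) by simp
qed

lemma slice_measurable:
  assumes "adm U W" "t \<in> {0..T}"
  shows "(\<lambda>(s, z). indicator {0..t} s * U t s z) \<in> borel_measurable borel"
proof -
  have "(\<lambda>p. (\<lambda>(((t, x), s), v). indicator {0..T} t * (indicator {0..t} s * U t s (x, v))) (((t, fst (snd p)), fst p), snd (snd p))) \<in> borel_measurable borel"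
    by (rule measurable_compose[OF _ adm_measurable[OF assms(1)]]) measurable
  then show ?thesis using assms(2) by (simp add: case_prod_unfold)
qed

text \<open>Cauchy-Schwarz in s, weighted Cauchy-Schwarz in v, then Tonelli. The value is crude,
  since \<open>W\<close> will involve the supremum of the gradient of H; the point is
  finiteness.\<close>

lemma avg_L2:
  assumes U: "adm U W" and t: "t \<in> {0..T}"
  shows "(\<integral>\<^sup>+x. ennreal ((avg U t x)\<^sup>2) \<partial>torus) \<le> ennreal ((t * (sqrt (wt_mass TYPE('n) \<sigma>) * W))\<^sup>2)"
proof -
  have W: "0 \<le> W" and m0: "0 \<le> wt_mass TYPE('n) \<sigma>" using U by (auto simp: adm_def)
  interpret R: pair_sigma_finite "lborel :: real measure" "phase :: ((real^'n) \<times> (real^'n)) measure"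
    by unfold_locales
  interpret X: pair_sigma_finite "lborel :: real measure" "torus :: (real^'n) measure"
    by unfold_locales
  define V where "V s z = indicator {0..t} s * U t s z" for s z
  have Vb: "(\<lambda>(s, z). V s z) \<in> borel_measurable borel"
    unfolding V_def by (rule slice_measurable[OF U t])
  have V3 [measurable]: "(\<lambda>p. V (snd (fst p)) (fst (fst p), snd p)) \<in> borel_measurable ((borel \<Otimes>\<^sub>M borel) \<Otimes>\<^sub>M borel)"
    using measurable_compose[OF _ Vb, of "\<lambda>p. (snd (fst p), (fst (fst p), snd p))" borel]
    by (simp add: borel_prod)
  have V2 [measurable]: "(\<lambda>(s, v). V s (x, v)) \<in> borel_measurable (borel \<Otimes>\<^sub>M borel)" for x
    using measurable_compose[OF _ Vb, of "\<lambda>p. (fst p, (x, snd p))" borel]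
    by (simp add: borel_prod case_prod_unfold)
  have V1 [measurable]: "(\<lambda>v. V s (x, v)) \<in> borel_measurable borel" for s x
    using measurable_compose[OF _ Vb, of "\<lambda>v. (s, (x, v))" borel] by simp
  have Vz [measurable]: "V s \<in> borel_measurable borel" for s
    using measurable_compose[OF _ Vb, of "\<lambda>z. (s, z)" borel] by simp
  let ?I = "\<lambda>s. indicator {0..t} s :: ennreal"
  let ?N = "\<lambda>s x. \<integral>\<^sup>+v. ennreal (wt \<sigma> v * (V s (x, v))\<^sup>2) \<partial>lborel"
  have [measurable]: "(\<lambda>(x, s). ?N s x) \<in> borel_measurable (borel \<Otimes>\<^sub>M borel)"
    by measurable
  have "ennreal ((avg U t x)\<^sup>2) \<le> ennreal (t * wt_mass TYPE('n) \<sigma>) * (\<integral>\<^sup>+s. ?N s x \<partial>lborel)" for x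
  proof -
    have "ennreal \<bar>avg U t x\<bar> \<le> (\<integral>\<^sup>+s. ennreal \<bar>LINT v|lborel. V s (x, v)\<bar> \<partial>lborel)"
      unfolding avg_eq[OF t] V_def by (rule ennreal_abs_integral_le)
    also have "\<dots> \<le> (\<integral>\<^sup>+s. ?I s * (\<integral>\<^sup>+v. ennreal \<bar>V s (x, v)\<bar> \<partial>lborel) \<partial>lborel)"
    proof (rule nn_integral_mono)
      fix s
      show "ennreal \<bar>LINT v|lborel. V s (x, v)\<bar> \<le> ?I s * (\<integral>\<^sup>+v. ennreal \<bar>V s (x, v)\<bar> \<partial>lborel)"
        using ennreal_abs_integral_le[of lborel "\<lambda>v. V s (x, v)"] by (cases "s \<in> {0..t}") (auto simp: V_def)
    qed
    finally have "(ennreal \<bar>avg U t x\<bar>)\<^sup>2 \<le> (\<integral>\<^sup>+s. ?I s * (\<integral>\<^sup>+v. ennreal \<bar>V s (x, v)\<bar> \<partial>lborel) \<partial>lborel)\<^sup>2"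
      by (rule power_mono) simp
    also have "\<dots> \<le> (\<integral>\<^sup>+s. (?I s)\<^sup>2 \<partial>lborel) * (\<integral>\<^sup>+s. (\<integral>\<^sup>+v. ennreal \<bar>V s (x, v)\<bar> \<partial>lborel)\<^sup>2 \<partial>lborel)"
      by (rule Cauchy_Schwarz_nn_integral) measurable
    also have "(\<integral>\<^sup>+s. (?I s)\<^sup>2 \<partial>lborel) = ennreal t"
      using t by (simp add: power2_eq_square flip: indicator_inter_arith)
    also have "(\<integral>\<^sup>+s. (\<integral>\<^sup>+v. ennreal \<bar>V s (x, v)\<bar> \<partial>lborel)\<^sup>2 \<partial>lborel) \<le> (\<integral>\<^sup>+s. ennreal (wt_mass TYPE('n) \<sigma>) * ?N s x \<partial>lborel)"
    proof (rule nn_integral_mono)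
      fix s
      have "(\<integral>\<^sup>+v. ennreal \<bar>V s (x, v)\<bar> \<partial>lborel)\<^sup>2 \<le> ennreal (wt_mass TYPE('n) \<sigma>) * (\<integral>\<^sup>+v. ennreal (wt \<sigma> v) * (ennreal \<bar>V s (x, v)\<bar>)\<^sup>2 \<partial>lborel)"
        unfolding ennreal_wt_mass[OF sigma, symmetric] by (rule nn_integral_cauchy_schwarz_wt) (auto simp: wt_pos)
      then show "(\<integral>\<^sup>+v. ennreal \<bar>V s (x, v)\<bar> \<partial>lborel)\<^sup>2 \<le> ennreal (wt_mass TYPE('n) \<sigma>) * ?N s x"
        by (simp add: ennreal_power ennreal_mult' wt_pos less_imp_le)
    qed
    also have "(\<integral>\<^sup>+s. ennreal (wt_mass TYPE('n) \<sigma>) * ?N s x \<partial>lborel) = ennreal (wt_mass TYPE('n) \<sigma>) * (\<integral>\<^sup>+s. ?N s x \<partial>lborel)"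
      by (rule nn_integral_cmult) measurable
    finally show ?thesis
      using t by (simp add: ennreal_power ennreal_mult mult.assoc mult_left_mono)
  qed
  then have "(\<integral>\<^sup>+x. ennreal ((avg U t x)\<^sup>2) \<partial>torus) \<le> (\<integral>\<^sup>+x. ennreal (t * wt_mass TYPE('n) \<sigma>) * (\<integral>\<^sup>+s. ?N s x \<partial>lborel) \<partial>torus)"
    by (intro nn_integral_mono)
  also have "\<dots> = ennreal (t * wt_mass TYPE('n) \<sigma>) * (\<integral>\<^sup>+x. (\<integral>\<^sup>+s. ?N s x \<partial>lborel) \<partial>torus)"
    by (rule nn_integral_cmult) measurable
  also have "(\<integral>\<^sup>+x. (\<integral>\<^sup>+s. ?N s x \<partial>lborel) \<partial>torus) = (\<integral>\<^sup>+s. (\<integral>\<^sup>+x. ?N s x \<partial>torus) \<partial>lborel)"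
    by (rule X.Fubini') measurable
  also have "ennreal (t * wt_mass TYPE('n) \<sigma>) * \<dots> \<le> ennreal (t * wt_mass TYPE('n) \<sigma>) * (\<integral>\<^sup>+s. ennreal (W\<^sup>2) * ?I s \<partial>lborel)"
  proof (intro mult_left_mono nn_integral_mono)
    fix s
    have "(\<integral>\<^sup>+x. ?N s x \<partial>torus) = (\<integral>\<^sup>+z. ennreal (wt \<sigma> (snd z) * (V s z)\<^sup>2) \<partial>phase)"
      by (subst lborel.nn_integral_fst[symmetric]) (auto simp: measurable_cong_sets[OF sets_phase refl])
    also have "\<dots> \<le> ennreal (W\<^sup>2) * ?I s"
      using U t by (cases "s \<in> {0..t}") (auto simp: V_def adm_def)
    finally show "(\<integral>\<^sup>+x. ?N s x \<partial>torus) \<le> ennreal (W\<^sup>2) * ?I s" .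
  qed simp
  also have "\<dots> = ennreal (t * wt_mass TYPE('n) \<sigma>) * ennreal (W\<^sup>2 * t)"
    using t by (simp add: nn_integral_cmult ennreal_mult')
  also have "\<dots> = ennreal ((t * (sqrt (wt_mass TYPE('n) \<sigma>) * W))\<^sup>2)"
    using t m0 W by (subst ennreal_mult[symmetric]) (auto simp: power_mult_distrib power2_eq_square mult_ac)
  finally show ?thesis .
qed

lemma avg_sqint:
  assumes U: "adm U W"
  shows "sqint (cyl T) (\<lambda>z. indicator {0..T} (fst z) * avg U (fst z) (snd z))"
    and "t \<in> {0..T} \<Longrightarrow> sqint torus (avg U t)"
proof -
  let ?f = "\<lambda>z. indicator {0..T} (fst z) * avg U (fst z) (snd z)"
  have [measurable]: "?f \<in> borel_measurable borel" using avg_measurable[OF U] by (simp add: case_prod_unfold)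
  show "sqint torus (avg U t)" if t: "t \<in> {0..T}"
    using avg_measurable_slice[OF U t] le_less_trans[OF avg_L2[OF U t]]
    by (intro sqintI_nn) (auto simp: measurable_cong_sets[OF sets_torus refl])
  show "sqint (cyl T) ?f"
  proof (rule sqintI_nn)
    show "?f \<in> borel_measurable (cyl T)" by (simp add: measurable_cong_sets[OF sets_cyl refl])
    have "(\<integral>\<^sup>+z. ennreal ((?f z)\<^sup>2) \<partial>cyl T) = (\<integral>\<^sup>+t\<in>{0<..<T}. (\<integral>\<^sup>+x. ennreal ((?f (t, x))\<^sup>2) \<partial>torus) \<partial>lborel)"
      by (rule nn_integral_cyl) measurable
    also have "\<dots> \<le> (\<integral>\<^sup>+t\<in>{0<..<T}. ennreal ((T * (sqrt (wt_mass TYPE('n) \<sigma>) * W))\<^sup>2) \<partial>lborel)"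
    proof (rule nn_integral_mono)
      fix t
      have "(\<integral>\<^sup>+x. ennreal ((?f (t, x))\<^sup>2) \<partial>torus) \<le> ennreal ((T * (sqrt (wt_mass TYPE('n) \<sigma>) * W))\<^sup>2)" if t: "t \<in> {0<..<T}"
      proof -
        have "(\<integral>\<^sup>+x. ennreal ((?f (t, x))\<^sup>2) \<partial>torus) \<le> ennreal ((t * (sqrt (wt_mass TYPE('n) \<sigma>) * W))\<^sup>2)"
          using avg_L2[OF U, of t] t by simp
        also have "\<dots> \<le> ennreal ((T * (sqrt (wt_mass TYPE('n) \<sigma>) * W))\<^sup>2)"
          using t U by (intro ennreal_leI power_mono mult_right_mono) (auto simp: adm_def)
        finally show ?thesis .
      qed
      then show "(\<integral>\<^sup>+x. ennreal ((?f (t, x))\<^sup>2) \<partial>torus) * indicator {0<..<T} t \<le> ennreal ((T * (sqrt (wt_mass TYPE('n) \<sigma>) * W))\<^sup>2) * indicator {0<..<T} t"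
        by (cases "t \<in> {0<..<T}") auto
    qed
    also have "\<dots> < \<infinity>" using T by (simp add: nn_integral_cmult ennreal_mult_less_top)
    finally show "(\<integral>\<^sup>+z. ennreal ((?f z)\<^sup>2) \<partial>cyl T) < \<infinity>" .
  qed
qed

text \<open>Pairing in x merges the integrals over x and v into one over \<open>phase\<close>, where
  Fourier transforms and integration by parts are available.\<close>

lemma avg_pairing:
  assumes U: "adm U W" and t: "t \<in> {0..T}"
    and \<psi>: "\<psi> \<in> borel_measurable borel" and b: "\<And>x. \<bar>\<psi> x\<bar> \<le> b"
  shows "(LINT x|torus. avg U t x * \<psi> x) = (LINT s|lborel. indicator {0..t} s * (LINT z|phase. U t s z * \<psi> (fst z)))"
    and "integrable lborel (\<lambda>s. indicator {0..t} s * (LINT z|phase. U t s z * \<psi> (fst z)))"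
    and "\<And>s. s \<in> {0..t} \<Longrightarrow> integrable phase (\<lambda>z. U t s z * \<psi> (fst z))"
proof -
  note [measurable] = \<psi>
  interpret X: pair_sigma_finite "torus :: (real^'n) measure" "lborel :: real measure"
    by unfold_locales
  note sX = sets_pair_borel[OF sets_torus sets_lborel]
  have b0: "0 \<le> b" using b[of undefined] by linarith
  show ip: "integrable phase (\<lambda>z. U t s z * \<psi> (fst z))" if s: "s \<in> {0..t}" for s
  proof -
    note Us = adm_slice[OF U, of s t]
    have [measurable]: "U t s \<in> borel_measurable borel" using Us(2) s t by auto
    show ?thesis
      by (rule Bochner_Integration.integrable_bound[where f = "\<lambda>z. b * U t s z"])
        (use Us(3) s t b b0 in \<open>auto simp: measurable_cong_sets[OF sets_phase refl] abs_mult mult.commute[of b] intro!: mult_left_mono\<close>)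
  qed
  let ?g = "\<lambda>x s. LINT v|lborel. indicator {0..t} s * U t s (x, v)"
  have "(\<lambda>p. (\<lambda>((t, x), s). LINT v|lborel. indicator {0..T} t * (indicator {0..t} s * U t s (x, v))) ((t, fst p), snd p)) \<in> borel_measurable borel"
    by (rule measurable_compose[OF _ inner_measurable[OF U]]) measurable
  then have gm0: "(\<lambda>p. ?g (fst p) (snd p)) \<in> borel_measurable borel" using t by (simp add: case_prod_unfold)
  have gm: "(\<lambda>(x, s). ?g x s * \<psi> x) \<in> borel_measurable (torus \<Otimes>\<^sub>M lborel)"
    unfolding measurable_cong_sets[OF sX refl] case_prod_unfold
    by (intro borel_measurable_times gm0 measurable_compose[OF borel_measurable_fst_snd(1) \<psi>])
  have split: "(LINT x|torus. ?g x s * \<psi> x) = indicator {0..t} s * (LINT z|phase. U t s z * \<psi> (fst z))" for s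
  proof (cases "s \<in> {0..t}")
    case True
    have "(LINT z|phase. U t s z * \<psi> (fst z)) = (LINT x|torus. LINT v|lborel. U t s (x, v) * \<psi> x)"
      using torus_lborel.integral_fst'[OF ip[OF True]] by simp
    then show ?thesis using True by simp
  qed simp
  have gb: "(\<integral>\<^sup>+x. ennreal \<bar>?g x s * \<psi> x\<bar> \<partial>torus) \<le> ennreal (b * (sqrt (wt_mass TYPE('n) \<sigma>) * W)) * indicator {0..t} s" for s
  proof (cases "s \<in> {0..t}")
    case True
    note Us = adm_slice[OF U, of s t]
    have [measurable]: "U t s \<in> borel_measurable borel" using Us(2) True t by auto
    have [measurable]: "U t s \<in> borel_measurable phase" by (simp add: measurable_cong_sets[OF sets_phase refl])
    have "(\<integral>\<^sup>+x. ennreal \<bar>?g x s * \<psi> x\<bar> \<partial>torus) \<le> (\<integral>\<^sup>+x. (\<integral>\<^sup>+v. ennreal b * ennreal \<bar>U t s (x, v)\<bar> \<partial>lborel) \<partial>torus)"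
    proof (rule nn_integral_mono)
      fix x
      have "ennreal \<bar>LINT v|lborel. U t s (x, v)\<bar> \<le> (\<integral>\<^sup>+v. ennreal \<bar>U t s (x, v)\<bar> \<partial>lborel)"
        by (rule ennreal_abs_integral_le)
      then have "ennreal \<bar>LINT v|lborel. U t s (x, v)\<bar> * ennreal \<bar>\<psi> x\<bar> \<le> (\<integral>\<^sup>+v. ennreal \<bar>U t s (x, v)\<bar> \<partial>lborel) * ennreal b"
        using b[of x] by (intro mult_mono ennreal_leI) auto
      also have "\<dots> = (\<integral>\<^sup>+v. ennreal b * ennreal \<bar>U t s (x, v)\<bar> \<partial>lborel)"
        by (subst nn_integral_cmult) (auto simp: mult.commute)
      finally show "ennreal \<bar>?g x s * \<psi> x\<bar> \<le> (\<integral>\<^sup>+v. ennreal b * ennreal \<bar>U t s (x, v)\<bar> \<partial>lborel)"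
        using True by (simp add: abs_mult ennreal_mult)
    qed
    also have "\<dots> = (\<integral>\<^sup>+z. ennreal b * ennreal \<bar>U t s z\<bar> \<partial>phase)"
      by (subst lborel.nn_integral_fst[symmetric]) auto
    also have "\<dots> = ennreal b * (\<integral>\<^sup>+z. ennreal \<bar>U t s z\<bar> \<partial>phase)"
      by (rule nn_integral_cmult) measurable
    also have "\<dots> \<le> ennreal b * ennreal (sqrt (wt_mass TYPE('n) \<sigma>) * W)"
      using Us(4) True t by (intro mult_left_mono) auto
    finally show ?thesis using True b0 by (simp add: ennreal_mult')
  qed simp
  have "(\<integral>\<^sup>+p. ennreal (norm ((\<lambda>(x, s). ?g x s * \<psi> x) p)) \<partial>(torus \<Otimes>\<^sub>M lborel)) = (\<integral>\<^sup>+s. (\<integral>\<^sup>+x. ennreal \<bar>?g x s * \<psi> x\<bar> \<partial>torus) \<partial>lborel)"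
    by (subst X.nn_integral_snd[symmetric]) (use gm in auto)
  also have "\<dots> \<le> (\<integral>\<^sup>+s. ennreal (b * (sqrt (wt_mass TYPE('n) \<sigma>) * W)) * indicator {0..t} s \<partial>lborel)"
    by (intro nn_integral_mono gb)
  also have "\<dots> < \<infinity>" using t by (simp add: nn_integral_cmult ennreal_mult_less_top)
  finally have int: "integrable (torus \<Otimes>\<^sub>M lborel) (\<lambda>(x, s). ?g x s * \<psi> x)"
    using gm by (simp add: integrable_iff_bounded)
  have "(LINT x|torus. avg U t x * \<psi> x) = (LINT x|torus. LINT s|lborel. ?g x s * \<psi> x)"
    by (simp add: avg_eq[OF t])
  also have "\<dots> = (LINT s|lborel. LINT x|torus. ?g x s * \<psi> x)" using X.Fubini_integral[OF int] by simp
  finally show "(LINT x|torus. avg U t x * \<psi> x) = (LINT s|lborel. indicator {0..t} s * (LINT z|phase. U t s z * \<psi> (fst z)))"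
    unfolding split .
  show "integrable lborel (\<lambda>s. indicator {0..t} s * (LINT z|phase. U t s z * \<psi> (fst z)))"
    using X.integrable_snd[OF int] unfolding split .
qed

text \<open>Additivity is asserted after pairing only: at exceptional points x the inner integrals
  may diverge and take the value 0, so \<open>avg\<close> need not be additive pointwise.\<close>

lemma avg_pairing_diff:
  assumes "adm U W" "adm U' W'" "adm (\<lambda>t s z. U t s z - U' t s z) W''" and t: "t \<in> {0..T}"
    and \<psi>: "\<psi> \<in> borel_measurable borel" "\<And>x. \<bar>\<psi> x\<bar> \<le> b"
  shows "(LINT x|torus. avg (\<lambda>t s z. U t s z - U' t s z) t x * \<psi> x)
     = (LINT x|torus. avg U t x * \<psi> x) - (LINT x|torus. avg U' t x * \<psi> x)"
proof -
  note P = avg_pairing[OF assms(1) t \<psi>] avg_pairing[OF assms(2) t \<psi>] avg_pairing[OF assms(3) t \<psi>]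
  have "indicator {0..t} s * (LINT z|phase. (U t s z - U' t s z) * \<psi> (fst z))
    = indicator {0..t} s * (LINT z|phase. U t s z * \<psi> (fst z)) - indicator {0..t} s * (LINT z|phase. U' t s z * \<psi> (fst z))" for s
    using P(3)[of s] P(6)[of s] by (cases "s \<in> {0..t}") (auto simp: left_diff_distrib)
  then show ?thesis unfolding P(1,4,7) using P(2,5) by simp
qed

end

subsection \<open>Regular functions on the space-time cylinder\<close>

lemma has_dderiv_periodic:
  fixes f :: "real^'n \<Rightarrow> 'b::real_normed_vector"
  assumes d: "has_dderiv f e f'" and p: "periodic f"
  shows "periodic f'"
  unfolding periodic_def
proof (intro allI)
  fix x i
  have "((\<lambda>r. f (x + axis i (2 * pi) + r *\<^sub>R e)) has_vector_derivative f' (x + axis i (2 * pi))) (at 0)"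
    using d by (simp add: has_dderiv_def)
  moreover have "f (x + axis i (2 * pi) + r *\<^sub>R e) = f (x + r *\<^sub>R e)" for r
    using p[unfolded periodic_def, rule_format, of "x + r *\<^sub>R e" i] by (simp add: algebra_simps)
  ultimately have "((\<lambda>r. f (x + r *\<^sub>R e)) has_vector_derivative f' (x + axis i (2 * pi))) (at 0)"
    by simp
  moreover have "((\<lambda>r. f (x + r *\<^sub>R e)) has_vector_derivative f' x) (at 0)"
    using d by (simp add: has_dderiv_def)
  ultimately show "f' (x + axis i (2 * pi)) = f' x" by (rule vector_derivative_unique_at)
qed

lemma has_dderiv_diff:
  "has_dderiv f e f' \<Longrightarrow> has_dderiv g e g' \<Longrightarrow> has_dderiv (\<lambda>z. f z - g z) e (\<lambda>z. f' z - g' z)"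
  unfolding has_dderiv_def by (auto intro!: has_vector_derivative_diff)

text \<open>Two x-derivatives suffice: \<open>h\<close> is the gradient of \<open>H\<close> and
  enters the operator, \<open>hj\<close> collects the derivatives of \<open>h\<close> and enters the
  derivative of the operator. Carrying them as data makes the class visibly closed under
  differences.\<close>

definition reg :: "real \<Rightarrow> (real \<Rightarrow> real^'n \<Rightarrow> real) \<Rightarrow> (real \<Rightarrow> real^'n \<Rightarrow> real^'n) \<Rightarrow>
    ('n \<Rightarrow> real \<Rightarrow> real^'n \<Rightarrow> real^'n) \<Rightarrow> bool" where
  "reg T H h hj \<longleftrightarrow>
    continuous_on ({0..T} \<times> UNIV) (\<lambda>(t, x). H t x) \<and>
    continuous_on ({0..T} \<times> UNIV) (\<lambda>(t, x). h t x) \<and>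
    (\<forall>j. continuous_on ({0..T} \<times> UNIV) (\<lambda>(t, x). hj j t x)) \<and>
    (\<forall>t\<in>{0..T}. periodic (H t) \<and> (\<forall>j. has_dderiv (H t) (axis j 1) (\<lambda>x. h t x $ j) \<and>
      has_dderiv (h t) (axis j 1) (hj j t)))"

lemma reg_periodic:
  fixes H :: "real \<Rightarrow> real^'n \<Rightarrow> real"
  assumes "reg T H h hj" "t \<in> {0..T}"
  shows "periodic (H t)" "periodic (h t)" "periodic (hj j t)"
proof -
  show "periodic (H t)" using assms by (simp add: reg_def)
  have "periodic (\<lambda>x. h t x $ i)" for i
    by (rule has_dderiv_periodic[of "H t" "axis i 1"]) (use assms in \<open>auto simp: reg_def\<close>)
  then show *: "periodic (h t)" by (simp add: periodic_def vec_eq_iff)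
  show "periodic (hj j t)"
    by (rule has_dderiv_periodic[of "h t" "axis j 1"]) (use assms * in \<open>auto simp: reg_def\<close>)
qed

lemma reg_diff:
  fixes H :: "real \<Rightarrow> real^'n \<Rightarrow> real"
  assumes "reg T H h hj" "reg T H' h' hj'"
  shows "reg T (\<lambda>t x. H t x - H' t x) (\<lambda>t x. h t x - h' t x) (\<lambda>j t x. hj j t x - hj' j t x)"
proof -
  have c': "continuous_on A (\<lambda>(t, x). f t x - g t x)"
    if "continuous_on A (\<lambda>(t, x). f t x)" "continuous_on A (\<lambda>(t, x). g t x)"
    for A and f g :: "real \<Rightarrow> real^'n \<Rightarrow> real"
    using continuous_on_diff[OF that] by (simp add: case_prod_unfold)
  have c'': "continuous_on A (\<lambda>(t, x). f t x - g t x)"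
    if "continuous_on A (\<lambda>(t, x). f t x)" "continuous_on A (\<lambda>(t, x). g t x)"
    for A and f g :: "real \<Rightarrow> real^'n \<Rightarrow> real^'n"
    using continuous_on_diff[OF that] by (simp add: case_prod_unfold)
  show ?thesis
    using assms unfolding reg_def
    by (auto simp: periodic_def intro!: c' c'' has_dderiv_diff)
qed

lemma periodic_continuous_bounded:
  fixes f :: "real \<Rightarrow> real^'n \<Rightarrow> 'b::real_normed_vector"
  assumes c: "continuous_on ({0..T} \<times> UNIV) (\<lambda>(t, x). f t x)" and p: "\<And>t. t \<in> {0..T} \<Longrightarrow> periodic (f t)"
  shows "\<exists>b\<ge>0. \<forall>t\<in>{0..T}. \<forall>x. norm (f t x) \<le> b"
proof -
  have "compact ({0..T} \<times> (period_cell :: (real^'n) set))"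
    by (simp add: period_cell_def compact_Times)
  then have "bounded ((\<lambda>(t, x). f t x) ` ({0..T} \<times> period_cell))"
    by (intro compact_imp_bounded compact_continuous_image continuous_on_subset[OF c]) auto
  then obtain b where b: "\<And>t x. t \<in> {0..T} \<Longrightarrow> x \<in> period_cell \<Longrightarrow> norm (f t x) \<le> b"
    by (force simp: bounded_iff)
  have "norm (f t x) \<le> max b 0" if "t \<in> {0..T}" for t x
    using b[OF that, of "reduce x"] reduce_in_cell[of x] cell_subset periodic_reduce[OF p[OF that], of x]
    by (auto simp: le_max_iff_disj)
  then show ?thesis by (intro exI[of _ "max b 0"]) auto
qed

lemma has_dderiv_vec:
  fixes f :: "'a::real_normed_vector \<Rightarrow> real^'n"
  assumes "\<And>i. has_dderiv (\<lambda>x. f x $ i) e (\<lambda>x. f' x $ i)"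
  shows "has_dderiv f e f'"
  unfolding has_dderiv_def has_vector_derivative_def
proof
  fix z
  show "((\<lambda>r. f (z + r *\<^sub>R e)) has_derivative (\<lambda>r. r *\<^sub>R f' z)) (at 0)"
    using assms unfolding has_dderiv_def has_vector_derivative_def
    by (subst has_derivative_componentwise_within) (auto simp: Basis_vec_def inner_axis)
qed

lemma smooth_periodic_reg:
  fixes H :: "real \<Rightarrow> real^'n \<Rightarrow> real"
  assumes H: "smooth_periodic T H"
  shows "\<exists>hj. reg T H (\<lambda>t. grad (H t)) hj"
proof -
  let ?A = "{0..T} \<times> (UNIV :: (real^'n) set)"
  define F where "F = (\<lambda>(t, x). H t x)"
  have F: "smooth_on ?A F" using H by (simp add: smooth_periodic_def F_def)
  define F1 where "F1 i = dir_deriv ?A (0, axis i 1) F" for i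
  define F2 where "F2 j i = dir_deriv ?A (0, axis j 1) (F1 i)" for i j
  have B: "(0, axis i 1) \<in> (Basis :: (real \<times> (real^'n)) set)" for i by (auto simp: Basis_prod_def Basis_vec_def)
  have fd: "foldr (dir_deriv ?A) es F differentiable_on ?A" if "set es \<subseteq> Basis" for es
    using that by (intro smooth_on_iter(1)[OF F]) (auto simp: in_lists_conv_set)
  have dF: "F differentiable_on ?A" and dF1: "F1 i differentiable_on ?A" and dF2: "F2 j i differentiable_on ?A" for i j
    using fd[of "[]"] fd[of "[(0, axis i 1)]"] fd[of "[(0, axis j 1), (0, axis i 1)]"] B
    by (simp_all add: F1_def F2_def)
  note cont = differentiable_imp_continuous_on[OF dF] differentiable_imp_continuous_on[OF dF1] differentiable_imp_continuous_on[OF dF2]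
  have D: "((\<lambda>x. (t, x)) has_derivative (\<lambda>h. (0, h))) (at x)" for t :: real and x :: "real^'n"
    by (auto intro!: derivative_eq_intros)
  have slice: "has_dderiv (\<lambda>x. f (t, x)) (axis i 1) (\<lambda>x. dir_deriv ?A (0, axis i 1) f (t, x))"
    "dir_deriv UNIV (axis i 1) (\<lambda>x. f (t, x)) = (\<lambda>x. dir_deriv ?A (0, axis i 1) f (t, x))"
    if "f differentiable_on ?A" "t \<in> {0..T}" for f :: "_ \<Rightarrow> real" and t i
  proof -
    note * = dir_deriv_compose[OF that(1) _ D, of t]
    show 2: "dir_deriv UNIV (axis i 1) (\<lambda>x. f (t, x)) = (\<lambda>x. dir_deriv ?A (0, axis i 1) f (t, x))"
      using *(2) that(2) by simp
    have "(\<lambda>x. f (t, x)) differentiable_on UNIV" using *(1) that(2) by simp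
    from has_dderiv_dir_deriv[OF this, of "axis i 1"]
    show "has_dderiv (\<lambda>x. f (t, x)) (axis i 1) (\<lambda>x. dir_deriv ?A (0, axis i 1) f (t, x))"
      unfolding 2 .
  qed
  have g: "grad (H t) x = (\<chi> i. F1 i (t, x))" if "t \<in> {0..T}" for t x
    using slice(2)[OF dF that] by (simp add: grad_def F1_def F_def)
  have "reg T H (\<lambda>t. grad (H t)) (\<lambda>j t x. \<chi> i. F2 j i (t, x))"
    unfolding reg_def
  proof (intro conjI allI ballI)
    show "continuous_on ?A (\<lambda>(t, x). H t x)" using cont(1) by (simp add: F_def)
    have "continuous_on ?A (\<lambda>z. \<chi> i. F1 i z)" by (intro continuous_intros cont)
    then show "continuous_on ?A (\<lambda>(t, x). grad (H t) x)"
      by (rule continuous_on_eq) (auto simp: g)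
    show "continuous_on ?A (\<lambda>(t, x). \<chi> i. F2 j i (t, x))" for j
      unfolding case_prod_unfold prod.collapse by (intro continuous_intros cont)
    fix t assume t: "t \<in> {0..T}"
    show "periodic (H t)" using H t by (simp add: smooth_periodic_def)
    show "has_dderiv (H t) (axis j 1) (\<lambda>x. grad (H t) x $ j)" for j
      using slice(1)[OF dF t, of j] by (simp add: g[OF t] F1_def F_def)
    have "grad (H t) = (\<lambda>x. \<chi> i. F1 i (t, x))" using g[OF t] by (rule ext)
    then show "has_dderiv (grad (H t)) (axis j 1) (\<lambda>x. \<chi> i. F2 j i (t, x))" for j
      using slice(1)[OF dF1 t, of _ j] by (intro has_dderiv_vec) (simp add: F2_def)
  qed
  then show ?thesis by blast
qed

lemma trig_grad:
  fixes H :: "real \<Rightarrow> real^'n \<Rightarrow> real"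
  assumes H: "trig_rep F p H" and r: "reg T H h hj" and t: "t \<in> {0..T}"
  shows "of_real (h t x \<bullet> y) = (\<Sum>k\<in>F. \<i> * of_real (emb k \<bullet> y) * (poly (p k) (of_real t) * E k x))"
proof -
  have *: "of_real (h t x $ j) = (\<Sum>k\<in>F. \<i> * of_int (k $ j) * (poly (p k) (of_real t) * E k x))" for j
  proof -
    obtain f' where f': "trig_rep F (\<lambda>k. smult (\<i> * of_int (k $ j)) (p k)) f'" "has_dderiv (H t) (axis j 1) (f' t)"
      using trig_dderiv[OF H, of j] by blast
    have "has_dderiv (H t) (axis j 1) (\<lambda>x. h t x $ j)" using r t by (simp add: reg_def)
    then have "f' t = (\<lambda>x. h t x $ j)" using has_dderiv_unique[OF f'(2)] by blast
    then have "h t x $ j = f' t x" by simp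
    then show ?thesis using f'(1) by (simp add: trig_rep_def trig_sum_def mult.assoc)
  qed
  have "of_real (h t x \<bullet> y) = (\<Sum>j\<in>UNIV. of_real (y $ j) * (of_real (h t x $ j) :: complex))"
    by (simp add: inner_vec_def mult.commute)
  also have "\<dots> = (\<Sum>j\<in>UNIV. \<Sum>k\<in>F. of_real (y $ j) * (\<i> * of_int (k $ j) * (poly (p k) (of_real t) * E k x)))"
    by (simp only: * sum_distrib_left)
  also have "\<dots> = (\<Sum>k\<in>F. \<Sum>j\<in>UNIV. of_real (y $ j) * (\<i> * of_int (k $ j) * (poly (p k) (of_real t) * E k x)))"
    by (rule sum.swap)
  also have "\<dots> = (\<Sum>k\<in>F. \<i> * of_real (emb k \<bullet> y) * (poly (p k) (of_real t) * E k x))"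
    by (intro sum.cong refl) (simp add: inner_vec_def sum_distrib_left sum_distrib_right mult_ac)
  finally show ?thesis .
qed

context avg_kernel
begin

lemma adm_inner:
  fixes a :: "real \<Rightarrow> real^'n \<Rightarrow> real^'n" and \<gamma> :: "real \<Rightarrow> real \<Rightarrow> (real^'n) \<times> (real^'n) \<Rightarrow> real^'n"
  assumes a: "continuous_on ({0..T} \<times> UNIV) (\<lambda>(t, x). a t x)" "\<And>t x. t \<in> {0..T} \<Longrightarrow> norm (a t x) \<le> b" "0 \<le> b"
    and \<gamma>: "continuous_on (kernel_dom T) (\<lambda>(t, s, z). \<gamma> t s z)"
      "\<And>t s. 0 \<le> s \<Longrightarrow> s \<le> t \<Longrightarrow> t \<le> T \<Longrightarrow> (\<integral>\<^sup>+z. ennreal (wt \<sigma> (snd z) * (norm (\<gamma> t s z))\<^sup>2) \<partial>phase) \<le> ennreal (B\<^sup>2)"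
  shows "adm (\<lambda>t s z. a s (fst z - \<theta> (t - s) *\<^sub>R snd z) \<bullet> \<gamma> t s z) (b * B)"
  unfolding adm_def
proof (intro conjI allI impI)
  show "0 \<le> b * B" using a B by simp
  have "continuous_on (kernel_dom T) (\<lambda>p. (\<lambda>(t, x). a t x) (fst (snd p), fst (snd (snd p)) - \<theta> (fst p - fst (snd p)) *\<^sub>R snd (snd (snd p))))"
    by (rule continuous_on_compose2[OF a(1)])
      (auto intro!: continuous_intros continuous_on_compose2[OF theta(1)])
  then show "continuous_on (kernel_dom T) (\<lambda>(t, s, z). a s (fst z - \<theta> (t - s) *\<^sub>R snd z) \<bullet> \<gamma> t s z)"
    using continuous_on_inner[OF _ \<gamma>(1)] by (simp add: case_prod_unfold)
  fix t s :: real assume st: "0 \<le> s" "s \<le> t" "t \<le> T"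
  have [measurable]: "\<gamma> t s \<in> borel_measurable borel"
  proof -
    have "continuous_on UNIV (\<lambda>z. (\<lambda>(t, s, z). \<gamma> t s z) (t, s, z))"
      by (rule continuous_on_compose2[OF \<gamma>(1)]) (use st in \<open>auto intro!: continuous_intros\<close>)
    then show ?thesis by (intro borel_measurable_continuous_onI) simp
  qed
  have "(\<integral>\<^sup>+z. ennreal (wt \<sigma> (snd z) * (a s (fst z - \<theta> (t - s) *\<^sub>R snd z) \<bullet> \<gamma> t s z)\<^sup>2) \<partial>phase)
     \<le> (\<integral>\<^sup>+z. ennreal (b\<^sup>2) * ennreal (wt \<sigma> (snd z) * (norm (\<gamma> t s z))\<^sup>2) \<partial>phase)"
  proof (rule nn_integral_mono)
    fix z :: "(real^'n) \<times> (real^'n)"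
    let ?a = "a s (fst z - \<theta> (t - s) *\<^sub>R snd z)"
    have "\<bar>?a \<bullet> \<gamma> t s z\<bar> \<le> b * norm (\<gamma> t s z)"
      by (rule order_trans[OF Cauchy_Schwarz_ineq2 mult_right_mono]) (use a st in auto)
    then have "(?a \<bullet> \<gamma> t s z)\<^sup>2 \<le> (b * norm (\<gamma> t s z))\<^sup>2" by (intro abs_le_square_iff[THEN iffD1]) (use a in simp)
    then have "wt \<sigma> (snd z) * (?a \<bullet> \<gamma> t s z)\<^sup>2 \<le> wt \<sigma> (snd z) * (b * norm (\<gamma> t s z))\<^sup>2"
      by (intro mult_left_mono) (auto simp: wt_pos less_imp_le)
    then show "ennreal (wt \<sigma> (snd z) * (?a \<bullet> \<gamma> t s z)\<^sup>2) \<le> ennreal (b\<^sup>2) * ennreal (wt \<sigma> (snd z) * (norm (\<gamma> t s z))\<^sup>2)"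
      by (simp add: ennreal_mult'[symmetric] ennreal_leI power_mult_distrib mult_ac)
  qed
  also have "\<dots> = ennreal (b\<^sup>2) * (\<integral>\<^sup>+z. ennreal (wt \<sigma> (snd z) * (norm (\<gamma> t s z))\<^sup>2) \<partial>phase)"
    by (rule nn_integral_cmult) (simp add: measurable_cong_sets[OF sets_phase refl])
  also have "\<dots> \<le> ennreal (b\<^sup>2) * ennreal (B\<^sup>2)" by (intro mult_left_mono \<gamma>(2) st) simp
  also have "\<dots> = ennreal ((b * B)\<^sup>2)" by (simp add: ennreal_mult'[symmetric] power_mult_distrib)
  finally show "(\<integral>\<^sup>+z. ennreal (wt \<sigma> (snd z) * (a s (fst z - \<theta> (t - s) *\<^sub>R snd z) \<bullet> \<gamma> t s z)\<^sup>2) \<partial>phase) \<le> ennreal ((b * B)\<^sup>2)" .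
qed

lemma adm_add:
  assumes "adm U W" "adm U' W'"
  shows "adm (\<lambda>t s z. U t s z + U' t s z) (2 * (W + W'))"
  unfolding adm_def
proof (intro conjI allI impI)
  have W: "0 \<le> W" "0 \<le> W'" using assms by (auto simp: adm_def)
  then show "0 \<le> 2 * (W + W')" by simp
  show "continuous_on (kernel_dom T) (\<lambda>(t, s, z). U t s z + U' t s z)"
    using continuous_on_add[of "kernel_dom T" "\<lambda>(t, s, z). U t s z" "\<lambda>(t, s, z). U' t s z"] assms
    by (simp add: adm_def case_prod_unfold)
  fix t s :: real assume st: "0 \<le> s" "s \<le> t" "t \<le> T"
  have [measurable]: "U t s \<in> borel_measurable phase" "U' t s \<in> borel_measurable phase"
    using adm_slice(2)[OF assms(1) st] adm_slice(2)[OF assms(2) st] by (simp_all add: measurable_cong_sets[OF sets_phase refl])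
  let ?w = "\<lambda>z::(real^'n) \<times> (real^'n). wt \<sigma> (snd z)"
  have "(\<integral>\<^sup>+z. ennreal (?w z * (U t s z + U' t s z)\<^sup>2) \<partial>phase)
    \<le> (\<integral>\<^sup>+z. 2 * ennreal (?w z * (U t s z)\<^sup>2) + 2 * ennreal (?w z * (U' t s z)\<^sup>2) \<partial>phase)"
  proof (rule nn_integral_mono)
    fix z
    have "(U t s z + U' t s z)\<^sup>2 \<le> 2 * (U t s z)\<^sup>2 + 2 * (U' t s z)\<^sup>2"
      using sum_squares_bound[of "U t s z" "U' t s z"] by (simp add: power2_sum)
    then have "?w z * (U t s z + U' t s z)\<^sup>2 \<le> ?w z * (2 * (U t s z)\<^sup>2 + 2 * (U' t s z)\<^sup>2)"
      by (intro mult_left_mono) (auto simp: wt_pos less_imp_le)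
    also have "\<dots> = 2 * (?w z * (U t s z)\<^sup>2) + 2 * (?w z * (U' t s z)\<^sup>2)" by (simp add: algebra_simps)
    finally have "ennreal (?w z * (U t s z + U' t s z)\<^sup>2) \<le> ennreal (2 * (?w z * (U t s z)\<^sup>2) + 2 * (?w z * (U' t s z)\<^sup>2))"
      by (rule ennreal_leI)
    also have "\<dots> = 2 * ennreal (?w z * (U t s z)\<^sup>2) + 2 * ennreal (?w z * (U' t s z)\<^sup>2)"
      by (simp add: wt_pos less_imp_le ennreal_mult)
    finally show "ennreal (?w z * (U t s z + U' t s z)\<^sup>2) \<le> 2 * ennreal (?w z * (U t s z)\<^sup>2) + 2 * ennreal (?w z * (U' t s z)\<^sup>2)" .
  qed
  also have "\<dots> = 2 * (\<integral>\<^sup>+z. ennreal (?w z * (U t s z)\<^sup>2) \<partial>phase) + 2 * (\<integral>\<^sup>+z. ennreal (?w z * (U' t s z)\<^sup>2) \<partial>phase)"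
    by (simp add: nn_integral_add nn_integral_cmult)
  also have "\<dots> \<le> 2 * ennreal (W\<^sup>2) + 2 * ennreal (W'\<^sup>2)"
    using assms st by (intro add_mono mult_left_mono) (auto simp: adm_def)
  also have "\<dots> = ennreal (2 * W\<^sup>2 + 2 * W'\<^sup>2)" by (simp add: ennreal_mult)
  also have "\<dots> \<le> ennreal ((2 * (W + W'))\<^sup>2)"
    using W by (intro ennreal_leI) (simp add: power2_eq_square algebra_simps)
  finally show "(\<integral>\<^sup>+z. ennreal (?w z * (U t s z + U' t s z)\<^sup>2) \<partial>phase) \<le> ennreal ((2 * (W + W'))\<^sup>2)" .
qed

text \<open>The integrand common to both operators, written with the shift \<theta>; here
  \<open>h\<close> stands for the gradient of H.\<close>

definition U1 :: "(real \<Rightarrow> real^'n \<Rightarrow> real^'n) \<Rightarrow> real \<Rightarrow> real \<Rightarrow> (real^'n) \<times> (real^'n) \<Rightarrow> real" where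
  "U1 h t s z = h s (fst z - \<theta> (t - s) *\<^sub>R snd z) \<bullet> g t s z"

text \<open>The x_j-derivative of \<open>U1\<close> by the product rule.\<close>

definition U2 :: "(real \<Rightarrow> real^'n \<Rightarrow> real^'n) \<Rightarrow> ('n \<Rightarrow> real \<Rightarrow> real^'n \<Rightarrow> real^'n) \<Rightarrow>
    'n \<Rightarrow> real \<Rightarrow> real \<Rightarrow> (real^'n) \<times> (real^'n) \<Rightarrow> real" where
  "U2 h hj j t s z = hj j s (fst z - \<theta> (t - s) *\<^sub>R snd z) \<bullet> g t s z + h s (fst z - \<theta> (t - s) *\<^sub>R snd z) \<bullet> gj j t s z"

lemma adm_U:
  assumes "reg T H h hj"
  shows "\<exists>W. adm (U1 h) W" "\<exists>W. adm (U2 h hj j) W"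
proof -
  have c: "continuous_on ({0..T} \<times> UNIV) (\<lambda>(t, x). h t x)" "continuous_on ({0..T} \<times> UNIV) (\<lambda>(t, x). hj j t x)"
    using assms by (auto simp: reg_def)
  obtain b where b: "0 \<le> b" "\<And>t x. t \<in> {0..T} \<Longrightarrow> norm (h t x) \<le> b"
    using periodic_continuous_bounded[OF c(1) reg_periodic(2)[OF assms]] by blast
  obtain b' where b': "0 \<le> b'" "\<And>t x. t \<in> {0..T} \<Longrightarrow> norm (hj j t x) \<le> b'"
    using periodic_continuous_bounded[OF c(2) reg_periodic(3)[OF assms]] by blast
  have "adm (U1 h) (b * B)" unfolding U1_def by (rule adm_inner[OF c(1) b(2,1) cont(1) bound(1)])
  then show "\<exists>W. adm (U1 h) W" by blast
  have "adm (U2 h hj j) (2 * (b' * B + b * B))"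
    unfolding U2_def
    by (rule adm_add[OF adm_inner[OF c(2) b'(2,1) cont(1) bound(1)] adm_inner[OF c(1) b(2,1) cont(2) bound(2)]])
  then show "\<exists>W. adm (U2 h hj j) W" by blast
qed

lemma kernel_shift_periodic:
  assumes "periodic f" "t \<in> {0..T}" "s \<in> {0..T}"
  shows "xperiodic (\<lambda>z. f (fst z - \<theta> (t - s) *\<^sub>R snd z))"
  unfolding xperiodic_def periodic_def fst_conv snd_conv
proof (intro allI)
  fix v x i
  show "f (x + axis i (2 * pi) - \<theta> (t - s) *\<^sub>R v) = f (x - \<theta> (t - s) *\<^sub>R v)"
    using assms(1)[unfolded periodic_def, rule_format, of "x - \<theta> (t - s) *\<^sub>R v" i] by (simp add: algebra_simps)
qed

lemma has_dderiv_shift: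
  fixes f :: "real^'n \<Rightarrow> 'z::real_normed_vector"
  assumes "has_dderiv f (axis j 1) f'"
  shows "has_dderiv (\<lambda>z. f (fst z - c *\<^sub>R snd z)) (axis j 1, 0) (\<lambda>z. f' (fst z - c *\<^sub>R snd z))"
  unfolding has_dderiv_def
proof
  fix z :: "(real^'n) \<times> (real^'n)"
  show "((\<lambda>r. f (fst (z + r *\<^sub>R (axis j 1, 0)) - c *\<^sub>R snd (z + r *\<^sub>R (axis j 1, 0)))) has_vector_derivative f' (fst z - c *\<^sub>R snd z)) (at 0)"
    using assms[unfolded has_dderiv_def, rule_format, of "fst z - c *\<^sub>R snd z"] by (simp add: algebra_simps)
qed

lemma has_dderiv_fst:
  fixes \<phi> :: "real^'n \<Rightarrow> 'z::real_normed_vector"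
  assumes "has_dderiv \<phi> (axis j 1) \<phi>'"
  shows "has_dderiv (\<lambda>z. \<phi> (fst z)) (axis j 1, 0 :: real^'n) (\<lambda>z. \<phi>' (fst z))"
  using assms by (simp add: has_dderiv_def)

lemma has_dderiv_mult:
  fixes f k :: "'z::real_normed_vector \<Rightarrow> real"
  assumes "has_dderiv f e f'" "has_dderiv k e k'"
  shows "has_dderiv (\<lambda>z. f z * k z) e (\<lambda>z. f z * k' z + f' z * k z)"
  unfolding has_dderiv_def
proof
  fix z
  show "((\<lambda>r. f (z + r *\<^sub>R e) * k (z + r *\<^sub>R e)) has_vector_derivative f z * k' z + f' z * k z) (at 0)"
    using has_vector_derivative_mult[of "\<lambda>r. f (z + r *\<^sub>R e)" "f' z" 0 UNIV "\<lambda>r. k (z + r *\<^sub>R e)" "k' z"] assms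
    by (simp add: has_dderiv_def)
qed

lemma has_dderiv_inner:
  fixes f k :: "'z::real_normed_vector \<Rightarrow> real^'n"
  assumes "has_dderiv f e f'" "has_dderiv k e k'"
  shows "has_dderiv (\<lambda>z. f z \<bullet> k z) e (\<lambda>z. f' z \<bullet> k z + f z \<bullet> k' z)"
  unfolding has_dderiv_def
proof
  fix z
  show "((\<lambda>r. f (z + r *\<^sub>R e) \<bullet> k (z + r *\<^sub>R e)) has_vector_derivative f' z \<bullet> k z + f z \<bullet> k' z) (at 0)"
    using bounded_bilinear.has_vector_derivative[OF bounded_bilinear_inner,
        of "\<lambda>r. f (z + r *\<^sub>R e)" "f' z" 0 UNIV "\<lambda>r. k (z + r *\<^sub>R e)" "k' z"] assms
    by (simp add: has_dderiv_def add.commute)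
qed

lemma periodic_bounded:
  fixes \<phi> :: "real^'n \<Rightarrow> real"
  assumes "continuous_on UNIV \<phi>" "periodic \<phi>"
  shows "\<exists>b\<ge>0. \<forall>x. \<bar>\<phi> x\<bar> \<le> b"
proof -
  have "continuous_on ({0..0::real} \<times> UNIV) (\<lambda>(t, x). \<phi> x)"
    unfolding case_prod_unfold by (rule continuous_on_compose2[OF assms(1)]) (auto intro!: continuous_intros)
  from periodic_continuous_bounded[OF this] show ?thesis using assms(2) by auto
qed

text \<open>Weak differentiation in \<open>x\<close> only needs Fubini and periodicity, because for fixed \<open>s\<close> and \<open>v\<close> the
  integrand is a classically differentiable function of \<open>x\<close>.\<close>

lemma avg_weak_deriv:
  assumes H: "reg T H h hj" and t: "t \<in> {0..T}"
    and \<phi>: "continuous_on UNIV \<phi>" "periodic \<phi>" "has_dderiv \<phi> (axis j 1) \<phi>'" "continuous_on UNIV \<phi>'"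
  shows "(LINT x|torus. avg (U1 h) t x * \<phi>' x) = - (LINT x|torus. avg (U2 h hj j) t x * \<phi> x)"
proof -
  obtain W1 W2 where W: "adm (U1 h) W1" "adm (U2 h hj j) W2" using adm_U[OF H] by blast
  have p\<phi>': "periodic \<phi>'" by (rule has_dderiv_periodic[OF \<phi>(3,2)])
  obtain b where b: "\<And>x. \<bar>\<phi> x\<bar> \<le> b" using periodic_bounded[OF \<phi>(1,2)] by blast
  obtain b' where b': "\<And>x. \<bar>\<phi>' x\<bar> \<le> b'" using periodic_bounded[OF \<phi>(4) p\<phi>'] by blast
  note P1 = avg_pairing[OF W(1) t borel_measurable_continuous_onI[OF \<phi>(4)] b']
  note P2 = avg_pairing[OF W(2) t borel_measurable_continuous_onI[OF \<phi>(1)] b]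
  have eq: "(LINT z|phase. U1 h t s z * \<phi>' (fst z)) = - (LINT z|phase. U2 h hj j t s z * \<phi> (fst z))" if s: "s \<in> {0..t}" for s
  proof -
    have s': "s \<in> {0..T}" "0 \<le> s" "s \<le> t" "t \<le> T" using s t by auto
    note i\<phi> = avg_pairing(3)[OF W(1) t borel_measurable_continuous_onI[OF \<phi>(1)] b s]
    let ?h' = "\<lambda>z. U1 h t s z * \<phi>' (fst z) + U2 h hj j t s z * \<phi> (fst z)"
    have "(LINT z|phase. ?h' z) = 0"
    proof (rule phase_integral_dderiv)
      have "has_dderiv (h s) (axis j 1) (hj j s)" using H s' by (simp add: reg_def)
      from has_dderiv_mult[OF has_dderiv_inner[OF has_dderiv_shift[OF this] deriv[OF t s'(1)]] has_dderiv_fst[OF \<phi>(3)]]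
      show "has_dderiv (\<lambda>z. U1 h t s z * \<phi> (fst z)) (axis j 1, 0) ?h'"
        unfolding U1_def U2_def by simp
      show "integrable phase (\<lambda>z. U1 h t s z * \<phi> (fst z))" by (rule i\<phi>)
      show "integrable phase ?h'" using P1(3)[OF s] P2(3)[OF s] by simp
      have "xperiodic (\<lambda>z. U1 h t s z * \<phi> (fst z))"
        using kernel_shift_periodic[OF reg_periodic(2)[OF H s'(1)] t s'(1)] per[OF t s'(1)] \<phi>(2)
        by (simp add: xperiodic_def periodic_def U1_def)
      then show "xperiodic (\<lambda>z. U1 h t s z * \<phi> (fst z))" "xperiodic ?h'"
        using has_dderiv_xperiodic[OF \<open>has_dderiv (\<lambda>z. U1 h t s z * \<phi> (fst z)) (axis j 1, 0) ?h'\<close>] by auto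
      have c: "continuous_on UNIV (\<lambda>z::(real^'n) \<times> (real^'n). \<phi> (fst z))" "continuous_on UNIV (\<lambda>z::(real^'n) \<times> (real^'n). \<phi>' (fst z))"
        by (rule continuous_on_compose2[OF \<phi>(1)] continuous_on_compose2[OF \<phi>(4)]; auto intro!: continuous_intros)+
      note cU = adm_slice(1)[OF W(1) s'(2-4)] adm_slice(1)[OF W(2) s'(2-4)]
      show "continuous_on UNIV (\<lambda>z. U1 h t s z * \<phi> (fst z))" by (intro continuous_on_mult cU c)
      show "continuous_on UNIV ?h'" by (intro continuous_on_add continuous_on_mult cU c)
    qed
    then show ?thesis using P1(3)[OF s] P2(3)[OF s] by simp
  qed
  have "indicator {0..t} s * (LINT z|phase. U1 h t s z * \<phi>' (fst z)) = - (indicator {0..t} s * (LINT z|phase. U2 h hj j t s z * \<phi> (fst z)))" for s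
    using eq[of s] by (cases "s \<in> {0..t}") auto
  then show ?thesis unfolding P1(1) P2(1) by simp
qed

end

subsection \<open>The bilinear form\<close>

text \<open>Elements of the space-time L2 space are controlled on the open interval only, so
  everything outside is replaced by 0 before measurability on the cylinder is discussed.\<close>

definition cylf :: "real \<Rightarrow> (real \<Rightarrow> real^'n \<Rightarrow> real) \<Rightarrow> real \<times> (real^'n) \<Rightarrow> real" where
  "cylf T H z = indicator {0<..<T} (fst z) * H (fst z) (snd z)"

lemma nn_integral_Icc_Ioo:
  fixes a b :: real
  shows "(\<integral>\<^sup>+t\<in>{a..b}. f t \<partial>lborel) = (\<integral>\<^sup>+t\<in>{a<..<b}. f t \<partial>lborel)"
proof (rule nn_integral_cong_AE)
  show "AE t in lborel. f t * indicator {a..b} t = f t * indicator {a<..<b} t"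
    using AE_lborel_singleton[of a] AE_lborel_singleton[of b]
    by eventually_elim (auto simp: indicator_def)
qed

lemma nn_integral_cylf:
  assumes "cylf T H \<in> borel_measurable borel"
  shows "(\<integral>\<^sup>+z. ennreal ((cylf T H z)\<^sup>2) \<partial>cyl T) = (\<integral>\<^sup>+t\<in>{0<..<T}. (\<integral>\<^sup>+x. ennreal ((H t x)\<^sup>2) \<partial>torus) \<partial>lborel)"
proof -
  have "(\<integral>\<^sup>+z. ennreal ((cylf T H z)\<^sup>2) \<partial>cyl T) = (\<integral>\<^sup>+t\<in>{0<..<T}. (\<integral>\<^sup>+x. ennreal ((cylf T H (t, x))\<^sup>2) \<partial>torus) \<partial>lborel)"
    by (rule nn_integral_cyl) (use assms in measurable)
  also have "\<dots> = (\<integral>\<^sup>+t\<in>{0<..<T}. (\<integral>\<^sup>+x. ennreal ((H t x)\<^sup>2) \<partial>torus) \<partial>lborel)"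
  proof (rule nn_integral_cong)
    fix t show "(\<integral>\<^sup>+x. ennreal ((cylf T H (t, x))\<^sup>2) \<partial>torus) * indicator {0<..<T} t = (\<integral>\<^sup>+x. ennreal ((H t x)\<^sup>2) \<partial>torus) * indicator {0<..<T} t"
      by (cases "t \<in> {0<..<T}") (auto simp: cylf_def)
  qed
  finally show ?thesis .
qed

lemma periodic_cylf_sqint:
  fixes H :: "real \<Rightarrow> real^'n \<Rightarrow> real"
  assumes T: "0 < T" and c: "continuous_on ({0..T} \<times> UNIV) (\<lambda>(t, x). H t x)" and p: "\<And>t. t \<in> {0..T} \<Longrightarrow> periodic (H t)"
  shows "cylf T H \<in> borel_measurable borel" "sqint (cyl T) (cylf T H)" "t \<in> {0..T} \<Longrightarrow> sqint torus (H t)"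
proof -
  have "(\<lambda>z. indicator ({0..T} \<times> UNIV) z *\<^sub>R (\<lambda>(t, x). H t x) z) \<in> borel_measurable borel"
    by (rule borel_measurable_continuous_closed[OF _ c]) (simp add: closed_Times)
  then have "(\<lambda>z. indicator {0<..<T} (fst z) * (indicator ({0..T} \<times> UNIV) z *\<^sub>R (\<lambda>(t, x). H t x) z)) \<in> borel_measurable borel"
    by measurable
  moreover have "(\<lambda>z. indicator {0<..<T} (fst z) * (indicator ({0..T} \<times> UNIV) z *\<^sub>R (\<lambda>(t, x). H t x) z)) = cylf T H"
    by (auto simp: fun_eq_iff cylf_def indicator_def)
  ultimately show m: "cylf T H \<in> borel_measurable borel" by simp
  obtain b where b: "0 \<le> b" "\<And>t x. t \<in> {0..T} \<Longrightarrow> \<bar>H t x\<bar> \<le> b"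
    using periodic_continuous_bounded[OF c p] by auto
  show "sqint (cyl T) (cylf T H)"
  proof (rule l2n_cyl_bounded(1)[OF m b(1)])
    have "\<bar>cylf T H z\<bar> \<le> b" for z using b by (auto simp: cylf_def indicator_def)
    then show "AE z in cyl T. \<bar>cylf T H z\<bar> \<le> b" by simp
  qed (use T in simp)
  show "sqint torus (H t)" if t: "t \<in> {0..T}"
  proof (rule sqintI_nn)
    have "continuous_on UNIV (\<lambda>x. (\<lambda>(t, x). H t x) (t, x))"
      by (rule continuous_on_compose2[OF c]) (use t in \<open>auto intro!: continuous_intros\<close>)
    then show "H t \<in> borel_measurable torus"
      by (simp add: measurable_cong_sets[OF sets_torus refl] borel_measurable_continuous_onI)
    have "(\<integral>\<^sup>+x. ennreal ((H t x)\<^sup>2) \<partial>torus) \<le> (\<integral>\<^sup>+x. ennreal (b\<^sup>2) \<partial>(torus :: (real^'n) measure))"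
      by (intro nn_integral_mono ennreal_leI abs_le_square_iff[THEN iffD1]) (use b t in simp)
    also have "\<dots> < \<infinity>" by (simp add: emeasure_torus)
    finally show "(\<integral>\<^sup>+x. ennreal ((H t x)\<^sup>2) \<partial>torus) < \<infinity>" .
  qed
qed

lemma trig_cylf:
  fixes \<Psi> :: "real \<Rightarrow> real^'n \<Rightarrow> real"
  assumes T: "0 < T" and "trig \<Psi>"
  shows "sqint (cyl T) (cylf T \<Psi>)" "\<exists>b\<ge>0. \<forall>t\<in>{0..T}. \<forall>x. \<bar>\<Psi> t x\<bar> \<le> b" "continuous_on UNIV (\<Psi> t)"
    "\<Psi> t \<in> borel_measurable borel" "cylf T \<Psi> \<in> borel_measurable borel"
proof -
  have c: "continuous_on ({0..T} \<times> UNIV) (\<lambda>(t, x). \<Psi> t x)"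
    using continuous_on_trig[OF assms(2)] by (simp add: case_prod_unfold)
  have "periodic (\<Psi> t)" for t using assms(2) by (rule periodic_trig)
  note * = periodic_cylf_sqint[OF T c this] periodic_continuous_bounded[OF c this]
  show "sqint (cyl T) (cylf T \<Psi>)" "\<exists>b\<ge>0. \<forall>t\<in>{0..T}. \<forall>x. \<bar>\<Psi> t x\<bar> \<le> b" "cylf T \<Psi> \<in> borel_measurable borel"
    using * by auto
  have "continuous_on UNIV (\<lambda>x. (\<lambda>z. \<Psi> (fst z) (snd z)) (t, x))"
    by (rule continuous_on_compose2[OF continuous_on_trig[OF assms(2), of UNIV]]) (auto intro!: continuous_intros)
  then show "continuous_on UNIV (\<Psi> t)" by simp
  then show "\<Psi> t \<in> borel_measurable borel" by (rule borel_measurable_continuous_onI)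
qed

lemma reg_cylf:
  fixes H :: "real \<Rightarrow> real^'n \<Rightarrow> real"
  assumes "0 < T" "reg T H h hj"
  shows "cylf T H \<in> borel_measurable borel" "sqint (cyl T) (cylf T H)" "t \<in> {0..T} \<Longrightarrow> sqint torus (H t)"
proof -
  have c: "continuous_on ({0..T} \<times> UNIV) (\<lambda>(t, x). H t x)" using assms(2) by (simp add: reg_def)
  show "cylf T H \<in> borel_measurable borel" "sqint (cyl T) (cylf T H)" "t \<in> {0..T} \<Longrightarrow> sqint torus (H t)"
    using periodic_cylf_sqint[OF assms(1) c reg_periodic(1)[OF assms(2)]] by auto
qed

context avg_kernel
begin

definition form :: "(real \<Rightarrow> real \<Rightarrow> (real^'n) \<times> (real^'n) \<Rightarrow> real) \<Rightarrow> (real \<Rightarrow> real^'n \<Rightarrow> real) \<Rightarrow> real" where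
  "form U \<Psi> = (LINT z|cyl T. cylf T (avg U) z * cylf T \<Psi> z)"

lemma sqint_cylf_avg:
  assumes "adm U W"
  shows "sqint (cyl T) (cylf T (avg U))"
proof -
  let ?f = "\<lambda>z. indicator {0..T} (fst z) * avg U (fst z) (snd z)"
  note f = avg_sqint(1)[OF assms]
  have "(\<lambda>z. indicator {0<..<T} (fst z) * ?f z) \<in> borel_measurable (cyl T)"
    using sqint_measurable[OF f] by (simp add: measurable_cong_sets[OF sets_cyl refl])
  moreover have "cylf T (avg U) = (\<lambda>z. indicator {0<..<T} (fst z) * ?f z)"
    by (auto simp: fun_eq_iff cylf_def indicator_def)
  moreover have "(\<integral>\<^sup>+z. ennreal ((indicator {0<..<T} (fst z) * ?f z)\<^sup>2) \<partial>cyl T) \<le> (\<integral>\<^sup>+z. ennreal ((?f z)\<^sup>2) \<partial>cyl T)"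
    by (intro nn_integral_mono) (auto simp: indicator_def)
  ultimately show ?thesis
    using sqint_nn_integral[OF f] by (intro sqintI_nn) (auto simp: le_less_trans)
qed

lemma form_fubini:
  assumes U: "adm U W" and \<Psi>: "trig \<Psi>"
  shows "form U \<Psi> = (LINT t|time_measure T. LINT x|torus. cylf T (avg U) (t, x) * cylf T \<Psi> (t, x))"
    and "integrable (time_measure T) (\<lambda>t. LINT x|torus. cylf T (avg U) (t, x) * cylf T \<Psi> (t, x))"
proof -
  interpret tm: finite_measure "time_measure T" by (rule finite_measure_time)
  interpret TX: pair_sigma_finite "time_measure T" "torus :: (real^'n) measure" ..
  have i: "integrable (time_measure T \<Otimes>\<^sub>M torus) (\<lambda>z. cylf T (avg U) z * cylf T \<Psi> z)"
    using sqint_mult[OF sqint_cylf_avg[OF U] trig_cylf(1)[OF T \<Psi>]] by (simp add: cyl_def)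
  show "form U \<Psi> = (LINT t|time_measure T. LINT x|torus. cylf T (avg U) (t, x) * cylf T \<Psi> (t, x))"
    using TX.integral_fst'[OF i] by (simp add: form_def cyl_def)
  show "integrable (time_measure T) (\<lambda>t. LINT x|torus. cylf T (avg U) (t, x) * cylf T \<Psi> (t, x))"
    using TX.integrable_fst'[OF i] .
qed

lemma form_le:
  assumes U: "adm U W" and \<Psi>: "trig \<Psi>"
  shows "ennreal \<bar>form U \<Psi>\<bar> \<le> (\<integral>\<^sup>+t\<in>{0<..<T}. ennreal \<bar>LINT x|torus. avg U t x * \<Psi> t x\<bar> \<partial>lborel)"
proof -
  note F = form_fubini[OF U \<Psi>]
  let ?f = "\<lambda>t. LINT x|torus. cylf T (avg U) (t, x) * cylf T \<Psi> (t, x)"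
  have m: "?f \<in> borel_measurable borel"
    using F(2) by (auto simp: measurable_cong_sets[OF sets_time_measure refl] dest!: borel_measurable_integrable)
  have "ennreal \<bar>form U \<Psi>\<bar> \<le> (\<integral>\<^sup>+t. ennreal \<bar>?f t\<bar> \<partial>time_measure T)"
    unfolding F(1) by (rule ennreal_abs_integral_le)
  also have "\<dots> = (\<integral>\<^sup>+t\<in>{0<..<T}. ennreal \<bar>?f t\<bar> \<partial>lborel)"
    by (rule nn_integral_time_measure) (use m in measurable)
  also have "\<dots> = (\<integral>\<^sup>+t\<in>{0<..<T}. ennreal \<bar>LINT x|torus. avg U t x * \<Psi> t x\<bar> \<partial>lborel)"
  proof (rule nn_integral_cong)
    fix t show "ennreal \<bar>?f t\<bar> * indicator {0<..<T} t = ennreal \<bar>LINT x|torus. avg U t x * \<Psi> t x\<bar> * indicator {0<..<T} t"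
      by (cases "t \<in> {0<..<T}") (auto simp: cylf_def)
  qed
  finally show ?thesis .
qed

lemma form_diff:
  assumes "adm U W" "adm U' W'" "adm (\<lambda>t s z. U t s z - U' t s z) W''" and \<Psi>: "trig \<Psi>"
  shows "form (\<lambda>t s z. U t s z - U' t s z) \<Psi> = form U \<Psi> - form U' \<Psi>"
proof -
  note F = form_fubini[OF assms(1) \<Psi>] form_fubini[OF assms(2) \<Psi>] form_fubini[OF assms(3) \<Psi>]
  obtain b where b: "\<And>t x. t \<in> {0..T} \<Longrightarrow> \<bar>\<Psi> t x\<bar> \<le> b" using trig_cylf(2)[OF T \<Psi>] by blast
  have "form (\<lambda>t s z. U t s z - U' t s z) \<Psi> = (LINT t|time_measure T.
     (LINT x|torus. cylf T (avg U) (t, x) * cylf T \<Psi> (t, x)) - (LINT x|torus. cylf T (avg U') (t, x) * cylf T \<Psi> (t, x)))"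
    unfolding F(5)
  proof (rule integral_cong_AE)
    show "AE t in time_measure T. (LINT x|torus. cylf T (avg (\<lambda>t s z. U t s z - U' t s z)) (t, x) * cylf T \<Psi> (t, x))
       = (LINT x|torus. cylf T (avg U) (t, x) * cylf T \<Psi> (t, x)) - (LINT x|torus. cylf T (avg U') (t, x) * cylf T \<Psi> (t, x))"
      using AE_time_measure
    proof eventually_elim
      case (elim t)
      then have t: "t \<in> {0..T}" by simp
      show ?case
        using avg_pairing_diff[OF assms(1-3) t trig_cylf(4)[OF T \<Psi>] b[OF t]] elim by (simp add: cylf_def)
    qed
  qed (use F(2,4,6) in \<open>auto dest: borel_measurable_integrable\<close>)
  then show ?thesis using F by simp
qed

text \<open>Integration by parts in x moves the derivative from H to the kernel and the test
  function, leaving only the L2 norm of H. The constant contains \<open>b\<close>, a bound on the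
  test function and its gradient, and is meant for continuity alone.\<close>

lemma adjoint_bound:
  assumes H: "reg T H h hj" and st: "0 \<le> s" "s \<le> t" "t \<le> T"
    and \<phi>: "continuous_on UNIV \<phi>" "periodic \<phi>" "\<And>q. has_dderiv \<phi> (axis q 1) (\<phi>' q)" "\<And>q. continuous_on UNIV (\<phi>' q)"
    and b: "\<And>x. \<bar>\<phi> x\<bar> \<le> b" "\<And>q x. \<bar>\<phi>' q x\<bar> \<le> b"
  shows "\<bar>LINT z|phase. U1 h t s z * \<phi> (fst z)\<bar> \<le> real CARD('n) * (sqrt (wt_mass TYPE('n) \<sigma>) * (2 * b * B)) * l2n torus (H s)"
proof -
  have b0: "0 \<le> b" using b(1)[of undefined] by linarith
  have ts: "t \<in> {0..T}" "s \<in> {0..T}" using st by auto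
  have cH: "continuous_on UNIV (H s)" and ch: "continuous_on UNIV (h s)"
  proof -
    have "continuous_on UNIV (\<lambda>x. (\<lambda>(t, x). H t x) (s, x))" "continuous_on UNIV (\<lambda>x. (\<lambda>(t, x). h t x) (s, x))"
      by (rule continuous_on_compose2[of "{0..T} \<times> UNIV"]; use H ts in \<open>auto simp: reg_def intro!: continuous_intros\<close>)+
    then show "continuous_on UNIV (H s)" "continuous_on UNIV (h s)" by simp_all
  qed
  have cg: "continuous_on UNIV (g t s)" and cgj: "continuous_on UNIV (gj q t s)" for q
  proof -
    have "continuous_on UNIV (\<lambda>z. (\<lambda>(t, s, z). g t s z) (t, s, z))" "continuous_on UNIV (\<lambda>z. (\<lambda>(t, s, z). gj q t s z) (t, s, z))"
      by (rule continuous_on_compose2[OF cont(1)] continuous_on_compose2[OF cont(2)]; use ts in \<open>auto intro!: continuous_intros\<close>)+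
    then show "continuous_on UNIV (g t s)" "continuous_on UNIV (gj q t s)" by simp_all
  qed
  let ?S = "\<lambda>z::(real^'n) \<times> (real^'n). fst z - \<theta> (t - s) *\<^sub>R snd z"
  have cS: "continuous_on UNIV ?S" by (intro continuous_intros)
  have cHS: "continuous_on UNIV (\<lambda>z. H s (?S z))" and chS: "continuous_on UNIV (\<lambda>z. h s (?S z))"
    by (rule continuous_on_compose2[OF cH cS] continuous_on_compose2[OF ch cS]; simp)+
  have c\<phi>: "continuous_on UNIV (\<lambda>z::(real^'n) \<times> (real^'n). \<phi> (fst z))"
    and c\<phi>': "continuous_on UNIV (\<lambda>z::(real^'n) \<times> (real^'n). \<phi>' q (fst z))" for q
    by (rule continuous_on_compose2[OF \<phi>(1)] continuous_on_compose2[OF \<phi>(4)]; auto intro!: continuous_intros)+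
  note [measurable] = borel_measurable_continuous_onI[OF cH] borel_measurable_continuous_onI[OF cHS]
    borel_measurable_continuous_onI[OF cg] borel_measurable_continuous_onI[OF cgj]
    borel_measurable_continuous_onI[OF c\<phi>] borel_measurable_continuous_onI[OF c\<phi>'] borel_measurable_continuous_onI[OF chS]
  note mph = measurable_cong_sets[OF sets_phase refl]
  have [measurable]: "(\<lambda>z. g t s z $ q) \<in> borel_measurable borel" "(\<lambda>z. gj p t s z $ q) \<in> borel_measurable borel"
    "(\<lambda>z. h s (?S z) $ q) \<in> borel_measurable borel" for p q
    by (intro borel_measurable_continuous_onI continuous_on_component cg cgj chS)+
  obtain bH where bH: "\<And>x. \<bar>H s x\<bar> \<le> bH" using periodic_bounded[OF cH reg_periodic(1)[OF H ts(2)]] by blast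
  obtain bh where bh: "\<And>x. norm (h s x) \<le> bh"
  proof -
    have "continuous_on ({0..T} \<times> UNIV) (\<lambda>(t, x). h t x)" using H by (simp add: reg_def)
    from periodic_continuous_bounded[OF this reg_periodic(2)[OF H]] ts that show ?thesis by blast
  qed
  have ig: "integrable phase (\<lambda>z. norm (g t s z))" and igj: "integrable phase (\<lambda>z. norm (gj q t s z))" for q
    using weighted_L2_imp_L1(2)[OF sigma _ bound(1)[OF st] B] weighted_L2_imp_L1(2)[OF sigma _ bound(2)[OF st] B]
    by (auto intro!: integrable_norm)
  have ib: "integrable phase f" if "f \<in> borel_measurable borel" "\<And>z. \<bar>f z\<bar> \<le> C * norm (k z)" "integrable phase (\<lambda>z. norm (k z))"
    for f :: "(real^'n) \<times> (real^'n) \<Rightarrow> real" and k :: "(real^'n) \<times> (real^'n) \<Rightarrow> real^'n" and C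
  proof (rule Bochner_Integration.integrable_bound[OF integrable_mult_right[OF that(3), of C]])
    show "f \<in> borel_measurable phase" using that(1) by (simp only: mph)
    show "AE z in phase. norm (f z) \<le> norm (C * norm (k z))"
      by (rule AE_I2) (use that(2) in \<open>simp add: order_trans[OF _ abs_ge_self]\<close>)
  qed
  have cpt: "\<bar>y $ q\<bar> \<le> norm y" for y :: "real^'n" and q by (rule component_le_norm_cart)
  \<comment> \<open>For fixed v the shift is a translation of the torus and leaves the L2 norm of
    \<open>H s\<close> unchanged; the remaining v-integral is the mass of the inverse
    weight.\<close>
  have mass: "(\<integral>\<^sup>+z. ennreal ((H s (?S z))\<^sup>2 / wt \<sigma> (snd z)) \<partial>phase) = ennreal (wt_mass TYPE('n) \<sigma> * (l2n torus (H s))\<^sup>2)"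
  proof -
    have "(\<integral>\<^sup>+z. ennreal ((H s (?S z))\<^sup>2 / wt \<sigma> (snd z)) \<partial>phase)
       = (\<integral>\<^sup>+v. (\<integral>\<^sup>+x. ennreal ((H s (?S (x, v)))\<^sup>2 / wt \<sigma> v) \<partial>torus) \<partial>lborel)"
      by (subst torus_lborel.nn_integral_snd[symmetric]) (auto simp: mph)
    also have "\<dots> = (\<integral>\<^sup>+v. ennreal (1 / wt \<sigma> v) * ennreal ((l2n torus (H s))\<^sup>2) \<partial>(lborel :: (real^'n) measure))"
    proof (rule nn_integral_cong)
      fix v :: "real^'n"
      have mt: "(\<lambda>x. H s (x + - \<theta> (t - s) *\<^sub>R v)) \<in> borel_measurable torus" by (simp add: measurable_cong_sets[OF sets_torus refl])
      have "(\<integral>\<^sup>+x. ennreal ((H s (?S (x, v)))\<^sup>2 / wt \<sigma> v) \<partial>torus)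
         = (\<integral>\<^sup>+x. ennreal (1 / wt \<sigma> v) * ennreal ((H s (x + - \<theta> (t - s) *\<^sub>R v))\<^sup>2) \<partial>torus)"
        by (intro nn_integral_cong) (simp add: ennreal_mult[symmetric] wt_pos less_imp_le)
      also have "\<dots> = ennreal (1 / wt \<sigma> v) * (\<integral>\<^sup>+x. ennreal ((H s (x + - \<theta> (t - s) *\<^sub>R v))\<^sup>2) \<partial>torus)"
        by (rule nn_integral_cmult) (use mt in measurable)
      also have "(\<integral>\<^sup>+x. ennreal ((H s (x + - \<theta> (t - s) *\<^sub>R v))\<^sup>2) \<partial>torus) = (\<integral>\<^sup>+x. ennreal ((H s x)\<^sup>2) \<partial>torus)"
        using reg_periodic(1)[OF H ts(2)]
        by (intro nn_integral_torus_translate[where f = "\<lambda>x. ennreal ((H s x)\<^sup>2)"]) (auto simp: periodic_def)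
      also have "\<dots> = ennreal ((l2n torus (H s))\<^sup>2)" by (rule sqint_nn_integral[OF reg_cylf(3)[OF T H ts(2)]])
      finally show "(\<integral>\<^sup>+x. ennreal ((H s (?S (x, v)))\<^sup>2 / wt \<sigma> v) \<partial>torus) = ennreal (1 / wt \<sigma> v) * ennreal ((l2n torus (H s))\<^sup>2)" .
    qed
    also have "\<dots> = ennreal (wt_mass TYPE('n) \<sigma>) * ennreal ((l2n torus (H s))\<^sup>2)"
      by (subst nn_integral_multc) (auto simp: ennreal_wt_mass[OF sigma])
    finally show ?thesis by (simp add: ennreal_mult)
  qed
  have comp: "\<bar>LINT z|phase. h s (?S z) $ q * (g t s z $ q * \<phi> (fst z))\<bar> \<le> sqrt (wt_mass TYPE('n) \<sigma>) * (2 * b * B) * l2n torus (H s)"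
    and icomp: "integrable phase (\<lambda>z. h s (?S z) $ q * (g t s z $ q * \<phi> (fst z)))" for q
  proof -
    \<comment> \<open>\<open>?k'\<close> is the x_q-derivative of \<open>?k\<close>, so its integral
      vanishes; \<open>?Y\<close> is the part where the derivative falls on the kernel or on the
      test function.\<close>
    let ?Y = "\<lambda>z. g t s z $ q * \<phi>' q (fst z) + gj q t s z $ q * \<phi> (fst z)"
    let ?k = "\<lambda>z. H s (?S z) * (g t s z $ q * \<phi> (fst z))"
    let ?k' = "\<lambda>z. H s (?S z) * ?Y z + h s (?S z) $ q * (g t s z $ q * \<phi> (fst z))"
    show i3: "integrable phase (\<lambda>z. h s (?S z) $ q * (g t s z $ q * \<phi> (fst z)))"
    proof (rule ib[OF _ _ ig, of _ "bh * b"])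
      fix z
      have "\<bar>h s (?S z) $ q * (g t s z $ q * \<phi> (fst z))\<bar> \<le> bh * (norm (g t s z) * b)"
        unfolding abs_mult using b0 by (intro mult_mono order_trans[OF cpt bh] cpt b) (auto intro: order_trans[OF norm_ge_zero bh])
      then show "\<bar>h s (?S z) $ q * (g t s z $ q * \<phi> (fst z))\<bar> \<le> bh * b * norm (g t s z)" by (simp add: mult_ac)
    qed measurable
    have i1: "integrable phase ?k"
    proof (rule ib[OF _ _ ig, of _ "bH * b"])
      fix z
      have "\<bar>?k z\<bar> \<le> bH * (norm (g t s z) * b)"
        unfolding abs_mult using b0 by (intro mult_mono cpt bH b) (auto intro: order_trans[OF abs_ge_zero bH])
      then show "\<bar>?k z\<bar> \<le> bH * b * norm (g t s z)" by (simp add: mult_ac)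
    qed measurable
    have i2: "integrable phase (\<lambda>z. H s (?S z) * ?Y z)"
    proof -
      have "integrable phase (\<lambda>z. H s (?S z) * (g t s z $ q * \<phi>' q (fst z)))"
      proof (rule ib[OF _ _ ig, of _ "bH * b"])
        fix z
        have "\<bar>H s (?S z) * (g t s z $ q * \<phi>' q (fst z))\<bar> \<le> bH * (norm (g t s z) * b)"
          unfolding abs_mult using b0 by (intro mult_mono cpt bH b) (auto intro: order_trans[OF abs_ge_zero bH])
        then show "\<bar>H s (?S z) * (g t s z $ q * \<phi>' q (fst z))\<bar> \<le> bH * b * norm (g t s z)" by (simp add: mult_ac)
      qed measurable
      moreover have "integrable phase (\<lambda>z. H s (?S z) * (gj q t s z $ q * \<phi> (fst z)))"
      proof (rule ib[OF _ _ igj, of _ "bH * b"])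
        fix z
        have "\<bar>H s (?S z) * (gj q t s z $ q * \<phi> (fst z))\<bar> \<le> bH * (norm (gj q t s z) * b)"
          unfolding abs_mult using b0 by (intro mult_mono cpt bH b) (auto intro: order_trans[OF abs_ge_zero bH])
        then show "\<bar>H s (?S z) * (gj q t s z $ q * \<phi> (fst z))\<bar> \<le> bH * b * norm (gj q t s z)" by (simp add: mult_ac)
      qed measurable
      ultimately show ?thesis by (simp add: distrib_left)
    qed
    have "(LINT z|phase. ?k' z) = 0"
    proof (rule phase_integral_dderiv)
      have dg: "has_dderiv (\<lambda>z. g t s z $ q) (axis q 1, 0) (\<lambda>z. gj q t s z $ q)"
        using deriv[OF ts, of q] unfolding has_dderiv_def
        using bounded_linear.has_vector_derivative[OF bounded_linear_vec_nth] by blast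
      have "has_dderiv (H s) (axis q 1) (\<lambda>x. h s x $ q)" using H ts by (simp add: reg_def)
      from has_dderiv_mult[OF has_dderiv_shift[OF this] has_dderiv_mult[OF dg has_dderiv_fst[OF \<phi>(3)]]]
      show d: "has_dderiv ?k (axis q 1, 0) ?k'" .
      show "integrable phase ?k" by (rule i1)
      show "integrable phase ?k'" using i2 i3 by simp
      show "xperiodic ?k"
        using kernel_shift_periodic[OF reg_periodic(1)[OF H ts(2)] ts] per[OF ts] \<phi>(2)
        by (simp add: xperiodic_def periodic_def)
      then show "xperiodic ?k'" by (rule has_dderiv_xperiodic[OF d])
      show "continuous_on UNIV ?k" "continuous_on UNIV ?k'"
        by (intro continuous_on_add continuous_on_mult continuous_on_component cHS chS cg cgj c\<phi> c\<phi>')+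
    qed
    then have "(LINT z|phase. h s (?S z) $ q * (g t s z $ q * \<phi> (fst z))) = - (LINT z|phase. H s (?S z) * ?Y z)"
      using i2 i3 by (subst (asm) Bochner_Integration.integral_add) auto
    then have eq: "ennreal \<bar>LINT z|phase. h s (?S z) $ q * (g t s z $ q * \<phi> (fst z))\<bar> = ennreal \<bar>LINT z|phase. H s (?S z) * ?Y z\<bar>"
      by simp
    let ?w = "\<lambda>z::(real^'n) \<times> (real^'n). wt \<sigma> (snd z)"
    have "\<dots> \<le> (\<integral>\<^sup>+z. ennreal \<bar>H s (?S z) * ?Y z\<bar> \<partial>phase)" by (rule ennreal_abs_integral_le)
    also have "\<dots> = (\<integral>\<^sup>+z. ennreal (\<bar>H s (?S z)\<bar> / sqrt (?w z)) * ennreal (sqrt (?w z) * \<bar>?Y z\<bar>) \<partial>phase)"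
    proof (intro nn_integral_cong)
      fix z
      show "ennreal \<bar>H s (?S z) * ?Y z\<bar> = ennreal (\<bar>H s (?S z)\<bar> / sqrt (?w z)) * ennreal (sqrt (?w z) * \<bar>?Y z\<bar>)"
        using wt_pos[of \<sigma> "snd z"] by (simp add: abs_mult ennreal_mult[symmetric])
    qed
    finally have "(ennreal \<bar>LINT z|phase. H s (?S z) * ?Y z\<bar>)\<^sup>2
       \<le> (\<integral>\<^sup>+z. ennreal (\<bar>H s (?S z)\<bar> / sqrt (?w z)) * ennreal (sqrt (?w z) * \<bar>?Y z\<bar>) \<partial>phase)\<^sup>2"
      by (rule power_mono) simp
    also have "\<dots> \<le> (\<integral>\<^sup>+z. (ennreal (\<bar>H s (?S z)\<bar> / sqrt (?w z)))\<^sup>2 \<partial>phase) * (\<integral>\<^sup>+z. (ennreal (sqrt (?w z) * \<bar>?Y z\<bar>))\<^sup>2 \<partial>phase)"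
      by (rule Cauchy_Schwarz_nn_integral) (simp_all add: mph)
    also have "(\<integral>\<^sup>+z. (ennreal (\<bar>H s (?S z)\<bar> / sqrt (?w z)))\<^sup>2 \<partial>phase) = ennreal (wt_mass TYPE('n) \<sigma> * (l2n torus (H s))\<^sup>2)"
      unfolding mass[symmetric] by (intro nn_integral_cong) (simp add: ennreal_power power_divide wt_pos less_imp_le)
    also have "(\<integral>\<^sup>+z. (ennreal (sqrt (?w z) * \<bar>?Y z\<bar>))\<^sup>2 \<partial>phase) \<le> ennreal ((2 * b * B)\<^sup>2)"
    proof -
      have "(\<integral>\<^sup>+z. (ennreal (sqrt (?w z) * \<bar>?Y z\<bar>))\<^sup>2 \<partial>phase)
         \<le> (\<integral>\<^sup>+z. ennreal (2 * b\<^sup>2) * ennreal (?w z * (norm (g t s z))\<^sup>2) + ennreal (2 * b\<^sup>2) * ennreal (?w z * (norm (gj q t s z))\<^sup>2) \<partial>phase)"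
      proof (rule nn_integral_mono)
        fix z
        have "\<bar>?Y z\<bar> \<le> b * norm (g t s z) + b * norm (gj q t s z)"
        proof (rule order_trans[OF abs_triangle_ineq], rule add_mono)
          show "\<bar>g t s z $ q * \<phi>' q (fst z)\<bar> \<le> b * norm (g t s z)"
            unfolding abs_mult mult.commute[of b] by (intro mult_mono cpt b) auto
          show "\<bar>gj q t s z $ q * \<phi> (fst z)\<bar> \<le> b * norm (gj q t s z)"
            unfolding abs_mult mult.commute[of b] by (intro mult_mono cpt b) auto
        qed
        then have "\<bar>?Y z\<bar>\<^sup>2 \<le> (b * norm (g t s z) + b * norm (gj q t s z))\<^sup>2" by (rule power_mono) simp
        also have "\<dots> \<le> 2 * (b * norm (g t s z))\<^sup>2 + 2 * (b * norm (gj q t s z))\<^sup>2"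
          using sum_squares_bound[of "b * norm (g t s z)" "b * norm (gj q t s z)"] by (simp add: power2_sum)
        finally have "?w z * \<bar>?Y z\<bar>\<^sup>2 \<le> ?w z * (2 * (b * norm (g t s z))\<^sup>2 + 2 * (b * norm (gj q t s z))\<^sup>2)"
          by (intro mult_left_mono) (auto simp: wt_pos less_imp_le)
        also have "\<dots> = 2 * b\<^sup>2 * (?w z * (norm (g t s z))\<^sup>2) + 2 * b\<^sup>2 * (?w z * (norm (gj q t s z))\<^sup>2)"
          by (simp add: power_mult_distrib algebra_simps)
        finally have "ennreal (?w z * \<bar>?Y z\<bar>\<^sup>2) \<le> ennreal (2 * b\<^sup>2 * (?w z * (norm (g t s z))\<^sup>2) + 2 * b\<^sup>2 * (?w z * (norm (gj q t s z))\<^sup>2))"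
          by (rule ennreal_leI)
        also have "\<dots> = ennreal (2 * b\<^sup>2) * ennreal (?w z * (norm (g t s z))\<^sup>2) + ennreal (2 * b\<^sup>2) * ennreal (?w z * (norm (gj q t s z))\<^sup>2)"
          by (subst ennreal_plus) (simp_all add: wt_pos less_imp_le ennreal_mult)
        finally show "(ennreal (sqrt (?w z) * \<bar>?Y z\<bar>))\<^sup>2 \<le> ennreal (2 * b\<^sup>2) * ennreal (?w z * (norm (g t s z))\<^sup>2) + ennreal (2 * b\<^sup>2) * ennreal (?w z * (norm (gj q t s z))\<^sup>2)"
          by (simp add: ennreal_power power_mult_distrib wt_pos less_imp_le)
      qed
      also have "\<dots> = ennreal (2 * b\<^sup>2) * (\<integral>\<^sup>+z. ennreal (?w z * (norm (g t s z))\<^sup>2) \<partial>phase) + ennreal (2 * b\<^sup>2) * (\<integral>\<^sup>+z. ennreal (?w z * (norm (gj q t s z))\<^sup>2) \<partial>phase)"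
        by (subst nn_integral_add) (simp_all add: mph nn_integral_cmult)
      also have "\<dots> \<le> ennreal (2 * b\<^sup>2) * ennreal (B\<^sup>2) + ennreal (2 * b\<^sup>2) * ennreal (B\<^sup>2)"
        by (intro add_mono mult_left_mono bound st) auto
      also have "\<dots> = ennreal ((2 * b * B)\<^sup>2)"
        by (simp add: ennreal_mult[symmetric] ennreal_plus[symmetric] power_mult_distrib del: ennreal_plus)
      finally show ?thesis .
    qed
    finally have "(ennreal \<bar>LINT z|phase. H s (?S z) * ?Y z\<bar>)\<^sup>2 \<le> ennreal (wt_mass TYPE('n) \<sigma> * (l2n torus (H s))\<^sup>2) * ennreal ((2 * b * B)\<^sup>2)"
      by (simp add: mult_left_mono)
    also have "\<dots> = (ennreal (sqrt (wt_mass TYPE('n) \<sigma>) * (2 * b * B) * l2n torus (H s)))\<^sup>2"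
      using b0 B by (simp add: ennreal_mult[symmetric] ennreal_power power_mult_distrib mult_ac)
    finally have "ennreal \<bar>LINT z|phase. H s (?S z) * ?Y z\<bar> \<le> ennreal (sqrt (wt_mass TYPE('n) \<sigma>) * (2 * b * B) * l2n torus (H s))"
      by (rule power2_le_imp_le_ennreal)
    then show "\<bar>LINT z|phase. h s (?S z) $ q * (g t s z $ q * \<phi> (fst z))\<bar> \<le> sqrt (wt_mass TYPE('n) \<sigma>) * (2 * b * B) * l2n torus (H s)"
      unfolding eq[symmetric] using b0 B by (subst (asm) ennreal_le_iff) auto
  qed
  have "(LINT z|phase. U1 h t s z * \<phi> (fst z)) = (LINT z|phase. (\<Sum>q\<in>UNIV. h s (?S z) $ q * (g t s z $ q * \<phi> (fst z))))"
    by (simp add: U1_def inner_vec_def sum_distrib_right mult.assoc)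
  also have "\<dots> = (\<Sum>q\<in>UNIV. LINT z|phase. h s (?S z) $ q * (g t s z $ q * \<phi> (fst z)))"
    by (rule Bochner_Integration.integral_sum) (rule icomp)
  finally have "\<bar>LINT z|phase. U1 h t s z * \<phi> (fst z)\<bar> \<le> (\<Sum>q\<in>UNIV. \<bar>LINT z|phase. h s (?S z) $ q * (g t s z $ q * \<phi> (fst z))\<bar>)"
    by (simp add: sum_abs)
  also have "\<dots> \<le> (\<Sum>q\<in>(UNIV::'n set). sqrt (wt_mass TYPE('n) \<sigma>) * (2 * b * B) * l2n torus (H s))"
    by (intro sum_mono comp)
  finally show ?thesis by simp
qed

end

subsection \<open>The Schur estimate\<close>

lemma nn_integral_reflect:
  fixes f :: "real \<Rightarrow> ennreal"
  assumes "f \<in> borel_measurable borel"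
  shows "(\<integral>\<^sup>+s. f (t - s) \<partial>lborel) = (\<integral>\<^sup>+s. f s \<partial>lborel)"
  using nn_integral_real_affine[OF assms, of "-1" t] by simp

text \<open>The two marginals of Schur's test in time. The kernel depends on t - s only, so
  integrating it over t with s fixed, or over s with t fixed, gives at most 1/2.\<close>

lemma schur_time:
  assumes [measurable]: "\<alpha> \<in> borel_measurable borel" and r: "0 \<le> r" and nn: "\<And>s. 0 \<le> \<alpha> s"
  shows "(\<integral>\<^sup>+t\<in>{0<..<T}. (\<integral>\<^sup>+s. ennreal (\<alpha> s * time_kernel r (t - s)) * indicator {0..t} s \<partial>lborel) \<partial>lborel)
      \<le> ennreal (1/2) * (\<integral>\<^sup>+s\<in>{0<..<T}. ennreal (\<alpha> s) \<partial>lborel)" (is ?A)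
    and "(\<integral>\<^sup>+t\<in>{0<..<T}. (\<integral>\<^sup>+s. ennreal (\<alpha> t * time_kernel r (t - s)) * indicator {0..t} s \<partial>lborel) \<partial>lborel)
      \<le> ennreal (1/2) * (\<integral>\<^sup>+s\<in>{0<..<T}. ennreal (\<alpha> s) \<partial>lborel)" (is ?B)
proof -
  let ?k = "\<lambda>\<tau>. ennreal (time_kernel r \<tau>)"
  have split: "ennreal (\<alpha> q * time_kernel r \<tau>) = ennreal (\<alpha> q) * ?k \<tau>" for q \<tau>
    using nn by (rule ennreal_mult')
  have k: "(\<integral>\<^sup>+s. ?k (t - s) * indicator {0..b} (t - s) \<partial>lborel) \<le> ennreal (1/2)" for t b
    using nn_integral_time_kernel[OF r, of b]
    by (subst nn_integral_reflect[where f = "\<lambda>s. ?k s * indicator {0..b} s"]) auto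
  have k': "(\<integral>\<^sup>+t. ?k (t - s) * indicator {0..b} (t - s) \<partial>lborel) \<le> ennreal (1/2)" for s b
    using nn_integral_time_kernel[OF r, of b]
      nn_integral_lborel_translate[of "\<lambda>t. ?k t * indicator {0..b} t" "- s"] by simp
  have "(\<integral>\<^sup>+t\<in>{0<..<T}. (\<integral>\<^sup>+s. ennreal (\<alpha> s * time_kernel r (t - s)) * indicator {0..t} s \<partial>lborel) \<partial>lborel)
    \<le> (\<integral>\<^sup>+t. (\<integral>\<^sup>+s. ennreal (\<alpha> s) * indicator {0..T} s * (?k (t - s) * indicator {0..T} (t - s)) \<partial>lborel) \<partial>lborel)"
  proof (rule nn_integral_mono)
    fix t
    show "(\<integral>\<^sup>+s. ennreal (\<alpha> s * time_kernel r (t - s)) * indicator {0..t} s \<partial>lborel) * indicator {0<..<T} t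
      \<le> (\<integral>\<^sup>+s. ennreal (\<alpha> s) * indicator {0..T} s * (?k (t - s) * indicator {0..T} (t - s)) \<partial>lborel)"
    proof (cases "t \<in> {0<..<T}")
      case True
      then show ?thesis by (auto simp: split indicator_def intro!: nn_integral_mono)
    qed simp
  qed
  also have "\<dots> = (\<integral>\<^sup>+s. (\<integral>\<^sup>+t. ennreal (\<alpha> s) * indicator {0..T} s * (?k (t - s) * indicator {0..T} (t - s)) \<partial>lborel) \<partial>lborel)"
    by (rule lborel_pair.Fubini') measurable
  also have "\<dots> \<le> (\<integral>\<^sup>+s. ennreal (1/2) * (ennreal (\<alpha> s) * indicator {0..T} s) \<partial>lborel)"
  proof (rule nn_integral_mono)
    fix s
    have "(\<integral>\<^sup>+t. ennreal (\<alpha> s) * indicator {0..T} s * (?k (t - s) * indicator {0..T} (t - s)) \<partial>lborel)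
       = ennreal (\<alpha> s) * indicator {0..T} s * (\<integral>\<^sup>+t. ?k (t - s) * indicator {0..T} (t - s) \<partial>lborel)"
      by (rule nn_integral_cmult) measurable
    also have "\<dots> \<le> ennreal (\<alpha> s) * indicator {0..T} s * ennreal (1/2)" by (intro mult_left_mono k') simp
    finally show "(\<integral>\<^sup>+t. ennreal (\<alpha> s) * indicator {0..T} s * (?k (t - s) * indicator {0..T} (t - s)) \<partial>lborel)
       \<le> ennreal (1/2) * (ennreal (\<alpha> s) * indicator {0..T} s)" by (simp add: mult.commute)
  qed
  also have "\<dots> = ennreal (1/2) * (\<integral>\<^sup>+s\<in>{0..T}. ennreal (\<alpha> s) \<partial>lborel)"
    by (rule nn_integral_cmult) measurable
  finally show ?A by (simp add: nn_integral_Icc_Ioo)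
  have "(\<integral>\<^sup>+t\<in>{0<..<T}. (\<integral>\<^sup>+s. ennreal (\<alpha> t * time_kernel r (t - s)) * indicator {0..t} s \<partial>lborel) \<partial>lborel)
     \<le> (\<integral>\<^sup>+t. ennreal (1/2) * (ennreal (\<alpha> t) * indicator {0<..<T} t) \<partial>lborel)"
  proof (rule nn_integral_mono)
    fix t
    have "(\<integral>\<^sup>+s. ennreal (\<alpha> t * time_kernel r (t - s)) * indicator {0..t} s \<partial>lborel)
       = (\<integral>\<^sup>+s. ennreal (\<alpha> t) * (?k (t - s) * indicator {0..t} (t - s)) \<partial>lborel)"
      by (intro nn_integral_cong) (auto simp: split indicator_def)
    also have "\<dots> = ennreal (\<alpha> t) * (\<integral>\<^sup>+s. ?k (t - s) * indicator {0..t} (t - s) \<partial>lborel)"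
      by (rule nn_integral_cmult) measurable
    also have "\<dots> \<le> ennreal (\<alpha> t) * ennreal (1/2)" by (intro mult_left_mono k) simp
    finally have "(\<integral>\<^sup>+s. ennreal (\<alpha> t * time_kernel r (t - s)) * indicator {0..t} s \<partial>lborel) * indicator {0<..<T} t
       \<le> ennreal (\<alpha> t) * ennreal (1/2) * indicator {0<..<T} t" by (rule mult_right_mono) simp
    then show "(\<integral>\<^sup>+s. ennreal (\<alpha> t * time_kernel r (t - s)) * indicator {0..t} s \<partial>lborel) * indicator {0<..<T} t
       \<le> ennreal (1/2) * (ennreal (\<alpha> t) * indicator {0<..<T} t)" by (simp add: mult_ac)
  qed
  also have "\<dots> = ennreal (1/2) * (\<integral>\<^sup>+s\<in>{0<..<T}. ennreal (\<alpha> s) \<partial>lborel)"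
    by (rule nn_integral_cmult) measurable
  finally show ?B .
qed

text \<open>The best parameter would be Y / X, which degenerates when X or Y is 0.\<close>

lemma scale_optimize:
  fixes a C X Y :: real
  assumes C: "0 \<le> C" and X: "0 \<le> X" and Y: "0 \<le> Y"
    and le: "\<And>\<mu>. 0 < \<mu> \<Longrightarrow> a \<le> C / 2 * (\<mu> * X\<^sup>2 + Y\<^sup>2 / \<mu>)"
  shows "a \<le> C * X * Y"
proof (rule field_le_epsilon)
  fix e :: real assume e: "0 < e"
  \<comment> \<open>Both norms are enlarged by \<open>d\<close> to make the optimal ratio positive
    and finite; \<open>d\<close> is small enough that the excess d C (X + Y + d) stays below
    \<open>e\<close>.\<close>
  define d where "d = min 1 (e / (C * (X + Y + 1) + 1))"
  have p: "0 < C * (X + Y + 1) + 1" using C X Y by (intro add_nonneg_pos mult_nonneg_nonneg) auto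
  have d: "0 < d" "d \<le> 1" "d * (C * (X + Y + 1) + 1) \<le> e"
  proof -
    show "0 < d" "d \<le> 1" using e p by (auto simp: d_def)
    have "d \<le> e / (C * (X + Y + 1) + 1)" by (simp add: d_def)
    then show "d * (C * (X + Y + 1) + 1) \<le> e" using p by (simp add: pos_le_divide_eq)
  qed
  let ?x = "X + d" and ?y = "Y + d"
  have xy: "0 < ?x" "0 < ?y" using X Y d by auto
  have "a \<le> C / 2 * (?y / ?x * X\<^sup>2 + Y\<^sup>2 / (?y / ?x))" using le[of "?y / ?x"] xy by simp
  also have "\<dots> \<le> C / 2 * (?y / ?x * ?x\<^sup>2 + ?y\<^sup>2 / (?y / ?x))"
    using C X Y xy d by (intro mult_left_mono add_mono divide_right_mono power_mono) auto
  also have "?y / ?x * ?x\<^sup>2 + ?y\<^sup>2 / (?y / ?x) = 2 * (?x * ?y)"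
    using xy by (simp add: power2_eq_square)
  also have "C / 2 * (2 * (?x * ?y)) = C * X * Y + d * (C * (X + Y + d))" by (simp add: algebra_simps)
  also have "d * (C * (X + Y + d)) \<le> d * (C * (X + Y + 1) + 1)"
  proof -
    have "C * (X + Y + d) \<le> C * (X + Y + 1)" using C d by (intro mult_left_mono) auto
    then show ?thesis using d by (intro mult_left_mono) auto
  qed
  also have "\<dots> \<le> e" by (rule d(3))
  finally show "a \<le> C * X * Y + e" by simp
qed

lemma ennreal_combine:
  "0 \<le> a \<Longrightarrow> 0 \<le> b \<Longrightarrow> 0 \<le> c \<Longrightarrow> 0 \<le> d \<Longrightarrow> ennreal a * ennreal b + ennreal c * ennreal d = ennreal (a * b + c * d)"
  by (simp add: ennreal_mult)

lemma sum_split_swap: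
  fixes f h :: "'a \<Rightarrow> 'b \<Rightarrow> 'c::comm_semiring_1"
  shows "(\<Sum>k\<in>F. \<Sum>n\<in>G. f k n * a k + h k n * b n) = (\<Sum>k\<in>F. (\<Sum>n\<in>G. f k n) * a k) + (\<Sum>n\<in>G. (\<Sum>k\<in>F. h k n) * b n)"
  using sum.swap[of "\<lambda>k n. h k n * b n" G F] by (simp add: sum.distrib sum_distrib_right)

lemma ennreal_sum2:
  "(\<And>k n. 0 \<le> A k n) \<Longrightarrow> ennreal (\<Sum>k\<in>F. \<Sum>n\<in>G. A k n) = (\<Sum>k\<in>F. \<Sum>n\<in>G. ennreal (A k n))"
  by (simp add: sum_ennreal sum_nonneg)

lemma sum_ennreal_cmult:
  assumes "0 \<le> c" "\<And>n. 0 \<le> f n" "sum f F \<le> S"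
  shows "(\<Sum>n\<in>F. ennreal (c * f n)) \<le> ennreal (c * S)"
  using assms by (simp add: sum_ennreal sum_distrib_left[symmetric] ennreal_leI mult_left_mono)

lemma norm_emb_ge_1: "k \<noteq> 0 \<Longrightarrow> 1 \<le> norm (emb k)"
proof -
  assume "k \<noteq> 0"
  then obtain j where "k $ j \<noteq> 0" by (auto simp: vec_eq_iff)
  then have "1 \<le> \<bar>emb k $ j\<bar>" by simp
  also have "\<dots> \<le> norm (emb k)" by (rule component_le_norm_cart)
  finally show ?thesis .
qed

context avg_kernel
begin

text \<open>Here 1 + |n| \<le> (1 + |k+n|) + |k| \<le> 2 |k| (1 + |k+n|), since |k| \<ge> 1 for k
  \<noteq> 0; the mode k = 0 contributes nothing because the gradient removes constants. One power
  of |k| arises here, the other from pairing the kernel with \<open>emb k\<close>, and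
  \<theta>(\<tau>) \<ge> \<tau> lets \<open>time_kernel\<close> appear.\<close>

lemma multiplier_bound:
  assumes st: "0 \<le> s" "s \<le> t" "t \<le> T"
  shows "(1 + norm (emb n)) * norm (LINT z|phase. of_real (g t s z \<bullet> emb k) * phase_char (k + n) (\<theta> (t - s) *\<^sub>R emb k) z)
    \<le> 2 * K * time_kernel (norm (emb k)) (t - s) * lattice_wt (k + n)"
proof (cases "k = 0")
  case True
  then show ?thesis by (simp add: emb_simps time_kernel_def)
next
  case False
  let ?r = "norm (emb k)" and ?l = "1 + norm (emb (k + n))" and ?\<tau> = "t - s" and ?\<xi> = "\<theta> (t - s) *\<^sub>R emb k"
  let ?I = "norm (LINT z|phase. of_real (g t s z \<bullet> emb k) * phase_char (k + n) ?\<xi> z)"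
  have r: "1 \<le> ?r" by (rule norm_emb_ge_1[OF False])
  have l: "1 \<le> ?l" and \<tau>: "0 \<le> ?\<tau>" using st by auto
  have q: "0 < 1 + ?r * ?\<tau>" using r \<tau> by (intro add_pos_nonneg mult_nonneg_nonneg) auto
  have "?r * ?\<tau> \<le> ?r * \<theta> ?\<tau>" by (rule mult_left_mono[OF theta(2)[OF \<tau>]]) simp
  also have "\<dots> \<le> norm ?\<xi>" by (simp add: mult.commute[of "norm (emb k)"] mult_right_mono)
  finally have "(1 + ?r * ?\<tau>) ^ 3 \<le> (1 + norm ?\<xi>) ^ 3" using q by (intro power_mono) auto
  then have "?l ^ (CARD('n) + 2) * (1 + ?r * ?\<tau>) ^ 3 * ?I \<le> ?l ^ (CARD('n) + 2) * (1 + norm ?\<xi>) ^ 3 * ?I"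
    using l by (intro mult_right_mono mult_left_mono) auto
  also have "\<dots> \<le> K * ?\<tau> * ?r" using decay[OF st, of "k + n" ?\<xi> "emb k"] by simp
  finally have I: "?l ^ (CARD('n) + 2) * (1 + ?r * ?\<tau>) ^ 3 * ?I \<le> K * ?\<tau> * ?r" .
  have "norm (emb n) \<le> norm (emb (k + n)) + ?r"
    using norm_triangle_ineq4[of "emb (k + n)" "emb k"] by (simp add: emb_simps)
  then have "1 + norm (emb n) \<le> ?l + ?r" by simp
  also have "\<dots> \<le> 2 * ?r * ?l"
  proof -
    have "x + y \<le> 2 * y * x" if "1 \<le> x" "1 \<le> y" for x y :: real
    proof -
      have "x \<le> y * x" using mult_right_mono[OF that(2), of x] that(1) by simp
      moreover have "y \<le> y * x" using mult_left_mono[OF that(1), of y] that(2) by simp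
      ultimately show ?thesis by linarith
    qed
    from this[OF l r] show ?thesis .
  qed
  finally have n: "1 + norm (emb n) \<le> 2 * ?r * ?l" .
  define D where "D = ?l ^ (CARD('n) + 1) * (1 + ?r * ?\<tau>) ^ 3"
  have "0 < ?l" using l by linarith
  then have D: "0 < D" unfolding D_def using q by (intro mult_pos_pos zero_less_power)
  have "D * ((1 + norm (emb n)) * ?I) \<le> D * ((2 * ?r * ?l) * ?I)"
    using D n by (intro mult_left_mono mult_right_mono) auto
  also have "\<dots> = 2 * ?r * (?l ^ (CARD('n) + 2) * (1 + ?r * ?\<tau>) ^ 3 * ?I)" by (simp add: D_def)
  also have "\<dots> \<le> 2 * ?r * (K * ?\<tau> * ?r)" using r by (intro mult_left_mono I) auto
  finally have "(1 + norm (emb n)) * ?I \<le> 2 * ?r * (K * ?\<tau> * ?r) / D"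
    using D by (simp add: pos_le_divide_eq mult.commute)
  also have "\<dots> = 2 * K * time_kernel ?r ?\<tau> * lattice_wt (k + n)"
    by (simp add: D_def time_kernel_def lattice_wt_def power2_eq_square mult_ac)
  finally show ?thesis .
qed

text \<open>The multiplier \<open>m\<close> treats two tests at once: m = 1 for a test function
  itself, and m n = i n_j for its x_j-derivative. The bound is in terms of the coefficients before
  multiplication.\<close>

lemma slice_bound_trig:
  assumes H: "trig_rep F p H" "reg T H h hj" and \<Psi>: "trig_rep F' (\<lambda>n. smult (m n) (q n)) \<Psi>"
    and m: "\<And>n. norm (m n) \<le> 1 + norm (emb n)" and st: "0 \<le> s" "s \<le> t" "t \<le> T"
  shows "\<bar>LINT z|phase. U1 h t s z * \<Psi> t (fst z)\<bar> \<le> (\<Sum>k\<in>F. \<Sum>n\<in>F'.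
      norm (poly (p k) (of_real s)) * norm (poly (q n) (of_real t)) *
      (2 * K * time_kernel (norm (emb k)) (t - s) * lattice_wt (k + n)))"
proof -
  let ?c = "\<lambda>k. poly (p k) (of_real s)" and ?d = "\<lambda>n. poly (q n) (of_real t)"
  let ?\<xi> = "\<lambda>k. \<theta> (t - s) *\<^sub>R emb k"
  let ?f = "\<lambda>k n z. of_real (g t s z \<bullet> emb k) * phase_char (k + n) (?\<xi> k) z"
  have s: "s \<in> {0..T}" using st by simp
  have pt: "of_real (U1 h t s z * \<Psi> t (fst z)) = (\<Sum>k\<in>F. \<Sum>n\<in>F'. (\<i> * ?c k * (m n * ?d n)) * ?f k n z)" for z
  proof -
    \<comment> \<open>The shift along characteristics turns the mode k of H into frequency
      -\<theta>(t-s) k in v, and multiplying by the mode n of the test adds the frequencies in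
      x.\<close>
    have e: "E k (fst z - \<theta> (t - s) *\<^sub>R snd z) * E n (fst z) = phase_char (k + n) (?\<xi> k) z" for k n
    proof -
      have "E k (fst z + - \<theta> (t - s) *\<^sub>R snd z) = E k (fst z) * cis (- (?\<xi> k \<bullet> snd z))"
        by (simp only: E_simps(2)) (simp add: E_def)
      then show ?thesis by (simp add: phase_char_def E_simps(1))
    qed
    have "of_real (U1 h t s z * \<Psi> t (fst z)) = (\<Sum>k\<in>F. \<i> * of_real (emb k \<bullet> g t s z) * (?c k * E k (fst z - \<theta> (t - s) *\<^sub>R snd z)))
       * (\<Sum>n\<in>F'. m n * ?d n * E n (fst z))"
      using trig_grad[OF H s, of "fst z - \<theta> (t - s) *\<^sub>R snd z" "g t s z"] \<Psi>
      by (simp add: U1_def trig_rep_def trig_sum_def)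
    also have "\<dots> = (\<Sum>k\<in>F. \<Sum>n\<in>F'. (\<i> * ?c k * (m n * ?d n)) * (of_real (g t s z \<bullet> emb k) * (E k (fst z - \<theta> (t - s) *\<^sub>R snd z) * E n (fst z))))"
      unfolding sum_product by (intro sum.cong refl) (simp add: inner_commute mult_ac)
    finally show ?thesis unfolding e .
  qed
  have gm [measurable]: "g t s \<in> borel_measurable borel"
  proof -
    have "continuous_on UNIV (\<lambda>z. (\<lambda>(t, s, z). g t s z) (t, s, z))"
      by (rule continuous_on_compose2[OF cont(1)]) (use st in \<open>auto intro!: continuous_intros\<close>)
    then show ?thesis by (intro borel_measurable_continuous_onI) simp
  qed
  have ig: "integrable phase (g t s)" by (rule weighted_L2_imp_L1(2)[OF sigma gm bound(1)[OF st] B])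
  have if': "integrable phase (?f k n)" for k n
    by (rule Bochner_Integration.integrable_bound[OF integrable_inner_left[OF ig, of "emb k"]])
      (auto simp: norm_mult measurable_cong_sets[OF sets_phase refl])
  have "of_real (LINT z|phase. U1 h t s z * \<Psi> t (fst z)) = (LINT z|phase. complex_of_real (U1 h t s z * \<Psi> t (fst z)))"
    by (rule integral_complex_of_real[symmetric])
  also have "\<dots> = (LINT z|phase. (\<Sum>k\<in>F. \<Sum>n\<in>F'. (\<i> * ?c k * (m n * ?d n)) * ?f k n z))" by (simp only: pt)
  also have "\<dots> = (\<Sum>k\<in>F. \<Sum>n\<in>F'. (\<i> * ?c k * (m n * ?d n)) * (LINT z|phase. ?f k n z))"
    using if' by (simp add: Bochner_Integration.integral_sum)
  finally have eq: "complex_of_real (LINT z|phase. U1 h t s z * \<Psi> t (fst z)) = (\<Sum>k\<in>F. \<Sum>n\<in>F'. (\<i> * ?c k * (m n * ?d n)) * (LINT z|phase. ?f k n z))" .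
  have "\<bar>LINT z|phase. U1 h t s z * \<Psi> t (fst z)\<bar> = norm (\<Sum>k\<in>F. \<Sum>n\<in>F'. (\<i> * ?c k * (m n * ?d n)) * (LINT z|phase. ?f k n z))"
    by (simp only: eq[symmetric] norm_of_real)
  also have "\<dots> \<le> (\<Sum>k\<in>F. \<Sum>n\<in>F'. norm ((\<i> * ?c k * (m n * ?d n)) * (LINT z|phase. ?f k n z)))"
    by (rule order_trans[OF norm_sum sum_mono[OF norm_sum]])
  also have "\<dots> \<le> (\<Sum>k\<in>F. \<Sum>n\<in>F'. norm (?c k) * norm (?d n) * (2 * K * time_kernel (norm (emb k)) (t - s) * lattice_wt (k + n)))"
  proof (intro sum_mono)
    fix k n
    have "norm ((\<i> * ?c k * (m n * ?d n)) * (LINT z|phase. ?f k n z)) = norm (?c k) * norm (?d n) * (norm (m n) * norm (LINT z|phase. ?f k n z))"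
      by (simp add: norm_mult)
    also have "\<dots> \<le> norm (?c k) * norm (?d n) * ((1 + norm (emb n)) * norm (LINT z|phase. ?f k n z))"
      by (intro mult_left_mono mult_right_mono m) auto
    also have "\<dots> \<le> norm (?c k) * norm (?d n) * (2 * K * time_kernel (norm (emb k)) (t - s) * lattice_wt (k + n))"
      by (intro mult_left_mono multiplier_bound st) auto
    finally show "norm ((\<i> * ?c k * (m n * ?d n)) * (LINT z|phase. ?f k n z)) \<le> norm (?c k) * norm (?d n) * (2 * K * time_kernel (norm (emb k)) (t - s) * lattice_wt (k + n))" .
  qed
  finally show ?thesis .
qed

lemma slice_le_nn:
  assumes U: "adm U W" and t: "t \<in> {0..T}" and \<psi>: "\<psi> \<in> borel_measurable borel" and b: "\<And>x. \<bar>\<psi> x\<bar> \<le> b"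
    and le: "\<And>s. s \<in> {0..t} \<Longrightarrow> \<bar>LINT z|phase. U t s z * \<psi> (fst z)\<bar> \<le> c s"
  shows "ennreal \<bar>LINT x|torus. avg U t x * \<psi> x\<bar> \<le> (\<integral>\<^sup>+s. ennreal (c s) * indicator {0..t} s \<partial>lborel)"
proof -
  have "ennreal \<bar>LINT x|torus. avg U t x * \<psi> x\<bar> \<le> (\<integral>\<^sup>+s. ennreal \<bar>indicator {0..t} s * (LINT z|phase. U t s z * \<psi> (fst z))\<bar> \<partial>lborel)"
    unfolding avg_pairing(1)[OF U t \<psi> b] by (rule ennreal_abs_integral_le)
  also have "\<dots> \<le> (\<integral>\<^sup>+s. ennreal (c s) * indicator {0..t} s \<partial>lborel)"
    by (rule nn_integral_mono) (use le in \<open>auto simp: indicator_def intro: ennreal_leI\<close>)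
  finally show ?thesis .
qed

lemma trig_norm_eq:
  assumes "trig_rep F p H"
  shows "(\<Sum>k\<in>F. \<integral>\<^sup>+t\<in>{0<..<T}. ennreal ((norm (poly (p k) (of_real t)))\<^sup>2) \<partial>lborel) = ennreal ((l2n (cyl T) (cylf T H))\<^sup>2)"
proof -
  have tr: "trig H" using assms by (auto simp: trig_def)
  note C = trig_cylf[OF T tr]
  have c: "continuous_on ({0..T} \<times> UNIV) (\<lambda>(t, x). H t x)"
    using continuous_on_trig[OF tr] by (simp add: case_prod_unfold)
  have [measurable]: "(\<lambda>t. poly (p k) (of_real t)) \<in> borel_measurable borel" for k
    by (intro borel_measurable_continuous_onI continuous_intros)
  have "ennreal ((l2n (cyl T) (cylf T H))\<^sup>2) = (\<integral>\<^sup>+t\<in>{0<..<T}. (\<integral>\<^sup>+x. ennreal ((H t x)\<^sup>2) \<partial>torus) \<partial>lborel)"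
    using sqint_nn_integral[OF C(1)] nn_integral_cylf[OF C(5)] by simp
  also have "\<dots> = (\<integral>\<^sup>+t. (\<Sum>k\<in>F. ennreal ((norm (poly (p k) (of_real t)))\<^sup>2) * indicator {0<..<T} t) \<partial>lborel)"
  proof (rule nn_integral_cong)
    fix t
    show "(\<integral>\<^sup>+x. ennreal ((H t x)\<^sup>2) \<partial>torus) * indicator {0<..<T} t = (\<Sum>k\<in>F. ennreal ((norm (poly (p k) (of_real t)))\<^sup>2) * indicator {0<..<T} t)"
    proof (cases "t \<in> {0<..<T}")
      case True
      then have "t \<in> {0..T}" by simp
      from sqint_nn_integral[OF periodic_cylf_sqint(3)[OF T c periodic_trig[OF tr] this]]
      show ?thesis using True trig_parseval[OF assms, of t] by (simp add: l2n_power2)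
    qed simp
  qed
  also have "\<dots> = (\<Sum>k\<in>F. \<integral>\<^sup>+t\<in>{0<..<T}. ennreal ((norm (poly (p k) (of_real t)))\<^sup>2) \<partial>lborel)"
    by (rule nn_integral_sum) measurable
  finally show ?thesis by simp
qed

text \<open>Schur's test with a free parameter \<mu>: each product of coefficients is split by the
  arithmetic-geometric mean inequality, the lattice sum removes the free index, and the time
  integral of the kernel gives 1/2. The factor 2 of the multiplier bound is used up in the
  splitting, and optimising in \<mu> leaves K S.\<close>

lemma form_bound_trig:
  assumes H: "trig_rep F p H" "reg T H h hj" and \<Phi>: "trig_rep F' q \<Phi>" and \<Psi>: "trig_rep F' (\<lambda>n. smult (m n) (q n)) \<Psi>"
    and m: "\<And>n. norm (m n) \<le> 1 + norm (emb n)"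
    and S: "0 \<le> S" "\<And>F. finite F \<Longrightarrow> (\<Sum>l\<in>F. lattice_wt (l :: int^'n)) \<le> S"
  shows "\<bar>form (U1 h) \<Psi>\<bar> \<le> K * S * l2n (cyl T) (cylf T H) * l2n (cyl T) (cylf T \<Phi>)"
proof (rule scale_optimize)
  show "0 \<le> K * S" using K S by simp
  fix \<mu> :: real assume \<mu>: "0 < \<mu>"
  let ?X = "l2n (cyl T) (cylf T H)" and ?Y = "l2n (cyl T) (cylf T \<Phi>)"
  let ?c = "\<lambda>k s. (norm (poly (p k) (of_real s)))\<^sup>2" and ?d = "\<lambda>n t. (norm (poly (q n) (of_real t)))\<^sup>2"
  let ?k = "\<lambda>k \<tau>. time_kernel (norm (emb k)) \<tau>"
  have tr: "trig \<Psi>" "trig \<Phi>" using \<Psi> \<Phi> by (auto simp: trig_def)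
  have fin: "finite F" "finite F'" using H \<Phi> by (auto simp: trig_rep_def)
  obtain W where W: "adm (U1 h) W" using adm_U(1)[OF H(2)] by blast
  obtain b where b: "\<And>t x. t \<in> {0..T} \<Longrightarrow> \<bar>\<Psi> t x\<bar> \<le> b" using trig_cylf(2)[OF T tr(1)] by blast
  have [measurable]: "(\<lambda>t. poly (p k) (of_real t)) \<in> borel_measurable borel" "(\<lambda>t. poly (q k) (of_real t)) \<in> borel_measurable borel" for k
    by (intro borel_measurable_continuous_onI continuous_intros)+
  let ?w = "\<lambda>k n. ennreal (K * \<mu> * lattice_wt (k + n))" and ?w' = "\<lambda>k n. ennreal (K / \<mu> * lattice_wt (k + n))"
  let ?P = "\<lambda>k t s. ennreal (?c k s * ?k k (t - s)) * indicator {0..t} s" and ?Q = "\<lambda>k n t s. ennreal (?d n t * ?k k (t - s)) * indicator {0..t} s"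
  have slice: "ennreal \<bar>LINT x|torus. avg (U1 h) t x * \<Psi> t x\<bar>
     \<le> (\<Sum>k\<in>F. \<Sum>n\<in>F'. ?w k n * (\<integral>\<^sup>+s. ?P k t s \<partial>lborel) + ?w' k n * (\<integral>\<^sup>+s. ?Q k n t s \<partial>lborel))"
    if t: "t \<in> {0<..<T}" for t
  proof -
    have t': "t \<in> {0..T}" using t by simp
    have "ennreal \<bar>LINT x|torus. avg (U1 h) t x * \<Psi> t x\<bar> \<le> (\<integral>\<^sup>+s. ennreal (\<Sum>k\<in>F. \<Sum>n\<in>F'.
      norm (poly (p k) (of_real s)) * norm (poly (q n) (of_real t)) * (2 * K * ?k k (t - s) * lattice_wt (k + n))) * indicator {0..t} s \<partial>lborel)"
      by (rule slice_le_nn[OF W t' trig_cylf(4)[OF T tr(1)] b[OF t']])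
        (rule slice_bound_trig[OF H \<Psi> m], use t in auto)
    also have "\<dots> \<le> (\<integral>\<^sup>+s. (\<Sum>k\<in>F. \<Sum>n\<in>F'. ?w k n * ?P k t s + ?w' k n * ?Q k n t s) \<partial>lborel)"
    proof (rule nn_integral_mono)
      fix s
      show "ennreal (\<Sum>k\<in>F. \<Sum>n\<in>F'. norm (poly (p k) (of_real s)) * norm (poly (q n) (of_real t)) * (2 * K * ?k k (t - s) * lattice_wt (k + n))) * indicator {0..t} s
         \<le> (\<Sum>k\<in>F. \<Sum>n\<in>F'. ?w k n * ?P k t s + ?w' k n * ?Q k n t s)"
      proof (cases "s \<in> {0..t}")
        case True
        have k0: "0 \<le> ?k k (t - s)" for k using True by (intro time_kernel_nonneg) auto
        have "(\<Sum>k\<in>F. \<Sum>n\<in>F'. norm (poly (p k) (of_real s)) * norm (poly (q n) (of_real t)) * (2 * K * ?k k (t - s) * lattice_wt (k + n)))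
          \<le> (\<Sum>k\<in>F. \<Sum>n\<in>F'. K * \<mu> * lattice_wt (k + n) * (?c k s * ?k k (t - s)) + K / \<mu> * lattice_wt (k + n) * (?d n t * ?k k (t - s)))"
        proof (intro sum_mono)
          fix k n
          let ?a = "norm (poly (p k) (of_real s))" and ?e = "norm (poly (q n) (of_real t))"
          have "2 * (sqrt \<mu> * ?a) * (?e / sqrt \<mu>) \<le> (sqrt \<mu> * ?a)\<^sup>2 + (?e / sqrt \<mu>)\<^sup>2" by (rule sum_squares_bound)
          then have am: "2 * (?a * ?e) \<le> \<mu> * ?a\<^sup>2 + ?e\<^sup>2 / \<mu>" using \<mu> by (simp add: power_mult_distrib power_divide)
          have "?a * ?e * (2 * K * ?k k (t - s) * lattice_wt (k + n)) = (K * ?k k (t - s) * lattice_wt (k + n)) * (2 * (?a * ?e))"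
            by simp
          also have "\<dots> \<le> (K * ?k k (t - s) * lattice_wt (k + n)) * (\<mu> * ?a\<^sup>2 + ?e\<^sup>2 / \<mu>)"
            using K k0 by (intro mult_left_mono am mult_nonneg_nonneg lattice_wt_nonneg)
          finally show "?a * ?e * (2 * K * ?k k (t - s) * lattice_wt (k + n))
             \<le> K * \<mu> * lattice_wt (k + n) * (?c k s * ?k k (t - s)) + K / \<mu> * lattice_wt (k + n) * (?d n t * ?k k (t - s))"
            by (simp add: algebra_simps)
        qed
        then have "ennreal (\<Sum>k\<in>F. \<Sum>n\<in>F'. norm (poly (p k) (of_real s)) * norm (poly (q n) (of_real t)) * (2 * K * ?k k (t - s) * lattice_wt (k + n)))
          \<le> ennreal (\<Sum>k\<in>F. \<Sum>n\<in>F'. K * \<mu> * lattice_wt (k + n) * (?c k s * ?k k (t - s)) + K / \<mu> * lattice_wt (k + n) * (?d n t * ?k k (t - s)))"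
          by (rule ennreal_leI)
        also have "\<dots> = (\<Sum>k\<in>F. \<Sum>n\<in>F'. ?w k n * ?P k t s + ?w' k n * ?Q k n t s)"
        proof -
          have nn: "0 \<le> K * \<mu> * lattice_wt (k + n)" "0 \<le> K / \<mu> * lattice_wt (k + n)"
            "0 \<le> ?c k s * ?k k (t - s)" "0 \<le> ?d n t * ?k k (t - s)" for k n
            using K \<mu> k0 lattice_wt_nonneg by (auto intro!: mult_nonneg_nonneg divide_nonneg_nonneg)
          have "?w k n * ?P k t s + ?w' k n * ?Q k n t s
             = ennreal (K * \<mu> * lattice_wt (k + n) * (?c k s * ?k k (t - s)) + K / \<mu> * lattice_wt (k + n) * (?d n t * ?k k (t - s)))" for k n
            using ennreal_combine[OF nn(1)[of k n] nn(3)[of k] nn(2)[of k n] nn(4)[of n k]] True by simp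
          note eq = this
          show ?thesis
            unfolding eq by (rule ennreal_sum2) (intro add_nonneg_nonneg mult_nonneg_nonneg[OF nn(1,3)] mult_nonneg_nonneg[OF nn(2,4)])
        qed
        finally show ?thesis using True by simp
      qed simp
    qed
    also have "\<dots> = (\<Sum>k\<in>F. \<Sum>n\<in>F'. ?w k n * (\<integral>\<^sup>+s. ?P k t s \<partial>lborel) + ?w' k n * (\<integral>\<^sup>+s. ?Q k n t s \<partial>lborel))"
      by (simp add: nn_integral_sum nn_integral_add nn_integral_cmult)
    finally show ?thesis .
  qed
  \<comment> \<open>The interval [0,t] moves with the outer variable; written as inequalities its
    indicator is jointly measurable in t and s.\<close>
  have [measurable]: "(\<lambda>t. \<integral>\<^sup>+s. ?P k t s \<partial>lborel) \<in> borel_measurable borel" "(\<lambda>t. \<integral>\<^sup>+s. ?Q k n t s \<partial>lborel) \<in> borel_measurable borel" for k n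
    unfolding indicator_def atLeastAtMost_iff by measurable
  have "ennreal \<bar>form (U1 h) \<Psi>\<bar> \<le> (\<integral>\<^sup>+t\<in>{0<..<T}. ennreal \<bar>LINT x|torus. avg (U1 h) t x * \<Psi> t x\<bar> \<partial>lborel)"
    by (rule form_le[OF W tr(1)])
  also have "\<dots> \<le> (\<integral>\<^sup>+t. (\<Sum>k\<in>F. \<Sum>n\<in>F'. ?w k n * ((\<integral>\<^sup>+s. ?P k t s \<partial>lborel) * indicator {0<..<T} t) + ?w' k n * ((\<integral>\<^sup>+s. ?Q k n t s \<partial>lborel) * indicator {0<..<T} t)) \<partial>lborel)"
  proof (rule nn_integral_mono)
    fix t
    show "ennreal \<bar>LINT x|torus. avg (U1 h) t x * \<Psi> t x\<bar> * indicator {0<..<T} t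
      \<le> (\<Sum>k\<in>F. \<Sum>n\<in>F'. ?w k n * ((\<integral>\<^sup>+s. ?P k t s \<partial>lborel) * indicator {0<..<T} t) + ?w' k n * ((\<integral>\<^sup>+s. ?Q k n t s \<partial>lborel) * indicator {0<..<T} t))"
      using slice[of t] by (cases "t \<in> {0<..<T}") auto
  qed
  also have "\<dots> = (\<Sum>k\<in>F. \<Sum>n\<in>F'. ?w k n * (\<integral>\<^sup>+t\<in>{0<..<T}. (\<integral>\<^sup>+s. ?P k t s \<partial>lborel) \<partial>lborel) + ?w' k n * (\<integral>\<^sup>+t\<in>{0<..<T}. (\<integral>\<^sup>+s. ?Q k n t s \<partial>lborel) \<partial>lborel))"
    by (simp add: nn_integral_sum nn_integral_add nn_integral_cmult)
  also have "\<dots> \<le> (\<Sum>k\<in>F. \<Sum>n\<in>F'. ?w k n * (ennreal (1/2) * (\<integral>\<^sup>+s\<in>{0<..<T}. ennreal (?c k s) \<partial>lborel)) + ?w' k n * (ennreal (1/2) * (\<integral>\<^sup>+t\<in>{0<..<T}. ennreal (?d n t) \<partial>lborel)))"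
    by (intro sum_mono add_mono mult_left_mono schur_time) auto
  also have "\<dots> = (\<Sum>k\<in>F. (\<Sum>n\<in>F'. ?w k n) * (ennreal (1/2) * (\<integral>\<^sup>+s\<in>{0<..<T}. ennreal (?c k s) \<partial>lborel)))
     + (\<Sum>n\<in>F'. (\<Sum>k\<in>F. ?w' k n) * (ennreal (1/2) * (\<integral>\<^sup>+t\<in>{0<..<T}. ennreal (?d n t) \<partial>lborel)))"
    by (rule sum_split_swap)
  also have "\<dots> \<le> (\<Sum>k\<in>F. ennreal (K * \<mu> * S) * (ennreal (1/2) * (\<integral>\<^sup>+s\<in>{0<..<T}. ennreal (?c k s) \<partial>lborel)))
     + (\<Sum>n\<in>F'. ennreal (K / \<mu> * S) * (ennreal (1/2) * (\<integral>\<^sup>+t\<in>{0<..<T}. ennreal (?d n t) \<partial>lborel)))"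
  proof -
    \<comment> \<open>Translation in the lattice permutes indices, so the same \<open>S\<close>
      bounds row sums and column sums.\<close>
    have sh: "(\<Sum>n\<in>G. lattice_wt (k + n)) \<le> S" "(\<Sum>n\<in>G. lattice_wt (n + k)) \<le> S" if "finite G" for G and k :: "int^'n"
      using S(2)[of "(+) k ` G"] that by (simp_all add: sum.reindex add.commute[of _ k])
    have "(\<Sum>n\<in>F'. ?w k n) \<le> ennreal (K * \<mu> * S)" for k
      by (rule sum_ennreal_cmult[OF _ lattice_wt_nonneg sh(1)[OF fin(2)]]) (use K \<mu> in simp)
    moreover have "(\<Sum>k\<in>F. ?w' k n) \<le> ennreal (K / \<mu> * S)" for n
      by (rule sum_ennreal_cmult[OF _ lattice_wt_nonneg sh(2)[OF fin(1)]]) (use K \<mu> in simp)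
    ultimately show ?thesis by (intro add_mono sum_mono mult_right_mono) auto
  qed
  also have "\<dots> = ennreal (K * \<mu> * S) * (ennreal (1/2) * ennreal (?X\<^sup>2)) + ennreal (K / \<mu> * S) * (ennreal (1/2) * ennreal (?Y\<^sup>2))"
    unfolding sum_distrib_left[symmetric] trig_norm_eq[OF H(1)] trig_norm_eq[OF \<Phi>] ..
  also have "\<dots> = ennreal (K * S / 2 * (\<mu> * ?X\<^sup>2 + ?Y\<^sup>2 / \<mu>))"
  proof -
    have h: "ennreal (1/2) * ennreal x = ennreal (x / 2)" if "0 \<le> x" for x
      using that by (subst ennreal_mult[symmetric]) auto
    have "ennreal (K * \<mu> * S) * ennreal (?X\<^sup>2 / 2) + ennreal (K / \<mu> * S) * ennreal (?Y\<^sup>2 / 2)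
       = ennreal (K * \<mu> * S * (?X\<^sup>2 / 2) + K / \<mu> * S * (?Y\<^sup>2 / 2))"
      using K S \<mu> by (intro ennreal_combine) auto
    also have "K * \<mu> * S * (?X\<^sup>2 / 2) + K / \<mu> * S * (?Y\<^sup>2 / 2) = K * S / 2 * (\<mu> * ?X\<^sup>2 + ?Y\<^sup>2 / \<mu>)"
      by (simp add: algebra_simps)
    finally show ?thesis by (simp only: h[OF zero_le_power2])
  qed
  finally show "\<bar>form (U1 h) \<Psi>\<bar> \<le> K * S / 2 * (\<mu> * ?X\<^sup>2 + ?Y\<^sup>2 / \<mu>)"
    using K S \<mu> by (subst (asm) ennreal_le_iff) (auto intro!: mult_nonneg_nonneg add_nonneg_nonneg)
qed auto

end

subsection \<open>Estimates for regular functions\<close>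

lemma trig_dense_cylf:
  fixes f :: "real \<times> (real^'n) \<Rightarrow> real"
  assumes T: "0 < T" and f: "sqint (cyl T) f" and e: "0 < e"
  shows "\<exists>\<phi>. trig \<phi> \<and> l2n (cyl T) (\<lambda>z. f z - cylf T \<phi> z) < e"
proof -
  obtain \<phi> where \<phi>: "trig \<phi>" "sqint (cyl T) (\<lambda>z. \<phi> (fst z) (snd z))" "l2n (cyl T) (\<lambda>z. f z - \<phi> (fst z) (snd z)) < e"
    using trig_dense[OF T f e] by blast
  have "(LINT z|cyl T. (f z - cylf T \<phi> z)\<^sup>2) = (LINT z|cyl T. (f z - \<phi> (fst z) (snd z))\<^sup>2)"
  proof (rule integral_cong_AE)
    show "AE z in cyl T. (f z - cylf T \<phi> z)\<^sup>2 = (f z - \<phi> (fst z) (snd z))\<^sup>2"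
      using AE_cyl[of T] by eventually_elim (simp add: cylf_def)
  qed (use f \<phi>(2) trig_cylf(1)[OF T \<phi>(1)] in \<open>auto simp: sqint_def\<close>)
  then have "l2n (cyl T) (\<lambda>z. f z - cylf T \<phi> z) < e" using \<phi>(3) by (simp add: l2n_def)
  then show ?thesis using \<phi>(1) by blast
qed

lemma cylf_diff: "cylf T (\<lambda>t x. H t x - H' t x) = (\<lambda>z. cylf T H z - cylf T H' z)"
  by (simp add: cylf_def fun_eq_iff right_diff_distrib)

lemma l2n_dual_trig:
  fixes f :: "real \<times> (real^'n) \<Rightarrow> real"
  assumes T: "0 < T" and f: "sqint (cyl T) f" and A: "0 \<le> A"
    and le: "\<And>\<Phi>. trig \<Phi> \<Longrightarrow> \<bar>LINT z|cyl T. f z * cylf T \<Phi> z\<bar> \<le> A * l2n (cyl T) (cylf T \<Phi>)"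
  shows "l2n (cyl T) f \<le> A"
proof (rule l2n_dual[OF f A, of "{cylf T \<Phi> |\<Phi>. trig \<Phi>}"])
  show "\<exists>\<phi>\<in>{cylf T \<Phi> |\<Phi>. trig \<Phi>}. sqint (cyl T) \<phi> \<and> l2n (cyl T) (\<lambda>x. f x - \<phi> x) < e" if "0 < e" for e
    using trig_dense_cylf[OF T f that] trig_cylf(1)[OF T] by blast
qed (use le in auto)

lemma trig_reg:
  assumes "0 < T" "trig \<phi>"
  shows "\<exists>hj. reg T \<phi> (\<lambda>t. grad (\<phi> t)) hj"
  by (rule smooth_periodic_reg[OF trig_smooth_periodic[OF assms]])

lemma le_of_all_eps:
  fixes a b c :: real
  assumes c: "0 \<le> c" and le: "\<And>e. 0 < e \<Longrightarrow> a \<le> b + e * c"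
  shows "a \<le> b"
proof (rule field_le_epsilon)
  fix e :: real assume e: "0 < e"
  have "a \<le> b + e / (c + 1) * c" using e c by (intro le) simp
  also have "e / (c + 1) * c \<le> e" using e c by (simp add: divide_simps)
  finally show "a \<le> b + e" by simp
qed

context avg_kernel
begin

text \<open>Continuity in L2 for a fixed test function, from \<open>adjoint_bound\<close> at each
  pair of times and Cauchy-Schwarz in time. The constant depends on \<Psi> and T and serves only to
  pass to the limit in H.\<close>

lemma form_continuous:
  assumes "trig_rep F p \<Psi>"
  shows "\<exists>C\<ge>0. \<forall>H h hj. reg T H h hj \<longrightarrow> \<bar>form (U1 h) \<Psi>\<bar> \<le> C * l2n (cyl T) (cylf T H)"
proof -
  have tr: "trig \<Psi>" using assms by (auto simp: trig_def)
  have "\<forall>q. \<exists>f'. trig f' \<and> (\<forall>t. has_dderiv (\<Psi> t) (axis q 1) (f' t))"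
    using trig_dderiv[OF assms] unfolding trig_def by blast
  then obtain D where D: "\<And>q. trig (D q)" "\<And>q t. has_dderiv (\<Psi> t) (axis q 1) (D q t)" by metis
  obtain b0 where b0: "b0 \<ge> 0" "\<And>t x. t \<in> {0..T} \<Longrightarrow> \<bar>\<Psi> t x\<bar> \<le> b0" using trig_cylf(2)[OF T tr] by blast
  have "\<forall>q. \<exists>b\<ge>0. \<forall>t\<in>{0..T}. \<forall>x. \<bar>D q t x\<bar> \<le> b" using trig_cylf(2)[OF T D(1)] by blast
  then obtain bq where bq: "\<And>q. bq q \<ge> 0" "\<And>q t x. t \<in> {0..T} \<Longrightarrow> \<bar>D q t x\<bar> \<le> bq q" by metis
  \<comment> \<open>A common bound for \<Psi> and all its first derivatives in x.\<close>
  define b where "b = b0 + sum bq UNIV"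
  have bq_le: "bq q \<le> sum bq UNIV" for q using bq(1) by (intro member_le_sum) auto
  have bn: "0 \<le> b" "b0 \<le> b" "\<And>q. bq q \<le> b"
    using b0(1) bq(1) bq_le by (auto simp: b_def sum_nonneg intro: add_increasing)
  define C1 where "C1 = real CARD('n) * (sqrt (wt_mass TYPE('n) \<sigma>) * (2 * b * B))"
  have C1: "0 \<le> C1" using bn(1) B by (simp add: C1_def)
  have "\<bar>form (U1 h) \<Psi>\<bar> \<le> (C1 * sqrt T * T) * l2n (cyl T) (cylf T H)" if H: "reg T H h hj" for H h hj
  proof -
    obtain W where W: "adm (U1 h) W" using adm_U(1)[OF H] by blast
    note CH = reg_cylf[OF T H]
    let ?N = "l2n (cyl T) (cylf T H)"
    \<comment> \<open>On the open interval this is the L2 norm of \<open>H s\<close>; passing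
      through \<open>cylf\<close> makes it a Borel function on the whole line.\<close>
    define a where "a s = l2n torus (\<lambda>x. cylf T H (s, x))" for s
    have am [measurable]: "a \<in> borel_measurable borel"
    proof -
      have "(\<lambda>(s, x). (cylf T H (s, x))\<^sup>2) \<in> borel_measurable (borel \<Otimes>\<^sub>M torus)"
        unfolding measurable_cong_sets[OF sets_pair_borel[OF refl sets_torus] refl] case_prod_unfold prod.collapse
        using CH(1) by measurable
      from torus.borel_measurable_lebesgue_integral[OF this] show ?thesis
        unfolding a_def l2n_def by measurable
    qed
    have slice: "\<bar>LINT z|phase. U1 h t s z * \<Psi> t (fst z)\<bar> \<le> C1 * l2n torus (H s)" if "0 \<le> s" "s \<le> t" "t \<le> T" for s t
      unfolding C1_def
    proof (rule adjoint_bound[OF H that trig_cylf(3)[OF T tr] periodic_trig[OF tr] D(2) trig_cylf(3)[OF T D(1)]])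
      have t: "t \<in> {0..T}" using that by simp
      show "\<bar>\<Psi> t x\<bar> \<le> b" for x using b0(2)[OF t, of x] bn(2) by linarith
      show "\<bar>D q t x\<bar> \<le> b" for q x using bq(2)[OF t, of q x] bn(3)[of q] by linarith
    qed
    have A: "(\<integral>\<^sup>+s\<in>{0..T}. ennreal (l2n torus (H s)) \<partial>lborel) \<le> ennreal (sqrt T * ?N)"
    proof (rule power2_le_imp_le_ennreal)
      have "(\<integral>\<^sup>+s\<in>{0..T}. ennreal (l2n torus (H s)) \<partial>lborel) = (\<integral>\<^sup>+s. indicator {0<..<T} s * ennreal (a s) \<partial>lborel)"
        unfolding nn_integral_Icc_Ioo
        by (intro nn_integral_cong) (auto simp: a_def cylf_def indicator_def)
      also have "\<dots>\<^sup>2 = (\<integral>\<^sup>+s. indicator {0<..<T} s * (indicator {0<..<T} s * ennreal (a s)) \<partial>lborel)\<^sup>2"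
        by (intro arg_cong[of _ _ "\<lambda>x. x\<^sup>2"] nn_integral_cong) (auto simp: indicator_def)
      also have "\<dots> \<le> (\<integral>\<^sup>+s. (indicator {0<..<T} s)\<^sup>2 \<partial>lborel) * (\<integral>\<^sup>+s. (indicator {0<..<T} s * ennreal (a s))\<^sup>2 \<partial>lborel)"
        by (rule Cauchy_Schwarz_nn_integral) measurable
      also have "(\<integral>\<^sup>+s. (indicator {0<..<T} s)\<^sup>2 \<partial>lborel) = ennreal T"
        using T by (simp add: power2_eq_square flip: indicator_inter_arith)
      also have "(\<integral>\<^sup>+s. (indicator {0<..<T} s * ennreal (a s))\<^sup>2 \<partial>lborel) = (\<integral>\<^sup>+s\<in>{0<..<T}. (\<integral>\<^sup>+x. ennreal ((H s x)\<^sup>2) \<partial>torus) \<partial>lborel)"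
      proof (intro nn_integral_cong)
        fix s
        show "(indicator {0<..<T} s * ennreal (a s))\<^sup>2 = (\<integral>\<^sup>+x. ennreal ((H s x)\<^sup>2) \<partial>torus) * indicator {0<..<T} s"
        proof (cases "s \<in> {0<..<T}")
          case True
          then have "s \<in> {0..T}" by simp
          from sqint_nn_integral[OF CH(3)[OF this]] True show ?thesis
            by (simp add: a_def cylf_def ennreal_power)
        qed simp
      qed
      also have "\<dots> = ennreal (?N\<^sup>2)"
        using nn_integral_cylf[OF CH(1)] sqint_nn_integral[OF CH(2)] by simp
      also have "ennreal T * ennreal (?N\<^sup>2) = (ennreal (sqrt T * ?N))\<^sup>2"
        using T by (simp add: ennreal_mult[symmetric] ennreal_power power_mult_distrib)
      finally show "(\<integral>\<^sup>+s\<in>{0..T}. ennreal (l2n torus (H s)) \<partial>lborel)\<^sup>2 \<le> (ennreal (sqrt T * ?N))\<^sup>2" .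
    qed
    have sl: "ennreal \<bar>LINT x|torus. avg (U1 h) t x * \<Psi> t x\<bar> \<le> ennreal (C1 * (sqrt T * ?N))" if t: "t \<in> {0..T}" for t
    proof -
      have "ennreal \<bar>LINT x|torus. avg (U1 h) t x * \<Psi> t x\<bar> \<le> (\<integral>\<^sup>+s. ennreal (C1 * l2n torus (H s)) * indicator {0..t} s \<partial>lborel)"
        by (rule slice_le_nn[OF W t trig_cylf(4)[OF T tr] b0(2)[OF t]]) (use slice t in auto)
      also have "\<dots> \<le> (\<integral>\<^sup>+s. ennreal C1 * (ennreal (l2n torus (H s)) * indicator {0..T} s) \<partial>lborel)"
        using t C1 by (intro nn_integral_mono) (auto simp: indicator_def ennreal_mult)
      also have "\<dots> = (\<integral>\<^sup>+s. ennreal C1 * (ennreal (a s) * indicator {0<..<T} s) \<partial>lborel)"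
      proof (rule nn_integral_cong_AE)
        show "AE s in lborel. ennreal C1 * (ennreal (l2n torus (H s)) * indicator {0..T} s) = ennreal C1 * (ennreal (a s) * indicator {0<..<T} s)"
          using AE_lborel_singleton[of 0] AE_lborel_singleton[of T]
          by eventually_elim (auto simp: indicator_def a_def cylf_def)
      qed
      also have "\<dots> = ennreal C1 * (\<integral>\<^sup>+s. ennreal (a s) * indicator {0<..<T} s \<partial>lborel)"
        by (rule nn_integral_cmult) measurable
      also have "(\<integral>\<^sup>+s. ennreal (a s) * indicator {0<..<T} s \<partial>lborel) = (\<integral>\<^sup>+s\<in>{0..T}. ennreal (l2n torus (H s)) \<partial>lborel)"
        unfolding nn_integral_Icc_Ioo
        by (intro nn_integral_cong) (auto simp: a_def cylf_def indicator_def)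
      also have "ennreal C1 * \<dots> \<le> ennreal C1 * ennreal (sqrt T * ?N)" by (intro mult_left_mono A) simp
      also have "\<dots> = ennreal (C1 * (sqrt T * ?N))" using C1 by (simp add: ennreal_mult')
      finally show ?thesis .
    qed
    have "ennreal \<bar>form (U1 h) \<Psi>\<bar> \<le> (\<integral>\<^sup>+t\<in>{0<..<T}. ennreal \<bar>LINT x|torus. avg (U1 h) t x * \<Psi> t x\<bar> \<partial>lborel)"
      by (rule form_le[OF W tr])
    also have "\<dots> \<le> (\<integral>\<^sup>+t\<in>{0<..<T}. ennreal (C1 * (sqrt T * ?N)) \<partial>lborel)"
      by (rule nn_integral_mono) (use sl in \<open>auto simp: indicator_def\<close>)
    also have "\<dots> = ennreal (C1 * (sqrt T * ?N) * T)"
      using T C1 by (simp add: nn_integral_cmult ennreal_mult)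
    finally show ?thesis
      using T C1 by (subst (asm) ennreal_le_iff) (auto simp: mult_ac)
  qed
  moreover have "0 \<le> C1 * sqrt T * T" using C1 T by simp
  ultimately show ?thesis by blast
qed

lemma U1_diff: "U1 (\<lambda>t x. h t x - h' t x) = (\<lambda>t s z. U1 h t s z - U1 h' t s z)"
  by (simp add: U1_def fun_eq_iff inner_diff_left)

text \<open>H is replaced by a trigonometric polynomial within \<open>e\<close> in L2. The
  difference costs at most C e by \<open>form_continuous\<close>, and since \<Psi> stays fixed while
  e tends to 0, its large constant disappears.\<close>

lemma form_bound_reg:
  assumes H: "reg T H h hj" and \<Phi>: "trig_rep F' q \<Phi>" and \<Psi>: "trig_rep F' (\<lambda>n. smult (m n) (q n)) \<Psi>"
    and m: "\<And>n. norm (m n) \<le> 1 + norm (emb n)"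
    and S: "0 \<le> S" "\<And>F. finite F \<Longrightarrow> (\<Sum>l\<in>F. lattice_wt (l :: int^'n)) \<le> S"
  shows "\<bar>form (U1 h) \<Psi>\<bar> \<le> K * S * l2n (cyl T) (cylf T H) * l2n (cyl T) (cylf T \<Phi>)"
proof -
  let ?X = "l2n (cyl T) (cylf T H)" and ?Y = "l2n (cyl T) (cylf T \<Phi>)"
  obtain C where C: "C \<ge> 0" "\<And>H h hj. reg T H h hj \<Longrightarrow> \<bar>form (U1 h) \<Psi>\<bar> \<le> C * l2n (cyl T) (cylf T H)"
    using form_continuous[OF \<Psi>] by blast
  have tr: "trig \<Psi>" using \<Psi> by (auto simp: trig_def)
  show ?thesis
  proof (rule le_of_all_eps[where c = "C + K * S * ?Y"])
    show "0 \<le> C + K * S * ?Y" using C K S by simp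
    fix e :: real assume e: "0 < e"
    obtain \<phi> where \<phi>: "trig \<phi>" "l2n (cyl T) (\<lambda>z. cylf T H z - cylf T \<phi> z) < e"
      using trig_dense_cylf[OF T reg_cylf(2)[OF T H] e] by blast
    obtain kj where k: "reg T \<phi> (\<lambda>t. grad (\<phi> t)) kj" using trig_reg[OF T \<phi>(1)] by blast
    obtain F p where F: "trig_rep F p \<phi>" using \<phi>(1) by (auto simp: trig_def)
    note d = reg_diff[OF H k]
    obtain W W' W'' where W: "adm (U1 h) W" "adm (U1 (\<lambda>t. grad (\<phi> t))) W'" "adm (U1 (\<lambda>t x. h t x - grad (\<phi> t) x)) W''"
      using adm_U(1)[OF H] adm_U(1)[OF k] adm_U(1)[OF d] by blast
    have "form (U1 (\<lambda>t x. h t x - grad (\<phi> t) x)) \<Psi> = form (U1 h) \<Psi> - form (U1 (\<lambda>t. grad (\<phi> t))) \<Psi>"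
      using form_diff[OF W(1,2) _ tr] W(3) unfolding U1_diff by blast
    then have "\<bar>form (U1 h) \<Psi>\<bar> \<le> \<bar>form (U1 (\<lambda>t x. h t x - grad (\<phi> t) x)) \<Psi>\<bar> + \<bar>form (U1 (\<lambda>t. grad (\<phi> t))) \<Psi>\<bar>"
      by linarith
    also have "\<dots> \<le> C * l2n (cyl T) (cylf T (\<lambda>t x. H t x - \<phi> t x)) + K * S * l2n (cyl T) (cylf T \<phi>) * ?Y"
      by (intro add_mono C(2)[OF d] form_bound_trig[OF F k \<Phi> \<Psi> m S])
    also have "\<dots> \<le> C * e + K * S * (?X + e) * ?Y"
    proof (intro add_mono mult_left_mono mult_right_mono)
      show "l2n (cyl T) (cylf T (\<lambda>t x. H t x - \<phi> t x)) \<le> e" using \<phi>(2) by (simp add: cylf_diff)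
      show "l2n (cyl T) (cylf T \<phi>) \<le> ?X + e"
        using l2n_le_add[OF reg_cylf(2)[OF T k] reg_cylf(2)[OF T H]] \<phi>(2) l2n_minus_commute[of "cyl T" "cylf T H" "cylf T \<phi>"]
        by simp
    qed (use C K S in auto)
    also have "\<dots> = K * S * ?X * ?Y + e * (C + K * S * ?Y)" by (simp add: algebra_simps)
    finally show "\<bar>form (U1 h) \<Psi>\<bar> \<le> K * S * ?X * ?Y + e * (C + K * S * ?Y)" .
  qed
qed

text \<open>Pairing the derivative with \<Phi> is pairing the function with the derivative of
  \<Phi>, so the gradient bound becomes a bound for the same form with multiplier i n_j.\<close>

lemma form_U2:
  assumes H: "reg T H h hj" and \<Phi>: "trig \<Phi>" "trig \<Phi>'" "\<And>t. has_dderiv (\<Phi> t) (axis j 1) (\<Phi>' t)"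
  shows "form (U2 h hj j) \<Phi> = - form (U1 h) \<Phi>'"
proof -
  obtain W W' where W: "adm (U1 h) W" "adm (U2 h hj j) W'" using adm_U[OF H] by blast
  note F = form_fubini[OF W(2) \<Phi>(1)] form_fubini[OF W(1) \<Phi>(2)]
  have "form (U2 h hj j) \<Phi> = (LINT t|time_measure T. - (LINT x|torus. cylf T (avg (U1 h)) (t, x) * cylf T \<Phi>' (t, x)))"
    unfolding F(1)
  proof (rule integral_cong_AE)
    show "AE t in time_measure T. (LINT x|torus. cylf T (avg (U2 h hj j)) (t, x) * cylf T \<Phi> (t, x))
       = - (LINT x|torus. cylf T (avg (U1 h)) (t, x) * cylf T \<Phi>' (t, x))"
      using AE_time_measure
    proof eventually_elim
      case (elim t)
      then have t: "t \<in> {0..T}" by simp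
      show ?case
        using avg_weak_deriv[OF H t trig_cylf(3)[OF T \<Phi>(1)] periodic_trig[OF \<Phi>(1)] \<Phi>(3) trig_cylf(3)[OF T \<Phi>(2)]] elim
        by (simp add: cylf_def)
    qed
  qed (use F(2,4) in \<open>auto dest: borel_measurable_integrable\<close>)
  then show ?thesis using F by simp
qed

text \<open>The two functions whose \<open>L\<^sup>2\<close> norms control the \<open>H\<^sup>1\<close> norm obey the same bound, and so do their
  differences; both are read off from the bilinear form by duality.\<close>

lemma avg_bound:
  assumes S: "0 \<le> S" "\<And>F. finite F \<Longrightarrow> (\<Sum>l\<in>F. lattice_wt (l :: int^'n)) \<le> S" and H: "reg T H h hj"
  shows "l2n (cyl T) (cylf T (avg (U1 h))) \<le> K * S * l2n (cyl T) (cylf T H)"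
    and "l2n (cyl T) (cylf T (avg (U2 h hj j))) \<le> K * S * l2n (cyl T) (cylf T H)"
proof -
  obtain W W' where W: "adm (U1 h) W" "adm (U2 h hj j) W'" using adm_U[OF H] by blast
  have A: "0 \<le> K * S * l2n (cyl T) (cylf T H)" using K S by simp
  have b1: "\<bar>form (U1 h) \<Phi>\<bar> \<le> K * S * l2n (cyl T) (cylf T H) * l2n (cyl T) (cylf T \<Phi>)" if "trig \<Phi>" for \<Phi>
  proof -
    obtain F q where q: "trig_rep F q \<Phi>" using \<open>trig \<Phi>\<close> by (auto simp: trig_def)
    show ?thesis by (rule form_bound_reg[OF H q _ _ S, of "\<lambda>_. 1"]) (use q in auto)
  qed
  have b2: "\<bar>form (U2 h hj j) \<Phi>\<bar> \<le> K * S * l2n (cyl T) (cylf T H) * l2n (cyl T) (cylf T \<Phi>)" if \<Phi>: "trig \<Phi>" for \<Phi>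
  proof -
    obtain F q where q: "trig_rep F q \<Phi>" using \<open>trig \<Phi>\<close> by (auto simp: trig_def)
    obtain \<Phi>' where \<Phi>': "trig_rep F (\<lambda>k. smult (\<i> * of_int (k $ j)) (q k)) \<Phi>'" "\<And>t. has_dderiv (\<Phi> t) (axis j 1) (\<Phi>' t)"
      using trig_dderiv[OF q] by blast
    have "trig \<Phi>'" using \<Phi>'(1) by (auto simp: trig_def)
    have "norm (\<i> * of_int (k $ j)) \<le> 1 + norm (emb k)" for k
      using component_le_norm_cart[of "emb k" j] by (simp add: norm_mult)
    from form_bound_reg[OF H q \<Phi>'(1) this S] show ?thesis
      by (simp add: form_U2[OF H \<Phi> \<open>trig \<Phi>'\<close> \<Phi>'(2)])
  qed
  show "l2n (cyl T) (cylf T (avg (U1 h))) \<le> K * S * l2n (cyl T) (cylf T H)"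
    by (rule l2n_dual_trig[OF T sqint_cylf_avg[OF W(1)] A]) (use b1 in \<open>simp add: form_def\<close>)
  show "l2n (cyl T) (cylf T (avg (U2 h hj j))) \<le> K * S * l2n (cyl T) (cylf T H)"
    by (rule l2n_dual_trig[OF T sqint_cylf_avg[OF W(2)] A]) (use b2 in \<open>simp add: form_def\<close>)
qed

lemma U2_diff: "U2 (\<lambda>t x. h t x - h' t x) (\<lambda>j t x. hj j t x - hj' j t x) j = (\<lambda>t s z. U2 h hj j t s z - U2 h' hj' j t s z)"
  by (simp add: U2_def fun_eq_iff inner_diff_left)

text \<open>The difference of two averages need not be pointwise the average of the difference, so
  duality is used once more: paired with test functions the two agree.\<close>

lemma avg_diff_bound:
  assumes S: "0 \<le> S" "\<And>F. finite F \<Longrightarrow> (\<Sum>l\<in>F. lattice_wt (l :: int^'n)) \<le> S"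
    and H: "reg T H h hj" "reg T H' h' hj'"
  shows "l2n (cyl T) (\<lambda>z. cylf T (avg (U1 h)) z - cylf T (avg (U1 h')) z)
      \<le> K * S * l2n (cyl T) (\<lambda>z. cylf T H z - cylf T H' z)"
    and "l2n (cyl T) (\<lambda>z. cylf T (avg (U2 h hj j)) z - cylf T (avg (U2 h' hj' j)) z)
      \<le> K * S * l2n (cyl T) (\<lambda>z. cylf T H z - cylf T H' z)"
proof -
  note d = reg_diff[OF H]
  have eq: "l2n (cyl T) (\<lambda>z. cylf T (avg U) z - cylf T (avg U') z) \<le> K * S * l2n (cyl T) (\<lambda>z. cylf T H z - cylf T H' z)"
    if U: "adm U W" "adm U' W'" "adm (\<lambda>t s z. U t s z - U' t s z) W''"
      and le: "l2n (cyl T) (cylf T (avg (\<lambda>t s z. U t s z - U' t s z))) \<le> K * S * l2n (cyl T) (cylf T (\<lambda>t x. H t x - H' t x))" for U U' W W' W''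
  proof (rule l2n_dual_trig[OF T])
    note s = sqint_cylf_avg[OF U(1)] sqint_cylf_avg[OF U(2)] sqint_cylf_avg[OF U(3)]
    show "sqint (cyl T) (\<lambda>z. cylf T (avg U) z - cylf T (avg U') z)" by (rule sqint_diff[OF s(1,2)])
    show "0 \<le> K * S * l2n (cyl T) (\<lambda>z. cylf T H z - cylf T H' z)" using K S by simp
    fix \<Phi> :: "real \<Rightarrow> real^'n \<Rightarrow> real" assume \<Phi>: "trig \<Phi>"
    note \<phi> = trig_cylf(1)[OF T \<Phi>]
    have "(LINT z|cyl T. (cylf T (avg U) z - cylf T (avg U') z) * cylf T \<Phi> z) = form U \<Phi> - form U' \<Phi>"
      using sqint_mult[OF s(1) \<phi>] sqint_mult[OF s(2) \<phi>] by (simp add: form_def left_diff_distrib)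
    also have "\<dots> = form (\<lambda>t s z. U t s z - U' t s z) \<Phi>" by (rule form_diff[OF U \<Phi>, symmetric])
    also have "\<bar>\<dots>\<bar> \<le> l2n (cyl T) (cylf T (avg (\<lambda>t s z. U t s z - U' t s z))) * l2n (cyl T) (cylf T \<Phi>)"
      unfolding form_def by (rule l2n_cauchy_schwarz[OF s(3) \<phi>])
    also have "\<dots> \<le> K * S * l2n (cyl T) (\<lambda>z. cylf T H z - cylf T H' z) * l2n (cyl T) (cylf T \<Phi>)"
      using le by (intro mult_right_mono) (simp_all add: cylf_diff)
    finally show "\<bar>LINT z|cyl T. (cylf T (avg U) z - cylf T (avg U') z) * cylf T \<Phi> z\<bar>
       \<le> K * S * l2n (cyl T) (\<lambda>z. cylf T H z - cylf T H' z) * l2n (cyl T) (cylf T \<Phi>)" .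
  qed
  obtain W1 W1' W1'' W2 W2' W2'' where W: "adm (U1 h) W1" "adm (U1 h') W1'" "adm (U1 (\<lambda>t x. h t x - h' t x)) W1''"
    "adm (U2 h hj j) W2" "adm (U2 h' hj' j) W2'" "adm (U2 (\<lambda>t x. h t x - h' t x) (\<lambda>j t x. hj j t x - hj' j t x) j) W2''"
    using adm_U[OF H(1)] adm_U[OF H(2)] adm_U[OF d] by meson
  show "l2n (cyl T) (\<lambda>z. cylf T (avg (U1 h)) z - cylf T (avg (U1 h')) z) \<le> K * S * l2n (cyl T) (\<lambda>z. cylf T H z - cylf T H' z)"
    by (rule eq[OF W(1,2) W(3)[unfolded U1_diff] avg_bound(1)[OF S d, unfolded U1_diff]])
  show "l2n (cyl T) (\<lambda>z. cylf T (avg (U2 h hj j)) z - cylf T (avg (U2 h' hj' j)) z) \<le> K * S * l2n (cyl T) (\<lambda>z. cylf T H z - cylf T H' z)"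
    by (rule eq[OF W(4,5) W(6)[unfolded U2_diff] avg_bound(2)[OF S d, unfolded U2_diff]])
qed

lemma periodic_avg:
  assumes H: "reg T H h hj" and t: "t \<in> {0..T}"
  shows "periodic (avg (U1 h) t)"
  unfolding periodic_def
proof (intro allI)
  fix x i
  have "indicator {0..t} s * U1 h t s (x + axis i (2 * pi), v) = indicator {0..t} s * U1 h t s (x, v)" for s v
  proof (cases "s \<in> {0..t}")
    case True
    then have s: "s \<in> {0..T}" using t by auto
    show ?thesis
      using kernel_shift_periodic[OF reg_periodic(2)[OF H s] t s] per[OF t s]
      by (simp add: xperiodic_def periodic_def U1_def)
  qed simp
  then show "avg (U1 h) t (x + axis i (2 * pi)) = avg (U1 h) t x" unfolding avg_eq[OF t] by (simp only:)
qed

end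

subsection \<open>Extension by density and the smoothing estimate\<close>

lemma sqrt_ennreal_sq: "(sqrt_ennreal a)\<^sup>2 = a"
  by (cases a) (auto simp: sqrt_ennreal_def ennreal_power top_power_ennreal)

lemma sqrt_ennreal_mono: "a \<le> b \<Longrightarrow> sqrt_ennreal a \<le> sqrt_ennreal b"
  by (rule power2_le_imp_le_ennreal) (simp add: sqrt_ennreal_sq)

lemma sqrt_ennreal_square: "0 \<le> x \<Longrightarrow> sqrt_ennreal (ennreal (x\<^sup>2)) = ennreal x"
  by (simp add: sqrt_ennreal_def)

lemma cyl_borel: "f \<in> borel_measurable (cyl T) \<longleftrightarrow> f \<in> borel_measurable borel"
  by (simp add: measurable_cong_sets[OF sets_cyl refl])

lemma L2L2_norm_eq:
  assumes "cylf T u \<in> borel_measurable borel"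
  shows "L2L2_norm T u = sqrt_ennreal (\<integral>\<^sup>+z. ennreal ((cylf T u z)\<^sup>2) \<partial>cyl T)"
  unfolding nn_integral_cylf[OF assms] by (simp add: L2_time_norm_def L2_norm_torus_def sqrt_ennreal_sq)

lemma L2L2_norm_sqint:
  assumes "sqint (cyl T) (cylf T u)"
  shows "L2L2_norm T u = ennreal (l2n (cyl T) (cylf T u))"
  using L2L2_norm_eq[of T u] assms sqint_nn_integral[OF assms]
  by (simp add: sqint_def cyl_borel sqrt_ennreal_square)

lemma L2L2_sqint:
  fixes H :: "real \<Rightarrow> real^'n \<Rightarrow> real"
  assumes "H \<in> L2L2 T"
  shows "sqint (cyl T) (cylf T H)"
proof -
  have eq: "(\<lambda>z. indicator ({0<..<T} \<times> UNIV) z *\<^sub>R (case z of (t, x) \<Rightarrow> H t x)) = cylf T H"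
    by (auto simp: fun_eq_iff cylf_def indicator_def)
  have "set_borel_measurable lborel ({0<..<T} \<times> UNIV) (\<lambda>(t, x). H t x)"
    using assms by (simp only: L2L2_def mem_Collect_eq)
  then have m: "cylf T H \<in> borel_measurable borel"
    unfolding set_borel_measurable_def eq by simp
  have "sqrt_ennreal (\<integral>\<^sup>+z. ennreal ((cylf T H z)\<^sup>2) \<partial>cyl T) < \<infinity>"
    using assms by (simp add: L2L2_def L2L2_norm_eq[OF m])
  then have "(\<integral>\<^sup>+z. ennreal ((cylf T H z)\<^sup>2) \<partial>cyl T) < \<infinity>"
    by (auto simp: sqrt_ennreal_def less_top split: if_splits)
  then show ?thesis using m by (intro sqintI_nn) (simp_all add: cyl_borel)
qed

lemma L2L2_norm_diff:
  assumes "sqint (cyl T) (cylf T u)" "sqint (cyl T) (cylf T w)"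
  shows "L2L2_norm T (\<lambda>t x. u t x - w t x) = ennreal (l2n (cyl T) (\<lambda>z. cylf T u z - cylf T w z))"
  using L2L2_norm_sqint[of T "\<lambda>t x. u t x - w t x"] sqint_diff[OF assms] by (simp add: cylf_diff)

lemma trig_approximation:
  fixes H :: "real \<Rightarrow> real^'n \<Rightarrow> real"
  assumes T: "0 < T" and H: "sqint (cyl T) (cylf T H)"
  shows "\<exists>Hn. \<forall>n::nat. trig (Hn n) \<and> l2n (cyl T) (\<lambda>z. cylf T (Hn n) z - cylf T H z) < 1 / real (Suc n)"
proof -
  have "\<exists>\<phi>. trig \<phi> \<and> l2n (cyl T) (\<lambda>z. cylf T \<phi> z - cylf T H z) < 1 / real (Suc n)" for n :: nat
    using trig_dense_cylf[OF T H, of "1 / real (Suc n)"] l2n_minus_commute[of "cyl T" "cylf T H"] by auto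
  then show ?thesis by metis
qed

lemma l2n_pairing_tendsto:
  assumes F: "\<And>k::nat. sqint M (F k)" "sqint M f" "sqint M \<psi>" and lim: "(\<lambda>k. l2n M (\<lambda>x. F k x - f x)) \<longlonglongrightarrow> 0"
  shows "(\<lambda>k. LINT x|M. F k x * \<psi> x) \<longlonglongrightarrow> (LINT x|M. f x * \<psi> x)"
proof (rule Lim_null[THEN iffD2], rule tendsto_rabs_zero_cancel)
  have "\<bar>(LINT x|M. F k x * \<psi> x) - (LINT x|M. f x * \<psi> x)\<bar> \<le> l2n M (\<lambda>x. F k x - f x) * l2n M \<psi>" for k
  proof -
    have "(LINT x|M. F k x * \<psi> x) - (LINT x|M. f x * \<psi> x) = (LINT x|M. (F k x - f x) * \<psi> x)"
      using sqint_mult[OF F(1,3)] sqint_mult[OF F(2,3)] by (simp add: left_diff_distrib)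
    then show ?thesis using l2n_cauchy_schwarz[OF sqint_diff[OF F(1,2)] F(3)] by simp
  qed
  moreover have "(\<lambda>k. l2n M (\<lambda>x. F k x - f x) * l2n M \<psi>) \<longlonglongrightarrow> 0"
    using tendsto_mult_right[OF lim, of "l2n M \<psi>"] by simp
  ultimately show "(\<lambda>k. \<bar>(LINT x|M. F k x * \<psi> x) - (LINT x|M. f x * \<psi> x)\<bar>) \<longlonglongrightarrow> 0"
    by - (rule tendsto_sandwich[OF _ _ tendsto_const, rotated 2], auto)
qed

lemma cyl_slices:
  fixes F :: "real \<times> (real^'n) \<Rightarrow> real"
  assumes "sqint (cyl T) F"
  shows "integrable (time_measure T) (\<lambda>t. (l2n torus (\<lambda>x. F (t, x)))\<^sup>2)"
    and "(LINT t|time_measure T. (l2n torus (\<lambda>x. F (t, x)))\<^sup>2) = (l2n (cyl T) F)\<^sup>2"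
    and "AE t in time_measure T. sqint torus (\<lambda>x. F (t, x))"
proof -
  interpret tm: finite_measure "time_measure T" by (rule finite_measure_time)
  interpret TX: pair_sigma_finite "time_measure T" "torus :: (real^'n) measure" ..
  have i: "integrable (time_measure T \<Otimes>\<^sub>M torus) (\<lambda>z. (F z)\<^sup>2)"
    using assms by (simp add: sqint_def cyl_def)
  show "integrable (time_measure T) (\<lambda>t. (l2n torus (\<lambda>x. F (t, x)))\<^sup>2)"
    using TX.integrable_fst'[OF i] by (simp add: l2n_power2)
  show "(LINT t|time_measure T. (l2n torus (\<lambda>x. F (t, x)))\<^sup>2) = (l2n (cyl T) F)\<^sup>2"
    using TX.integral_fst'[OF i] by (simp add: l2n_power2 cyl_def)
  have m: "F \<in> borel_measurable borel" using assms by (simp add: sqint_def cyl_borel)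
  have "(\<lambda>x. F (t, x)) \<in> borel_measurable torus" for t
    unfolding measurable_cong_sets[OF sets_torus refl] by (rule measurable_compose[OF _ m]) measurable
  then show "AE t in time_measure T. sqint torus (\<lambda>x. F (t, x))"
    using TX.AE_integrable_fst'[OF i] by (auto simp: sqint_def)
qed

lemma torus_sqint_integrable:
  fixes f :: "real^'n \<Rightarrow> real"
  assumes "sqint torus f" shows "integrable torus f"
proof -
  have "sqint torus (\<lambda>_::real^'n. 1::real)" by (simp add: sqint_def)
  from sqint_mult[OF assms this] show ?thesis by simp
qed

lemma periodic_sqint:
  fixes \<phi> :: "real^'n \<Rightarrow> real"
  assumes "continuous_on UNIV \<phi>" "periodic \<phi>"
  shows "sqint torus \<phi>"
proof -
  have "continuous_on ({0..1::real} \<times> UNIV) (\<lambda>(t, x). \<phi> x)"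
    unfolding case_prod_unfold by (rule continuous_on_compose2[OF assms(1)]) (auto intro!: continuous_intros)
  from periodic_cylf_sqint(3)[OF zero_less_one this, of 0] assms(2) show ?thesis by simp
qed

text \<open>Any weak gradient is a competitor in the infimum that defines the norm.\<close>

lemma H1_norm_le:
  fixes f :: "real^'n \<Rightarrow> real" and G :: "'n \<Rightarrow> real^'n \<Rightarrow> real"
  assumes f: "sqint torus f" and G: "\<And>j. sqint torus (G j)"
    and w: "\<And>\<phi> i. smooth_on UNIV \<phi> \<Longrightarrow> periodic \<phi> \<Longrightarrow> (LINT x|torus. f x * grad \<phi> x $ i) = - (LINT x|torus. G i x * \<phi> x)"
  shows "(H1_norm_torus f)\<^sup>2 \<le> ennreal ((l2n torus f)\<^sup>2 + (\<Sum>j\<in>UNIV. (l2n torus (G j))\<^sup>2))"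
proof -
  let ?g = "\<lambda>x. \<chi> j. G j x"
  have eq: "?g = (\<lambda>x. \<Sum>j\<in>UNIV. G j x *\<^sub>R axis j 1)"
    by (auto simp: fun_eq_iff vec_eq_iff axis_def if_distrib[where f = "\<lambda>x. _ * x"] cong: if_cong)
  have "integrable torus ?g"
    unfolding eq using torus_sqint_integrable[OF G] by (intro Bochner_Integration.integrable_sum integrable_scaleR_left)
  then have "weak_grad f ?g"
    using torus_sqint_integrable[OF f] w by (simp add: weak_grad_def)
  then have "H1_norm_torus f \<le> sqrt_ennreal ((L2_norm_torus f)\<^sup>2 + (L2_norm_torus ?g)\<^sup>2)"
    unfolding H1_norm_torus_def by (intro INF_lower) simp
  then have "(H1_norm_torus f)\<^sup>2 \<le> (sqrt_ennreal ((L2_norm_torus f)\<^sup>2 + (L2_norm_torus ?g)\<^sup>2))\<^sup>2" by (rule power_mono) simp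
  also have "\<dots> = (\<integral>\<^sup>+x. ennreal ((f x)\<^sup>2) \<partial>torus) + (\<integral>\<^sup>+x. ennreal ((norm (?g x))\<^sup>2) \<partial>torus)"
    by (simp add: sqrt_ennreal_sq L2_norm_torus_def)
  also have "(\<integral>\<^sup>+x. ennreal ((norm (?g x))\<^sup>2) \<partial>torus) = (\<integral>\<^sup>+x. (\<Sum>j\<in>UNIV. ennreal ((G j x)\<^sup>2)) \<partial>torus)"
  proof (intro nn_integral_cong)
    fix x :: "real^'n"
    have "(norm (?g x))\<^sup>2 = (\<Sum>j\<in>UNIV. (G j x)\<^sup>2)"
      by (simp only: power2_norm_eq_inner inner_vec_def vec_lambda_beta inner_real_def) (simp only: power2_eq_square)
    then show "ennreal ((norm (?g x))\<^sup>2) = (\<Sum>j\<in>UNIV. ennreal ((G j x)\<^sup>2))" by (simp add: sum_ennreal)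
  qed
  also have "\<dots> = (\<Sum>j\<in>UNIV. \<integral>\<^sup>+x. ennreal ((G j x)\<^sup>2) \<partial>torus)"
    using G by (intro nn_integral_sum) (auto simp: sqint_def)
  also have "(\<integral>\<^sup>+x. ennreal ((f x)\<^sup>2) \<partial>torus) + \<dots> = ennreal ((l2n torus f)\<^sup>2 + (\<Sum>j\<in>UNIV. (l2n torus (G j))\<^sup>2))"
    by (simp add: sqint_nn_integral[OF f] sqint_nn_integral[OF G] sum_ennreal sum_nonneg)
  finally show ?thesis .
qed

text \<open>Measurability in t of the H^1 norm, an infimum over weak gradients, is not established;
  the norm is dominated for almost every t by a measurable function before integrating.\<close>

lemma L2H1_norm_le:
  fixes u :: "real \<Rightarrow> real^'n \<Rightarrow> real" and G :: "'n \<Rightarrow> real \<times> (real^'n) \<Rightarrow> real"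
  assumes u: "sqint (cyl T) (cylf T u)" and G: "\<And>j. sqint (cyl T) (G j)"
    and w: "AE t in time_measure T. \<forall>\<phi> i. smooth_on UNIV \<phi> \<longrightarrow> periodic \<phi> \<longrightarrow>
       (LINT x|torus. cylf T u (t, x) * grad \<phi> x $ i) = - (LINT x|torus. G i (t, x) * \<phi> x)"
  shows "L2H1_norm T u \<le> ennreal (sqrt ((l2n (cyl T) (cylf T u))\<^sup>2 + (\<Sum>j\<in>UNIV. (l2n (cyl T) (G j))\<^sup>2)))"
proof -
  let ?a = "\<lambda>t. (l2n torus (\<lambda>x. cylf T u (t, x)))\<^sup>2 + (\<Sum>j\<in>UNIV. (l2n torus (\<lambda>x. G j (t, x)))\<^sup>2)"
  have int: "integrable (time_measure T) ?a"
    using cyl_slices(1)[OF u] cyl_slices(1)[OF G] by auto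
  have am: "?a \<in> borel_measurable borel"
    using borel_measurable_integrable[OF int] by (simp only: measurable_cong_sets[OF sets_time_measure refl])
  have "AE t in time_measure T. \<forall>j. sqint torus (\<lambda>x. G j (t, x))"
    using cyl_slices(3)[OF G] by (simp add: AE_all_countable)
  then have "AE t in time_measure T. t \<in> {0<..<T} \<and> (H1_norm_torus (u t))\<^sup>2 \<le> ennreal (?a t)"
    using cyl_slices(3)[OF u] w AE_time_measure
  proof eventually_elim
    case (elim t)
    have ut: "(\<lambda>x. cylf T u (t, x)) = u t" using elim(4) by (simp add: cylf_def fun_eq_iff)
    have "(H1_norm_torus (u t))\<^sup>2 \<le> ennreal ((l2n torus (u t))\<^sup>2 + (\<Sum>j\<in>UNIV. (l2n torus (\<lambda>x. G j (t, x)))\<^sup>2))"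
      by (rule H1_norm_le) (use elim ut in \<open>auto simp: fun_eq_iff\<close>)
    then show ?case using elim(4) by (simp only: ut simp_thms)
  qed
  then have "AE t in lborel. t \<in> {0<..<T} \<longrightarrow> (H1_norm_torus (u t))\<^sup>2 \<le> ennreal (?a t)"
    unfolding time_measure_def by (subst (asm) AE_density) (auto simp: indicator_def elim!: eventually_mono)
  then have "(\<integral>\<^sup>+t\<in>{0<..<T}. (H1_norm_torus (u t))\<^sup>2 \<partial>lborel) \<le> (\<integral>\<^sup>+t\<in>{0<..<T}. ennreal (?a t) \<partial>lborel)"
    by (intro nn_integral_mono_AE) (auto simp: indicator_def elim!: eventually_mono)
  also have "\<dots> = (\<integral>\<^sup>+t. ennreal (?a t) \<partial>time_measure T)"
    by (rule nn_integral_time_measure[symmetric]) (use am in measurable)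
  also have "\<dots> = ennreal (LINT t|time_measure T. ?a t)"
    by (rule nn_integral_eq_integral[OF int]) (auto intro!: add_nonneg_nonneg sum_nonneg)
  also have "(LINT t|time_measure T. ?a t) = (l2n (cyl T) (cylf T u))\<^sup>2 + (\<Sum>j\<in>UNIV. (l2n (cyl T) (G j))\<^sup>2)"
    using cyl_slices(1,2)[OF u] cyl_slices(1,2)[OF G] by simp
  finally have "(\<integral>\<^sup>+t\<in>{0<..<T}. (H1_norm_torus (u t))\<^sup>2 \<partial>lborel) \<le> ennreal ((sqrt ((l2n (cyl T) (cylf T u))\<^sup>2 + (\<Sum>j\<in>UNIV. (l2n (cyl T) (G j))\<^sup>2)))\<^sup>2)"
    by (simp add: sum_nonneg)
  from sqrt_ennreal_mono[OF this] show ?thesis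
    by (simp add: L2_time_norm_def sqrt_ennreal_square sum_nonneg del: real_sqrt_pow2 real_sqrt_pow2_iff)
qed

text \<open>Meant for kernels of infinite norm: the product of infinity and 0 is 0, so for H of norm
  0 the estimate asserts that the image vanishes in H^1 as well. Zero is then a weak gradient for
  almost every t.\<close>

lemma L2H1_norm_zero:
  fixes u :: "real \<Rightarrow> real^'n \<Rightarrow> real"
  assumes u: "u \<in> L2L2 T" and 0: "L2L2_norm T u = 0"
  shows "L2H1_norm T u = 0"
proof -
  note s = L2L2_sqint[OF u]
  have l0: "l2n (cyl T) (cylf T u) = 0" using 0 L2L2_norm_sqint[OF s] by simp
  have z: "sqint (cyl T) (\<lambda>_::real \<times> (real^'n). 0::real)" by (simp add: sqint_def)
  have "AE t in time_measure T. (l2n torus (\<lambda>x. cylf T u (t, x)))\<^sup>2 = 0"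
    using integral_nonneg_eq_0_iff_AE[OF cyl_slices(1)[OF s]] cyl_slices(2)[OF s] l0 by simp
  then have "AE t in time_measure T. \<forall>\<phi> i. smooth_on UNIV \<phi> \<longrightarrow> periodic \<phi> \<longrightarrow>
       (LINT x|torus. cylf T u (t, x) * grad \<phi> x $ i) = - (LINT x|torus. 0 * \<phi> x)"
    using cyl_slices(3)[OF s]
  proof eventually_elim
    case (elim t)
    have "(LINT x|torus. (cylf T u (t, x))\<^sup>2) = 0" using elim(1) by (simp only: l2n_power2)
    then have "AE x in torus. (cylf T u (t, x))\<^sup>2 = 0"
      using elim(2) by (subst (asm) integral_nonneg_eq_0_iff_AE) (auto simp: sqint_def)
    then have ae: "AE x in torus. cylf T u (t, x) = 0" by simp
    have "(LINT x|torus. cylf T u (t, x) * \<psi> x) = 0" for \<psi> :: "real^'n \<Rightarrow> real"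
      by (rule integral_eq_zero_AE) (use ae in eventually_elim, simp)
    then show ?case by simp
  qed
  from L2H1_norm_le[OF s z this] show ?thesis by (simp add: l0 l2n_power2)
qed

context avg_kernel
begin

definition Kop :: "(real \<Rightarrow> real^'n \<Rightarrow> real) \<Rightarrow> real \<Rightarrow> real^'n \<Rightarrow> real" where
  "Kop H = avg (U1 (\<lambda>s. grad (H s)))"

lemma Kop_sqint:
  assumes "smooth_periodic T H"
  shows "sqint (cyl T) (cylf T (Kop H))" "sqint (cyl T) (cylf T H)"
proof -
  obtain hj where r: "reg T H (\<lambda>t. grad (H t)) hj" using smooth_periodic_reg[OF assms] by blast
  then show "sqint (cyl T) (cylf T H)" by (rule reg_cylf(2)[OF T])
  show "sqint (cyl T) (cylf T (Kop H))" using adm_U(1)[OF r] sqint_cylf_avg by (auto simp: Kop_def)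
qed

context
  fixes S :: real
  assumes S: "0 \<le> S" "\<And>F. finite F \<Longrightarrow> (\<Sum>l\<in>F. lattice_wt (l :: int^'n)) \<le> S"
begin

lemma Kop_diff_bound:
  assumes "smooth_periodic T H" "smooth_periodic T H'"
  shows "l2n (cyl T) (\<lambda>z. cylf T (Kop H) z - cylf T (Kop H') z) \<le> K * S * l2n (cyl T) (\<lambda>z. cylf T H z - cylf T H' z)"
  using smooth_periodic_reg[OF assms(1)] smooth_periodic_reg[OF assms(2)] avg_diff_bound(1)[OF S]
  unfolding Kop_def by blast

lemma approx_cauchy:
  fixes H :: "real \<Rightarrow> real^'n \<Rightarrow> real" and f :: "nat \<Rightarrow> real \<times> (real^'n) \<Rightarrow> real"
  assumes Hn: "\<And>n. sqint (cyl T) (cylf T (Hn n))" "sqint (cyl T) (cylf T H)"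
      "\<And>n::nat. l2n (cyl T) (\<lambda>z. cylf T (Hn n) z - cylf T H z) < 1 / real (Suc n)"
    and le: "\<And>m n. l2n (cyl T) (\<lambda>z. f m z - f n z) \<le> K * S * l2n (cyl T) (\<lambda>z. cylf T (Hn m) z - cylf T (Hn n) z)"
    and e: "0 < e"
  shows "\<exists>N. \<forall>m\<ge>N. \<forall>n\<ge>N. l2n (cyl T) (\<lambda>z. f m z - f n z) < e"
proof -
  have C: "0 < 2 * (K * S) + 1" using K S(1) by (intro add_nonneg_pos) auto
  obtain N where N: "1 / real (Suc N) < e / (2 * (K * S) + 1)"
    using reals_Archimedean[of "e / (2 * (K * S) + 1)"] e C by (auto simp: inverse_eq_divide)
  have "l2n (cyl T) (\<lambda>z. f m z - f n z) < e" if "m \<ge> N" "n \<ge> N" for m n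
  proof -
    have inv: "1 / real (Suc k) \<le> 1 / real (Suc N)" if "k \<ge> N" for k
      using that by (intro divide_left_mono) auto
    have "l2n (cyl T) (\<lambda>z. cylf T (Hn m) z - cylf T (Hn n) z) \<le> 1 / real (Suc N) + 1 / real (Suc N)"
      using l2n_triangle[OF Hn(1)[of m] Hn(2) Hn(1)[of n]] Hn(3)[of m] Hn(3)[of n] inv[OF that(1)] inv[OF that(2)]
        l2n_minus_commute[of "cyl T" "cylf T H" "cylf T (Hn n)"] by linarith
    then have "K * S * l2n (cyl T) (\<lambda>z. cylf T (Hn m) z - cylf T (Hn n) z) \<le> K * S * (1 / real (Suc N) + 1 / real (Suc N))"
      using K S(1) by (intro mult_left_mono) auto
    also have "\<dots> = 2 * (K * S) * (1 / real (Suc N))" by (simp add: algebra_simps)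
    also have "\<dots> < (2 * (K * S) + 1) * (1 / real (Suc N))" by (intro mult_strict_right_mono) auto
    also have "\<dots> < e" using N C by (simp only: pos_less_divide_eq mult.commute)
    finally show ?thesis using le[of m n] by linarith
  qed
  then show ?thesis by blast
qed

lemma approx_bound:
  fixes H :: "real \<Rightarrow> real^'n \<Rightarrow> real" and f :: "nat \<Rightarrow> real \<times> (real^'n) \<Rightarrow> real"
  assumes Hn: "\<And>n. sqint (cyl T) (cylf T (Hn n))" "sqint (cyl T) (cylf T H)"
      "\<And>n::nat. l2n (cyl T) (\<lambda>z. cylf T (Hn n) z - cylf T H z) < 1 / real (Suc n)"
    and f: "\<And>n. sqint (cyl T) (f n)" "sqint (cyl T) w" "(\<lambda>n. l2n (cyl T) (\<lambda>z. f n z - w z)) \<longlonglongrightarrow> 0"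
    and le: "\<And>n. l2n (cyl T) (f n) \<le> K * S * l2n (cyl T) (cylf T (Hn n))"
  shows "l2n (cyl T) w \<le> K * S * l2n (cyl T) (cylf T H)"
proof -
  let ?h = "l2n (cyl T) (cylf T H)"
  have "l2n (cyl T) w \<le> l2n (cyl T) (\<lambda>z. f n z - w z) + K * S * (?h + 1 / real (Suc n))" for n
  proof -
    have "l2n (cyl T) w \<le> l2n (cyl T) (\<lambda>z. f n z - w z) + l2n (cyl T) (f n)"
      using l2n_le_add[OF f(2) f(1)[of n]] l2n_minus_commute[of "cyl T" w "f n"] by simp
    moreover have "l2n (cyl T) (cylf T (Hn n)) \<le> ?h + 1 / real (Suc n)"
      using l2n_le_add[OF Hn(1)[of n] Hn(2)] Hn(3)[of n] by linarith
    then have "K * S * l2n (cyl T) (cylf T (Hn n)) \<le> K * S * (?h + 1 / real (Suc n))"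
      using K S(1) by (intro mult_left_mono) auto
    ultimately show ?thesis using le[of n] by linarith
  qed
  moreover have "(\<lambda>n. l2n (cyl T) (\<lambda>z. f n z - w z) + K * S * (?h + 1 / real (Suc n))) \<longlonglongrightarrow> 0 + K * S * (?h + 0)"
    by (intro tendsto_intros f(3) LIMSEQ_Suc[OF lim_1_over_n])
  ultimately show ?thesis by (intro LIMSEQ_le_const[where X = "\<lambda>n. l2n (cyl T) (\<lambda>z. f n z - w z) + K * S * (?h + 1 / real (Suc n))"]) auto
qed

lemma tendsto_approx:
  fixes a :: "nat \<Rightarrow> real"
  assumes "\<And>n. 0 \<le> a n" "\<And>n. a n < 1 / real (Suc n)"
  shows "a \<longlonglongrightarrow> 0"
  by (rule tendsto_sandwich[OF _ _ tendsto_const LIMSEQ_Suc[OF lim_1_over_n]]) (use assms in \<open>auto simp: less_imp_le\<close>)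

text \<open>The images of trigonometric approximants form a Cauchy sequence by the difference bound,
  and their limit is the extension. Any other smooth sequence tending to H is compared with this one
  by the same bound.\<close>

lemma Kop_extends:
  assumes H: "H \<in> L2L2 T"
  shows "\<exists>u. extends_to T Kop H u"
proof -
  note sH = L2L2_sqint[OF H]
  obtain Hn where Hn: "\<And>n::nat. trig (Hn n)" "\<And>n. l2n (cyl T) (\<lambda>z. cylf T (Hn n) z - cylf T H z) < 1 / real (Suc n)"
    using trig_approximation[OF T sH] by blast
  note sm = trig_smooth_periodic[OF T Hn(1)]
  define f where "f n = cylf T (Kop (Hn n))" for n
  have f: "sqint (cyl T) (f n)" for n unfolding f_def by (rule Kop_sqint(1)[OF sm])
  have cau: "\<exists>N. \<forall>m\<ge>N. \<forall>n\<ge>N. l2n (cyl T) (\<lambda>z. f m z - f n z) < e" if "0 < e" for e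
    by (rule approx_cauchy[OF Kop_sqint(2)[OF sm] sH Hn(2) _ that]) (simp add: f_def Kop_diff_bound[OF sm sm])
  obtain r :: "nat \<Rightarrow> nat" where r: "sqint (cyl T) (\<lambda>z. lim (\<lambda>k. f (r k) z))"
    "(\<lambda>n. l2n (cyl T) (\<lambda>z. f n z - lim (\<lambda>k. f (r k) z))) \<longlonglongrightarrow> 0"
    by (rule l2n_complete[OF finite_measure_cyl f cau])
  define u where "u t x = lim (\<lambda>k. f (r k) (t, x))" for t x
  have cu: "cylf T u = (\<lambda>z. lim (\<lambda>k. f (r k) z))"
  proof
    fix z :: "real \<times> (real^'n)"
    show "cylf T u z = lim (\<lambda>k. f (r k) z)"
      by (cases "fst z \<in> {0<..<T}") (auto simp: cylf_def u_def f_def)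
  qed
  have su: "sqint (cyl T) (cylf T u)" using r(1) by (simp only: cu)
  \<comment> \<open>Where the sequence diverges, \<open>lim\<close> is some unspecified value
    determined by the sequence alone. The sequences at x and at x plus a period coincide, so
    periodicity holds at every point.\<close>
  have "periodic (u t)" if t: "t \<in> {0<..<T}" for t
  proof -
    have "periodic (Kop (Hn n) t)" for n
      using smooth_periodic_reg[OF sm[of n]] periodic_avg t by (auto simp: Kop_def)
    then show ?thesis by (simp add: periodic_def u_def f_def cylf_def)
  qed
  moreover have "set_borel_measurable lborel ({0<..<T} \<times> UNIV) (\<lambda>(t, x). u t x)"
  proof -
    have "(\<lambda>z. indicator ({0<..<T} \<times> UNIV) z *\<^sub>R (case z of (t, x) \<Rightarrow> u t x)) = cylf T u"
      by (auto simp: fun_eq_iff cylf_def indicator_def)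
    then show ?thesis using su by (simp add: set_borel_measurable_def sqint_def cyl_borel)
  qed
  ultimately have uL: "u \<in> L2L2 T" using L2L2_norm_sqint[OF su] by (simp add: L2L2_def)
  have "(\<lambda>n. L2L2_norm T (\<lambda>t x. Kop (H' n) t x - u t x)) \<longlonglongrightarrow> 0"
    if sm': "\<And>n. smooth_periodic T (H' n)" and lim: "(\<lambda>n. L2L2_norm T (\<lambda>t x. H' n t x - H t x)) \<longlonglongrightarrow> 0" for H'
  proof -
    note s' = Kop_sqint[OF sm'] and s = Kop_sqint[OF sm]
    have l1: "(\<lambda>n. l2n (cyl T) (\<lambda>z. cylf T (H' n) z - cylf T H z)) \<longlonglongrightarrow> 0"
      using lim by (simp add: L2L2_norm_diff[OF s'(2) sH] ennreal_tendsto_0_iff)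
    have l2: "(\<lambda>n. l2n (cyl T) (\<lambda>z. cylf T (Hn n) z - cylf T H z)) \<longlonglongrightarrow> 0"
      by (rule tendsto_approx[OF l2n_nonneg Hn(2)])
    have le: "l2n (cyl T) (\<lambda>z. cylf T (Kop (H' n)) z - cylf T u z)
       \<le> K * S * (l2n (cyl T) (\<lambda>z. cylf T (H' n) z - cylf T H z) + l2n (cyl T) (\<lambda>z. cylf T (Hn n) z - cylf T H z))
         + l2n (cyl T) (\<lambda>z. f n z - cylf T u z)" for n
    proof -
      have "l2n (cyl T) (\<lambda>z. cylf T (H' n) z - cylf T (Hn n) z)
         \<le> l2n (cyl T) (\<lambda>z. cylf T (H' n) z - cylf T H z) + l2n (cyl T) (\<lambda>z. cylf T (Hn n) z - cylf T H z)"
        using l2n_triangle[OF s'(2)[of n] sH s(2)[of n]] l2n_minus_commute[of "cyl T" "cylf T H" "cylf T (Hn n)"] by simp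
      then have "K * S * l2n (cyl T) (\<lambda>z. cylf T (H' n) z - cylf T (Hn n) z)
         \<le> K * S * (l2n (cyl T) (\<lambda>z. cylf T (H' n) z - cylf T H z) + l2n (cyl T) (\<lambda>z. cylf T (Hn n) z - cylf T H z))"
        using K S(1) by (intro mult_left_mono) auto
      then show ?thesis
        using Kop_diff_bound[OF sm'[of n] sm[of n]] l2n_triangle[OF s'(1)[of n] f[of n] su] unfolding f_def by linarith
    qed
    have "(\<lambda>n. K * S * (l2n (cyl T) (\<lambda>z. cylf T (H' n) z - cylf T H z) + l2n (cyl T) (\<lambda>z. cylf T (Hn n) z - cylf T H z))
         + l2n (cyl T) (\<lambda>z. f n z - cylf T u z)) \<longlonglongrightarrow> K * S * (0 + 0) + 0"
      using r(2) by (intro tendsto_intros l1 l2) (simp add: cu)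
    note lim' = this[simplified]
    have "(\<lambda>n. l2n (cyl T) (\<lambda>z. cylf T (Kop (H' n)) z - cylf T u z)) \<longlonglongrightarrow> 0"
      by (rule tendsto_sandwich[OF _ _ tendsto_const lim']) (use le in auto)
    then show ?thesis by (simp add: L2L2_norm_diff[OF s'(1) su] ennreal_tendsto_0_iff)
  qed
  then have "extends_to T Kop H u" using uL by (auto simp: extends_to_def)
  then show ?thesis by blast
qed

text \<open>Weak differentiability survives the limit. The approximating averages and their
  derivatives converge in L2 of the cylinder, hence along a subsequence on almost every time slice,
  and there the identity defining the weak gradient passes to the limit. The exceptional set of
  times does not depend on the test function.\<close>

lemma Kop_smoothing:
  assumes H: "H \<in> L2L2 T" and u: "extends_to T Kop H u"
  shows "L2H1_norm T u \<le> ennreal (sqrt (1 + real CARD('n)) * (K * S)) * L2L2_norm T H"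
proof -
  note sH = L2L2_sqint[OF H]
  have uL: "u \<in> L2L2 T" using u by (simp add: extends_to_def)
  note su = L2L2_sqint[OF uL]
  let ?h = "l2n (cyl T) (cylf T H)"
  obtain Hn where Hn: "\<And>n::nat. trig (Hn n)" "\<And>n. l2n (cyl T) (\<lambda>z. cylf T (Hn n) z - cylf T H z) < 1 / real (Suc n)"
    using trig_approximation[OF T sH] by blast
  note sm = trig_smooth_periodic[OF T Hn(1)]
  note sHn = Kop_sqint(2)[OF sm]
  have "\<forall>n. \<exists>hj. reg T (Hn n) (\<lambda>t. grad (Hn n t)) hj" using smooth_periodic_reg[OF sm] by blast
  then obtain hj where hj: "\<And>n. reg T (Hn n) (\<lambda>t. grad (Hn n t)) (hj n)" by metis
  define f where "f n = cylf T (Kop (Hn n))" for n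
  have f: "sqint (cyl T) (f n)" for n unfolding f_def by (rule Kop_sqint(1)[OF sm])
  define V where "V n j = avg (U2 (\<lambda>t. grad (Hn n t)) (hj n) j)" for n j
  define J where "J j n = cylf T (V n j)" for j n
  have J: "sqint (cyl T) (J j n)" for j n
    using adm_U(2)[OF hj] sqint_cylf_avg unfolding J_def V_def by blast
  have flim: "(\<lambda>n. l2n (cyl T) (\<lambda>z. f n z - cylf T u z)) \<longlonglongrightarrow> 0"
  proof -
    have "(\<lambda>n. L2L2_norm T (\<lambda>t x. Hn n t x - H t x)) \<longlonglongrightarrow> 0"
      by (simp add: L2L2_norm_diff[OF sHn sH] ennreal_tendsto_0_iff tendsto_approx[OF l2n_nonneg Hn(2)])
    then have "(\<lambda>n. L2L2_norm T (\<lambda>t x. Kop (Hn n) t x - u t x)) \<longlonglongrightarrow> 0"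
      using u sm unfolding extends_to_def by blast
    then show ?thesis by (simp add: L2L2_norm_diff[OF Kop_sqint(1)[OF sm] su] ennreal_tendsto_0_iff f_def)
  qed
  have ex: "\<exists>G. sqint (cyl T) G \<and> (\<lambda>n. l2n (cyl T) (\<lambda>z. J j n z - G z)) \<longlonglongrightarrow> 0" for j
  proof -
    have cau: "\<exists>N. \<forall>m\<ge>N. \<forall>n\<ge>N. l2n (cyl T) (\<lambda>z. J j m z - J j n z) < e" if "0 < e" for e
      by (rule approx_cauchy[OF sHn sH Hn(2) _ that]) (unfold J_def V_def, rule avg_diff_bound(2)[OF S hj hj])
    obtain r :: "nat \<Rightarrow> nat" where "sqint (cyl T) (\<lambda>z. lim (\<lambda>k. J j (r k) z))"
      "(\<lambda>n. l2n (cyl T) (\<lambda>z. J j n z - lim (\<lambda>k. J j (r k) z))) \<longlonglongrightarrow> 0"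
      by (rule l2n_complete[OF finite_measure_cyl J cau])
    then show ?thesis by (intro exI[of _ "\<lambda>z. lim (\<lambda>k. J j (r k) z)"] conjI)
  qed
  have "\<exists>G. \<forall>j. sqint (cyl T) (G j) \<and> (\<lambda>n. l2n (cyl T) (\<lambda>z. J j n z - G j z)) \<longlonglongrightarrow> 0"
    by (rule choice, rule allI, rule ex)
  then obtain G where "\<forall>j. sqint (cyl T) (G j) \<and> (\<lambda>n. l2n (cyl T) (\<lambda>z. J j n z - G j z)) \<longlonglongrightarrow> 0" ..
  then have G: "sqint (cyl T) (G j)" "(\<lambda>n. l2n (cyl T) (\<lambda>z. J j n z - G j z)) \<longlonglongrightarrow> 0" for j by simp_all
  have bu: "l2n (cyl T) (cylf T u) \<le> K * S * ?h"
    by (rule approx_bound[OF sHn sH Hn(2) f su flim]) (unfold f_def Kop_def, rule avg_bound(1)[OF S hj])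
  have bG: "l2n (cyl T) (G j) \<le> K * S * ?h" for j
    by (rule approx_bound[OF sHn sH Hn(2) J G]) (unfold J_def V_def, rule avg_bound(2)[OF S hj])
  \<comment> \<open>The slice errors of the function and of all its derivatives are added up, so
    that one subsequence serves all components.\<close>
  let ?A = "\<lambda>n t. (l2n torus (\<lambda>x. f n (t, x) - cylf T u (t, x)))\<^sup>2 + (\<Sum>j\<in>UNIV. (l2n torus (\<lambda>x. J j n (t, x) - G j (t, x)))\<^sup>2)"
  note fd = cyl_slices[OF sqint_diff[OF f su]] and Jd = cyl_slices[OF sqint_diff[OF J G(1)]]
  have iA: "integrable (time_measure T) (?A n)" for n using fd(1) Jd(1) by auto
  have "(LINT t|time_measure T. ?A n t) = (l2n (cyl T) (\<lambda>z. f n z - cylf T u z))\<^sup>2 + (\<Sum>j\<in>UNIV. (l2n (cyl T) (\<lambda>z. J j n z - G j z))\<^sup>2)" for n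
    using fd(1,2) Jd(1,2) by simp
  moreover have "(\<lambda>n. (l2n (cyl T) (\<lambda>z. f n z - cylf T u z))\<^sup>2 + (\<Sum>j\<in>UNIV. (l2n (cyl T) (\<lambda>z. J j n z - G j z))\<^sup>2)) \<longlonglongrightarrow> 0\<^sup>2 + (\<Sum>j\<in>(UNIV::'n set). 0\<^sup>2)"
    by (intro tendsto_intros flim G)
  ultimately have "(\<lambda>n. LINT t|time_measure T. ?A n t) \<longlonglongrightarrow> 0" by simp
  moreover have "norm (?A n t) = ?A n t" for n t by (simp add: add_nonneg_nonneg sum_nonneg)
  ultimately have "(\<lambda>n. LINT t|time_measure T. norm (?A n t)) \<longlonglongrightarrow> 0" by (simp only:)
  from tendsto_L1_AE_subseq[OF iA this] obtain r :: "nat \<Rightarrow> nat" where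
    r: "AE t in time_measure T. (\<lambda>k. ?A (r k) t) \<longlonglongrightarrow> 0" by blast
  have "AE t in time_measure T. \<forall>n. sqint torus (\<lambda>x. f n (t, x))"
    using cyl_slices(3)[OF f] by (simp add: AE_all_countable)
  moreover have "AE t in time_measure T. \<forall>n j. sqint torus (\<lambda>x. J j n (t, x))"
    using cyl_slices(3)[OF J] by (simp add: AE_all_countable)
  moreover have "AE t in time_measure T. \<forall>j. sqint torus (\<lambda>x. G j (t, x))"
    using cyl_slices(3)[OF G(1)] by (simp add: AE_all_countable)
  moreover note cyl_slices(3)[OF su] r AE_time_measure
  ultimately have "AE t in time_measure T. \<forall>\<phi> i. smooth_on UNIV \<phi> \<longrightarrow> periodic \<phi> \<longrightarrow>
       (LINT x|torus. cylf T u (t, x) * grad \<phi> x $ i) = - (LINT x|torus. G i (t, x) * \<phi> x)"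
  proof eventually_elim
    case (elim t)
    have t: "t \<in> {0..T}" using elim(6) by simp
    have sq: "(\<lambda>k. a k) \<longlonglongrightarrow> 0" if "\<And>k. 0 \<le> a k" "\<And>k. (a k)\<^sup>2 \<le> ?A (r k) t" for a :: "nat \<Rightarrow> real"
    proof -
      have "(\<lambda>k. (a k)\<^sup>2) \<longlonglongrightarrow> 0"
        by (rule tendsto_sandwich[OF _ _ tendsto_const elim(5)]) (use that in auto)
      then have "(\<lambda>k. sqrt ((a k)\<^sup>2)) \<longlonglongrightarrow> sqrt 0" by (rule tendsto_real_sqrt)
      then show ?thesis using that(1) by simp
    qed
    have lf: "(\<lambda>k. l2n torus (\<lambda>x. f (r k) (t, x) - cylf T u (t, x))) \<longlonglongrightarrow> 0"
      by (rule sq) (auto simp: sum_nonneg)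
    have lJ: "(\<lambda>k. l2n torus (\<lambda>x. J i (r k) (t, x) - G i (t, x))) \<longlonglongrightarrow> 0" for i
    proof (rule sq)
      fix k
      have "(l2n torus (\<lambda>x. J i (r k) (t, x) - G i (t, x)))\<^sup>2 \<le> (\<Sum>j\<in>UNIV. (l2n torus (\<lambda>x. J j (r k) (t, x) - G j (t, x)))\<^sup>2)"
        by (rule member_le_sum) auto
      then show "(l2n torus (\<lambda>x. J i (r k) (t, x) - G i (t, x)))\<^sup>2 \<le> ?A (r k) t" by (simp add: add_increasing)
    qed simp
    show ?case
    proof (intro allI impI)
      fix \<phi> :: "real^'n \<Rightarrow> real" and i assume \<phi>: "smooth_on UNIV \<phi>" "periodic \<phi>"
      have g: "(\<lambda>x. grad \<phi> x $ i) = dir_deriv UNIV (axis i 1) \<phi>" by (simp add: grad_def fun_eq_iff)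
      \<comment> \<open>A smooth periodic test function and its partial derivatives are square
        integrable on the torus, so both sides of the weak identity converge as L2 pairings.\<close>
      have c: "continuous_on UNIV \<phi>" "continuous_on UNIV (\<lambda>x. grad \<phi> x $ i)"
        using smooth_on_iter(2)[OF \<phi>(1), of "[]"] smooth_on_iter(2)[OF \<phi>(1), of "[axis i 1]"]
        unfolding g by (simp_all add: axis_in_Basis_iff)
      have d: "has_dderiv \<phi> (axis i 1) (\<lambda>x. grad \<phi> x $ i)"
        unfolding g using smooth_on_iter(1)[OF \<phi>(1), of "[]"] by (intro has_dderiv_dir_deriv) simp
      have s\<phi>: "sqint torus \<phi>" "sqint torus (\<lambda>x. grad \<phi> x $ i)"
        using periodic_sqint[OF c(1) \<phi>(2)] periodic_sqint[OF c(2) has_dderiv_periodic[OF d \<phi>(2)]] by auto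
      have eq: "(LINT x|torus. f n (t, x) * grad \<phi> x $ i) = - (LINT x|torus. J i n (t, x) * \<phi> x)" for n
        using avg_weak_deriv[OF hj t c(1) \<phi>(2) d c(2)] elim(6) by (simp add: f_def J_def V_def Kop_def cylf_def)
      have "(\<lambda>k. LINT x|torus. f (r k) (t, x) * grad \<phi> x $ i) \<longlonglongrightarrow> (LINT x|torus. cylf T u (t, x) * grad \<phi> x $ i)"
        by (rule l2n_pairing_tendsto[OF _ elim(4) s\<phi>(2) lf]) (use elim(1) in blast)
      moreover have "(\<lambda>k. LINT x|torus. J i (r k) (t, x) * \<phi> x) \<longlonglongrightarrow> (LINT x|torus. G i (t, x) * \<phi> x)"
        by (rule l2n_pairing_tendsto[OF _ _ s\<phi>(1) lJ]) (use elim(2,3) in blast)+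
      then have "(\<lambda>k. LINT x|torus. f (r k) (t, x) * grad \<phi> x $ i) \<longlonglongrightarrow> - (LINT x|torus. G i (t, x) * \<phi> x)"
        unfolding eq by (rule tendsto_minus)
      ultimately show "(LINT x|torus. cylf T u (t, x) * grad \<phi> x $ i) = - (LINT x|torus. G i (t, x) * \<phi> x)"
        by (rule LIMSEQ_unique)
    qed
  qed
  from L2H1_norm_le[OF su G(1) this]
  have "L2H1_norm T u \<le> ennreal (sqrt ((l2n (cyl T) (cylf T u))\<^sup>2 + (\<Sum>j\<in>UNIV. (l2n (cyl T) (G j))\<^sup>2)))" .
  also have "\<dots> \<le> ennreal (sqrt ((K * S * ?h)\<^sup>2 + (\<Sum>j\<in>(UNIV::'n set). (K * S * ?h)\<^sup>2)))"
    by (intro ennreal_leI real_sqrt_le_mono add_mono sum_mono power_mono bu bG) auto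
  \<comment> \<open>The function and its d partial derivatives obey the same bound, which produces
    the factor \<open>sqrt (1 + d)\<close>.\<close>
  also have "sqrt ((K * S * ?h)\<^sup>2 + (\<Sum>j\<in>(UNIV::'n set). (K * S * ?h)\<^sup>2)) = sqrt (1 + real CARD('n)) * (K * S) * ?h"
  proof -
    have "(K * S * ?h)\<^sup>2 + (\<Sum>j\<in>(UNIV::'n set). (K * S * ?h)\<^sup>2) = (1 + real CARD('n)) * (K * S * ?h)\<^sup>2"
      by (simp add: algebra_simps)
    then show ?thesis using K S(1) by (simp add: real_sqrt_mult)
  qed
  also have "ennreal \<dots> = ennreal (sqrt (1 + real CARD('n)) * (K * S)) * L2L2_norm T H"
    using K S(1) by (simp add: L2L2_norm_sqint[OF sH] ennreal_mult)
  finally show ?thesis .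
qed

end

end

text \<open>The constant sequence 0 tends to an H of norm 0, so the defining property of the
  extension forces \<open>u\<close> to be the limit of the images of 0.\<close>

lemma extends_to_zero:
  fixes H u :: "real \<Rightarrow> real^'n \<Rightarrow> real"
  assumes T: "0 < T" and u: "extends_to T op H u" and H: "L2L2_norm T H = 0"
    and op0: "op (\<lambda>t x. 0) = (\<lambda>t x. 0)"
  shows "L2H1_norm T u = 0"
proof -
  have neg: "L2L2_norm T (\<lambda>t x. 0 - w t x) = L2L2_norm T w" for w :: "real \<Rightarrow> real^'n \<Rightarrow> real"
    by (simp add: L2_time_norm_def L2_norm_torus_def)
  have "smooth_periodic T (\<lambda>t (x::real^'n). 0)" by (rule trig_smooth_periodic[OF T trig_const])
  moreover have "(\<forall>n::nat. smooth_periodic T (\<lambda>t (x::real^'n). 0)) \<and> (\<lambda>n::nat. L2L2_norm T (\<lambda>t x. 0 - H t x)) \<longlonglongrightarrow> 0 \<longrightarrow>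
      (\<lambda>n::nat. L2L2_norm T (\<lambda>t x. op (\<lambda>t x. 0) t x - u t x)) \<longlonglongrightarrow> 0"
    by (rule spec[OF u[unfolded extends_to_def, THEN conjunct2], of "\<lambda>_ _ _. 0"])
  ultimately have "(\<lambda>n::nat. L2L2_norm T (\<lambda>t x. op (\<lambda>t x. 0) t x - u t x)) \<longlonglongrightarrow> 0"
    unfolding neg H by simp
  then have "L2L2_norm T u = 0" by (simp only: op0 neg LIMSEQ_const_iff)
  moreover have "u \<in> L2L2 T" using u by (simp add: extends_to_def)
  ultimately show ?thesis by (intro L2H1_norm_zero)
qed

lemma grad_zero: "grad (\<lambda>x. 0) x = 0"
  by (simp add: grad_def dir_deriv_def vec_eq_iff frechet_derivative_const)

theorem proposition4p5:
  fixes p :: nat and \<sigma> :: real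
  assumes "p > 7 + CARD('n::finite)" and "\<sigma> > real CARD('n) / 2"
  shows "\<exists>C>0. \<forall>T>0. \<forall>G :: 'n kernel. \<forall>H\<in>L2L2 T.
    smooth_kernel T G \<and> (\<forall>t\<in>{0..T}. \<forall>x v. G t t x v = 0) \<longrightarrow>
    (let M = (SUP (s,t)\<in>{0..T} \<times> {0..T}. H_norm p \<sigma> (\<lambda>(x,v). ds_kernel T G t s x v)) in
      (M < \<infinity> \<longrightarrow> (\<exists>u. extends_to T (K_free G) H u) \<and> (\<exists>w. extends_to T (K_fric G) H w)) \<and>
      (\<forall>u w. extends_to T (K_free G) H u \<and> extends_to T (K_fric G) H w \<longrightarrow>
         L2H1_norm T u + L2H1_norm T w \<le> ennreal (C * (1 + T)) * M * L2L2_norm T H))"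
proof -
  obtain S where S: "0 \<le> S" "\<And>F. finite F \<Longrightarrow> (\<Sum>l\<in>F. lattice_wt (l :: int^'n)) \<le> S"
    using lattice_sum_bounded[where 'n = 'n] by blast
  \<comment> \<open>The smoothing constant of one operator per unit of kernel norm: \<open>K\<close>
    of the locale is \<open>decay_const\<close> times that norm.\<close>
  define C0 where "C0 = sqrt (1 + real CARD('n)) * (decay_const TYPE('n) \<sigma> * S)"
  have C0: "0 \<le> C0" using S(1) by (simp add: C0_def)
  \<comment> \<open>Two operators give the factor 2; the summand 1 keeps the constant positive even
    if \<open>C0\<close> is 0.\<close>
  show ?thesis
  proof (rule exI[of _ "2 * C0 + 1"], intro conjI allI ballI impI)
    show "0 < 2 * C0 + 1" using C0 by linarith
    fix T :: real and G :: "'n kernel" and H :: "real \<Rightarrow> real^'n \<Rightarrow> real"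
    assume T: "0 < T" and H: "H \<in> L2L2 T"
      and G: "smooth_kernel T G \<and> (\<forall>t\<in>{0..T}. \<forall>x v. G t t x v = 0)"
    define M where "M = (SUP (s,t)\<in>{0..T} \<times> {0..T}. H_norm p \<sigma> (\<lambda>(x,v). ds_kernel T G t s x v))"
    define \<theta> :: "real \<Rightarrow> real" where "\<theta> = (\<lambda>\<tau>. exp \<tau> - 1)"
    have \<theta>: "continuous_on UNIV \<theta>" "\<And>\<tau>. 0 \<le> \<tau> \<Longrightarrow> \<tau> \<le> \<theta> \<tau>"
      "continuous_on UNIV (\<lambda>\<tau>::real. \<tau>)" "\<And>\<tau>::real. 0 \<le> \<tau> \<Longrightarrow> \<tau> \<le> \<tau>"
      \<comment> \<open>The lower bound on the friction shift is e^\<tau> \<ge> 1 + \<tau>.\<close>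
      by (auto simp: \<theta>_def intro!: continuous_intros)
        (use exp_ge_add_one_self in \<open>simp add: le_diff_eq add.commute\<close>)
    have fin: "\<exists>m\<ge>0. M = ennreal m \<and> (\<exists>u. extends_to T (K_free G) H u) \<and> (\<exists>w. extends_to T (K_fric G) H w) \<and>
      (\<forall>u. extends_to T (K_free G) H u \<longrightarrow> L2H1_norm T u \<le> ennreal (C0 * m) * L2L2_norm T H) \<and>
      (\<forall>w. extends_to T (K_fric G) H w \<longrightarrow> L2H1_norm T w \<le> ennreal (C0 * m) * L2L2_norm T H)" if "M < \<infinity>"
    proof -
      obtain m where m: "0 \<le> m" "M = ennreal m" using \<open>M < \<infinity>\<close> by (cases M) auto
      have Hm: "H_norm p \<sigma> (\<lambda>(x, v). ds_kernel T G t s x v) \<le> ennreal m" if "t \<in> {0..T}" "s \<in> {0..T}" for t s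
        unfolding m(2)[symmetric] M_def using that by (intro SUP_upper2[of "(s, t)"]) auto
      note AK = smooth_kernel_avg_kernel[OF T assms(2) _ _ _ conjunct1[OF G] _ m(1) Hm]
      obtain gj where "avg_kernel T \<sigma> (T * m) (decay_const TYPE('n) \<sigma> * m) (\<lambda>\<tau>. \<tau>) (\<lambda>t s z. G t s (fst z) (snd z)) gj"
        using AK[OF _ \<theta>(3,4)] assms(1) G by auto
      then interpret free: avg_kernel T \<sigma> "T * m" "decay_const TYPE('n) \<sigma> * m" "\<lambda>\<tau>. \<tau>" "\<lambda>t s z. G t s (fst z) (snd z)" gj .
      obtain gj' where "avg_kernel T \<sigma> (T * m) (decay_const TYPE('n) \<sigma> * m) \<theta> (\<lambda>t s z. G t s (fst z) (snd z)) gj'"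
        using AK[OF _ \<theta>(1,2)] assms(1) G by auto
      then interpret fric: avg_kernel T \<sigma> "T * m" "decay_const TYPE('n) \<sigma> * m" \<theta> "\<lambda>t s z. G t s (fst z) (snd z)" gj' .
      have kf: "free.Kop = K_free G"
        by (simp add: fun_eq_iff free.Kop_def K_free_def avg_def free.U1_def)
      have ki: "fric.Kop = K_fric G"
        by (simp add: fun_eq_iff fric.Kop_def K_fric_def avg_def fric.U1_def) (simp add: \<theta>_def algebra_simps)
      have c: "sqrt (1 + real CARD('n)) * (decay_const TYPE('n) \<sigma> * m * S) = C0 * m" by (simp add: C0_def)
      note F = free.Kop_extends[OF S H] free.Kop_smoothing[OF S H]
      note I = fric.Kop_extends[OF S H] fric.Kop_smoothing[OF S H]
      show ?thesis using m F I unfolding kf ki c by blast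
    qed
    have bound: "L2H1_norm T u + L2H1_norm T w \<le> ennreal ((2 * C0 + 1) * (1 + T)) * M * L2L2_norm T H"
      if u: "extends_to T (K_free G) H u" and w: "extends_to T (K_fric G) H w" for u w
    proof (cases "M < \<infinity>")
      case True
      from fin[OF this] obtain m where m: "0 \<le> m" "M = ennreal m"
        "L2H1_norm T u \<le> ennreal (C0 * m) * L2L2_norm T H" "L2H1_norm T w \<le> ennreal (C0 * m) * L2L2_norm T H"
        using u w by blast
      have "L2H1_norm T u + L2H1_norm T w \<le> ennreal (C0 * m) * L2L2_norm T H + ennreal (C0 * m) * L2L2_norm T H"
        by (rule add_mono[OF m(3,4)])
      also have "\<dots> = ennreal (2 * C0 * m) * L2L2_norm T H"
        using C0 m(1) by (simp add: distrib_right[symmetric] ennreal_plus[symmetric] del: ennreal_plus)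
      also have "\<dots> \<le> ennreal ((2 * C0 + 1) * (1 + T) * m) * L2L2_norm T H"
      proof (intro mult_right_mono ennreal_leI)
        have "2 * C0 * 1 \<le> (2 * C0 + 1) * (1 + T)" using C0 T by (intro mult_mono) auto
        then show "2 * C0 \<le> (2 * C0 + 1) * (1 + T)" by simp
      qed (use m in auto)
      also have "\<dots> = ennreal ((2 * C0 + 1) * (1 + T)) * M * L2L2_norm T H"
        using C0 T m by (simp add: ennreal_mult)
      finally show ?thesis .
    next
      case False
      \<comment> \<open>With infinite kernel norm the right-hand side is infinite unless H has norm
        0, and in that case the product is 0 and both extensions must vanish.\<close>
      then have M: "M = \<infinity>" by (simp flip: less_top)
      show ?thesis
      proof (cases "L2L2_norm T H = 0")
        case True
        have "K_free G (\<lambda>t x. 0) = (\<lambda>t x. 0)" "K_fric G (\<lambda>t x. 0) = (\<lambda>t x. 0)"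
          by (auto simp: fun_eq_iff K_free_def K_fric_def grad_zero)
        then show ?thesis
          using extends_to_zero[OF T u True] extends_to_zero[OF T w True] by simp
      next
        case False
        have "0 < (2 * C0 + 1) * (1 + T)" using C0 T by (intro mult_pos_pos) auto
        then have "ennreal ((2 * C0 + 1) * (1 + T)) \<noteq> 0" by (simp only: ennreal_eq_0_iff not_le)
        then have "ennreal ((2 * C0 + 1) * (1 + T)) * M * L2L2_norm T H = \<infinity>"
          using False M by (simp add: ennreal_mult_top ennreal_top_mult ennreal_mult_eq_top_iff)
        then show ?thesis by simp
      qed
    qed
    show "let M = (SUP (s,t)\<in>{0..T} \<times> {0..T}. H_norm p \<sigma> (\<lambda>(x,v). ds_kernel T G t s x v)) in
      (M < \<infinity> \<longrightarrow> (\<exists>u. extends_to T (K_free G) H u) \<and> (\<exists>w. extends_to T (K_fric G) H w)) \<and>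
      (\<forall>u w. extends_to T (K_free G) H u \<and> extends_to T (K_fric G) H w \<longrightarrow>
         L2H1_norm T u + L2H1_norm T w \<le> ennreal ((2 * C0 + 1) * (1 + T)) * M * L2L2_norm T H)"
      unfolding Let_def M_def[symmetric] using fin bound by blast
  qed
qed

end
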